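(* (Bochner-Martinelli formula in superspace.) Let $m>n\ge 0$ be integers, $M=2m-2n$, and let $\Omega\subset\mathbb{R}^{2m}$ be open. Let $F=F(\mathbf Z)\in C^\infty(\Omega)\otimes\mathfrak G_{2n}$ be a superfunction that is holomorphic in the variables $z_1,\dots,z_m,\grave z_1,\dots,\grave z_n$. Let $g=g_0+\mathbf g\in C^\infty(\mathbb{R}^{2m})\otimes\mathfrak G_{2n}^{(ev)}$ be a phase function such that $\{g_0\le 0\}=\{\underline w\in\mathbb R^{2m}: g_0(\underline w)\le 0\}\subset\Omega$ is compact and the gradient of $g_0$ does not vanish on $g_0^{-1}(0)$. Then, for every $\mathbf y=\underline y+\grave{\underline y}$ with $g_0(\underline y)<0$, $$\frac{2}{|\mathbb S^{2m-1|2n}|}\int_{\mathbb R^{2m|2n}}\frac{\delta(g(\mathbf x))}{|\mathbf Z-\mathbf U|^{M}}\;D^\dagger_{\mathbf Z-\mathbf U,\mathbf Z}[g(\mathbf x)]\;F(\mathbf Z)=F(\mathbf U).$$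
   Context: Superspace. Take commuting variables $x_1,\dots,x_{2m}$ (coordinates of $\underline x\in\mathbb R^{2m}$) and anticommuting variables $\grave x_1,\dots,\grave x_{2n}$ ($\grave x_j\grave x_k=-\grave x_k\grave x_j$) that commute with the $x_j$; $\mathfrak G_{2n}$ is the Grassmann algebra generated by the $\grave x_j$ and $\mathfrak G_{2n}^{(ev)}$ its even part. A superfunction on $\Omega$ is $F(\mathbf x)=\sum_{A\subset\{1,\dots,2n\}}F_A(\underline x)\,\grave{\underline x}_A\in C^\infty(\Omega)\otimes\mathfrak G_{2n}$, with $F_A$ complex-valued and $\grave{\underline x}_A=\grave x_{j_1}\cdots\grave x_{j_k}$ for $A=\{j_1<\dots<j_k\}$; it is real if all $F_A$ are real-valued; its body is $F_0=F_\emptyset$ and its nilpotent part is $\mathbf F=F-F_0$. A phase function is an even real superfunction $g=g_0+\mathbf g$ (body $g_0$, nilpotent part $\mathbf g$). For an even real superfunction $a=a_0+\mathbf a$ with $a_0>0$ and $p\in\mathbb R$, $a^p=\sum_{j=0}^{n}\frac{\mathbf a^j}{j!}\,p(p-1)\cdots(p-j+1)\,a_0^{p-j}$. Derivatives. $\partial_{\grave x_j}$ is the left derivative: $\partial_{\grave x_j}[1]=0$, $\partial_{\grave x_j}\grave x_k+\grave x_k\partial_{\grave x_j}=\delta_{j,k}$, commuting with $x_k$ and $\partial_{x_k}$. Complex variables. $z_j=x_j+ix_{m+j}$, $z_j^c=x_j-ix_{m+j}$ ($1\le j\le m$); $\grave z_j=\grave x_{2j-1}+i\grave x_{2j}$,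 $\grave z_j^c=\grave x_{2j-1}-i\grave x_{2j}$ ($1\le j\le n$); $\partial_{z_j^c}=\frac12(\partial_{x_j}+i\partial_{x_{m+j}})$, $\partial_{\grave z_j^c}=\frac12(\partial_{\grave x_{2j-1}}+i\partial_{\grave x_{2j}})$. A superfunction $F$ is holomorphic in $z_1,\dots,z_m,\grave z_1,\dots,\grave z_n$ if $\partial_{z_j^c}[F]=0$ and $\partial_{\grave z_k^c}[F]=0$ for all $1\le j\le m$, $1\le k\le n$; then $F=F(\mathbf Z)=\sum_{A\subset\{1,\dots,n\}}F_A(\underline Z)\,\grave z_A$, with $F_A$ holomorphic in $z_1,\dots,z_m$ and $\grave z_A$ the ordered product of the $\grave z_j$, $j\in A$. Second point. $\mathbf y=\underline y+\grave{\underline y}$ consists of a point $\underline y\in\mathbb R^{2m}$ and further anticommuting variables $\grave y_1,\dots,\grave y_{2n}$ (which also anticommute with the $\grave x_j$) treated as parameters; $u_j=y_j+iy_{m+j}$, $\grave u_j=\grave y_{2j-1}+i\grave y_{2j}$, with conjugates $u_j^c,\grave u_j^c$; $F(\mathbf U)$ is $F(\mathbf Z)$ with $z_j,\grave z_j$ replaced by $u_j,\grave u_j$. Put $$|\mathbf Z-\mathbf U|^2=\sum_{j=1}^m(z_j-u_j)(z_j-u_j)^c-\frac i2\sum_{j=1}^n(\grave z_j-\grave u_j)(\grave z_j-\grave u_j)^c,$$ $|\mathbf Z-\mathbf U|^{M}=(|\mathbf Z-\mathbf U|^2)^{M/2}$, and $$D^\dagger_{\mathbf Z-\mathbf U,\mathbf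 Z}=\sum_{j=1}^m(z_j-u_j)^c\,\partial_{z_j^c}+\sum_{j=1}^n(\grave z_j-\grave u_j)^c\,\partial_{\grave z_j^c}.$$ Also $|\mathbb S^{2m-1|2n}|=\dfrac{2\pi^{M/2}}{\Gamma(M/2)}$. Integration. $\int_B=\pi^{-n}\partial_{\grave x_{2n}}\cdots\partial_{\grave x_1}$ is the Berezin integral. A superdistribution is $\alpha=\sum_A\alpha_A\grave{\underline x}_A$ with $\alpha_A$ Schwartz distributions on $\mathbb R^{2m}$. For compactly supported $\alpha$ and a superfunction $F=\sum_B F_B\grave{\underline x}_B$ smooth near the support, $\int_{\mathbb R^{2m|2n}}\alpha F=\sum_{A,B}\langle\alpha_A,F_B\rangle\int_B\grave{\underline x}_A\grave{\underline x}_B$ (the parameters $\grave y_j$ are treated as constants). For a phase function $g$ with $\nabla g_0\ne0$ on $g_0^{-1}(0)$, $\delta(g)=\sum_{j=0}^n\frac{\mathbf g^j}{j!}\,\delta^{(j)}(g_0)$, where $\delta^{(j)}(g_0)$ is the pullback by $g_0$ of the $j$-th derivative of the Dirac distribution on $\mathbb R$. Since $g_0(\underline y)\neq0$, the factor $|\mathbf Z-\mathbf U|^{-M}$ is smooth in $\underline x$ near $g_0^{-1}(0)$. *)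

theory Defs
  imports "HOL-Analysis.Analysis"
begin

section \<open>The Grassmann algebra\<close>

text \<open>
  The complex Grassmann algebra on generators indexed by the natural numbers. An element is given by
  its coefficients with respect to the monomials that are ordered products of generators over finite
  index sets. Formal infinite sums of monomials are allowed by the type, but only elements that
  involve the first \<open>4 * n\<close> generators are used: generators \<open>1, \<dots>, 2 * n\<close> are the
  anticommuting coordinates of \<open>x\<close>, and generators \<open>2 * n + 1, \<dots>, 4 * n\<close> are those of \<open>y\<close>.
\<close>

typedef grassmann = "{a :: nat set \<Rightarrow> complex. \<forall>A. infinite A \<longrightarrow> a A = 0}"
  morphisms gcoeff Abs_grassmann
  by auto

setup_lifting type_definition_grassmann

lemma grassmann_eqI: "(\<And>A. finite A \<Longrightarrow> gcoeff a A = gcoeff b A) \<Longrightarrow> a = b"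
  by (transfer; metis ext)

text \<open>The sign produced by sorting the concatenation of the ordered monomials over \<open>A\<close> and \<open>B\<close>.\<close>

definition gsign :: "nat set \<Rightarrow> nat set \<Rightarrow> complex" where
  "gsign A B = (-1) ^ card {(i, j). i \<in> A \<and> j \<in> B \<and> j < i}"

lemma gsign_Un_left:
  assumes "finite A" "finite B" "finite C" "A \<inter> B = {}"
  shows "gsign (A \<union> B) C = gsign A C * gsign B C"
proof -
  have "{(i, j). i \<in> A \<union> B \<and> j \<in> C \<and> j < i} =
      {(i, j). i \<in> A \<and> j \<in> C \<and> j < i} \<union> {(i, j). i \<in> B \<and> j \<in> C \<and> j < i}"
    by auto
  moreover have "finite {(i, j). i \<in> A \<and> j \<in> C \<and> j < i}"
    by (rule finite_subset[of _ "A \<times> C"]) (use assms in auto)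
  moreover have "finite {(i, j). i \<in> B \<and> j \<in> C \<and> j < i}"
    by (rule finite_subset[of _ "B \<times> C"]) (use assms in auto)
  moreover have "{(i, j). i \<in> A \<and> j \<in> C \<and> j < i} \<inter> {(i, j). i \<in> B \<and> j \<in> C \<and> j < i} = {}"
    using assms(4) by auto
  ultimately show ?thesis
    unfolding gsign_def by (simp add: card_Un_disjoint power_add)
qed

lemma gsign_Un_right:
  assumes "finite A" "finite B" "finite C" "B \<inter> C = {}"
  shows "gsign A (B \<union> C) = gsign A B * gsign A C"
proof -
  have "{(i, j). i \<in> A \<and> j \<in> B \<union> C \<and> j < i} =
      {(i, j). i \<in> A \<and> j \<in> B \<and> j < i} \<union> {(i, j). i \<in> A \<and> j \<in> C \<and> j < i}"
    by auto
  moreover have "finite {(i, j). i \<in> A \<and> j \<in> B \<and> j < i}"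
    by (rule finite_subset[of _ "A \<times> B"]) (use assms in auto)
  moreover have "finite {(i, j). i \<in> A \<and> j \<in> C \<and> j < i}"
    by (rule finite_subset[of _ "A \<times> C"]) (use assms in auto)
  moreover have "{(i, j). i \<in> A \<and> j \<in> B \<and> j < i} \<inter> {(i, j). i \<in> A \<and> j \<in> C \<and> j < i} = {}"
    using assms(4) by auto
  ultimately show ?thesis
    unfolding gsign_def by (simp add: card_Un_disjoint power_add)
qed

lemma gsign_empty [simp]: "gsign {} A = 1" "gsign A {} = 1"
  by (auto simp: gsign_def)

instantiation grassmann :: ring_1
begin

lift_definition zero_grassmann :: grassmann is "\<lambda>_. 0" by simp
lift_definition one_grassmann :: grassmann is "\<lambda>A. if A = {} then 1 else 0" by auto
lift_definition plus_grassmann :: "grassmann \<Rightarrow> grassmann \<Rightarrow> grassmann"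
  is "\<lambda>a b A. a A + b A" by simp
lift_definition uminus_grassmann :: "grassmann \<Rightarrow> grassmann" is "\<lambda>a A. - a A" by simp
lift_definition minus_grassmann :: "grassmann \<Rightarrow> grassmann \<Rightarrow> grassmann"
  is "\<lambda>a b A. a A - b A" by simp
lift_definition times_grassmann :: "grassmann \<Rightarrow> grassmann \<Rightarrow> grassmann"
  is "\<lambda>a b C. \<Sum>A\<in>Pow C. gsign A (C - A) * a A * b (C - A)"
  by (simp add: finite_Pow_iff)

instance
proof
  fix a b c :: grassmann
  show "a * b * c = a * (b * c)"
  proof (rule grassmann_eqI)
    fix D :: "nat set" assume D: "finite D"
    have fin: "finite X" if "X \<subseteq> D" for X using that D finite_subset by blast
    have "gcoeff (a * b * c) D = (\<Sum>E\<in>Pow D. gsign E (D - E) *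
        (\<Sum>A\<in>Pow E. gsign A (E - A) * gcoeff a A * gcoeff b (E - A)) * gcoeff c (D - E))"
      by (simp add: times_grassmann.rep_eq)
    also have "\<dots> = (\<Sum>E\<in>Pow D. \<Sum>A\<in>Pow E. gsign E (D - E) * gsign A (E - A) *
        gcoeff a A * gcoeff b (E - A) * gcoeff c (D - E))"
      by (simp add: sum_distrib_left sum_distrib_right mult.assoc)
    also have "\<dots> = (\<Sum>(E, A)\<in>(SIGMA E:Pow D. Pow E). gsign E (D - E) * gsign A (E - A) *
        gcoeff a A * gcoeff b (E - A) * gcoeff c (D - E))"
      using D fin by (subst sum.Sigma) auto
    also have "\<dots> = (\<Sum>(A, B)\<in>(SIGMA A:Pow D. Pow (D - A)).
        gsign A (D - A) * gsign B (D - A - B) * gcoeff a A * gcoeff b B * gcoeff c (D - A - B))"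
    proof (rule sum.reindex_bij_witness
        [where i = "\<lambda>(A, B). (A \<union> B, A)" and j = "\<lambda>(E, A). (A, E - A)"])
      fix p assume "p \<in> (SIGMA E:Pow D. Pow E)"
      then obtain E A where p: "p = (E, A)" and EA: "E \<subseteq> D" "A \<subseteq> E" by auto
      show "(case case p of (E, A) \<Rightarrow> (A, E - A) of (A, B) \<Rightarrow> (A \<union> B, A)) = p"
        using p EA by auto
      show "(case p of (E, A) \<Rightarrow> (A, E - A)) \<in> (SIGMA A:Pow D. Pow (D - A))"
        using p EA by auto
      have 1: "D - A - (E - A) = D - E" using EA by auto
      have "A \<union> (E - A) = E" using EA by auto
      then have 2: "gsign E (D - E) = gsign A (D - E) * gsign (E - A) (D - E)"
        using gsign_Un_left[OF fin fin fin, of A "E - A" "D - E"] EA by auto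
      have "gsign A ((E - A) \<union> (D - E)) = gsign A (E - A) * gsign A (D - E)"
        using EA fin by (intro gsign_Un_right) auto
      moreover have "(E - A) \<union> (D - E) = D - A" using EA by auto
      ultimately have 3: "gsign A (D - A) = gsign A (E - A) * gsign A (D - E)" by simp
      show "(case case p of (E, A) \<Rightarrow> (A, E - A) of (A, B) \<Rightarrow>
            gsign A (D - A) * gsign B (D - A - B) * gcoeff a A * gcoeff b B * gcoeff c (D - A - B)) =
          (case p of (E, A) \<Rightarrow>
            gsign E (D - E) * gsign A (E - A) * gcoeff a A * gcoeff b (E - A) * gcoeff c (D - E))"
        by (simp add: p 1 2 3)
    qed auto
    also have "\<dots> = (\<Sum>A\<in>Pow D. \<Sum>B\<in>Pow (D - A).
        gsign A (D - A) * gsign B (D - A - B) * gcoeff a A * gcoeff b B * gcoeff c (D - A - B))"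
      using D fin by (subst sum.Sigma) auto
    also have "\<dots> = (\<Sum>A\<in>Pow D. gsign A (D - A) * gcoeff a A *
        (\<Sum>B\<in>Pow (D - A). gsign B (D - A - B) * gcoeff b B * gcoeff c (D - A - B)))"
      unfolding sum_distrib_left by (intro sum.cong refl) simp
    also have "\<dots> = gcoeff (a * (b * c)) D"
      by (simp add: times_grassmann.rep_eq)
    finally show "gcoeff (a * b * c) D = gcoeff (a * (b * c)) D" .
  qed
  show "1 * a = a"
  proof (rule grassmann_eqI)
    fix D :: "nat set" assume "finite D"
    moreover have "gcoeff (1 * a) D = (\<Sum>A\<in>Pow D. if A = {} then gcoeff a D else 0)"
      unfolding times_grassmann.rep_eq one_grassmann.rep_eq by (rule sum.cong) auto
    ultimately show "gcoeff (1 * a) D = gcoeff a D" by simp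
  qed
  show "a * 1 = a"
  proof (rule grassmann_eqI)
    fix D :: "nat set" assume "finite D"
    moreover have "gcoeff (a * 1) D = (\<Sum>A\<in>Pow D. if A = D then gcoeff a D else 0)"
      unfolding times_grassmann.rep_eq one_grassmann.rep_eq by (rule sum.cong) auto
    ultimately show "gcoeff (a * 1) D = gcoeff a D" by simp
  qed
  show "(a + b) * c = a * c + b * c"
    by (rule grassmann_eqI)
      (simp add: plus_grassmann.rep_eq times_grassmann.rep_eq algebra_simps sum.distrib)
  show "a * (b + c) = a * b + a * c"
    by (rule grassmann_eqI)
      (simp add: plus_grassmann.rep_eq times_grassmann.rep_eq algebra_simps sum.distrib)
  show "(0 :: grassmann) \<noteq> 1"
  proof
    assume "(0 :: grassmann) = 1"
    then have "gcoeff 0 {} = gcoeff 1 {}" by (rule arg_cong)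
    then show False by (simp add: zero_grassmann.rep_eq one_grassmann.rep_eq)
  qed
  show "a + b + c = a + (b + c)"
    by (rule grassmann_eqI) (simp add: plus_grassmann.rep_eq)
  show "a + b = b + a"
    by (rule grassmann_eqI) (simp add: plus_grassmann.rep_eq)
  show "0 + a = a"
    by (rule grassmann_eqI) (simp add: plus_grassmann.rep_eq zero_grassmann.rep_eq)
  show "- a + a = 0"
    by (rule grassmann_eqI)
      (simp add: plus_grassmann.rep_eq uminus_grassmann.rep_eq zero_grassmann.rep_eq)
  show "a - b = a + - b"
    by (rule grassmann_eqI)
      (simp add: plus_grassmann.rep_eq uminus_grassmann.rep_eq minus_grassmann.rep_eq)
qed

end

definition gconst :: "complex \<Rightarrow> grassmann" where
  "gconst c = Abs_grassmann (\<lambda>A. if A = {} then c else 0)"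

lemma gcoeff_gconst: "gcoeff (gconst c) A = (if A = {} then c else 0)"
  unfolding gconst_def by (subst Abs_grassmann_inverse) auto

definition gmono :: "nat set \<Rightarrow> grassmann" where
  "gmono A = Abs_grassmann (\<lambda>B. if finite A \<and> B = A then 1 else 0)"

lemma gcoeff_gmono: "gcoeff (gmono A) B = (if finite A \<and> B = A then 1 else 0)"
  unfolding gmono_def by (subst Abs_grassmann_inverse) auto

abbreviation gen :: "nat \<Rightarrow> grassmann" where
  "gen j \<equiv> gmono {j}"

definition lderiv :: "nat \<Rightarrow> grassmann \<Rightarrow> grassmann" where
  "lderiv j a = Abs_grassmann
     (\<lambda>A. if j \<in> A then 0 else (-1) ^ card {i \<in> A. i < j} * gcoeff a (insert j A))"

lemma gcoeff_lderiv:
  "gcoeff (lderiv j a) A =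
     (if j \<in> A then 0 else (-1) ^ card {i \<in> A. i < j} * gcoeff a (insert j A))"
proof -
  have "gcoeff a (insert j B) = 0" if "infinite B" for B
    using gcoeff[of a] that by simp
  then show ?thesis
    unfolding lderiv_def by (subst Abs_grassmann_inverse) auto
qed

definition berezin :: "nat \<Rightarrow> grassmann \<Rightarrow> grassmann" where
  "berezin n a = gconst (of_real (1 / pi ^ n)) * fold lderiv [1..<2 * n + 1] a"


subsection \<open>Consistency of the coordinate description\<close>

lemma gcoeff_gen_mult:
  assumes "finite C"
  shows "gcoeff (gen k * a) C =
    (if k \<in> C then (-1) ^ card {i \<in> C. i < k} * gcoeff a (C - {k}) else 0)"
proof -
  have "gcoeff (gen k * a) C =
      (\<Sum>A\<in>Pow C. if A = {k} then gsign {k} (C - {k}) * gcoeff a (C - {k}) else 0)"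
    unfolding times_grassmann.rep_eq gcoeff_gmono by (rule sum.cong) auto
  also have "\<dots> = (if k \<in> C then gsign {k} (C - {k}) * gcoeff a (C - {k}) else 0)"
    using assms by (subst sum.delta) simp_all
  also have "gsign {k} (C - {k}) = (-1) ^ card {i \<in> C. i < k}"
  proof -
    have "{(i, j). i \<in> {k} \<and> j \<in> C - {k} \<and> j < i} = Pair k ` {i \<in> C. i < k}" by auto
    moreover have "card (Pair k ` {i \<in> C. i < k}) = card {i \<in> C. i < k}"
      by (rule card_image) (simp add: inj_on_def)
    ultimately show ?thesis unfolding gsign_def by (simp only:)
  qed
  finally show ?thesis .
qed

lemma gmono_empty: "gmono {} = 1"
  by (rule grassmann_eqI) (simp add: gcoeff_gmono one_grassmann.rep_eq)

lemma gmono_insert_less: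
  assumes "finite A" "\<forall>i\<in>A. k < i"
  shows "gmono (insert k A) = gen k * gmono A"
proof (rule grassmann_eqI)
  fix C :: "nat set" assume C: "finite C"
  have k: "k \<notin> A" using assms by auto
  show "gcoeff (gmono (insert k A)) C = gcoeff (gen k * gmono A) C"
  proof (cases "C = insert k A")
    case True
    then have "{i \<in> C. i < k} = {}" using assms by auto
    then have c: "card {i \<in> C. i < k} = 0" by (simp only: card.empty)
    have "C - {k} = A" "k \<in> C" using True k by auto
    then have "gcoeff (gen k * gmono A) C = 1"
      using assms by (simp only: gcoeff_gen_mult[OF C] c gcoeff_gmono) simp
    then show ?thesis using True C by (simp add: gcoeff_gmono)
  next
    case False
    then have "k \<in> C \<Longrightarrow> C - {k} \<noteq> A" by auto
    with False assms show ?thesis by (simp add: gcoeff_gen_mult[OF C] gcoeff_gmono)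
  qed
qed

lemma gmono_eq_prod_list: "sorted_wrt (<) js \<Longrightarrow> gmono (set js) = prod_list (map gen js)"
proof (induction js)
  case Nil
  then show ?case by (simp add: gmono_empty)
next
  case (Cons k js)
  then have "gmono (insert k (set js)) = gen k * gmono (set js)"
    by (intro gmono_insert_less) auto
  with Cons show ?case by simp
qed

lemma lderiv_one: "lderiv j 1 = 0"
  by (rule grassmann_eqI) (simp add: gcoeff_lderiv one_grassmann.rep_eq zero_grassmann.rep_eq)

lemma lderiv_gen_mult:
  "lderiv j (gen k * a) + gen k * lderiv j a = (if j = k then a else 0)"
proof (rule grassmann_eqI)
  fix C :: "nat set" assume C: "finite C"
  have sgn: "card {i \<in> insert l C. i < k} = card {i \<in> C. i < k} + (if l < k then 1 else 0)"
    if "l \<notin> C" for l k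
  proof (cases "l < k")
    case True
    then have "{i \<in> insert l C. i < k} = insert l {i \<in> C. i < k}" by auto
    then show ?thesis using True that C by simp
  next
    case False
    then have "{i \<in> insert l C. i < k} = {i \<in> C. i < k}" by auto
    then show ?thesis using False by simp
  qed
  have sgn': "card {i \<in> C. i < j} = card {i \<in> C - {k}. i < j} + (if k < j then 1 else 0)"
    if "k \<in> C" for k j
  proof -
    have "{i \<in> C. i < j} = (if k < j then insert k {i \<in> C - {k}. i < j} else {i \<in> C - {k}. i < j})"
      using that by auto
    then show ?thesis using C by simp
  qed
  let ?s = "\<lambda>k C. (-1 :: complex) ^ card {i \<in> C. i < k}"
  have sq: "?s k C * (?s k C * z) = z" for z
    by (cases "even (card {i \<in> C. i < k})") auto
  have L: "gcoeff (lderiv j (gen k * a)) C = (if j \<in> C then 0 else ?s j C *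
      (if k \<in> insert j C then ?s k (insert j C) * gcoeff a (insert j C - {k}) else 0))"
    using C by (simp only: gcoeff_lderiv gcoeff_gen_mult finite_insert)
  have R: "gcoeff (gen k * lderiv j a) C = (if k \<in> C then ?s k C *
      (if j \<in> C - {k} then 0 else ?s j (C - {k}) * gcoeff a (insert j (C - {k}))) else 0)"
    by (simp only: gcoeff_lderiv gcoeff_gen_mult[OF C])
  show "gcoeff (lderiv j (gen k * a) + gen k * lderiv j a) C = gcoeff (if j = k then a else 0) C"
  proof (cases "j = k")
    case eq: True
    show ?thesis
    proof (cases "k \<in> C")
      case True
      have 1: "?s k (C - {k}) = ?s k C" using sgn'[OF True, of k] by simp
      have 2: "insert k (C - {k}) = C" using True by auto
      have 3: "gcoeff (lderiv k (gen k * a)) C = 0"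
        unfolding L[unfolded eq] using True by simp
      have "gcoeff (gen k * lderiv k a) C =
          ?s k C * (?s k (C - {k}) * gcoeff a (insert k (C - {k})))"
        unfolding R[unfolded eq] using True by simp
      then have 4: "gcoeff (gen k * lderiv k a) C = gcoeff a C"
        by (simp only: 1 2 sq)
      show ?thesis by (simp add: eq plus_grassmann.rep_eq 3 4)
    next
      case False
      have 1: "?s k (insert k C) = ?s k C" using sgn[OF False, of k] by simp
      have 2: "insert k C - {k} = C" using False by auto
      have 3: "gcoeff (gen k * lderiv k a) C = 0"
        unfolding R[unfolded eq] using False by simp
      have "gcoeff (lderiv k (gen k * a)) C =
          ?s k C * (?s k (insert k C) * gcoeff a (insert k C - {k}))"
        unfolding L[unfolded eq] using False by simp
      then have 4: "gcoeff (lderiv k (gen k * a)) C = gcoeff a C"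
        by (simp only: 1 2 sq)
      show ?thesis by (simp add: eq plus_grassmann.rep_eq 3 4)
    qed
  next
    case ne: False
    show ?thesis
    proof (cases "k \<in> C \<and> j \<notin> C")
      case True
      have 1: "insert j C - {k} = insert j (C - {k})" using ne by auto
      have 2: "?s k (insert j C) = ?s k C * (if j < k then -1 else 1)"
        using sgn[of j k] True by simp
      have 3: "?s j C = ?s j (C - {k}) * (if k < j then -1 else 1)"
        using sgn'[of k j] True by simp
      define p q r where "p = ?s k C" and "q = ?s j (C - {k})" and "r = gcoeff a (insert j (C - {k}))"
      have "gcoeff (lderiv j (gen k * a)) C =
          ?s j C * (?s k (insert j C) * gcoeff a (insert j C - {k}))"
        unfolding L using True by simp
      then have "gcoeff (lderiv j (gen k * a)) C =
          q * (if k < j then -1 else 1) * (p * (if j < k then -1 else 1) * r)"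
        by (simp only: 1 2 3 p_def q_def r_def)
      moreover have "gcoeff (gen k * lderiv j a) C = p * (q * r)"
        unfolding R p_def q_def r_def using True ne by simp
      ultimately show ?thesis
        using ne by (auto simp: plus_grassmann.rep_eq zero_grassmann.rep_eq)
    next
      case False
      then have "gcoeff (lderiv j (gen k * a)) C = 0" "gcoeff (gen k * lderiv j a) C = 0"
        unfolding L R using ne by auto
      then show ?thesis using ne by (simp add: plus_grassmann.rep_eq zero_grassmann.rep_eq)
    qed
  qed
qed


section \<open>Real powers\<close>

definition rbody :: "grassmann \<Rightarrow> real" where
  "rbody a = Re (gcoeff a {})"

definition nilp :: "grassmann \<Rightarrow> grassmann" where
  "nilp a = a - gconst (gcoeff a {})"

text \<open>
  The power with real exponent \<open>p\<close>, for even real \<open>a\<close> with positive body. The Taylor expansion is cut at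
  \<open>n\<close> and is complete when the nilpotent part vanishes to the power \<open>n + 1\<close>.
\<close>

definition gpow :: "nat \<Rightarrow> grassmann \<Rightarrow> real \<Rightarrow> grassmann" where
  "gpow n a p = (\<Sum>j\<le>n. nilp a ^ j * gconst (of_real ((p gchoose j) * rbody a powr (p - real j))))"


section \<open>Smooth functions and superfunctions\<close>

text \<open>\<open>Ck_on\<close> is meant for open sets only.\<close>

primrec Ck_on :: "nat \<Rightarrow> 'a::euclidean_space set \<Rightarrow> ('a \<Rightarrow> complex) \<Rightarrow> bool" where
  "Ck_on 0 S f \<longleftrightarrow> continuous_on S f"
| "Ck_on (Suc k) S f \<longleftrightarrow>
     f differentiable_on S \<and> (\<forall>v. Ck_on k S (\<lambda>x. frechet_derivative f (at x) v))"

definition smooth_on :: "'a::euclidean_space set \<Rightarrow> ('a \<Rightarrow> complex) \<Rightarrow> bool" where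
  "smooth_on S f \<longleftrightarrow> (\<forall>k. Ck_on k S f)"

definition superfunction :: "nat \<Rightarrow> 'a::euclidean_space set \<Rightarrow> ('a \<Rightarrow> grassmann) \<Rightarrow> bool" where
  "superfunction n S F \<longleftrightarrow>
     (\<forall>x\<in>S. \<forall>A. \<not> A \<subseteq> {1..2 * n} \<longrightarrow> gcoeff (F x) A = 0) \<and>
     (\<forall>A. smooth_on S (\<lambda>x. gcoeff (F x) A))"

definition phase_function :: "nat \<Rightarrow> ('a::euclidean_space \<Rightarrow> grassmann) \<Rightarrow> bool" where
  "phase_function n g \<longleftrightarrow> superfunction n UNIV g \<and>
     (\<forall>x A. odd (card A) \<longrightarrow> gcoeff (g x) A = 0) \<and>
     (\<forall>x A. gcoeff (g x) A \<in> \<real>)"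

definition sderiv :: "'a::euclidean_space \<Rightarrow> ('a \<Rightarrow> grassmann) \<Rightarrow> 'a \<Rightarrow> grassmann" where
  "sderiv v F x = Abs_grassmann (\<lambda>A. frechet_derivative (\<lambda>w. gcoeff (F w) A) (at x) v)"

lemma gcoeff_sderiv: "gcoeff (sderiv v F x) A = frechet_derivative (\<lambda>w. gcoeff (F w) A) (at x) v"
proof -
  have "frechet_derivative (\<lambda>w. gcoeff (F w) A) (at x) v = 0" if "infinite A" for A
  proof -
    have "(\<lambda>w. gcoeff (F w) A) = (\<lambda>_. 0)" using that gcoeff by fastforce
    then show ?thesis by simp
  qed
  then show ?thesis unfolding sderiv_def by (subst Abs_grassmann_inverse) auto
qed


section \<open>Complex variables\<close>

text \<open>
  The space of dimension \<open>2 * m\<close> is \<^typ>\<open>real ^ ('m + 'm)\<close> with \<open>m = CARD('m)\<close>: the coordinate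
  \<open>Inl j\<close> is \<open>x\<^sub>j\<close>, and \<open>Inr j\<close> is the coordinate with index \<open>m + j\<close>.
\<close>

definition zvar :: "real ^ ('m::finite + 'm) \<Rightarrow> 'm \<Rightarrow> complex" where
  "zvar x j = Complex (x $ Inl j) (x $ Inr j)"

definition dzc :: "'m::finite \<Rightarrow> (real ^ ('m + 'm) \<Rightarrow> grassmann) \<Rightarrow> real ^ ('m + 'm) \<Rightarrow> grassmann" where
  "dzc j F x = gconst (1 / 2) *
     (sderiv (axis (Inl j) 1) F x + gconst \<i> * sderiv (axis (Inr j) 1) F x)"

definition gz :: "nat \<Rightarrow> grassmann" where
  "gz k = gen (2 * k - 1) + gconst \<i> * gen (2 * k)"

definition gzc :: "nat \<Rightarrow> grassmann" where
  "gzc k = gen (2 * k - 1) - gconst \<i> * gen (2 * k)"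

definition gu :: "nat \<Rightarrow> nat \<Rightarrow> grassmann" where
  "gu n k = gen (2 * n + (2 * k - 1)) + gconst \<i> * gen (2 * n + 2 * k)"

definition guc :: "nat \<Rightarrow> nat \<Rightarrow> grassmann" where
  "guc n k = gen (2 * n + (2 * k - 1)) - gconst \<i> * gen (2 * n + 2 * k)"

definition dgzc :: "nat \<Rightarrow> grassmann \<Rightarrow> grassmann" where
  "dgzc k a = gconst (1 / 2) * (lderiv (2 * k - 1) a + gconst \<i> * lderiv (2 * k) a)"

definition super_holomorphic ::
    "nat \<Rightarrow> (real ^ ('m::finite + 'm)) set \<Rightarrow> (real ^ ('m + 'm) \<Rightarrow> grassmann) \<Rightarrow> bool" where
  "super_holomorphic n S F \<longleftrightarrow>
     (\<forall>x\<in>S. (\<forall>j. dzc j F x = 0) \<and> (\<forall>k\<in>{1..n}. dgzc k (F x) = 0))"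

text \<open>
  The value of a holomorphic superfunction has a unique expansion in the ordered products of the
  \<^const>\<open>gz\<close>. Evaluating its coefficients at \<open>y\<close> and replacing \<^const>\<open>gz\<close> by \<^const>\<open>gu\<close> turns \<open>F(Z)\<close> into \<open>F(U)\<close>.
\<close>

definition hol_coeffs :: "nat \<Rightarrow> grassmann \<Rightarrow> nat set \<Rightarrow> complex" where
  "hol_coeffs n a = (THE c. (\<forall>A. \<not> A \<subseteq> {1..n} \<longrightarrow> c A = 0) \<and>
     a = (\<Sum>A\<in>Pow {1..n}. gconst (c A) * prod_list (map gz (sorted_list_of_set A))))"

definition subst_U :: "nat \<Rightarrow> ('a \<Rightarrow> grassmann) \<Rightarrow> 'a \<Rightarrow> grassmann" where
  "subst_U n F y =
     (\<Sum>A\<in>Pow {1..n}. gconst (hol_coeffs n (F y) A) * prod_list (map (gu n) (sorted_list_of_set A)))"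

definition sq_dist_ZU :: "nat \<Rightarrow> real ^ ('m::finite + 'm) \<Rightarrow> real ^ ('m + 'm) \<Rightarrow> grassmann" where
  "sq_dist_ZU n x y =
     (\<Sum>j\<in>UNIV. gconst ((zvar x j - zvar y j) * cnj (zvar x j - zvar y j))) -
     gconst (\<i> / 2) * (\<Sum>k=1..n. (gz k - gu n k) * (gzc k - guc n k))"

definition dist_ZU_pow ::
    "nat \<Rightarrow> real ^ ('m::finite + 'm) \<Rightarrow> real ^ ('m + 'm) \<Rightarrow> real \<Rightarrow> grassmann" where
  "dist_ZU_pow n x y p = gpow n (sq_dist_ZU n x y) (p / 2)"

definition D_dagger ::
    "nat \<Rightarrow> real ^ ('m::finite + 'm) \<Rightarrow> (real ^ ('m + 'm) \<Rightarrow> grassmann) \<Rightarrow> real ^ ('m + 'm) \<Rightarrow> grassmann" where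
  "D_dagger n y F x =
     (\<Sum>j\<in>UNIV. gconst (cnj (zvar x j - zvar y j)) * dzc j F x) +
     (\<Sum>k=1..n. (gzc k - guc n k) * dgzc k (F x))"

definition ssphere_area :: "real \<Rightarrow> real" where
  "ssphere_area M = 2 * pi powr (M / 2) / Gamma (M / 2)"


section \<open>Distributions\<close>

type_synonym 'a distribution = "('a \<Rightarrow> complex) \<Rightarrow> complex"

definition test_function :: "('a::euclidean_space \<Rightarrow> complex) \<Rightarrow> bool" where
  "test_function \<phi> \<longleftrightarrow> smooth_on UNIV \<phi> \<and> compact (closure {x. \<phi> x \<noteq> 0})"

definition dist_support :: "'a::euclidean_space distribution \<Rightarrow> 'a set" where
  "dist_support T = - \<Union>{U. open U \<and>
     (\<forall>\<phi>. test_function \<phi> \<and> closure {x. \<phi> x \<noteq> 0} \<subseteq> U \<longrightarrow> T \<phi> = 0)}"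

text \<open>
  The pairing of a compactly supported distribution with a function that is smooth near the support:
  the common value of the distribution at all test functions that agree with the function near the
  support.
\<close>

definition dist_pair :: "'a::euclidean_space distribution \<Rightarrow> ('a \<Rightarrow> complex) \<Rightarrow> complex" where
  "dist_pair T f = (THE c. \<forall>\<phi>. test_function \<phi> \<and>
     (\<exists>U. open U \<and> dist_support T \<subseteq> U \<and> (\<forall>x\<in>U. \<phi> x = f x)) \<longrightarrow> T \<phi> = c)"

definition dirac :: "real distribution" where
  "dirac \<psi> = \<psi> 0"

definition dist_deriv :: "real distribution \<Rightarrow> real distribution" where
  "dist_deriv u \<psi> = - u (\<lambda>t. vector_derivative \<psi> (at t))"

text \<open>
  The pullback of a distribution on the line by \<open>h\<close> is the transpose of the pushforward of test
  functions. The pushforward of \<open>\<phi>\<close> is the density of the image under \<open>h\<close> of \<open>\<phi>\<close> times Lebesgue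
  measure, so that the pullback of a function \<open>u\<close> is \<open>u \<circ> h\<close>. Derivatives of the Dirac distribution
  depend only on the pushforward near \<open>0\<close>, which is smooth if the gradient of \<open>h\<close> has no zero on the
  level set \<open>h = 0\<close>.
\<close>

definition pushforward :: "('a::euclidean_space \<Rightarrow> real) \<Rightarrow> ('a \<Rightarrow> complex) \<Rightarrow> real \<Rightarrow> complex" where
  "pushforward h \<phi> t = vector_derivative (\<lambda>s. LINT x:{x. h x < s}|lborel. \<phi> x) (at t)"

definition pullback :: "('a::euclidean_space \<Rightarrow> real) \<Rightarrow> real distribution \<Rightarrow> 'a distribution" where
  "pullback h u \<phi> = u (pushforward h \<phi>)"

text \<open>A superdistribution is the family of its components \<open>\<alpha>\<^sub>A\<close>.\<close>

type_synonym 'a superdistribution = "nat set \<Rightarrow> 'a distribution"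

definition sdelta :: "nat \<Rightarrow> ('a::euclidean_space \<Rightarrow> grassmann) \<Rightarrow> 'a superdistribution" where
  "sdelta n g A \<phi> = (\<Sum>j\<le>n. pullback (\<lambda>x. rbody (g x)) ((dist_deriv ^^ j) dirac)
     (\<lambda>x. gcoeff (nilp (g x) ^ j) A / fact j * \<phi> x))"

text \<open>
  Here \<open>F\<close> may involve the generators \<open>2 * n + 1, \<dots>, 4 * n\<close>, which are constants for the integration.
  Splitting the monomial over \<open>B\<close> into the product of its part over \<open>{1..2 * n}\<close> and its part over
  \<open>{2 * n + 1..4 * n}\<close> shows that \<^const>\<open>berezin\<close> leaves the second factor unchanged.
\<close>

definition super_integral ::
    "nat \<Rightarrow> 'a::euclidean_space superdistribution \<Rightarrow> ('a \<Rightarrow> grassmann) \<Rightarrow> grassmann" where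
  "super_integral n \<alpha> F = (\<Sum>A\<in>Pow {1..2 * n}. \<Sum>B\<in>Pow {1..4 * n}.
     gconst (dist_pair (\<alpha> A) (\<lambda>x. gcoeff (F x) B)) * berezin n (gmono A * gmono B))"

end

theory Submission
  imports Defs
begin

text \<open>
  The field \<open>D\<^sup>\<dagger>\<close> has superdivergence \<open>m - n\<close>, it annihilates \<open>F\<close>, and \<open>\<bar>Z - U\<bar>\<^sup>-\<^sup>M\<close> is homogeneous of
  degree \<open>-(m - n)\<close> under it. Hence integration by parts in both kinds of variables makes the
  Taylor expansion of \<open>\<delta>(g)\<close> telescope, and only the term in which \<open>g\<close> is replaced by its body \<open>g\<^sub>0\<close>
  survives. In that term the Berezin integral eliminates one pair of anticommuting variables after
  the other. Each step substitutes the \<open>U\<close>-variable in \<open>F\<close> and differentiates the kernel, which ends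
  as a multiple of \<open>\<bar>z - u\<bar>\<close> to the power \<open>-2 m\<close>. What remains is the classical Bochner-Martinelli
  formula for the coefficients of \<open>F\<close>, which is the divergence theorem on \<open>{g\<^sub>0 < 0}\<close> for a kernel
  regularised at \<open>u\<close>.

  Pairings with \<open>\<delta>\<^bsup>(j)\<^esup>(h)\<close> are derivatives at \<open>0\<close> of \<open>s \<mapsto> \<integral>\<^bsub>{h < s}\<^esub> \<phi>\<close>. If \<open>V h = 1\<close> near the level set,
  the derivative of this function is the same function for \<open>div (\<phi> V)\<close>, which gives smoothness and
  reduces everything to integration by parts against functions of \<open>h\<close>.
\<close>

section \<open>Grassmann algebra\<close>

text \<open>Distributions act on scalar functions, while the integrand takes values in a Grassmann
  algebra with the generators of \<open>y\<close> as parameters. Each coefficient of a Berezin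
  integral is a fixed scalar times one coefficient of the argument, so everything is run for one
  coefficient at a time.

  The delicate analytic point is that a Dirac derivative is an iterated derivative of a density, but
  integrals over sublevel sets can jump as the level moves. The way in is to integrate against
  \<open>max 0 (s - h)\<close> instead, which is Lipschitz in \<open>s\<close> for every continuous
  \<open>h\<close>. Near level 0 a sublevel integral is such a hinge integral plus a constant. This
  gives continuity; continuity of a dominating sublevel integral gives differentiability of hinge
  integrals; the same identity then gives all derivatives.

  In the classical part the singular power is continued below radius \<open>r\<close> by its
  tangent, since a single integration by parts asks for a continuously differentiable field. The
  divergence of that field is again a hinge in the squared distance, so its total weight comes from
  the divergence theorem on a ball, and no surface measure enters.\<close>

lemmas gcoeff_add [simp] = plus_grassmann.rep_eq
lemmas gcoeff_uminus [simp] = uminus_grassmann.rep_eq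
lemmas gcoeff_diff [simp] = minus_grassmann.rep_eq
lemmas gcoeff_0 [simp] = zero_grassmann.rep_eq
lemmas gcoeff_mult = times_grassmann.rep_eq

lemma gcoeff_infinite: "infinite A \<Longrightarrow> gcoeff a A = 0"
  using gcoeff[of a] by simp

lemma gcoeff_sum: "gcoeff (\<Sum>i\<in>I. f i) A = (\<Sum>i\<in>I. gcoeff (f i) A)"
  by (induction I rule: infinite_finite_induct) simp_all

lemma gcoeff_gconst_mult [simp]: "gcoeff (gconst c * a) C = c * gcoeff a C"
proof (cases "finite C")
  case True
  have "gcoeff (gconst c * a) C = (\<Sum>A\<in>Pow C. if A = {} then c * gcoeff a C else 0)"
    unfolding gcoeff_mult gcoeff_gconst by (rule sum.cong) auto
  with True show ?thesis by simp
qed (simp add: gcoeff_infinite)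

lemma gcoeff_mult_gconst [simp]: "gcoeff (a * gconst c) C = c * gcoeff a C"
proof (cases "finite C")
  case True
  have "gcoeff (a * gconst c) C = (\<Sum>A\<in>Pow C. if A = C then c * gcoeff a C else 0)"
    unfolding gcoeff_mult gcoeff_gconst by (rule sum.cong) auto
  with True show ?thesis by simp
qed (simp add: gcoeff_infinite)

lemma gconst_comm: "a * gconst c = gconst c * a"
  by (rule grassmann_eqI) simp

lemma gconst_left_comm: "a * (gconst c * b) = gconst c * (a * b)"
  by (metis gconst_comm mult.assoc)

lemma gconst_0 [simp]: "gconst 0 = 0"
  by (rule grassmann_eqI) (simp add: gcoeff_gconst)

lemma gconst_1 [simp]: "gconst 1 = 1"
  by (rule grassmann_eqI) (simp add: gcoeff_gconst one_grassmann.rep_eq)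

lemma gconst_add: "gconst (c + d) = gconst c + gconst d"
  by (rule grassmann_eqI) (simp add: gcoeff_gconst)

lemma gconst_diff: "gconst (c - d) = gconst c - gconst d"
  by (rule grassmann_eqI) (simp add: gcoeff_gconst)

lemma gconst_uminus: "gconst (- c) = - gconst c"
  by (rule grassmann_eqI) (simp add: gcoeff_gconst)

lemma gconst_mult: "gconst (c * d) = gconst c * gconst d"
  by (rule grassmann_eqI) (simp add: gcoeff_gconst)

lemma gconst_sum: "gconst (\<Sum>i\<in>I. f i) = (\<Sum>i\<in>I. gconst (f i))"
  by (induction I rule: infinite_finite_induct) (simp_all add: gconst_add)

lemma gconst_of_nat: "gconst (of_nat k) = of_nat k"
  by (induction k) (simp_all add: gconst_add)

subsection \<open>Parity\<close>

definition geven :: "grassmann \<Rightarrow> bool" where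
  "geven a \<longleftrightarrow> (\<forall>A. odd (card A) \<longrightarrow> gcoeff a A = 0)"

definition godd :: "grassmann \<Rightarrow> bool" where
  "godd a \<longleftrightarrow> (\<forall>A. even (card A) \<longrightarrow> gcoeff a A = 0)"

lemma geven_add: "geven a \<Longrightarrow> geven b \<Longrightarrow> geven (a + b)"
  and geven_diff: "geven a \<Longrightarrow> geven b \<Longrightarrow> geven (a - b)"
  and godd_add: "godd a \<Longrightarrow> godd b \<Longrightarrow> godd (a + b)"
  and godd_diff: "godd a \<Longrightarrow> godd b \<Longrightarrow> godd (a - b)"
  and geven_gconst_mult: "geven a \<Longrightarrow> geven (gconst c * a)"
  and godd_gconst_mult: "godd a \<Longrightarrow> godd (gconst c * a)"
  and geven_gconst: "geven (gconst c)"
  by (auto simp: geven_def godd_def gcoeff_gconst)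

lemma geven_0: "geven 0"
  by (simp add: geven_def)

lemma geven_1: "geven 1"
  using geven_gconst[of 1] by simp

lemma geven_sum: "(\<And>i. i \<in> I \<Longrightarrow> geven (f i)) \<Longrightarrow> geven (\<Sum>i\<in>I. f i)"
  by (induction I rule: infinite_finite_induct) (auto intro: geven_add geven_0)

lemma godd_gen: "godd (gen j)"
  by (auto simp: godd_def gcoeff_gmono)

lemma card_split:
  assumes "finite C" "A \<subseteq> C"
  shows "card C = card A + card (C - A)"
  using assms by (metis card_Diff_subset card_mono finite_subset le_add_diff_inverse)

lemma geven_mult:
  assumes "geven a" "geven b"
  shows "geven (a * b)"
  unfolding geven_def
proof (intro allI impI)
  fix C :: "nat set" assume C: "odd (card C)"
  then have fin: "finite C" using card.infinite by fastforce
  show "gcoeff (a * b) C = 0"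
    unfolding gcoeff_mult
  proof (rule sum.neutral, rule ballI)
    fix A assume "A \<in> Pow C"
    then have "card C = card A + card (C - A)" using card_split[OF fin] by blast
    then have "odd (card A) \<or> odd (card (C - A))" using C by auto
    then show "gsign A (C - A) * gcoeff a A * gcoeff b (C - A) = 0"
      using assms by (auto simp: geven_def)
  qed
qed

lemma godd_mult:
  assumes "godd a" "godd b"
  shows "geven (a * b)"
  unfolding geven_def
proof (intro allI impI)
  fix C :: "nat set" assume C: "odd (card C)"
  then have fin: "finite C" using card.infinite by fastforce
  show "gcoeff (a * b) C = 0"
    unfolding gcoeff_mult
  proof (rule sum.neutral, rule ballI)
    fix A assume "A \<in> Pow C"
    then have "card C = card A + card (C - A)" using card_split[OF fin] by blast
    then have "even (card A) \<or> even (card (C - A))" using C by auto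
    then show "gsign A (C - A) * gcoeff a A * gcoeff b (C - A) = 0"
      using assms by (auto simp: godd_def)
  qed
qed

lemma geven_power: "geven a \<Longrightarrow> geven (a ^ k)"
  by (induction k) (auto intro: geven_mult geven_1)

text \<open>As \<open>A\<close> and \<open>B\<close> are disjoint, \<open>A \<times> B\<close>
  splits into the inversions of \<open>(A, B)\<close> and the pairs with \<open>i < j\<close>, which
  become the inversions of \<open>(B, A)\<close> after swapping. The two counts add up to
  \<open>card A * card B\<close>.\<close>

lemma gsign_swap:
  assumes "finite A" "finite B" "A \<inter> B = {}"
  shows "gsign B A = (-1) ^ (card A * card B) * gsign A B"
proof -
  let ?P = "{(i, j). i \<in> A \<and> j \<in> B \<and> j < i}" and ?Q = "{(i, j). i \<in> A \<and> j \<in> B \<and> i < j}"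
  have fin: "finite (A \<times> B)" using assms by simp
  have "?P \<union> ?Q = A \<times> B"
  proof -
    have "i \<noteq> j" if "i \<in> A" "j \<in> B" for i j using assms(3) that by blast
    then show ?thesis by (fastforce simp: linorder_neq_iff)
  qed
  moreover have "?P \<inter> ?Q = {}" by auto
  moreover have "finite ?P" "finite ?Q"
    by (rule finite_subset[OF _ fin]; auto)+
  ultimately have "card ?P + card ?Q = card (A \<times> B)"
    using card_Un_disjoint[of ?P ?Q] by simp
  then have "card ?P + card ?Q = card A * card B" by (simp only: card_cartesian_product)
  moreover have "{(i, j). i \<in> B \<and> j \<in> A \<and> j < i} = prod.swap ` ?Q" by auto
  then have "card {(i, j). i \<in> B \<and> j \<in> A \<and> j < i} = card ?Q"
    by (simp add: card_image)
  ultimately have e: "card {(i, j). i \<in> B \<and> j \<in> A \<and> j < i} + card ?P = card A * card B" by simp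
  have "(-1 :: complex) ^ (card A * card B) * gsign A B =
      (-1) ^ card {(i, j). i \<in> B \<and> j \<in> A \<and> j < i} * ((-1) ^ card ?P * (-1) ^ card ?P)"
    unfolding gsign_def e[symmetric] power_add by (simp only: mult.assoc)
  also have "(-1 :: complex) ^ card ?P * (-1) ^ card ?P = 1" by (simp flip: power_add power_mult_distrib)
  finally show ?thesis by (simp add: gsign_def)
qed

text \<open>Common source of the commutation rules for even and odd elements: the reindexing
  \<open>A \<mapsto> C - A\<close> matches the terms of \<open>b * a\<close> with those of
  \<open>a * b\<close>, and only the sorting sign changes.\<close>

lemma gcoeff_mult_swap:
  assumes "finite C"
  shows "gcoeff (b * a) C =
    (\<Sum>A\<in>Pow C. (-1) ^ (card A * card (C - A)) * (gsign A (C - A) * gcoeff a A * gcoeff b (C - A)))"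
proof -
  have "gcoeff (b * a) C = (\<Sum>A\<in>Pow C. gsign (C - A) A * gcoeff b (C - A) * gcoeff a A)"
    unfolding gcoeff_mult
    by (rule sum.reindex_bij_witness[where i = "\<lambda>A. C - A" and j = "\<lambda>A. C - A"])
      (auto simp: double_diff)
  also have "\<dots> = (\<Sum>A\<in>Pow C. (-1) ^ (card A * card (C - A)) * (gsign A (C - A) * gcoeff a A * gcoeff b (C - A)))"
  proof (rule sum.cong[OF refl])
    fix A assume "A \<in> Pow C"
    then have "finite A" "finite (C - A)" "A \<inter> (C - A) = {}" using assms finite_subset by auto
    from gsign_swap[OF this]
    show "gsign (C - A) A * gcoeff b (C - A) * gcoeff a A =
        (-1) ^ (card A * card (C - A)) * (gsign A (C - A) * gcoeff a A * gcoeff b (C - A))"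
      by simp
  qed
  finally show ?thesis .
qed

lemma geven_comm:
  assumes "geven a"
  shows "a * b = b * a"
proof (rule grassmann_eqI)
  fix C :: "nat set" assume C: "finite C"
  show "gcoeff (a * b) C = gcoeff (b * a) C"
    unfolding gcoeff_mult_swap[OF C, of b a] gcoeff_mult[of a b]
  proof (rule sum.cong[OF refl])
    fix A assume "A \<in> Pow C"
    show "gsign A (C - A) * gcoeff a A * gcoeff b (C - A) =
        (-1) ^ (card A * card (C - A)) * (gsign A (C - A) * gcoeff a A * gcoeff b (C - A))"
      using assms by (cases "even (card A)") (auto simp: geven_def)
  qed
qed

lemma godd_anticomm:
  assumes "godd a" "godd b"
  shows "a * b = - (b * a)"
proof (rule grassmann_eqI)
  fix C :: "nat set" assume C: "finite C"
  show "gcoeff (a * b) C = gcoeff (- (b * a)) C"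
    unfolding gcoeff_uminus gcoeff_mult_swap[OF C, of b a] gcoeff_mult[of a b] sum_negf[symmetric]
  proof (rule sum.cong[OF refl])
    fix A assume "A \<in> Pow C"
    show "gsign A (C - A) * gcoeff a A * gcoeff b (C - A) =
        - ((-1) ^ (card A * card (C - A)) * (gsign A (C - A) * gcoeff a A * gcoeff b (C - A)))"
      using assms by (cases "odd (card A) \<and> odd (card (C - A))") (auto simp: godd_def)
  qed
qed

lemma godd_square:
  assumes "godd a"
  shows "a * a = 0"
proof (rule grassmann_eqI)
  fix C :: "nat set"
  have "gcoeff (a * a) C = - gcoeff (a * a) C"
    using godd_anticomm[OF assms assms] by (metis gcoeff_uminus)
  then show "gcoeff (a * a) C = gcoeff 0 C" by simp
qed

subsection \<open>Support and degree\<close>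

text \<open>The subalgebra of elements in which only generators with index in \<open>S\<close>
  occur.\<close>

definition gsupp :: "nat set \<Rightarrow> grassmann \<Rightarrow> bool" where
  "gsupp S a \<longleftrightarrow> (\<forall>A. \<not> A \<subseteq> S \<longrightarrow> gcoeff a A = 0)"

lemma gsupp_add: "gsupp S a \<Longrightarrow> gsupp S b \<Longrightarrow> gsupp S (a + b)"
  and gsupp_diff: "gsupp S a \<Longrightarrow> gsupp S b \<Longrightarrow> gsupp S (a - b)"
  and gsupp_gconst_mult: "gsupp S a \<Longrightarrow> gsupp S (gconst c * a)"
  and gsupp_gconst: "gsupp S (gconst c)"
  and gsupp_mono: "gsupp S a \<Longrightarrow> S \<subseteq> S' \<Longrightarrow> gsupp S' a"
  and gsupp_0: "gsupp S 0"
  by (auto simp: gsupp_def gcoeff_gconst)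

lemma gsupp_1: "gsupp S 1"
  using gsupp_gconst[of S 1] by simp

lemma gsupp_sum: "(\<And>i. i \<in> I \<Longrightarrow> gsupp S (f i)) \<Longrightarrow> gsupp S (\<Sum>i\<in>I. f i)"
  by (induction I rule: infinite_finite_induct) (auto intro: gsupp_add gsupp_0)

lemma gsupp_gen: "j \<in> S \<Longrightarrow> gsupp S (gen j)"
  by (auto simp: gsupp_def gcoeff_gmono)

lemma gsupp_mult:
  assumes "gsupp S a" "gsupp S b"
  shows "gsupp S (a * b)"
  unfolding gsupp_def
proof (intro allI impI)
  fix C assume C: "\<not> C \<subseteq> S"
  show "gcoeff (a * b) C = 0"
    unfolding gcoeff_mult
  proof (rule sum.neutral, rule ballI)
    fix A assume "A \<in> Pow C"
    then have "\<not> A \<subseteq> S \<or> \<not> C - A \<subseteq> S" using C by blast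
    then have "gcoeff a A = 0 \<or> gcoeff b (C - A) = 0"
      using assms(1)[unfolded gsupp_def, rule_format, of A]
        assms(2)[unfolded gsupp_def, rule_format, of "C - A"] by blast
    then show "gsign A (C - A) * gcoeff a A * gcoeff b (C - A) = 0" by auto
  qed
qed

lemma gsupp_power: "gsupp S a \<Longrightarrow> gsupp S (a ^ k)"
  by (induction k) (auto intro: gsupp_mult gsupp_1)

lemma gsupp_prod_list: "(\<And>a. a \<in> set as \<Longrightarrow> gsupp S a) \<Longrightarrow> gsupp S (prod_list as)"
  by (induction as) (auto intro: gsupp_mult gsupp_1)

lemma gsupp_lderiv: "gsupp S a \<Longrightarrow> gsupp S (lderiv j a)"
  by (auto simp: gsupp_def gcoeff_lderiv)

definition gdeg_ge :: "nat \<Rightarrow> grassmann \<Rightarrow> bool" where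
  "gdeg_ge d a \<longleftrightarrow> (\<forall>A. finite A \<longrightarrow> card A < d \<longrightarrow> gcoeff a A = 0)"

lemma gdeg_ge_mult:
  assumes "gdeg_ge d a" "gdeg_ge e b"
  shows "gdeg_ge (d + e) (a * b)"
  unfolding gdeg_ge_def
proof (intro allI impI)
  fix C :: "nat set" assume C: "finite C" "card C < d + e"
  show "gcoeff (a * b) C = 0"
    unfolding gcoeff_mult
  proof (rule sum.neutral, rule ballI)
    fix A assume A: "A \<in> Pow C"
    then have "card C = card A + card (C - A)" using card_split[OF C(1)] by blast
    then have "card A < d \<or> card (C - A) < e" using C(2) by linarith
    moreover have "finite A" "finite (C - A)" using A C(1) finite_subset by auto
    ultimately have "gcoeff a A = 0 \<or> gcoeff b (C - A) = 0"
      using assms(1)[unfolded gdeg_ge_def, rule_format, of A]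
        assms(2)[unfolded gdeg_ge_def, rule_format, of "C - A"] by blast
    then show "gsign A (C - A) * gcoeff a A * gcoeff b (C - A) = 0" by auto
  qed
qed

lemma gdeg_ge_power: "gdeg_ge d a \<Longrightarrow> gdeg_ge (k * d) (a ^ k)"
proof (induction k)
  case 0
  show ?case by (simp add: gdeg_ge_def)
next
  case (Suc k)
  then show ?case using gdeg_ge_mult[of d a "k * d" "a ^ k"] by simp
qed

text \<open>An even element without body starts in degree 2, so its \<open>k\<close>-th power starts
  in degree \<open>2 * k\<close>, which exceeds the number of available generators.\<close>

lemma geven_nilpotent:
  assumes "geven a" "gcoeff a {} = 0" "gsupp S a" "finite S" "card S < 2 * k"
  shows "a ^ k = 0"
proof (rule grassmann_eqI)
  fix A :: "nat set" assume A: "finite A"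
  have "gdeg_ge 2 a"
    unfolding gdeg_ge_def
  proof (intro allI impI)
    fix B :: "nat set" assume B: "finite B" "card B < 2"
    then have "B = {} \<or> odd (card B)" by (auto simp: less_2_cases_iff)
    then show "gcoeff a B = 0" using assms(1,2) by (auto simp: geven_def)
  qed
  from gdeg_ge_power[OF this, of k] have deg: "gdeg_ge (k * 2) (a ^ k)" .
  show "gcoeff (a ^ k) A = gcoeff 0 A"
  proof (cases "A \<subseteq> S")
    case True
    then have "card A < k * 2" using card_mono[OF assms(4) True] assms(5) by linarith
    then show ?thesis using deg A by (simp add: gdeg_ge_def)
  next
    case False
    then show ?thesis using gsupp_power[OF assms(3), of k] by (simp add: gsupp_def)
  qed
qed

subsection \<open>Left derivatives\<close>

lemma lderiv_add: "lderiv j (a + b) = lderiv j a + lderiv j b"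
  by (rule grassmann_eqI) (simp add: gcoeff_lderiv ring_distribs)

lemma lderiv_diff: "lderiv j (a - b) = lderiv j a - lderiv j b"
  by (rule grassmann_eqI) (simp add: gcoeff_lderiv ring_distribs)

lemma lderiv_gconst_mult: "lderiv j (gconst c * a) = gconst c * lderiv j a"
  by (rule grassmann_eqI) (simp add: gcoeff_lderiv)

lemma lderiv_0 [simp]: "lderiv j 0 = 0"
  by (rule grassmann_eqI) (simp add: gcoeff_lderiv)

lemma lderiv_gconst [simp]: "lderiv j (gconst c) = 0"
  using lderiv_gconst_mult[of j c 1] by (simp add: lderiv_one)

lemma lderiv_lderiv_same [simp]: "lderiv j (lderiv j a) = 0"
  by (rule grassmann_eqI) (simp add: gcoeff_lderiv)

lemma lderiv_gen: "lderiv j (gen k * a) = (if j = k then a else 0) - gen k * lderiv j a"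
  using lderiv_gen_mult[of j k a] by (metis add_diff_cancel_right')

text \<open>In what follows, \<open>lderiv j a = 0\<close> serves as the way to say that the
  generator \<open>j\<close> does not occur in \<open>a\<close>.\<close>

lemma lderiv_eq_0_iff: "lderiv j a = 0 \<longleftrightarrow> (\<forall>A. j \<in> A \<longrightarrow> gcoeff a A = 0)"
proof
  assume z: "lderiv j a = 0"
  show "\<forall>A. j \<in> A \<longrightarrow> gcoeff a A = 0"
  proof (intro allI impI)
    fix A assume "j \<in> A"
    then have "insert j (A - {j}) = A" by auto
    then have "gcoeff (lderiv j a) (A - {j}) = (-1) ^ card {i \<in> A - {j}. i < j} * gcoeff a A"
      unfolding gcoeff_lderiv by simp
    then show "gcoeff a A = 0" unfolding z by simp
  qed
next
  assume "\<forall>A. j \<in> A \<longrightarrow> gcoeff a A = 0"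
  then show "lderiv j a = 0" by (intro grassmann_eqI) (simp add: gcoeff_lderiv)
qed

lemma lderiv_mult_free:
  assumes "lderiv j a = 0" "lderiv j b = 0"
  shows "lderiv j (a * b) = 0"
  unfolding lderiv_eq_0_iff
proof (intro allI impI)
  fix C assume C: "j \<in> C"
  show "gcoeff (a * b) C = 0"
    unfolding gcoeff_mult
  proof (rule sum.neutral, rule ballI)
    fix A assume "A \<in> Pow C"
    then have "j \<in> A \<or> j \<in> C - A" using C by blast
    then have "gcoeff a A = 0 \<or> gcoeff b (C - A) = 0" using assms unfolding lderiv_eq_0_iff by blast
    then show "gsign A (C - A) * gcoeff a A * gcoeff b (C - A) = 0" by auto
  qed
qed

text \<open>Every element splits as \<open>(a - gen j * lderiv j a) + gen j * lderiv j a\<close>, where neither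
  the first summand nor \<open>lderiv j a\<close> involves the generator \<open>j\<close>.\<close>

lemma lderiv_free_part: "lderiv j (a - gen j * lderiv j a) = 0"
  by (simp add: lderiv_diff lderiv_gen)

lemma lderiv_mult_even_free:
  assumes "geven x" "lderiv j x = 0"
  shows "lderiv j (x * b) = x * lderiv j b"
proof -
  have "x * b = x * (b - gen j * lderiv j b) + x * (gen j * lderiv j b)"
    by (simp add: right_diff_distrib)
  also have "x * (gen j * lderiv j b) = gen j * (x * lderiv j b)"
    using geven_comm[OF assms(1), of "gen j"] by (simp flip: mult.assoc)
  finally have "lderiv j (x * b) = lderiv j (x * (b - gen j * lderiv j b)) + lderiv j (gen j * (x * lderiv j b))"
    by (simp only: lderiv_add)
  also have "lderiv j (x * (b - gen j * lderiv j b)) = 0"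
    by (rule lderiv_mult_free[OF assms(2) lderiv_free_part])
  also have "lderiv j (gen j * (x * lderiv j b)) = x * lderiv j b"
    using lderiv_mult_free[OF assms(2) lderiv_lderiv_same[of j b]] by (simp add: lderiv_gen)
  finally show ?thesis by simp
qed

lemma lderiv_mult_odd_free:
  assumes "godd x" "lderiv j x = 0"
  shows "lderiv j (x * b) = - (x * lderiv j b)"
proof -
  have "x * b = x * (b - gen j * lderiv j b) + x * (gen j * lderiv j b)"
    by (simp add: right_diff_distrib)
  also have "x * (gen j * lderiv j b) = - (gen j * (x * lderiv j b))"
    using godd_anticomm[OF assms(1) godd_gen, of j] by (simp flip: mult.assoc)
  finally have "lderiv j (x * b) = lderiv j (x * (b - gen j * lderiv j b)) - lderiv j (gen j * (x * lderiv j b))"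
    by (simp only: lderiv_diff diff_conv_add_uminus[symmetric])
  also have "lderiv j (x * (b - gen j * lderiv j b)) = 0"
    by (rule lderiv_mult_free[OF assms(2) lderiv_free_part])
  also have "lderiv j (gen j * (x * lderiv j b)) = x * lderiv j b"
    using lderiv_mult_free[OF assms(2) lderiv_lderiv_same[of j b]] by (simp add: lderiv_gen)
  finally show ?thesis by simp
qed

lemma godd_lderiv:
  assumes "geven a"
  shows "godd (lderiv j a)"
  unfolding godd_def gcoeff_lderiv
  using assms by (auto simp: geven_def) (metis card_insert_disjoint even_Suc finite_insert gcoeff_infinite)

text \<open>Split off the generator: \<open>a\<close> is the sum of an even element and of
  \<open>gen j\<close> times an odd one, both free of \<open>j\<close>. The signs from moving the
  derivative past \<open>gen j\<close> and past the odd element cancel.\<close>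

lemma lderiv_mult_even:
  assumes "geven a"
  shows "lderiv j (a * b) = lderiv j a * b + a * lderiv j b"
proof -
  let ?a0 = "a - gen j * lderiv j a" and ?a1 = "lderiv j a"
  have o: "godd ?a1" by (rule godd_lderiv[OF assms])
  have e: "geven ?a0" by (rule geven_diff[OF assms godd_mult[OF godd_gen o]])
  have "lderiv j (a * b) = lderiv j (?a0 * b + gen j * (?a1 * b))"
    by (simp add: left_diff_distrib mult.assoc)
  also have "\<dots> = ?a0 * lderiv j b + (?a1 * b - gen j * lderiv j (?a1 * b))"
    by (simp add: lderiv_add lderiv_mult_even_free[OF e lderiv_free_part] lderiv_gen)
  also have "lderiv j (?a1 * b) = - (?a1 * lderiv j b)"
    by (rule lderiv_mult_odd_free[OF o lderiv_lderiv_same])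
  also have "?a0 * lderiv j b + (?a1 * b - gen j * - (?a1 * lderiv j b)) = ?a1 * b + a * lderiv j b"
    by (simp add: left_diff_distrib mult.assoc)
  finally show ?thesis .
qed

subsection \<open>Berezin integral\<close>

lemma fold_lderiv_coeff: "\<exists>\<sigma>. \<forall>a. gcoeff (fold lderiv js a) C = \<sigma> * gcoeff a (C \<union> set js)"
proof (induction js)
  case Nil
  show ?case by (rule exI[of _ 1]) simp
next
  case (Cons j js)
  then obtain \<sigma> where \<sigma>: "\<And>a. gcoeff (fold lderiv js a) C = \<sigma> * gcoeff a (C \<union> set js)" by blast
  show ?case
  proof (rule exI, rule allI)
    fix a
    show "gcoeff (fold lderiv (j # js) a) C =
        (\<sigma> * (if j \<in> C \<union> set js then 0 else (-1) ^ card {i \<in> C \<union> set js. i < j})) *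
        gcoeff a (C \<union> set (j # js))"
      by (simp add: \<sigma> gcoeff_lderiv)
  qed
qed

text \<open>Each left derivative reads one coefficient of its argument up to a sign, or gives 0, so
  their composition does the same. The factor depends on \<open>n\<close> and \<open>C\<close> only.
  This turns the Berezin integral into a scalar functional that commutes with derivatives in
  \<open>x\<close> and with distributions.\<close>

lemma berezin_coeff: "\<exists>\<sigma>. \<forall>a. gcoeff (berezin n a) C = \<sigma> * gcoeff a (C \<union> {1..2 * n})"
proof -
  have s: "set [1..<2 * n + 1] = {1..2 * n}" by auto
  obtain \<sigma> where \<sigma>: "\<And>a. gcoeff (fold lderiv [1..<2 * n + 1] a) C = \<sigma> * gcoeff a (C \<union> {1..2 * n})"
    using fold_lderiv_coeff[of "[1..<2 * n + 1]" C] unfolding s by blast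
  have "gcoeff (berezin n a) C = (of_real (1 / pi ^ n) * \<sigma>) * gcoeff a (C \<union> {1..2 * n})" for a
    unfolding berezin_def gcoeff_gconst_mult \<sigma> by (simp only: mult.assoc)
  then show ?thesis by blast
qed

lemma berezin_add: "berezin n (a + b) = berezin n a + berezin n b"
proof (rule grassmann_eqI)
  fix C
  obtain \<sigma> where "\<forall>a. gcoeff (berezin n a) C = \<sigma> * gcoeff a (C \<union> {1..2 * n})"
    using berezin_coeff by blast
  then show "gcoeff (berezin n (a + b)) C = gcoeff (berezin n a + berezin n b) C"
    by (simp add: ring_distribs)
qed

lemma berezin_gconst_mult: "berezin n (gconst c * a) = gconst c * berezin n a"
proof (rule grassmann_eqI)
  fix C
  obtain \<sigma> where "\<forall>a. gcoeff (berezin n a) C = \<sigma> * gcoeff a (C \<union> {1..2 * n})"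
    using berezin_coeff by blast
  then show "gcoeff (berezin n (gconst c * a)) C = gcoeff (gconst c * berezin n a) C" by simp
qed

lemma berezin_0 [simp]: "berezin n 0 = 0"
  using berezin_gconst_mult[of n 0 0] by simp

lemma berezin_diff: "berezin n (a - b) = berezin n a - berezin n b"
  using berezin_add[of n "a - b" b] by simp

lemma berezin_sum: "berezin n (\<Sum>i\<in>I. f i) = (\<Sum>i\<in>I. berezin n (f i))"
  by (induction I rule: infinite_finite_induct) (simp_all add: berezin_add)

text \<open>The integral reads a coefficient whose index set contains \<open>j\<close>, and no
  monomial of a \<open>j\<close>-th derivative contains \<open>j\<close>.\<close>

lemma berezin_lderiv:
  assumes "j \<in> {1..2 * n}"
  shows "berezin n (lderiv j a) = 0"
proof (rule grassmann_eqI)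
  fix C
  obtain \<sigma> where "\<forall>a. gcoeff (berezin n a) C = \<sigma> * gcoeff a (C \<union> {1..2 * n})"
    using berezin_coeff by blast
  then show "gcoeff (berezin n (lderiv j a)) C = gcoeff 0 C"
    using assms by (simp add: gcoeff_lderiv)
qed

subsection \<open>Complex anticommuting variables\<close>

definition gw :: "nat \<Rightarrow> nat \<Rightarrow> grassmann" where "gw n k = gz k - gu n k"

definition gwc :: "nat \<Rightarrow> nat \<Rightarrow> grassmann" where "gwc n k = gzc k - guc n k"

text \<open>Meant for linear combinations \<open>v\<close> of the generators, with coefficients \<open>d j\<close>.\<close>

definition glinear :: "nat \<Rightarrow> grassmann \<Rightarrow> (nat \<Rightarrow> complex) \<Rightarrow> bool" where
  "glinear n v d \<longleftrightarrow> (\<forall>j\<in>{1..2 * n}. \<forall>a. lderiv j (v * a) = gconst (d j) * a - v * lderiv j a)"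

lemma glinearD:
  "glinear n v d \<Longrightarrow> j \<in> {1..2 * n} \<Longrightarrow> lderiv j (v * a) = gconst (d j) * a - v * lderiv j a"
  by (simp add: glinear_def)

lemma glinear_gen: "glinear n (gen k) (\<lambda>j. if j = k then 1 else 0)"
  by (auto simp: glinear_def lderiv_gen)

lemma glinear_add: "glinear n v d \<Longrightarrow> glinear n v' d' \<Longrightarrow> glinear n (v + v') (\<lambda>j. d j + d' j)"
  by (auto simp: glinear_def gconst_add distrib_right lderiv_add)

lemma glinear_diff: "glinear n v d \<Longrightarrow> glinear n v' d' \<Longrightarrow> glinear n (v - v') (\<lambda>j. d j - d' j)"
  by (auto simp: glinear_def gconst_diff left_diff_distrib lderiv_diff)

lemma glinear_gconst_mult: "glinear n v d \<Longrightarrow> glinear n (gconst c * v) (\<lambda>j. c * d j)"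
  by (auto simp: glinear_def mult.assoc lderiv_gconst_mult gconst_mult right_diff_distrib)

lemma glinear_cong: "glinear n v d \<Longrightarrow> (\<And>j. j \<in> {1..2 * n} \<Longrightarrow> d j = d' j) \<Longrightarrow> glinear n v d'"
  by (simp add: glinear_def)

text \<open>\<open>c\<close> is \<i> for \<open>gz k\<close> and -\<i> for its conjugate.\<close>

definition dzcoeff :: "complex \<Rightarrow> nat \<Rightarrow> nat \<Rightarrow> complex" where
  "dzcoeff c k j = (if j = 2 * k - 1 then 1 else if j = 2 * k then c else 0)"

lemma glinear_gz: "k \<ge> 1 \<Longrightarrow> glinear n (gz k) (dzcoeff \<i> k)"
  unfolding gz_def
  by (rule glinear_cong[OF glinear_add[OF glinear_gen glinear_gconst_mult[OF glinear_gen]]])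
    (auto simp: dzcoeff_def)

lemma glinear_gzc: "k \<ge> 1 \<Longrightarrow> glinear n (gzc k) (dzcoeff (- \<i>) k)"
  unfolding gzc_def
  by (rule glinear_cong[OF glinear_diff[OF glinear_gen glinear_gconst_mult[OF glinear_gen]]])
    (auto simp: dzcoeff_def)

lemma glinear_gu: "k \<ge> 1 \<Longrightarrow> glinear n (gu n k) (\<lambda>_. 0)"
  unfolding gu_def
  by (rule glinear_cong[OF glinear_add[OF glinear_gen glinear_gconst_mult[OF glinear_gen]]]) auto

lemma glinear_guc: "k \<ge> 1 \<Longrightarrow> glinear n (guc n k) (\<lambda>_. 0)"
  unfolding guc_def
  by (rule glinear_cong[OF glinear_diff[OF glinear_gen glinear_gconst_mult[OF glinear_gen]]]) auto

lemma glinear_gw: "k \<ge> 1 \<Longrightarrow> glinear n (gw n k) (dzcoeff \<i> k)"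
  unfolding gw_def by (rule glinear_cong[OF glinear_diff[OF glinear_gz glinear_gu]]) auto

lemma glinear_gwc: "k \<ge> 1 \<Longrightarrow> glinear n (gwc n k) (dzcoeff (- \<i>) k)"
  unfolding gwc_def by (rule glinear_cong[OF glinear_diff[OF glinear_gzc glinear_guc]]) auto

lemma godd_gz: "godd (gz k)" and godd_gzc: "godd (gzc k)"
  and godd_gu: "godd (gu n k)" and godd_guc: "godd (guc n k)"
  unfolding gz_def gzc_def gu_def guc_def
  by (intro godd_add godd_diff godd_gconst_mult godd_gen)+

lemma godd_gw: "godd (gw n k)" and godd_gwc: "godd (gwc n k)"
  unfolding gw_def gwc_def by (intro godd_diff godd_gz godd_gzc godd_gu godd_guc)+

lemma dgzc_add: "dgzc k (a + b) = dgzc k a + dgzc k b"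
  and dgzc_diff: "dgzc k (a - b) = dgzc k a - dgzc k b"
  and dgzc_gconst_mult: "dgzc k (gconst c * a) = gconst c * dgzc k a"
  by (rule grassmann_eqI;
      simp add: dgzc_def lderiv_add lderiv_diff lderiv_gconst_mult algebra_simps add_divide_distrib diff_divide_distrib)+

lemma dgzc_gconst [simp]: "dgzc k (gconst c) = 0"
  by (simp add: dgzc_def)

lemma dgzc_0 [simp]: "dgzc k 0 = 0" and dgzc_1 [simp]: "dgzc k 1 = 0"
  using dgzc_gconst[of k 0] dgzc_gconst[of k 1] by simp_all

lemma dgzc_sum: "dgzc k (\<Sum>i\<in>I. f i) = (\<Sum>i\<in>I. dgzc k (f i))"
  by (induction I rule: infinite_finite_induct) (simp_all add: dgzc_add)

lemma dgzc_mult_even: "geven a \<Longrightarrow> dgzc k (a * b) = dgzc k a * b + a * dgzc k b"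
  by (simp add: dgzc_def lderiv_mult_even distrib_left distrib_right mult.assoc gconst_left_comm[of a])

text \<open>The constant is the conjugate derivative of \<open>v\<close> itself:
  \<open>(1 + \<i> * \<i>) / 2 = 0\<close> for \<open>gz k\<close>, and
  \<open>(1 - \<i> * \<i>) / 2 = 1\<close> for \<open>gzc k\<close>.\<close>

lemma dgzc_glinear:
  assumes "glinear n v d" "k \<in> {1..n}"
  shows "dgzc k (v * a) = gconst ((d (2 * k - 1) + \<i> * d (2 * k)) / 2) * a - v * dgzc k a"
proof -
  have "2 * k - 1 \<in> {1..2 * n}" "2 * k \<in> {1..2 * n}" using assms(2) by auto
  note l = this[THEN glinearD[OF assms(1)]]
  show ?thesis
    unfolding dgzc_def l gconst_left_comm[of v] distrib_left[of v]
    by (rule grassmann_eqI) (simp add: gconst_left_comm[of v] field_simps)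
qed

lemma dgzc_gz: "k \<in> {1..n} \<Longrightarrow> l \<ge> 1 \<Longrightarrow> dgzc k (gz l * a) = - (gz l * dgzc k a)"
  by (subst dgzc_glinear[OF glinear_gz]) (auto simp: dzcoeff_def)

lemma dgzc_gu: "k \<in> {1..n} \<Longrightarrow> l \<ge> 1 \<Longrightarrow> dgzc k (gu n l * a) = - (gu n l * dgzc k a)"
  by (subst dgzc_glinear[OF glinear_gu]) auto

lemma dgzc_gw: "k \<in> {1..n} \<Longrightarrow> l \<ge> 1 \<Longrightarrow> dgzc k (gw n l * a) = - (gw n l * dgzc k a)"
  by (subst dgzc_glinear[OF glinear_gw]) (auto simp: dzcoeff_def)

lemma dgzc_gwc:
  "k \<in> {1..n} \<Longrightarrow> l \<ge> 1 \<Longrightarrow> dgzc k (gwc n l * a) = (if k = l then a else 0) - gwc n l * dgzc k a"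
  by (subst dgzc_glinear[OF glinear_gwc]) (auto simp: dzcoeff_def)

text \<open>The nilpotent part of \<open>\<bar>Z - U\<bar>\<^sup>2\<close>, with only the pairs \<open>i + 1, \<dots>, n\<close>.\<close>

definition gN :: "nat \<Rightarrow> nat \<Rightarrow> grassmann" where
  "gN n i = gconst (- \<i> / 2) * (\<Sum>k=Suc i..n. gw n k * gwc n k)"

lemma geven_gN: "geven (gN n i)"
  unfolding gN_def by (intro geven_gconst_mult geven_sum godd_mult godd_gw godd_gwc)

lemma gcoeff_godd_mult_empty: "godd a \<Longrightarrow> gcoeff (a * b) {} = 0"
  by (simp add: gcoeff_mult godd_def)

lemma gcoeff_gN_empty: "gcoeff (gN n i) {} = 0"
  by (simp add: gN_def gcoeff_sum gcoeff_godd_mult_empty godd_gw)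

text \<open>The anticommuting part of \<open>D\<^sup>\<dagger>\<close>.\<close>

definition odd_D :: "nat \<Rightarrow> grassmann \<Rightarrow> grassmann" where
  "odd_D n a = (\<Sum>k=1..n. gwc n k * dgzc k a)"

lemma odd_D_gconst [simp]: "odd_D n (gconst c) = 0"
  by (simp add: odd_D_def)

lemma odd_D_sum: "odd_D n (\<Sum>i\<in>I. f i) = (\<Sum>i\<in>I. odd_D n (f i))"
  unfolding odd_D_def dgzc_sum sum_distrib_left by (rule sum.swap)

lemma odd_D_mult_even:
  assumes "geven a"
  shows "odd_D n (a * b) = odd_D n a * b + a * odd_D n b"
proof -
  have "gwc n k * dgzc k (a * b) = (gwc n k * dgzc k a) * b + a * (gwc n k * dgzc k b)" for k
    using geven_comm[OF assms, of "gwc n k"]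
    by (simp add: dgzc_mult_even[OF assms] distrib_left flip: mult.assoc)
  then show ?thesis by (simp add: odd_D_def sum.distrib sum_distrib_left sum_distrib_right)
qed

text \<open>\<open>odd_D\<close> is the Euler field of the variables \<open>gwc\<close>, and every
  summand of \<open>gN\<close> has degree one in them. The sign from passing \<open>gw\<close> with
  the derivative and the sign from reordering the two factors cancel.\<close>

lemma odd_D_gN: "odd_D n (gN n 0) = gN n 0"
proof -
  have d: "dgzc k (gN n 0) = gconst (\<i> / 2) * gw n k" if k: "k \<in> {1..n}" for k
  proof -
    have "dgzc k (gw n l * gwc n l) = (if k = l then - gw n l else 0)" if "l \<in> {Suc 0..n}" for l
      using dgzc_gwc[OF k, of l 1] dgzc_gw[OF k, of l "gwc n l"] that by auto
    then have "dgzc k (gN n 0) = gconst (- \<i> / 2) * (\<Sum>l=Suc 0..n. if k = l then - gw n l else 0)"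
      unfolding gN_def dgzc_gconst_mult dgzc_sum
      by (intro arg_cong[of _ _ "\<lambda>b. gconst (- \<i> / 2) * b"] sum.cong refl)
    also have "\<dots> = gconst (\<i> / 2) * gw n k"
      using k by (simp add: gconst_uminus)
    finally show ?thesis .
  qed
  have "odd_D n (gN n 0) = (\<Sum>k=1..n. gwc n k * (gconst (\<i> / 2) * gw n k))"
    unfolding odd_D_def by (rule sum.cong[OF refl]) (simp add: d)
  also have "\<dots> = (\<Sum>k=1..n. gconst (- \<i> / 2) * (gw n k * gwc n k))"
    by (rule sum.cong[OF refl])
      (simp add: gconst_left_comm gconst_uminus godd_anticomm[OF godd_gwc godd_gw])
  finally show ?thesis by (simp add: gN_def sum_distrib_left)
qed

lemma odd_D_power:
  assumes "geven a" "odd_D n a = a"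
  shows "odd_D n (a ^ j) = gconst (of_nat j) * a ^ j"
proof (induction j)
  case 0
  show ?case using odd_D_gconst[of n 1] by simp
next
  case (Suc j)
  then show ?case
    by (simp add: odd_D_mult_even[OF assms(1)] assms(2) gconst_left_comm gconst_add distrib_right)
qed

text \<open>Integration by parts: a derivative has Berezin integral \<open>0\<close>, and each of the \<open>n\<close> pairs
  contributes \<open>1\<close> to the divergence of the field.\<close>

lemma berezin_odd_D: "berezin n (odd_D n a) = gconst (of_nat n) * berezin n a"
proof -
  have "berezin n (gwc n k * dgzc k a) = berezin n a" if k: "k \<in> {1..n}" for k
  proof -
    have j: "2 * k - 1 \<in> {1..2 * n}" "2 * k \<in> {1..2 * n}" using k by auto
    have "berezin n (dgzc k b) = 0" for b
      unfolding dgzc_def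
      by (simp only: berezin_gconst_mult berezin_add berezin_lderiv[OF j(1)] berezin_lderiv[OF j(2)]
          mult_zero_right add_0_left)
    then have "berezin n (a - gwc n k * dgzc k a) = 0"
      using dgzc_gwc[OF k, of k a] k by (metis atLeastAtMost_iff)
    then show ?thesis by (simp add: berezin_diff)
  qed
  then have "berezin n (odd_D n a) = (\<Sum>k=1..n. berezin n a)"
    unfolding odd_D_def berezin_sum by (intro sum.cong) simp_all
  then show ?thesis by (simp add: gconst_of_nat)
qed

subsection \<open>Holomorphic elements\<close>

text \<open>At a monomial in odd-numbered generators only the summand \<open>gen (2 * k - 1)\<close>
  of each factor \<open>gz k\<close> contributes. These coefficients are therefore dual to the
  ordered products of the \<open>gz\<close>, which gives uniqueness and an explicit formula for the
  holomorphic expansion.\<close>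

lemma sorted_gz_coeff:
  assumes "sorted_wrt (<) ks" "0 \<notin> set ks" "finite B" "0 \<notin> B"
  shows "gcoeff (prod_list (map gz ks)) ((\<lambda>k. 2 * k - 1) ` B) = (if set ks = B then 1 else 0)"
  using assms
proof (induction ks arbitrary: B)
  case Nil
  then show ?case by (simp add: one_grassmann.rep_eq)
next
  case (Cons k ks)
  let ?o = "\<lambda>k::nat. 2 * k - 1"
  let ?a = "prod_list (map gz ks)"
  have k: "k \<ge> 1" "k \<notin> set ks" "\<forall>l\<in>set ks. k < l" using Cons.prems(1,2) by auto
  have fin: "finite (?o ` B)" using Cons.prems(3) by simp
  have o_eq: "?o l = ?o l' \<longleftrightarrow> l = l'" if "l \<ge> 1" "l' \<ge> 1" for l l' using that by linarith
  have B1: "l \<ge> 1" if "l \<in> B" for l using that Cons.prems(4) by (metis One_nat_def Suc_leI neq0_conv)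
  have "2 * k \<notin> ?o ` B"
  proof
    assume "2 * k \<in> ?o ` B"
    then obtain l where "l \<in> B" "2 * k = 2 * l - 1" by blast
    then show False using B1[of l] by presburger
  qed
  then have e: "gcoeff (gen (2 * k) * ?a) (?o ` B) = 0" by (simp only: gcoeff_gen_mult[OF fin] if_False)
  have "gz k * ?a = gen (?o k) * ?a + gconst \<i> * (gen (2 * k) * ?a)"
    by (simp add: gz_def distrib_right mult.assoc)
  then have main: "gcoeff (gz k * ?a) (?o ` B) = gcoeff (gen (?o k) * ?a) (?o ` B)"
    by (simp only: gcoeff_add gcoeff_gconst_mult e) simp
  show ?case
  proof (cases "k \<in> B")
    case False
    have "?o k \<notin> ?o ` B"
    proof
      assume "?o k \<in> ?o ` B"
      then obtain l where "l \<in> B" "?o k = ?o l" by blast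
      then show False using False o_eq[OF k(1) B1] by blast
    qed
    then have "gcoeff (gen (?o k) * ?a) (?o ` B) = 0" by (simp only: gcoeff_gen_mult[OF fin] if_False)
    moreover have "set (k # ks) \<noteq> B" using False by auto
    ultimately show ?thesis using main by simp
  next
    case True
    have "?o ` B - {?o k} = ?o ` (B - {k})"
    proof (intro equalityI subsetI)
      fix i assume "i \<in> ?o ` B - {?o k}"
      then show "i \<in> ?o ` (B - {k})" by blast
    next
      fix i assume "i \<in> ?o ` (B - {k})"
      then obtain l where l: "l \<in> B" "l \<noteq> k" "i = ?o l" by blast
      have "?o l \<noteq> ?o k" using o_eq[OF B1[OF l(1)] k(1)] l(2) by blast
      then show "i \<in> ?o ` B - {?o k}" unfolding l(3) using imageI[OF l(1), of ?o] by blast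
    qed
    moreover have "?o k \<in> ?o ` B" using True by blast
    ultimately have c: "gcoeff (gen (?o k) * ?a) (?o ` B) =
        (-1) ^ card {i \<in> ?o ` B. i < ?o k} * gcoeff ?a (?o ` (B - {k}))"
      by (simp only: gcoeff_gen_mult[OF fin] if_True)
    have ih: "gcoeff ?a (?o ` (B - {k})) = (if set ks = B - {k} then 1 else 0)"
      using Cons.prems by (intro Cons.IH) auto
    have iff: "set (k # ks) = B \<longleftrightarrow> set ks = B - {k}" using True k(2) by auto
    show ?thesis
    proof (cases "set ks = B - {k}")
      case eq: True
      \<comment> \<open>The new index \<open>k\<close> is the smallest one, so its generator already
        stands in front and the sign is 1.\<close>
      have none: "\<not> ?o l < ?o k" if "l \<in> B" for l
      proof -
        have "l = k \<or> l \<in> set ks" using that eq by blast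
        then have "k \<le> l" using k(3) less_imp_le by blast
        then show ?thesis by simp
      qed
      then have "{i \<in> ?o ` B. i < ?o k} = {}" by blast
      then have z: "card {i \<in> ?o ` B. i < ?o k} = 0" by (simp only: card.empty)
      have "gcoeff (gz k * ?a) (?o ` B) = 1"
        unfolding main c z ih using eq by simp
      then show ?thesis using eq iff by simp
    next
      case False
      then show ?thesis using main c ih iff by simp
    qed
  qed
qed

lemma gsupp_gz: "k \<in> {1..n} \<Longrightarrow> gsupp {1..2 * n} (gz k)"
  unfolding gz_def by (intro gsupp_add gsupp_gconst_mult gsupp_gen) auto

text \<open>The monomial after integration over the first \<open>i\<close> pairs. It joins the
  monomials of F(Z), at \<open>i = 0\<close>, to those of F(U), at \<open>i = n\<close>.\<close>

definition mixed_prod :: "nat \<Rightarrow> nat \<Rightarrow> nat list \<Rightarrow> grassmann" where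
  "mixed_prod n i ks = prod_list (map (\<lambda>k. if k \<le> i then gu n k else gz k) ks)"

lemma mixed_prod_Nil [simp]: "mixed_prod n i [] = 1"
  and mixed_prod_Cons: "mixed_prod n i (k # ks) = (if k \<le> i then gu n k else gz k) * mixed_prod n i ks"
  by (simp_all add: mixed_prod_def)

lemma mixed_prod_0: "0 \<notin> set ks \<Longrightarrow> mixed_prod n 0 ks = prod_list (map gz ks)"
  unfolding mixed_prod_def by (rule arg_cong[of _ _ prod_list]) (auto intro: map_cong)

lemma mixed_prod_n: "set ks \<subseteq> {..n} \<Longrightarrow> mixed_prod n n ks = prod_list (map (gu n) ks)"
  unfolding mixed_prod_def by (rule arg_cong[of _ _ prod_list]) (auto intro: map_cong)

lemma dgzc_mixed_prod: "k \<in> {1..n} \<Longrightarrow> 0 \<notin> set ks \<Longrightarrow> dgzc k (mixed_prod n i ks) = 0"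
proof (induction ks)
  case (Cons l ks)
  then have "l \<ge> 1" "dgzc k (mixed_prod n i ks) = 0" by (auto simp: Suc_le_eq)
  with Cons.prems(1) show ?case by (simp add: mixed_prod_Cons dgzc_gu[OF Cons.prems(1)] dgzc_gz[OF Cons.prems(1)])
qed simp

text \<open>The equation \<open>dgzc k a = 0\<close> expresses a coefficient whose monomial contains
  \<open>2 * k\<close> by the one with \<open>2 * k\<close> replaced by \<open>2 * k - 1\<close>,
  and makes it 0 if that generator is present as well. Induction on the number of even indices
  leaves the monomials in odd-numbered generators.\<close>

lemma hol_element_eq_0:
  assumes supp: "gsupp {1..2 * n} a" and hol: "\<forall>k\<in>{1..n}. dgzc k a = 0"
    and odd: "\<forall>A\<subseteq>{1..n}. gcoeff a ((\<lambda>k. 2 * k - 1) ` A) = 0"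
  shows "a = 0"
proof -
  let ?o = "\<lambda>k::nat. 2 * k - 1"
  have "gcoeff a C = 0" if "C \<subseteq> {1..2 * n}" for C
    using that
  proof (induction "card {k\<in>{1..n}. 2 * k \<in> C}" arbitrary: C)
    case 0
    then have no: "2 * k \<notin> C" if "k \<in> {1..n}" for k using that by auto
    have "C = ?o ` {k\<in>{1..n}. ?o k \<in> C}"
    proof (intro equalityI subsetI)
      fix i assume i: "i \<in> C"
      then have b: "1 \<le> i" "i \<le> 2 * n" using 0 by auto
      have "odd i"
      proof
        assume "even i"
        then obtain k where "i = 2 * k" by blast
        then show False using no[of k] i b by auto
      qed
      then obtain k where "i = 2 * k + 1" by (elim oddE)
      then have "i = ?o (k + 1)" "k + 1 \<in> {1..n}" using b by auto
      then show "i \<in> ?o ` {k\<in>{1..n}. ?o k \<in> C}" using i by blast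
    qed auto
    moreover have "gcoeff a (?o ` {k\<in>{1..n}. ?o k \<in> C}) = 0" by (rule odd[rule_format]) auto
    ultimately show ?case by simp
  next
    case (Suc c)
    have "{k\<in>{1..n}. 2 * k \<in> C} \<noteq> {}" using Suc.hyps(2) by (metis card.empty Zero_not_Suc)
    then obtain k where k: "k \<in> {1..n}" "2 * k \<in> C" by blast
    let ?D = "C - {2 * k}"
    have ins: "insert (2 * k) ?D = C" using k(2) by blast
    have z: "gcoeff a (insert (?o k) ?D) = 0"
    proof (rule Suc.hyps(1))
      have "2 * l \<noteq> ?o k" if "l \<in> {1..n}" for l using that k(1) by simp presburger
      then have "{l\<in>{1..n}. 2 * l \<in> insert (?o k) ?D} = {l\<in>{1..n}. 2 * l \<in> C} - {k}"
        by auto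
      moreover have "k \<in> {l\<in>{1..n}. 2 * l \<in> C}" using k by simp
      ultimately show "c = card {l\<in>{1..n}. 2 * l \<in> insert (?o k) ?D}" using Suc.hyps(2) by simp
      show "insert (?o k) ?D \<subseteq> {1..2 * n}" using Suc.prems k(1) by auto
    qed
    have "gcoeff (dgzc k a) ?D = 0" using hol k(1) by simp
    then have "gcoeff (lderiv (?o k) a) ?D + \<i> * gcoeff (lderiv (2 * k) a) ?D = 0"
      by (simp only: dgzc_def gcoeff_gconst_mult gcoeff_add) simp
    moreover have "gcoeff (lderiv (?o k) a) ?D = 0" by (simp only: gcoeff_lderiv z mult_zero_right if_cancel)
    ultimately have "gcoeff (lderiv (2 * k) a) ?D = 0" by simp
    moreover have "2 * k \<notin> ?D" by simp
    ultimately have "(-1) ^ card {i \<in> ?D. i < 2 * k} * gcoeff a C = 0"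
      by (simp only: gcoeff_lderiv if_False ins)
    then show ?case by simp
  qed
  then have "gcoeff a C = gcoeff 0 C" for C
    using supp by (cases "C \<subseteq> {1..2 * n}") (auto simp: gsupp_def)
  then show ?thesis by (intro grassmann_eqI)
qed

lemma sorted_list_gz_coeff:
  assumes "A \<subseteq> {1..n}" "B \<subseteq> {1..n}"
  shows "gcoeff (prod_list (map gz (sorted_list_of_set A))) ((\<lambda>k. 2 * k - 1) ` B) = (if A = B then 1 else 0)"
proof -
  have "finite A" "finite B" "0 \<notin> A" "0 \<notin> B" using assms finite_subset by auto
  then show ?thesis using sorted_gz_coeff[of "sorted_list_of_set A" B] by simp
qed

lemma hol_expansion_coeff:
  assumes "a = (\<Sum>A\<in>Pow {1..n}. gconst (c A) * prod_list (map gz (sorted_list_of_set A)))" "B \<subseteq> {1..n}"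
  shows "gcoeff a ((\<lambda>k. 2 * k - 1) ` B) = c B"
proof -
  have "gcoeff a ((\<lambda>k. 2 * k - 1) ` B) = (\<Sum>A\<in>Pow {1..n}. if A = B then c A else 0)"
    unfolding assms(1) gcoeff_sum gcoeff_gconst_mult
  proof (rule sum.cong[OF refl])
    fix A assume "A \<in> Pow {1..n}"
    then have "A \<subseteq> {1..n}" by simp
    from sorted_list_gz_coeff[OF this assms(2)]
    show "c A * gcoeff (prod_list (map gz (sorted_list_of_set A))) ((\<lambda>k. 2 * k - 1) ` B) = (if A = B then c A else 0)"
      by simp
  qed
  also have "\<dots> = c B" using assms(2) by (subst sum.delta) auto
  finally show ?thesis .
qed

text \<open>The difference of the two sides is holomorphic, and its coefficients at the monomials in
  odd-numbered generators vanish.\<close>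

lemma hol_expansion:
  assumes supp: "gsupp {1..2 * n} a" and hol: "\<forall>k\<in>{1..n}. dgzc k a = 0"
  shows "a = (\<Sum>A\<in>Pow {1..n}. gconst (gcoeff a ((\<lambda>k. 2 * k - 1) ` A)) *
    prod_list (map gz (sorted_list_of_set A)))" (is "a = ?e")
proof -
  have l: "set (sorted_list_of_set A) = A" "0 \<notin> A" if "A \<in> Pow {1..n}" for A
    using that finite_subset[of A "{1..n}"] by auto
  have "gsupp {1..2 * n} ?e"
    by (intro gsupp_sum gsupp_gconst_mult gsupp_prod_list) (use l(1) gsupp_gz in force)
  moreover have "dgzc k ?e = 0" if k: "k \<in> {1..n}" for k
  proof -
    have "dgzc k (prod_list (map gz (sorted_list_of_set A))) = 0" if "A \<in> Pow {1..n}" for A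
      using dgzc_mixed_prod[OF k, of "sorted_list_of_set A" 0] mixed_prod_0[of "sorted_list_of_set A" n] l[OF that]
      by simp
    then show ?thesis unfolding dgzc_sum dgzc_gconst_mult by (intro sum.neutral ballI) simp
  qed
  ultimately have "a - ?e = 0"
    using hol hol_expansion_coeff[OF refl, where n = n and c = "\<lambda>A. gcoeff a ((\<lambda>k. 2 * k - 1) ` A)"]
    by (intro hol_element_eq_0[of n] gsupp_diff supp) (simp_all add: dgzc_diff)
  then show ?thesis by (simp only: right_minus_eq)
qed

text \<open>Existence of the expansion is \<open>hol_expansion\<close>, uniqueness is
  \<open>hol_expansion_coeff\<close>. Together they turn the definite description into a plain
  coefficient, to which smoothness and holomorphy of F apply directly.\<close>

lemma hol_coeffs_eq:
  assumes "gsupp {1..2 * n} a" "\<forall>k\<in>{1..n}. dgzc k a = 0" "A \<subseteq> {1..n}"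
  shows "hol_coeffs n a A = gcoeff a ((\<lambda>k. 2 * k - 1) ` A)"
proof -
  define c where "c = (\<lambda>A. if A \<subseteq> {1..n} then gcoeff a ((\<lambda>k. 2 * k - 1) ` A) else 0)"
  have "hol_coeffs n a = c"
    unfolding hol_coeffs_def
  proof (rule the_equality)
    have "(\<Sum>A\<in>Pow {1..n}. gconst (gcoeff a ((\<lambda>k. 2 * k - 1) ` A)) * prod_list (map gz (sorted_list_of_set A))) =
        (\<Sum>A\<in>Pow {1..n}. gconst (c A) * prod_list (map gz (sorted_list_of_set A)))"
      by (rule sum.cong) (auto simp: c_def)
    then show "(\<forall>A. \<not> A \<subseteq> {1..n} \<longrightarrow> c A = 0) \<and>
        a = (\<Sum>A\<in>Pow {1..n}. gconst (c A) * prod_list (map gz (sorted_list_of_set A)))"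
      using hol_expansion[OF assms(1,2)] by (simp add: c_def)
  next
    fix c' assume c': "(\<forall>A. \<not> A \<subseteq> {1..n} \<longrightarrow> c' A = 0) \<and>
        a = (\<Sum>A\<in>Pow {1..n}. gconst (c' A) * prod_list (map gz (sorted_list_of_set A)))"
    show "c' = c"
    proof
      fix B
      show "c' B = c B"
      proof (cases "B \<subseteq> {1..n}")
        case True
        then show ?thesis using hol_expansion_coeff[OF conjunct2[OF c'] True] by (simp add: c_def)
      next
        case False
        then show ?thesis using c' by (simp add: c_def)
      qed
    qed
  qed
  then show ?thesis using assms(3) by (simp add: c_def)
qed

subsection \<open>Berezin integral of the kernel\<close>

text \<open>Two derivatives at once form an even operation, which passes all variables outside the
  pair without a sign.\<close>

definition pair_deriv :: "nat \<Rightarrow> grassmann \<Rightarrow> grassmann" where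
  "pair_deriv k a = lderiv (2 * k) (lderiv (2 * k - 1) a)"

lemma fold_lderiv_pairs: "fold lderiv [1..<2 * n + 1] a = fold pair_deriv [1..<n + 1] a"
proof (induction n)
  case (Suc n)
  have "[1..<2 * Suc n + 1] = [1..<2 * n + 1] @ [2 * n + 1, 2 * n + 2]" by simp
  then have "fold lderiv [1..<2 * Suc n + 1] a =
      lderiv (2 * n + 2) (lderiv (2 * n + 1) (fold lderiv [1..<2 * n + 1] a))" by simp
  also have "\<dots> = pair_deriv (Suc n) (fold pair_deriv [1..<n + 1] a)"
    unfolding Suc.IH by (simp add: pair_deriv_def)
  also have "\<dots> = fold pair_deriv [1..<Suc n + 1] a" by simp
  finally show ?case .
qed simp

lemma pair_deriv_add: "pair_deriv k (a + b) = pair_deriv k a + pair_deriv k b"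
  by (simp add: pair_deriv_def lderiv_add)

text \<open>Phrased through left multiplication, so that it is closed under sums and products and
  covers polynomials in all variables outside the \<open>k\<close>-th pair.\<close>

definition pair_commutes :: "nat \<Rightarrow> grassmann \<Rightarrow> bool" where
  "pair_commutes k u \<longleftrightarrow> (\<forall>a. pair_deriv k (u * a) = u * pair_deriv k a)"

lemma pair_commutesD: "pair_commutes k u \<Longrightarrow> pair_deriv k (u * a) = u * pair_deriv k a"
  by (simp add: pair_commutes_def)

lemma pair_commutes_mult: "pair_commutes k u \<Longrightarrow> pair_commutes k v \<Longrightarrow> pair_commutes k (u * v)"
  by (simp add: pair_commutes_def mult.assoc)

lemma pair_commutes_add: "pair_commutes k u \<Longrightarrow> pair_commutes k v \<Longrightarrow> pair_commutes k (u + v)"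
  by (simp add: pair_commutes_def distrib_right pair_deriv_add)

lemma pair_commutes_gconst: "pair_commutes k (gconst c)"
  by (simp add: pair_commutes_def pair_deriv_def lderiv_gconst_mult)

lemma pair_commutes_1: "pair_commutes k 1" and pair_commutes_0: "pair_commutes k 0"
  using pair_commutes_gconst[of k 1] pair_commutes_gconst[of k 0] by simp_all

lemma pair_commutes_sum: "(\<And>i. i \<in> I \<Longrightarrow> pair_commutes k (f i)) \<Longrightarrow> pair_commutes k (\<Sum>i\<in>I. f i)"
  by (induction I rule: infinite_finite_induct) (auto intro: pair_commutes_add pair_commutes_0)

lemma pair_commutes_power: "pair_commutes k u \<Longrightarrow> pair_commutes k (u ^ j)"
  by (induction j) (auto intro: pair_commutes_mult pair_commutes_1)

lemma pair_commutes_glinear: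
  assumes "glinear n v d" "k \<in> {1..n}" "d (2 * k - 1) = 0" "d (2 * k) = 0"
  shows "pair_commutes k v"
proof -
  have "2 * k - 1 \<in> {1..2 * n}" "2 * k \<in> {1..2 * n}" using assms(2) by auto
  note l = this[THEN glinearD[OF assms(1)]]
  have "lderiv (2 * k) (- b) = - lderiv (2 * k) b" for b using lderiv_diff[of "2 * k" 0 b] by simp
  then show ?thesis unfolding pair_commutes_def pair_deriv_def l assms(3,4) by (simp add: l assms(4))
qed

lemma pair_commutes_gu: "k \<in> {1..n} \<Longrightarrow> l \<ge> 1 \<Longrightarrow> pair_commutes k (gu n l)"
  by (rule pair_commutes_glinear[OF glinear_gu]) auto

lemma dzcoeff_other:
  assumes "k \<ge> 1" "l \<ge> 1" "l \<noteq> k"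
  shows "dzcoeff c l (2 * k - 1) = 0 \<and> dzcoeff c l (2 * k) = 0"
proof -
  have "2 * k - 1 \<noteq> 2 * l - 1" "2 * k - 1 \<noteq> 2 * l" "2 * k \<noteq> 2 * l - 1" "2 * k \<noteq> 2 * l"
    using assms by presburger+
  then show ?thesis by (simp only: dzcoeff_def if_False)
qed

lemma pair_commutes_gz: "k \<in> {1..n} \<Longrightarrow> l \<ge> 1 \<Longrightarrow> l \<noteq> k \<Longrightarrow> pair_commutes k (gz l)"
  by (rule pair_commutes_glinear[OF glinear_gz]) (use dzcoeff_other[of k l] in auto)

lemma pair_commutes_gw: "k \<in> {1..n} \<Longrightarrow> l \<ge> 1 \<Longrightarrow> l \<noteq> k \<Longrightarrow> pair_commutes k (gw n l)"
  by (rule pair_commutes_glinear[OF glinear_gw]) (use dzcoeff_other[of k l] in auto)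

lemma pair_commutes_gwc: "k \<in> {1..n} \<Longrightarrow> l \<ge> 1 \<Longrightarrow> l \<noteq> k \<Longrightarrow> pair_commutes k (gwc n l)"
  by (rule pair_commutes_glinear[OF glinear_gwc]) (use dzcoeff_other[of k l] in auto)

lemma pair_commutes_gN: "i < n \<Longrightarrow> pair_commutes (Suc i) (gN n (Suc i))"
  unfolding gN_def
  by (intro pair_commutes_mult pair_commutes_gconst pair_commutes_sum pair_commutes_gw pair_commutes_gwc) auto

lemma pair_commutes_mixed_prod:
  assumes "i < n" "0 \<notin> set ks"
  shows "pair_commutes (Suc i) (mixed_prod n (Suc i) ks)"
  using assms(2)
proof (induction ks)
  case Nil
  show ?case by (simp add: pair_commutes_1)
next
  case (Cons l ks)
  then have l: "l \<ge> 1" by (simp add: Suc_le_eq)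
  have k: "Suc i \<in> {1..n}" using assms(1) by simp
  have "pair_commutes (Suc i) (if l \<le> Suc i then gu n l else gz l)"
    using pair_commutes_gu[OF k l] pair_commutes_gz[OF k l] by auto
  then show ?case unfolding mixed_prod_Cons using Cons by (intro pair_commutes_mult) simp_all
qed

text \<open>On such elements the two derivatives of the pair are proportional, and a left derivative
  applied twice gives 0.\<close>

lemma pair_deriv_hol:
  assumes "dgzc k a = 0"
  shows "pair_deriv k a = 0"
proof -
  have "gconst 2 * dgzc k a = lderiv (2 * k - 1) a + gconst \<i> * lderiv (2 * k) a"
    unfolding dgzc_def by (rule grassmann_eqI) simp
  then have "lderiv (2 * k - 1) a = - (gconst \<i> * lderiv (2 * k) a)"
    using assms by (simp add: eq_neg_iff_add_eq_0)
  then have "lderiv (2 * k - 1) a = gconst (- \<i>) * lderiv (2 * k) a"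
    by (simp add: gconst_uminus)
  then show ?thesis by (simp only: pair_deriv_def lderiv_gconst_mult lderiv_lderiv_same mult_zero_right)
qed

definition gnu :: "nat \<Rightarrow> nat \<Rightarrow> grassmann" where
  "gnu n k = gconst (- \<i> / 2) * (gw n k * gwc n k)"

lemma geven_gnu: "geven (gnu n k)"
  unfolding gnu_def by (intro geven_gconst_mult godd_mult godd_gw godd_gwc)

lemma gN_Suc: "i < n \<Longrightarrow> gN n i = gN n (Suc i) + gnu n (Suc i)"
  unfolding gN_def gnu_def
  by (simp add: sum.atLeast_Suc_atMost[of "Suc i" n] distrib_left add.commute)

lemma gw_gwc_gw: "gw n k * gwc n k * gw n k = 0"
proof -
  have "gw n k * gwc n k * gw n k = - (gw n k * gw n k * gwc n k)"
    using godd_anticomm[OF godd_gwc godd_gw, of n k n k] by (simp add: mult.assoc)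
  then show ?thesis by (simp add: godd_square[OF godd_gw])
qed

lemma gnu_square: "gnu n k * gnu n k = 0"
proof -
  have "gnu n k * gnu n k = gconst (- \<i> / 2) * (gconst (- \<i> / 2) * (gw n k * gwc n k * gw n k * gwc n k))"
    unfolding gnu_def by (simp only: mult.assoc gconst_left_comm[of "gwc n k"] gconst_left_comm[of "gw n k"])
  then show ?thesis by (simp only: gw_gwc_gw mult_zero_left mult_zero_right)
qed

text \<open>\<open>gnu n k\<close> carries the factor \<open>gw n k = gz k - gu n k\<close>, and
  \<open>gw n k\<close> squares to 0. Multiplication by \<open>gnu n k\<close> thus acts like a
  delta function that sets the \<open>k\<close>-th variable of Z equal to that of U. This is the
  source of the substitution in F.\<close>

lemma gnu_gz: "gnu n k * gz k = gnu n k * gu n k"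
proof -
  have "gnu n k * gw n k = gconst (- \<i> / 2) * (gw n k * gwc n k * gw n k)"
    unfolding gnu_def by (simp only: mult.assoc)
  then have "gnu n k * gw n k = 0" by (simp only: gw_gwc_gw mult_zero_right)
  then have "gnu n k * (gz k - gu n k) = 0" by (simp only: gw_def)
  then show ?thesis by (simp add: right_diff_distrib)
qed

lemma gnu_mixed_prod: "gnu n (Suc i) * mixed_prod n i ks = gnu n (Suc i) * mixed_prod n (Suc i) ks"
proof (induction ks)
  case (Cons l ks)
  let ?v = "gnu n (Suc i)"
  have comm: "?v * (x * b) = x * (?v * b)" for x b
    using geven_comm[OF geven_gnu, of n "Suc i" x] by (metis mult.assoc)
  show ?case
  proof (cases "l = Suc i")
    case True
    have "?v * mixed_prod n i (l # ks) = (?v * gz (Suc i)) * mixed_prod n i ks"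
      using True by (simp add: mixed_prod_Cons mult.assoc)
    also have "\<dots> = gu n (Suc i) * (?v * mixed_prod n i ks)"
      unfolding gnu_gz by (simp only: mult.assoc comm)
    also have "\<dots> = ?v * mixed_prod n (Suc i) (l # ks)"
      unfolding Cons.IH using True by (simp add: mixed_prod_Cons comm)
    finally show ?thesis .
  next
    case False
    then have "l \<le> Suc i \<longleftrightarrow> l \<le> i" by auto
    then show ?thesis unfolding mixed_prod_Cons comm Cons.IH by simp
  qed
qed simp

text \<open>The factor -\<i>/2 in |Z - U|^2 normalises this to a unit, since the pair derivative of
  \<open>gw n k * gwc n k\<close> is -2\<i>.\<close>

lemma pair_deriv_gnu:
  assumes "k \<in> {1..n}"
  shows "pair_deriv k (gnu n k) = - 1"
proof -
  have j: "2 * k - 1 \<in> {1..2 * n}" "2 * k \<in> {1..2 * n}" and k: "k \<ge> 1" using assms by auto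
  have c: "dzcoeff c k (2 * k - 1) = 1" "dzcoeff c k (2 * k) = c" for c
    using k by (auto simp: dzcoeff_def)
  have w: "lderiv (2 * k - 1) (gw n k) = 1" "lderiv (2 * k) (gw n k) = gconst \<i>"
    using glinearD[OF glinear_gw[OF k] j(1), of 1] glinearD[OF glinear_gw[OF k] j(2), of 1]
    by (simp_all only: c lderiv_one mult_1_right mult_zero_right diff_zero gconst_1)
  have wc: "lderiv (2 * k - 1) (gwc n k) = 1" "lderiv (2 * k) (gwc n k) = gconst (- \<i>)"
    using glinearD[OF glinear_gwc[OF k] j(1), of 1] glinearD[OF glinear_gwc[OF k] j(2), of 1]
    by (simp_all only: c lderiv_one mult_1_right mult_zero_right diff_zero gconst_1)
  have "lderiv (2 * k - 1) (gw n k * gwc n k) = gwc n k - gw n k"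
    using glinearD[OF glinear_gw[OF k] j(1), of "gwc n k"] by (simp only: c wc gconst_1 mult_1_left mult_1_right)
  then have "pair_deriv k (gw n k * gwc n k) = gconst (- \<i>) - gconst \<i>"
    unfolding pair_deriv_def by (simp only: lderiv_diff w wc)
  then have "pair_deriv k (gnu n k) = gconst (- \<i> / 2) * (gconst (- \<i>) - gconst \<i>)"
    unfolding gnu_def using pair_commutesD[OF pair_commutes_gconst] by simp
  also have "\<dots> = gconst (- 1)" unfolding gconst_diff[symmetric] gconst_mult[symmetric]
    by (rule arg_cong[of _ _ gconst]) (simp add: field_simps)
  finally show ?thesis by (simp add: gconst_uminus)
qed

lemma nilpotent_binomial:
  fixes N v :: grassmann
  assumes "geven v" "v * v = 0"
  shows "(N + v) ^ Suc j = N ^ Suc j + gconst (of_nat (Suc j)) * (N ^ j * v)"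
proof (induction j)
  case (Suc j)
  have vN: "v * a = a * v" for a by (rule geven_comm[OF assms(1)])
  have "v * (N ^ j * v) = N ^ j * (v * v)"
    using vN[of "N ^ j"] by (simp only: mult.assoc[symmetric])
  then have z: "v * (gconst (of_nat (Suc j)) * (N ^ j * v)) = 0"
    by (simp only: gconst_left_comm[of v] assms(2) mult_zero_right)
  have "(N + v) ^ Suc (Suc j) = (N + v) * (N ^ Suc j + gconst (of_nat (Suc j)) * (N ^ j * v))"
    unfolding Suc.IH[symmetric] by simp
  also have "\<dots> = N * N ^ Suc j + gconst (of_nat (Suc j)) * (N * N ^ j * v) + v * N ^ Suc j"
    unfolding distrib_right distrib_left z gconst_left_comm[of N] by (simp add: mult.assoc)
  also have "v * N ^ Suc j = gconst 1 * (N * N ^ j * v)" by (simp add: vN[of "N * N ^ j"])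
  finally have main: "(N + v) ^ Suc (Suc j) =
      N * N ^ Suc j + gconst (of_nat (Suc j)) * (N * N ^ j * v) + gconst 1 * (N * N ^ j * v)" .
  have "gconst (of_nat (Suc (Suc j))) = gconst (of_nat (Suc j)) + gconst 1"
    unfolding gconst_add[symmetric] by simp
  with main show ?case by (simp only: distrib_right power_Suc add.assoc)
qed (simp)

text \<open>Expanded in \<open>gnu\<close>, the product has a part of degree 0, in which the pair
  occurs holomorphically and which is therefore killed, and a part of degree 1, in which the
  substitution has taken place. What remains is minus the derivative of the polynomial with respect
  to \<open>gN\<close>.\<close>

lemma pair_deriv_kernel_step:
  assumes i: "i < n" and ks: "0 \<notin> set ks"
  shows "pair_deriv (Suc i) ((\<Sum>j\<le>Suc d. gconst (b j) * gN n i ^ j) * mixed_prod n i ks) =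
    (\<Sum>j\<le>d. gconst (- of_nat (Suc j) * b (Suc j)) * gN n (Suc i) ^ j) * mixed_prod n (Suc i) ks"
proof -
  let ?k = "Suc i" and ?N = "gN n (Suc i)" and ?v = "gnu n (Suc i)"
  let ?P = "\<Sum>j\<le>Suc d. gconst (b j) * ?N ^ j"
  let ?Q = "\<Sum>j\<le>d. gconst (of_nat (Suc j) * b (Suc j)) * ?N ^ j"
  have k: "?k \<in> {1..n}" using i by simp
  have "(\<Sum>j\<le>Suc d. gconst (b j) * gN n i ^ j) =
      gconst (b 0) + (\<Sum>j\<le>d. gconst (b (Suc j)) * (?N + ?v) ^ Suc j)"
    unfolding gN_Suc[OF i] sum.atMost_Suc_shift by simp
  also have "(\<Sum>j\<le>d. gconst (b (Suc j)) * (?N + ?v) ^ Suc j) =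
      (\<Sum>j\<le>d. gconst (b (Suc j)) * ?N ^ Suc j + gconst (of_nat (Suc j) * b (Suc j)) * ?N ^ j * ?v)"
    unfolding nilpotent_binomial[OF geven_gnu gnu_square]
  proof (rule sum.cong[OF refl])
    fix j
    show "gconst (b (Suc j)) * (?N ^ Suc j + gconst (of_nat (Suc j)) * (?N ^ j * ?v)) =
        gconst (b (Suc j)) * ?N ^ Suc j + gconst (of_nat (Suc j) * b (Suc j)) * ?N ^ j * ?v"
      unfolding distrib_left gconst_mult
      by (simp only: mult.assoc gconst_left_comm[of "gconst (b (Suc j))" "of_nat (Suc j)"])
  qed
  also have "\<dots> = (\<Sum>j\<le>d. gconst (b (Suc j)) * ?N ^ Suc j) + ?Q * ?v"
    by (simp only: sum.distrib sum_distrib_right)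
  also have "gconst (b 0) + ((\<Sum>j\<le>d. gconst (b (Suc j)) * ?N ^ Suc j) + ?Q * ?v) = ?P + ?Q * ?v"
    unfolding sum.atMost_Suc_shift by (simp add: add.assoc)
  finally have split: "(\<Sum>j\<le>Suc d. gconst (b j) * gN n i ^ j) * mixed_prod n i ks =
      ?P * mixed_prod n i ks + ?Q * (?v * mixed_prod n i ks)"
    by (simp only: distrib_right mult.assoc)
  have pP: "pair_commutes ?k ?P" and pQ: "pair_commutes ?k ?Q"
    by (intro pair_commutes_sum pair_commutes_mult pair_commutes_gconst pair_commutes_power pair_commutes_gN[OF i])+
  have v: "?v * mixed_prod n i ks = mixed_prod n (Suc i) ks * ?v"
    unfolding gnu_mixed_prod by (rule geven_comm[OF geven_gnu])
  have "pair_deriv ?k ((\<Sum>j\<le>Suc d. gconst (b j) * gN n i ^ j) * mixed_prod n i ks) =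
      ?Q * (mixed_prod n (Suc i) ks * - 1)"
    unfolding split pair_deriv_add pair_commutesD[OF pP] pair_commutesD[OF pQ] v
      pair_commutesD[OF pair_commutes_mixed_prod[OF i ks]] pair_deriv_gnu[OF k]
      pair_deriv_hol[OF dgzc_mixed_prod[OF k ks]] by simp
  also have "\<dots> = (- ?Q) * mixed_prod n (Suc i) ks" by simp
  also have "- ?Q = (\<Sum>j\<le>d. gconst (- of_nat (Suc j) * b (Suc j)) * ?N ^ j)"
    by (simp add: sum_negf[symmetric] gconst_uminus del: of_nat_Suc)
  finally show ?thesis .
qed

text \<open>Up to the sign, the polynomial in \<open>gN\<close> has been differentiated
  \<open>i\<close> times; the quotient of factorials comes from differentiating the power
  \<open>j + i\<close>.\<close>

lemma fold_pair_deriv_kernel: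
  assumes "i \<le> n" "0 \<notin> set ks"
  shows "fold pair_deriv [1..<i + 1] ((\<Sum>j\<le>n. gconst (b j) * gN n 0 ^ j) * mixed_prod n 0 ks) =
    (\<Sum>j\<le>n - i. gconst ((-1) ^ i * (fact (j + i) / fact j) * b (j + i)) * gN n i ^ j) * mixed_prod n i ks"
  using assms(1)
proof (induction i)
  case (Suc i)
  let ?b = "\<lambda>j. (-1) ^ i * (fact (j + i) / fact j) * b (j + i)"
  have i: "i < n" "n - i = Suc (n - Suc i)" using Suc.prems by auto
  have "fold pair_deriv [1..<Suc i + 1] ((\<Sum>j\<le>n. gconst (b j) * gN n 0 ^ j) * mixed_prod n 0 ks) =
      pair_deriv (Suc i) ((\<Sum>j\<le>Suc (n - Suc i). gconst (?b j) * gN n i ^ j) * mixed_prod n i ks)"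
    using Suc by (simp flip: i(2))
  also have "\<dots> = (\<Sum>j\<le>n - Suc i. gconst (- of_nat (Suc j) * ?b (Suc j)) * gN n (Suc i) ^ j) * mixed_prod n (Suc i) ks"
    by (rule pair_deriv_kernel_step[OF i(1) assms(2)])
  also have "(\<lambda>j. - of_nat (Suc j) * ?b (Suc j)) = (\<lambda>j. (-1) ^ Suc i * (fact (j + Suc i) / fact j) * b (j + Suc i))"
  proof
    fix j
    have "of_nat (Suc j) * (fact (Suc j + i) / fact (Suc j)) = (fact (j + Suc i) / fact j :: complex)"
      unfolding fact_Suc[of j] by (simp del: of_nat_Suc)
    moreover have "- of_nat (Suc j) * ?b (Suc j) =
        - ((-1) ^ i * (of_nat (Suc j) * (fact (Suc j + i) / fact (Suc j))) * b (Suc j + i))"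
      by (simp only: mult_minus_left mult.left_commute mult.assoc)
    ultimately show "- of_nat (Suc j) * ?b (Suc j) = (-1) ^ Suc i * (fact (j + Suc i) / fact j) * b (j + Suc i)"
      by (simp only: power_Suc add_Suc add_Suc_right) simp
  qed
  finally show ?case .
qed simp

lemma berezin_kernel:
  assumes "gsupp {1..2 * n} a" "\<forall>k\<in>{1..n}. dgzc k a = 0"
  shows "berezin n ((\<Sum>j\<le>n. gconst (b j) * gN n 0 ^ j) * a) =
    gconst (of_real (1 / pi ^ n) * ((-1) ^ n * fact n * b n)) *
    (\<Sum>A\<in>Pow {1..n}. gconst (gcoeff a ((\<lambda>k. 2 * k - 1) ` A)) * prod_list (map (gu n) (sorted_list_of_set A)))"
proof -
  let ?K = "\<Sum>j\<le>n. gconst (b j) * gN n 0 ^ j"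
  have l: "set (sorted_list_of_set A) = A" "0 \<notin> A" "A \<subseteq> {..n}" if "A \<in> Pow {1..n}" for A
    using that finite_subset[of A "{1..n}"] by auto
  have one: "berezin n (?K * prod_list (map gz (sorted_list_of_set A))) =
      gconst (of_real (1 / pi ^ n) * ((-1) ^ n * fact n * b n)) * prod_list (map (gu n) (sorted_list_of_set A))"
    if A: "A \<in> Pow {1..n}" for A
  proof -
    let ?ks = "sorted_list_of_set A"
    have ks: "0 \<notin> set ?ks" "set ?ks \<subseteq> {..n}" using l[OF A] by simp_all
    have "berezin n (?K * prod_list (map gz ?ks)) =
        gconst (of_real (1 / pi ^ n)) * fold pair_deriv [1..<n + 1] (?K * mixed_prod n 0 ?ks)"
      unfolding berezin_def fold_lderiv_pairs mixed_prod_0[OF ks(1)] ..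
    \<comment> \<open>The remaining sum runs over \<open>j \<le> n - n\<close>, so just the top
      coefficient \<open>b n\<close> survives, with n! from the \<open>n\<close>
      differentiations.\<close>
    also have "\<dots> = gconst (of_real (1 / pi ^ n)) * (gconst ((-1) ^ n * fact n * b n) * mixed_prod n n ?ks)"
      unfolding fold_pair_deriv_kernel[OF order_refl ks(1)] by simp
    finally show ?thesis unfolding mixed_prod_n[OF ks(2)] gconst_mult by (simp only: mult.assoc)
  qed
  have "?K * a = (\<Sum>A\<in>Pow {1..n}. gconst (gcoeff a ((\<lambda>k. 2 * k - 1) ` A)) *
      (?K * prod_list (map gz (sorted_list_of_set A))))"
    by (subst (1) hol_expansion[OF assms]) (simp only: sum_distrib_left[of ?K] gconst_left_comm[of ?K])
  then have "berezin n (?K * a) = (\<Sum>A\<in>Pow {1..n}. gconst (gcoeff a ((\<lambda>k. 2 * k - 1) ` A)) *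
      berezin n (?K * prod_list (map gz (sorted_list_of_set A))))"
    by (simp only: berezin_sum berezin_gconst_mult)
  also have "\<dots> = (\<Sum>A\<in>Pow {1..n}. gconst (of_real (1 / pi ^ n) * ((-1) ^ n * fact n * b n)) *
      (gconst (gcoeff a ((\<lambda>k. 2 * k - 1) ` A)) * prod_list (map (gu n) (sorted_list_of_set A))))"
  proof (rule sum.cong[OF refl])
    fix A assume "A \<in> Pow {1..n}"
    from one[OF this]
    show "gconst (gcoeff a ((\<lambda>k. 2 * k - 1) ` A)) * berezin n (?K * prod_list (map gz (sorted_list_of_set A))) =
        gconst (of_real (1 / pi ^ n) * ((-1) ^ n * fact n * b n)) *
        (gconst (gcoeff a ((\<lambda>k. 2 * k - 1) ` A)) * prod_list (map (gu n) (sorted_list_of_set A)))"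
      by (simp only: gconst_left_comm[of "gconst (gcoeff a ((\<lambda>k. 2 * k - 1) ` A))"])
  qed
  finally show ?thesis by (simp only: sum_distrib_left)
qed

section \<open>Calculus of smooth functions\<close>

definition dir_deriv :: "'a::euclidean_space \<Rightarrow> ('a \<Rightarrow> complex) \<Rightarrow> 'a \<Rightarrow> complex" where
  "dir_deriv v f = (\<lambda>x. frechet_derivative f (at x) v)"

lemma Ck_on_Suc_dir_deriv:
  "Ck_on (Suc k) S f \<longleftrightarrow> f differentiable_on S \<and> (\<forall>v. Ck_on k S (dir_deriv v f))"
  by (simp add: dir_deriv_def)

declare Ck_on.simps(2) [simp del]

lemma has_derivative_dir_deriv:
  "f differentiable at x \<Longrightarrow> (f has_derivative (\<lambda>v. dir_deriv v f x)) (at x)"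
  unfolding dir_deriv_def by (simp add: frechet_derivative_works)

lemma dir_deriv_eqI: "(f has_derivative D) (at x) \<Longrightarrow> dir_deriv v f x = D v"
  unfolding dir_deriv_def by (metis frechet_derivative_at)

lemma dir_deriv_cong:
  assumes "open S" "x \<in> S" "\<And>z. z \<in> S \<Longrightarrow> f z = g z"
  shows "dir_deriv v f x = dir_deriv v g x"
proof -
  have "(f has_derivative D) (at x) \<longleftrightarrow> (g has_derivative D) (at x)" for D
    using has_derivative_transform_within_open[OF _ assms(1,2)] assms(3) by metis
  then show ?thesis by (simp add: dir_deriv_def frechet_derivative_def)
qed

lemma Ck_on_differentiable:
  "Ck_on (Suc k) S f \<Longrightarrow> open S \<Longrightarrow> x \<in> S \<Longrightarrow> f differentiable at x"
  by (simp add: Ck_on.simps(2) differentiable_on_eq_differentiable_at)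

text \<open>Congruence is passed in as \<open>cong\<close>, because \<open>Ck_on_cong\<close> is
  itself proved by induction on \<open>k\<close> with this rule.\<close>

lemma Ck_on_SucI:
  assumes "open S" "\<And>x. x \<in> S \<Longrightarrow> (f has_derivative (\<lambda>v. D v x)) (at x)" "\<And>v. Ck_on k S (D v)"
    and cong: "\<And>f g. (\<And>x. x \<in> S \<Longrightarrow> f x = g x) \<Longrightarrow> Ck_on k S f \<Longrightarrow> Ck_on k S g"
  shows "Ck_on (Suc k) S f"
  unfolding Ck_on_Suc_dir_deriv
proof (intro conjI allI)
  show "f differentiable_on S"
    using assms(1,2) by (auto simp: differentiable_on_eq_differentiable_at differentiable_def)
  show "Ck_on k S (dir_deriv v f)" for v
    by (rule cong[OF _ assms(3)[of v]]) (simp add: dir_deriv_eqI[OF assms(2)])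
qed

lemma Ck_on_cong:
  assumes "open S" "\<And>x. x \<in> S \<Longrightarrow> f x = g x" "Ck_on k S f"
  shows "Ck_on k S g"
  using assms(2,3)
proof (induction k arbitrary: f g)
  case 0
  then show ?case using continuous_on_cong[of S S f g] by simp
next
  case (Suc k)
  show ?case
  proof (rule Ck_on_SucI[OF assms(1) _ _ Suc.IH])
    show "(g has_derivative (\<lambda>v. dir_deriv v f x)) (at x)" if "x \<in> S" for x
      by (rule has_derivative_transform_within_open[OF _ assms(1) that Suc.prems(1)])
        (use Ck_on_differentiable[OF Suc.prems(2) assms(1) that] in
          \<open>auto intro: has_derivative_dir_deriv\<close>)
    show "Ck_on k S (dir_deriv v f)" for v
      using Suc.prems(2) by (simp add: Ck_on_Suc_dir_deriv)
  qed
qed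

lemma Ck_on_Suc_intro:
  assumes "open S" "\<And>x. x \<in> S \<Longrightarrow> (f has_derivative (\<lambda>v. D v x)) (at x)" "\<And>v. Ck_on k S (D v)"
  shows "Ck_on (Suc k) S f"
  using Ck_on_SucI[OF assms] Ck_on_cong[OF assms(1)] by blast

lemma Ck_on_has_derivative:
  "Ck_on (Suc k) S f \<Longrightarrow> open S \<Longrightarrow> x \<in> S \<Longrightarrow> (f has_derivative (\<lambda>v. dir_deriv v f x)) (at x)"
  by (simp add: Ck_on_differentiable has_derivative_dir_deriv)

lemma Ck_on_lower: "open S \<Longrightarrow> Ck_on (Suc k) S f \<Longrightarrow> Ck_on k S f"
proof (induction k arbitrary: f)
  case 0
  then show ?case by (simp add: Ck_on.simps(2) differentiable_imp_continuous_on)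
next
  case (Suc k)
  then show ?case by (metis Ck_on_Suc_dir_deriv)
qed

lemma Ck_on_dir_deriv: "Ck_on (Suc k) S f \<Longrightarrow> Ck_on k S (dir_deriv v f)"
  by (simp add: Ck_on_Suc_dir_deriv)

lemma Ck_on_continuous: "open S \<Longrightarrow> Ck_on k S f \<Longrightarrow> continuous_on S f"
  by (induction k) (auto dest: Ck_on_lower)

lemma Ck_on_local:
  assumes "open S" "\<And>x. x \<in> S \<Longrightarrow> \<exists>U. open U \<and> x \<in> U \<and> Ck_on k U f"
  shows "Ck_on k S f"
  using assms(2)
proof (induction k arbitrary: f)
  case 0
  then have "\<exists>U. open U \<and> x \<in> U \<and> continuous_on U f" if "x \<in> S" for x using that by simp
  then show ?case using assms(1)
    by (simp add: continuous_on_eq_continuous_at) (meson continuous_on_eq_continuous_at)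
next
  case (Suc k)
  show ?case
  proof (rule Ck_on_Suc_intro[OF assms(1)])
    show "(f has_derivative (\<lambda>v. dir_deriv v f x)) (at x)" if x: "x \<in> S" for x
      using Suc.prems[OF x] Ck_on_has_derivative by blast
    show "Ck_on k S (dir_deriv v f)" for v
      by (rule Suc.IH) (meson Suc.prems Ck_on_dir_deriv)
  qed
qed

lemma Ck_on_subset:
  assumes "Ck_on k S f" "open T" "T \<subseteq> S" "open S"
  shows "Ck_on k T f"
  using assms(1)
proof (induction k arbitrary: f)
  case 0
  then show ?case using assms(3) continuous_on_subset by auto
next
  case (Suc k)
  then show ?case
    by (meson Ck_on_Suc_dir_deriv assms(3) differentiable_on_subset)
qed

lemma Ck_on_const: "open S \<Longrightarrow> Ck_on k S (\<lambda>x. c)"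
  by (induction k arbitrary: c)
    (auto simp: Ck_on.simps(2))

lemma Ck_on_bounded_linear:
  assumes "open S" "bounded_linear L"
  shows "Ck_on k S L"
proof (cases k)
  case 0
  then show ?thesis using assms by (simp add: linear_continuous_on)
next
  case (Suc j)
  show ?thesis unfolding Suc
    by (rule Ck_on_Suc_intro[where D = "\<lambda>v x. L v"])
      (use assms in \<open>auto intro: bounded_linear_imp_has_derivative Ck_on_const\<close>)
qed

lemma Ck_on_add: "open S \<Longrightarrow> Ck_on k S f \<Longrightarrow> Ck_on k S g \<Longrightarrow> Ck_on k S (\<lambda>x. f x + g x)"
proof (induction k arbitrary: f g)
  case 0
  then show ?case by (simp add: continuous_on_add)
next
  case (Suc k)
  show ?case
    by (rule Ck_on_Suc_intro[where D = "\<lambda>v x. dir_deriv v f x + dir_deriv v g x"])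
      (use Suc in \<open>auto intro!: has_derivative_add Ck_on_has_derivative Ck_on_dir_deriv\<close>)
qed

lemma Ck_on_mult: "open S \<Longrightarrow> Ck_on k S f \<Longrightarrow> Ck_on k S g \<Longrightarrow> Ck_on k S (\<lambda>x. f x * g x)"
proof (induction k arbitrary: f g)
  case 0
  then show ?case by (simp add: continuous_on_mult)
next
  case (Suc k)
  show ?case
    by (rule Ck_on_Suc_intro[where D = "\<lambda>v x. f x * dir_deriv v g x + dir_deriv v f x * g x"])
      (use Suc in \<open>auto intro!: has_derivative_mult Ck_on_has_derivative Ck_on_add Suc.IH
        intro: Ck_on_dir_deriv Ck_on_lower\<close>)
qed

lemma Ck_on_inverse:
  "open S \<Longrightarrow> Ck_on k S f \<Longrightarrow> (\<And>x. x \<in> S \<Longrightarrow> f x \<noteq> 0) \<Longrightarrow> Ck_on k S (\<lambda>x. inverse (f x))"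
proof (induction k arbitrary: f)
  case 0
  then show ?case by (simp add: continuous_on_inverse)
next
  case (Suc k)
  have IH: "Ck_on k S (\<lambda>x. inverse (f x))" using Suc Ck_on_lower by blast
  show ?case
  proof (rule Ck_on_Suc_intro)
    show "((\<lambda>x. inverse (f x)) has_derivative
        (\<lambda>v. (-1) * (inverse (f x) * dir_deriv v f x * inverse (f x)))) (at x)" if "x \<in> S" for x
      using Deriv.has_derivative_inverse[OF Suc.prems(3)[OF that]
          Ck_on_has_derivative[OF Suc.prems(2,1) that]] by simp
    show "Ck_on k S (\<lambda>x. (-1) * (inverse (f x) * dir_deriv v f x * inverse (f x)))" for v
      by (intro Ck_on_mult Ck_on_const IH Ck_on_dir_deriv Suc.prems)
  qed (use Suc in auto)
qed

text \<open>\<open>Ck_on\<close> is about complex-valued functions, so a real \<open>h\<close>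
  enters through its embedding. The proof takes real parts to differentiate \<open>h\<close> and
  embeds again, using that its directional derivatives are real.\<close>

lemma Ck_on_compose:
  fixes h :: "'a::euclidean_space \<Rightarrow> real"
  assumes "open S" "open T" "h ` S \<subseteq> T" "Ck_on k S (\<lambda>x. complex_of_real (h x))" "Ck_on k T u"
  shows "Ck_on k S (\<lambda>x. u (h x))"
  using assms(4,5)
proof (induction k arbitrary: u)
  case 0
  then have "continuous_on S (\<lambda>x. Re (complex_of_real (h x)))" by (intro continuous_intros) simp
  with 0 show ?case using assms(3) by (auto intro: continuous_on_compose2)
next
  case (Suc k)
  have h': "(h has_derivative (\<lambda>v. Re (dir_deriv v (\<lambda>x. complex_of_real (h x)) x))) (at x)"
    if "x \<in> S" for x
    using has_derivative_Re[OF Ck_on_has_derivative[OF Suc.prems(1) assms(1) that]] by simp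
  have ofr: "complex_of_real (Re (dir_deriv v (\<lambda>x. complex_of_real (h x)) x)) =
      dir_deriv v (\<lambda>x. complex_of_real (h x)) x" if "x \<in> S" for x v
    using dir_deriv_eqI[OF has_derivative_of_real[OF h'[OF that], where 'a = complex], of v] by simp
  show ?case
  proof (rule Ck_on_Suc_intro
      [where D = "\<lambda>v x. dir_deriv 1 u (h x) * dir_deriv v (\<lambda>x. complex_of_real (h x)) x"])
    show "((\<lambda>x. u (h x)) has_derivative
        (\<lambda>v. dir_deriv 1 u (h x) * dir_deriv v (\<lambda>x. complex_of_real (h x)) x)) (at x)"
      if x: "x \<in> S" for x
    proof -
      have hx: "h x \<in> T" using x assms(3) by auto
      have u: "(u has_derivative (\<lambda>v. dir_deriv v u (h x))) (at (h x))"
        by (rule Ck_on_has_derivative[OF Suc.prems(2) assms(2) hx])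
      have lin: "dir_deriv t u (h x) = dir_deriv 1 u (h x) * complex_of_real t" for t
        using linear_cmul[OF has_derivative_linear[OF u], of t 1]
        by (simp add: scaleR_conv_of_real mult.commute)
      have "((\<lambda>x. u (h x)) has_derivative
          (\<lambda>v. dir_deriv (Re (dir_deriv v (\<lambda>x. complex_of_real (h x)) x)) u (h x))) (at x)"
        by (rule has_derivative_compose[OF h'[OF x] u])
      then show ?thesis by (subst (asm) lin) (simp add: ofr[OF x])
    qed
    show "Ck_on k S (\<lambda>x. dir_deriv 1 u (h x) * dir_deriv v (\<lambda>x. complex_of_real (h x)) x)" for v
      by (rule Ck_on_mult[OF assms(1) Suc.IH])
        (use Suc.prems assms(1) in \<open>auto intro: Ck_on_dir_deriv Ck_on_lower\<close>)
  qed (use assms(1) in auto)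
qed

lemma smooth_on_Ck_on: "smooth_on S f \<Longrightarrow> Ck_on k S f"
  by (simp add: smooth_on_def)

lemma smooth_on_cong:
  "open S \<Longrightarrow> (\<And>x. x \<in> S \<Longrightarrow> f x = g x) \<Longrightarrow> smooth_on S f \<Longrightarrow> smooth_on S g"
  unfolding smooth_on_def using Ck_on_cong by metis

lemma smooth_on_local:
  assumes "open S" "\<And>x. x \<in> S \<Longrightarrow> \<exists>U. open U \<and> x \<in> U \<and> smooth_on U f"
  shows "smooth_on S f"
  unfolding smooth_on_def
  by (intro allI Ck_on_local) (use assms in \<open>auto simp: smooth_on_def\<close>)

lemma smooth_on_subset: "smooth_on S f \<Longrightarrow> open T \<Longrightarrow> T \<subseteq> S \<Longrightarrow> open S \<Longrightarrow> smooth_on T f"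
  unfolding smooth_on_def using Ck_on_subset by blast

lemma smooth_on_const: "open S \<Longrightarrow> smooth_on S (\<lambda>x. c)"
  by (simp add: smooth_on_def Ck_on_const)

lemma smooth_on_bounded_linear: "open S \<Longrightarrow> bounded_linear L \<Longrightarrow> smooth_on S L"
  by (simp add: smooth_on_def Ck_on_bounded_linear)

lemma smooth_on_add:
  "open S \<Longrightarrow> smooth_on S f \<Longrightarrow> smooth_on S g \<Longrightarrow> smooth_on S (\<lambda>x. f x + g x)"
  by (simp add: smooth_on_def Ck_on_add)

lemma smooth_on_mult:
  "open S \<Longrightarrow> smooth_on S f \<Longrightarrow> smooth_on S g \<Longrightarrow> smooth_on S (\<lambda>x. f x * g x)"
  by (simp add: smooth_on_def Ck_on_mult)

lemma smooth_on_uminus: "open S \<Longrightarrow> smooth_on S f \<Longrightarrow> smooth_on S (\<lambda>x. - f x)"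
  using smooth_on_mult[of S "\<lambda>_. -1" f] by (simp add: smooth_on_const)

lemma smooth_on_diff:
  "open S \<Longrightarrow> smooth_on S f \<Longrightarrow> smooth_on S g \<Longrightarrow> smooth_on S (\<lambda>x. f x - g x)"
  using smooth_on_add[of S f "\<lambda>x. - g x"] by (simp add: smooth_on_uminus)

lemma smooth_on_sum:
  "open S \<Longrightarrow> (\<And>i. i \<in> I \<Longrightarrow> smooth_on S (f i)) \<Longrightarrow> smooth_on S (\<lambda>x. \<Sum>i\<in>I. f i x)"
  by (induction I rule: infinite_finite_induct) (auto intro: smooth_on_const smooth_on_add)

lemma smooth_on_inverse:
  "open S \<Longrightarrow> smooth_on S f \<Longrightarrow> (\<And>x. x \<in> S \<Longrightarrow> f x \<noteq> 0) \<Longrightarrow> smooth_on S (\<lambda>x. inverse (f x))"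
  by (simp add: smooth_on_def Ck_on_inverse)

lemma smooth_on_dir_deriv: "smooth_on S f \<Longrightarrow> smooth_on S (dir_deriv v f)"
  unfolding smooth_on_def using Ck_on_dir_deriv by blast

lemma smooth_on_compose:
  fixes h :: "'a::euclidean_space \<Rightarrow> real"
  assumes "open S" "open T" "h ` S \<subseteq> T" "smooth_on S (\<lambda>x. complex_of_real (h x))" "smooth_on T u"
  shows "smooth_on S (\<lambda>x. u (h x))"
  using Ck_on_compose assms unfolding smooth_on_def by blast

lemma smooth_on_has_derivative:
  "smooth_on S f \<Longrightarrow> open S \<Longrightarrow> x \<in> S \<Longrightarrow> (f has_derivative (\<lambda>v. dir_deriv v f x)) (at x)"
  using Ck_on_has_derivative smooth_on_Ck_on by blast

lemma smooth_on_differentiable: "smooth_on S f \<Longrightarrow> open S \<Longrightarrow> x \<in> S \<Longrightarrow> f differentiable at x"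
  using Ck_on_differentiable smooth_on_Ck_on by blast

lemma smooth_on_continuous: "open S \<Longrightarrow> smooth_on S f \<Longrightarrow> continuous_on S f"
  using Ck_on_continuous smooth_on_Ck_on by blast

lemma dir_deriv_const [simp]: "dir_deriv v (\<lambda>x. c) = (\<lambda>x. 0)"
  by (simp add: dir_deriv_def)

lemma dir_deriv_add:
  "f differentiable at x \<Longrightarrow> g differentiable at x \<Longrightarrow>
     dir_deriv v (\<lambda>x. f x + g x) x = dir_deriv v f x + dir_deriv v g x"
  by (rule dir_deriv_eqI) (auto intro!: has_derivative_add has_derivative_dir_deriv)

lemma dir_deriv_mult:
  "f differentiable at x \<Longrightarrow> g differentiable at x \<Longrightarrow>
     dir_deriv v (\<lambda>x. f x * g x) x = f x * dir_deriv v g x + dir_deriv v f x * g x"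
  by (rule dir_deriv_eqI) (auto intro!: has_derivative_mult has_derivative_dir_deriv)

lemma dir_deriv_cmult:
  "f differentiable at x \<Longrightarrow> dir_deriv v (\<lambda>x. c * f x) x = c * dir_deriv v f x"
  by (simp add: dir_deriv_mult)

lemma dir_deriv_sum:
  "(\<And>i. i \<in> I \<Longrightarrow> f i differentiable at x) \<Longrightarrow>
     dir_deriv v (\<lambda>x. \<Sum>i\<in>I. f i x) x = (\<Sum>i\<in>I. dir_deriv v (f i) x)"
  by (rule dir_deriv_eqI) (auto intro!: has_derivative_sum has_derivative_dir_deriv)

lemma dir_deriv_linear:
  assumes "f differentiable at x"
  shows "dir_deriv (v + w) f x = dir_deriv v f x + dir_deriv w f x"
    "dir_deriv (c *\<^sub>R v) f x = c *\<^sub>R dir_deriv v f x"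
  using linear_add[OF has_derivative_linear[OF has_derivative_dir_deriv[OF assms]], of v w]
    linear_cmul[OF has_derivative_linear[OF has_derivative_dir_deriv[OF assms]], of c v]
  by simp_all

section \<open>Cutoff functions\<close>

text \<open>The classical flat functions t^(-a) exp(-1/t). The power \<open>a\<close> is a parameter
  because derivatives then stay in the span of the family, and smoothness is one induction for all
  \<open>a\<close> together.\<close>

definition flat_exp :: "nat \<Rightarrow> real \<Rightarrow> real" where
  "flat_exp a t = (if t > 0 then inverse t ^ a * exp (- inverse t) else 0)"

lemma flat_exp_pos [simp]: "t > 0 \<Longrightarrow> flat_exp a t > 0"
  and flat_exp_nonpos [simp]: "t \<le> 0 \<Longrightarrow> flat_exp a t = 0"
  and flat_exp_nonneg: "flat_exp a t \<ge> 0"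
  by (auto simp: flat_exp_def)

lemma flat_exp_tendsto_at_right: "(flat_exp a \<longlongrightarrow> 0) (at_right 0)"
proof -
  have "((\<lambda>s::real. s ^ a / exp s) \<longlongrightarrow> 0) at_top"
    by (rule tendsto_power_div_exp_0)
  then have "((\<lambda>t::real. inverse t ^ a / exp (inverse t)) \<longlongrightarrow> 0) (at_right 0)"
    by (rule filterlim_compose) (rule filterlim_inverse_at_top_right)
  moreover have "eventually (\<lambda>t. inverse t ^ a / exp (inverse t) = flat_exp a t) (at_right 0)"
    unfolding eventually_at_right_field
    by (rule exI[of _ 1]) (auto simp: flat_exp_def exp_minus divide_inverse)
  ultimately show ?thesis by (simp add: tendsto_cong)
qed

lemma flat_exp_tendsto: "(flat_exp a \<longlongrightarrow> 0) (at 0)"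
proof -
  have "(flat_exp a \<longlongrightarrow> 0) (at_left 0)"
    by (rule Lim_transform_eventually[OF tendsto_const])
      (auto simp: eventually_at_filter)
  then show ?thesis
    using flat_exp_tendsto_at_right by (simp add: filterlim_at_split)
qed

lemma flat_exp_has_derivative:
  "(flat_exp a has_real_derivative (flat_exp (a + 2) t - a * flat_exp (Suc a) t)) (at t)"
proof -
  consider "t < 0" | "t = 0" | "t > 0" by linarith
  then show ?thesis
  proof cases
    case 1
    show ?thesis
      by (rule has_field_derivative_transform_within_open[where S = "{..<0}" and f = "\<lambda>_. 0"])
        (use 1 in auto)
  next
    case 2
    have "((\<lambda>s. (flat_exp a s - flat_exp a 0) / (s - 0)) \<longlongrightarrow> 0) (at 0)"
    \<comment> \<open>At 0 the difference quotient is the flat function with the next power.\<close>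
    proof (rule Lim_transform_eventually[OF flat_exp_tendsto[of "Suc a"]])
      show "eventually (\<lambda>s. flat_exp (Suc a) s = (flat_exp a s - flat_exp a 0) / (s - 0)) (at 0)"
        by (auto simp: eventually_at_filter flat_exp_def divide_inverse)
    qed
    then show ?thesis using 2 by (simp add: has_field_derivative_iff)
  next
    case 3
    have i: "(inverse has_real_derivative - (inverse t * inverse t)) (at t)"
      using DERIV_inverse[of t UNIV] 3 by (simp add: power2_eq_square)
    have e: "((\<lambda>t. exp (- inverse t)) has_real_derivative exp (- inverse t) * (inverse t * inverse t)) (at t)"
      using DERIV_fun_exp[OF DERIV_minus[OF i]] by simp
    have "((\<lambda>t. inverse t ^ a * exp (- inverse t)) has_real_derivative
        (a * (- (inverse t * inverse t) * inverse t ^ (a - Suc 0))) * exp (- inverse t) +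
        (exp (- inverse t) * (inverse t * inverse t)) * inverse t ^ a) (at t)"
      by (rule DERIV_mult[OF DERIV_power[OF i] e])
    also have "(a * (- (inverse t * inverse t) * inverse t ^ (a - Suc 0))) * exp (- inverse t) +
        (exp (- inverse t) * (inverse t * inverse t)) * inverse t ^ a =
        flat_exp (a + 2) t - a * flat_exp (Suc a) t"
      unfolding flat_exp_def using 3 by (cases a) (simp_all add: algebra_simps del: inverse_mult_distrib)
    finally have "((\<lambda>t. inverse t ^ a * exp (- inverse t)) has_real_derivative
        (flat_exp (a + 2) t - a * flat_exp (Suc a) t)) (at t)" .
    then show ?thesis
      by (rule has_field_derivative_transform_within_open[where S = "{0<..}"])
        (use 3 in \<open>auto simp: flat_exp_def\<close>)
  qed
qed

lemma Ck_on_has_real_derivative: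
  assumes "open T" "\<And>t. t \<in> T \<Longrightarrow> (u has_real_derivative u' t) (at t)"
    "Ck_on k T (\<lambda>t. complex_of_real (u' t))"
  shows "Ck_on (Suc k) T (\<lambda>t. complex_of_real (u t))"
proof (rule Ck_on_Suc_intro[OF assms(1)])
  show "((\<lambda>t. complex_of_real (u t)) has_derivative (\<lambda>v. complex_of_real v * complex_of_real (u' t))) (at t)"
    if "t \<in> T" for t
    using has_derivative_of_real[OF has_field_derivative_imp_has_derivative[OF assms(2)[OF that]],
        where 'a = complex]
    by (simp add: mult.commute)
  show "Ck_on k T (\<lambda>t. complex_of_real v * complex_of_real (u' t))" for v
    by (intro Ck_on_mult Ck_on_const assms)
qed

lemma smooth_on_flat_exp: "smooth_on UNIV (\<lambda>t. complex_of_real (flat_exp a t))"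
proof -
  have "Ck_on k UNIV (\<lambda>t. complex_of_real (flat_exp a t))" for k
  proof (induction k arbitrary: a)
    case 0
    have "continuous_on UNIV (flat_exp a)"
      using flat_exp_has_derivative by (meson DERIV_isCont continuous_at_imp_continuous_on)
    then show ?case by (simp add: continuous_on_of_real)
  next
    case (Suc k)
    show ?case
    proof (rule Ck_on_has_real_derivative[OF _ flat_exp_has_derivative])
      have "Ck_on k UNIV (\<lambda>t. complex_of_real (flat_exp (a + 2) t) +
          (- of_nat a) * complex_of_real (flat_exp (Suc a) t))"
        by (intro Ck_on_add Ck_on_mult Ck_on_const Suc.IH) auto
      then show "Ck_on k UNIV (\<lambda>t. complex_of_real (flat_exp (a + 2) t - a * flat_exp (Suc a) t))"
        by simp
    qed simp
  qed
  then show ?thesis by (simp add: smooth_on_def)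
qed

lemma smooth_on_powr: "smooth_on {0<..} (\<lambda>t. complex_of_real (t powr p))"
proof -
  have "Ck_on k {0<..} (\<lambda>t. complex_of_real (t powr p))" for k
  proof (induction k arbitrary: p)
    case 0
    then show ?case by (auto intro!: continuous_intros)
  next
    case (Suc k)
    show ?case
    proof (rule Ck_on_has_real_derivative)
      show "((\<lambda>t. t powr p) has_real_derivative p * t powr (p - 1)) (at t)" if "t \<in> {0<..}" for t
        using that by (auto intro!: derivative_eq_intros)
      have "Ck_on k {0<..} (\<lambda>t. complex_of_real p * complex_of_real (t powr (p - 1)))"
        by (intro Ck_on_mult Ck_on_const Suc.IH) auto
      then show "Ck_on k {0<..} (\<lambda>t. complex_of_real (p * t powr (p - 1)))" by simp
    qed simp
  qed
  then show ?thesis by (simp add: smooth_on_def)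
qed

lemma smooth_on_flat_exp_compose:
  assumes "open S" "smooth_on S (\<lambda>x. complex_of_real (h x))"
  shows "smooth_on S (\<lambda>x. complex_of_real (flat_exp a (h x)))"
  by (rule smooth_on_compose[OF _ open_UNIV _ _ smooth_on_flat_exp]) (use assms in auto)

lemma smooth_on_inner: "open S \<Longrightarrow> smooth_on S (\<lambda>x. complex_of_real (inner x b))"
  by (rule smooth_on_bounded_linear)
    (auto intro: bounded_linear_compose[OF bounded_linear_of_real bounded_linear_inner_left])

lemma smooth_on_sq_dist:
  fixes y :: "'a::euclidean_space"
  assumes "open S"
  shows "smooth_on S (\<lambda>x. complex_of_real ((dist x y)\<^sup>2))"
proof -
  have "smooth_on S (\<lambda>x. \<Sum>b\<in>Basis. (complex_of_real (inner x b) - of_real (inner y b)) *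
      (complex_of_real (inner x b) - of_real (inner y b)))"
    using assms by (intro smooth_on_sum smooth_on_mult smooth_on_diff smooth_on_const smooth_on_inner)
  moreover have "(\<lambda>x. \<Sum>b\<in>Basis. (complex_of_real (inner x b) - of_real (inner y b)) *
      (complex_of_real (inner x b) - of_real (inner y b))) = (\<lambda>x. complex_of_real ((dist x y)\<^sup>2))"
  proof
    fix x
    have "(dist x y)\<^sup>2 = (\<Sum>b\<in>Basis. (inner x b - inner y b) * (inner x b - inner y b))"
      unfolding dist_norm power2_norm_eq_inner
      by (subst euclidean_inner) (simp add: inner_diff_left)
    then show "(\<Sum>b\<in>Basis. (complex_of_real (inner x b) - of_real (inner y b)) *
      (complex_of_real (inner x b) - of_real (inner y b))) = complex_of_real ((dist x y)\<^sup>2)"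
      by simp
  qed
  ultimately show ?thesis by simp
qed

section \<open>Test functions and localisation\<close>

lemma test_functionI:
  assumes "smooth_on UNIV \<phi>" "compact K" "\<And>x. x \<notin> K \<Longrightarrow> \<phi> x = 0"
  shows "test_function \<phi>"
proof -
  have "closure {x. \<phi> x \<noteq> 0} \<subseteq> K"
    using assms(3) compact_imp_closed[OF assms(2)] by (intro closure_minimal) auto
  then show ?thesis
    using assms(1) compact_Int_closed[OF assms(2) closed_closure, of "{x. \<phi> x \<noteq> 0}"]
    unfolding test_function_def by (simp add: Int_absorb1)
qed

lemma test_function_smooth: "test_function \<phi> \<Longrightarrow> smooth_on UNIV \<phi>"
  by (simp add: test_function_def)

lemma test_function_compact: "test_function \<phi> \<Longrightarrow> compact (closure {x. \<phi> x \<noteq> 0})"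
  by (simp add: test_function_def)

lemma test_function_outside: "x \<notin> closure {x. \<phi> x \<noteq> 0} \<Longrightarrow> \<phi> x = 0"
  using closure_subset[of "{x. \<phi> x \<noteq> 0}"] by blast

lemma test_function_mult_smooth:
  assumes "smooth_on UNIV f" "test_function \<phi>"
  shows "test_function (\<lambda>x. f x * \<phi> x)"
proof (rule test_functionI)
  show "smooth_on UNIV (\<lambda>x. f x * \<phi> x)"
    by (rule smooth_on_mult) (simp_all add: assms test_function_smooth)
  show "compact (closure {x. \<phi> x \<noteq> 0})" by (rule test_function_compact[OF assms(2)])
  show "f x * \<phi> x = 0" if "x \<notin> closure {x. \<phi> x \<noteq> 0}" for x
    using test_function_outside[OF that] by simp
qed

lemma test_function_add:
  assumes "test_function \<phi>" "test_function \<psi>"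
  shows "test_function (\<lambda>x. \<phi> x + \<psi> x)"
proof (rule test_functionI)
  show "compact (closure {x. \<phi> x \<noteq> 0} \<union> closure {x. \<psi> x \<noteq> 0})"
    using assms by (intro compact_Un test_function_compact)
  show "\<phi> x + \<psi> x = 0" if "x \<notin> closure {x. \<phi> x \<noteq> 0} \<union> closure {x. \<psi> x \<noteq> 0}" for x
    using that test_function_outside[of x \<phi>] test_function_outside[of x \<psi>] by simp
  show "smooth_on UNIV (\<lambda>x. \<phi> x + \<psi> x)"
    by (intro smooth_on_add test_function_smooth assms open_UNIV)
qed

lemma test_function_cmult: "test_function \<phi> \<Longrightarrow> test_function (\<lambda>x. c * \<phi> x)"
  by (rule test_function_mult_smooth[OF smooth_on_const[OF open_UNIV]])

lemma test_function_0: "test_function (\<lambda>x. 0)"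
  by (rule test_functionI[of _ "{}"]) (auto intro: smooth_on_const)

lemma test_function_sum:
  "(\<And>i. i \<in> I \<Longrightarrow> test_function (\<phi> i)) \<Longrightarrow> test_function (\<lambda>x. \<Sum>i\<in>I. \<phi> i x)"
  by (induction I rule: infinite_finite_induct) (auto intro: test_function_0 test_function_add)

text \<open>Here \<open>f\<close> is arbitrary outside \<open>U\<close>.\<close>

lemma test_function_mult_local:
  assumes "open U" "smooth_on U f" "test_function \<rho>" "closure {x. \<rho> x \<noteq> 0} \<subseteq> U"
  shows "test_function (\<lambda>x. \<rho> x * f x)"
proof (rule test_functionI)
  let ?K = "closure {x. \<rho> x \<noteq> 0}"
  show "smooth_on UNIV (\<lambda>x. \<rho> x * f x)"
  proof (rule smooth_on_local)
    fix x :: 'a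
    show "\<exists>V. open V \<and> x \<in> V \<and> smooth_on V (\<lambda>x. \<rho> x * f x)"
    proof (cases "x \<in> U")
      case True
      have "smooth_on U \<rho>"
        by (rule smooth_on_subset[OF test_function_smooth[OF assms(3)] assms(1)]) simp_all
      then have "smooth_on U (\<lambda>x. \<rho> x * f x)"
        by (rule smooth_on_mult[OF assms(1) _ assms(2)])
      with True assms(1) show ?thesis by blast
    next
      case False
      have "open (- ?K)" by (rule open_Compl[OF closed_closure])
      then have "smooth_on (- ?K) (\<lambda>x. \<rho> x * f x)"
      proof (rule smooth_on_cong)
        show "0 = \<rho> z * f z" if "z \<in> - ?K" for z
          using that test_function_outside[of z \<rho>] by simp
      qed (rule smooth_on_const, rule open_Compl[OF closed_closure])
      moreover have "x \<in> - ?K" using False assms(4) by auto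
      ultimately show ?thesis by (meson open_Compl closed_closure)
    qed
  qed simp
  show "compact ?K" by (rule test_function_compact[OF assms(3)])
  show "\<rho> x * f x = 0" if "x \<notin> ?K" for x
    using test_function_outside[OF that] by simp
qed

text \<open>A sum of bumps over a finite cover of \<open>K\<close> by balls is bounded below on
  \<open>K\<close>; a smooth step applied to it gives the plateau. The last conclusion says that
  \<rho> is real and nonnegative, so that cutoffs can serve as dominating functions and as
  weights.\<close>

lemma exists_cutoff:
  fixes K :: "'a::euclidean_space set"
  assumes "compact K" "open U" "K \<subseteq> U"
  obtains \<rho> V where "test_function \<rho>" "closure {x. \<rho> x \<noteq> 0} \<subseteq> U" "open V" "K \<subseteq> V"
    "\<And>x. x \<in> V \<Longrightarrow> \<rho> x = 1" "\<And>x. \<rho> x = complex_of_real (cmod (\<rho> x))"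
proof -
  have "\<exists>e>0. cball x e \<subseteq> U" if "x \<in> K" for x
    using assms that open_contains_cball by blast
  then obtain e where e: "\<And>x. x \<in> K \<Longrightarrow> e x > 0" "\<And>x. x \<in> K \<Longrightarrow> cball x (e x) \<subseteq> U"
    by metis
  have "K \<subseteq> (\<Union>x\<in>K. ball x (e x))" using e(1) by force
  then obtain F where F: "F \<subseteq> K" "finite F" "K \<subseteq> (\<Union>x\<in>F. ball x (e x))"
    using compactE_image[OF assms(1), of K "\<lambda>x. ball x (e x)"] by (metis open_ball)
  define \<beta> where "\<beta> x = (\<Sum>c\<in>F. flat_exp 0 ((e c)\<^sup>2 - (dist x c)\<^sup>2))" for x
  define L where "L = (\<Union>c\<in>F. cball c (e c))"
  have sm: "smooth_on UNIV (\<lambda>x. complex_of_real (\<beta> x))"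
  proof -
    have "smooth_on UNIV (\<lambda>x. \<Sum>c\<in>F. complex_of_real (flat_exp 0 ((e c)\<^sup>2 - (dist x c)\<^sup>2)))"
    proof (intro smooth_on_sum smooth_on_flat_exp_compose)
      fix c
      have "smooth_on UNIV (\<lambda>x. complex_of_real ((e c)\<^sup>2) - complex_of_real ((dist x c)\<^sup>2))"
        by (intro smooth_on_diff smooth_on_const smooth_on_sq_dist) auto
      then show "smooth_on UNIV (\<lambda>x. complex_of_real ((e c)\<^sup>2 - (dist x c)\<^sup>2))" by simp
    qed auto
    then show ?thesis by (simp add: \<beta>_def)
  qed
  have cont: "continuous_on UNIV \<beta>"
  proof -
    have "continuous_on UNIV (\<lambda>x. Re (complex_of_real (\<beta> x)))"
      by (intro continuous_intros smooth_on_continuous sm) auto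
    then show ?thesis by simp
  qed
  have nonneg: "\<beta> x \<ge> 0" for x
    by (simp add: \<beta>_def sum_nonneg flat_exp_nonneg)
  have pos: "\<beta> x > 0" if x: "x \<in> K" for x
  proof -
    obtain c where c: "c \<in> F" "x \<in> ball c (e c)" using F(3) x by auto
    then have "(dist x c)\<^sup>2 < (e c)\<^sup>2"
      by (simp add: dist_commute power_strict_mono)
    then have "0 < flat_exp 0 ((e c)\<^sup>2 - (dist x c)\<^sup>2)" by simp
    then show ?thesis
      unfolding \<beta>_def using c(1) F(2) by (intro sum_pos2[where i = c]) (auto simp: flat_exp_nonneg)
  qed
  have out: "\<beta> x = 0" if "x \<notin> L" for x
    unfolding \<beta>_def
  proof (rule sum.neutral, rule ballI)
    fix c assume c: "c \<in> F"
    then have "dist x c > e c" "e c > 0" using that e(1) F(1) by (auto simp: L_def dist_commute)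
    then have "(e c)\<^sup>2 \<le> (dist x c)\<^sup>2" by (simp add: power_mono)
    then show "flat_exp 0 ((e c)\<^sup>2 - (dist x c)\<^sup>2) = 0" by simp
  qed
  have L: "compact L" "L \<subseteq> U"
    unfolding L_def using F(1,2) e(2) by (auto intro!: compact_UN)
  obtain d where d: "d > 0" "\<And>x. x \<in> K \<Longrightarrow> d < \<beta> x"
  proof (cases "K = {}")
    case False
    have "continuous_on K \<beta>" using cont continuous_on_subset by blast
    then obtain z where z: "z \<in> K" "\<And>x. x \<in> K \<Longrightarrow> \<beta> z \<le> \<beta> x"
      using continuous_attains_inf[OF assms(1) False] by blast
    show ?thesis
      by (rule that[of "\<beta> z / 2"]) (use pos[OF z(1)] z(2) in force)+
  qed (use that[of 1] in auto)
  \<comment> \<open>A smooth step in \<beta>: it is 1 where \<beta> exceeds \<open>d\<close> and 0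
    where \<beta> is 0. The denominator is positive because \<beta> and \<open>d - \<beta>\<close>
    are not both \<le> 0.\<close>
  define \<rho> where "\<rho> x = complex_of_real (flat_exp 0 (\<beta> x)) *
    inverse (complex_of_real (flat_exp 0 (\<beta> x)) + complex_of_real (flat_exp 0 (d - \<beta> x)))" for x
  have den: "complex_of_real (flat_exp 0 (\<beta> x)) + complex_of_real (flat_exp 0 (d - \<beta> x)) \<noteq> 0" for x
  proof -
    have "flat_exp 0 (\<beta> x) + flat_exp 0 (d - \<beta> x) > 0"
    proof (cases "\<beta> x > 0")
      case True
      then show ?thesis using flat_exp_nonneg by (simp add: add_pos_nonneg)
    next
      case False
      then have "flat_exp 0 (d - \<beta> x) > 0" using d(1) by simp
      then show ?thesis using flat_exp_nonneg by (simp add: add_nonneg_pos)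
    qed
    then show ?thesis by (metis of_real_add of_real_eq_0_iff less_numeral_extra(3))
  qed
  have smd: "smooth_on UNIV (\<lambda>x. complex_of_real (d - \<beta> x))"
    using smooth_on_diff[OF open_UNIV smooth_on_const[OF open_UNIV, of "complex_of_real d"] sm] by simp
  have "smooth_on UNIV \<rho>"
    unfolding \<rho>_def using den
    by (intro smooth_on_mult smooth_on_inverse smooth_on_add smooth_on_flat_exp_compose sm smd) auto
  moreover have \<rho>out: "\<rho> x = 0" if "x \<notin> L" for x
    using out[OF that] by (simp add: \<rho>_def)
  ultimately have test: "test_function \<rho>"
    using L(1) test_functionI by blast
  show ?thesis
  proof (rule that[OF test, of "{x. d < \<beta> x}"])
    have "closure {x. \<rho> x \<noteq> 0} \<subseteq> L"
      using \<rho>out L(1) by (intro closure_minimal) (auto simp: compact_imp_closed)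
    then show "closure {x. \<rho> x \<noteq> 0} \<subseteq> U" using L(2) by simp
    show "open {x. d < \<beta> x}"
      using cont by (intro open_Collect_less) (auto intro: continuous_intros)
    show "\<rho> x = 1" if "x \<in> {x. d < \<beta> x}" for x
    proof -
      have "flat_exp 0 (\<beta> x) > 0" "flat_exp 0 (d - \<beta> x) = 0" using that d(1) by auto
      then show ?thesis by (simp add: \<rho>_def)
    qed
    show "\<rho> x = complex_of_real (cmod (\<rho> x))" for x
    proof -
      define r where "r = flat_exp 0 (\<beta> x) * inverse (flat_exp 0 (\<beta> x) + flat_exp 0 (d - \<beta> x))"
      have "\<rho> x = complex_of_real r" by (simp add: \<rho>_def r_def)
      moreover have "r \<ge> 0" by (simp add: r_def flat_exp_nonneg)
      ultimately show ?thesis by simp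
    qed
  qed (use d in auto)
qed

lemma dir_deriv_support: "{x. dir_deriv v f x \<noteq> 0} \<subseteq> closure {x. f x \<noteq> 0}"
proof -
  have "dir_deriv v f x = 0" if "x \<notin> closure {x. f x \<noteq> 0}" for x
  proof -
    have "dir_deriv v f x = dir_deriv v (\<lambda>_. 0) x"
      by (rule dir_deriv_cong[OF open_Compl[OF closed_closure[of "{x. f x \<noteq> 0}"]]])
        (use that test_function_outside[of _ f] in blast)+
    then show ?thesis by simp
  qed
  then show ?thesis by blast
qed

lemma test_function_dir_deriv:
  assumes "test_function \<phi>"
  shows "test_function (dir_deriv v \<phi>)"
proof (rule test_functionI)
  show "smooth_on UNIV (dir_deriv v \<phi>)"
    by (rule smooth_on_dir_deriv[OF test_function_smooth[OF assms]])
  show "compact (closure {x. \<phi> x \<noteq> 0})" by (rule test_function_compact[OF assms])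
  show "dir_deriv v \<phi> x = 0" if "x \<notin> closure {x. \<phi> x \<noteq> 0}" for x
    using that dir_deriv_support[of v \<phi>] by blast
qed

lemma test_function_diff:
  assumes "test_function \<phi>" "test_function \<psi>"
  shows "test_function (\<lambda>x. \<phi> x - \<psi> x)"
  using test_function_add[OF assms(1) test_function_cmult[OF assms(2), of "-1"]] by simp

section \<open>Pairing with compactly supported distributions\<close>

definition dist_null_on :: "'a::euclidean_space distribution \<Rightarrow> 'a set \<Rightarrow> bool" where
  "dist_null_on T U \<longleftrightarrow> open U \<and>
     (\<forall>\<phi>. test_function \<phi> \<and> closure {x. \<phi> x \<noteq> 0} \<subseteq> U \<longrightarrow> T \<phi> = 0)"

lemma dist_null_onD:
  "dist_null_on T U \<Longrightarrow> test_function \<phi> \<Longrightarrow> closure {x. \<phi> x \<noteq> 0} \<subseteq> U \<Longrightarrow> T \<phi> = 0"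
  by (simp add: dist_null_on_def)

definition dist_additive :: "'a::euclidean_space distribution \<Rightarrow> bool" where
  "dist_additive T \<longleftrightarrow> (\<forall>\<phi> \<psi>. test_function \<phi> \<longrightarrow> test_function \<psi> \<longrightarrow>
     T (\<lambda>x. \<phi> x + \<psi> x) = T \<phi> + T \<psi>)"

lemma dist_additiveD:
  "dist_additive T \<Longrightarrow> test_function \<phi> \<Longrightarrow> test_function \<psi> \<Longrightarrow> T (\<lambda>x. \<phi> x + \<psi> x) = T \<phi> + T \<psi>"
  by (simp add: dist_additive_def)

lemma dist_null_on_empty:
  assumes add: "dist_additive T"
  shows "dist_null_on T {}"
proof -
  have "T (\<lambda>_. 0) + T (\<lambda>_. 0) = T (\<lambda>_. 0)"
    using dist_additiveD[OF add test_function_0 test_function_0] by (simp only: add_0)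
  then have "T (\<lambda>_. 0) = 0" by (metis add_cancel_right_right)
  moreover have "\<phi> = (\<lambda>_. 0)" if "closure {x. \<phi> x \<noteq> 0} \<subseteq> {}" for \<phi> :: "'a \<Rightarrow> complex"
  proof
    show "\<phi> x = 0" for x
      using that closure_subset[of "{x. \<phi> x \<noteq> 0}"] by blast
  qed
  ultimately show ?thesis unfolding dist_null_on_def by (metis open_empty)
qed

text \<open>A partition of unity into two pieces: \<rho> is 1 near the part of the support that
  \<open>W\<close> does not cover, so the product with \<rho> is supported in \<open>U\<close> and
  the remainder in \<open>W\<close>.\<close>

lemma dist_null_on_Un:
  assumes add: "dist_additive T"
    and U: "dist_null_on T U" and W: "dist_null_on T W"
  shows "dist_null_on T (U \<union> W)"
  unfolding dist_null_on_def
proof (intro conjI allI impI)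
  show "open (U \<union> W)" using U W by (simp add: dist_null_on_def open_Un)
next
  fix \<phi> :: "'a \<Rightarrow> complex"
  let ?S = "closure {x. \<phi> x \<noteq> 0}"
  assume "test_function \<phi> \<and> ?S \<subseteq> U \<union> W"
  then have \<phi>: "test_function \<phi>" and S: "?S \<subseteq> U \<union> W" by auto
  have op: "open U" "open W" using U W by (auto simp: dist_null_on_def)
  have "compact (?S \<inter> - W)"
    by (rule compact_Int_closed[OF test_function_compact[OF \<phi>] closed_Compl[OF op(2)]])
  moreover have "?S \<inter> - W \<subseteq> U" using S by blast
  ultimately obtain \<rho> V where \<rho>: "test_function \<rho>" "closure {x. \<rho> x \<noteq> 0} \<subseteq> U" "open V"
      "?S \<inter> - W \<subseteq> V" "\<And>x. x \<in> V \<Longrightarrow> \<rho> x = 1"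
    using exists_cutoff[OF _ op(1), of "?S \<inter> - W"] by metis
  have t1: "test_function (\<lambda>x. \<rho> x * \<phi> x)"
    by (rule test_function_mult_smooth[OF test_function_smooth[OF \<rho>(1)] \<phi>])
  have t2: "test_function (\<lambda>x. \<phi> x - \<rho> x * \<phi> x)"
    by (rule test_function_diff[OF \<phi> t1])
  have "closure {x. \<rho> x * \<phi> x \<noteq> 0} \<subseteq> closure {x. \<rho> x \<noteq> 0}"
    by (rule closure_mono) auto
  then have "closure {x. \<rho> x * \<phi> x \<noteq> 0} \<subseteq> U" using \<rho>(2) by (rule order_trans)
  from dist_null_onD[OF U t1 this] have z1: "T (\<lambda>x. \<rho> x * \<phi> x) = 0" .
  have "{x. \<phi> x - \<rho> x * \<phi> x \<noteq> 0} \<subseteq> ?S \<inter> - V"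
  proof
    fix x assume "x \<in> {x. \<phi> x - \<rho> x * \<phi> x \<noteq> 0}"
    then have "\<phi> x \<noteq> 0" "\<rho> x \<noteq> 1" by auto
    then show "x \<in> ?S \<inter> - V" using \<rho>(5) test_function_outside[of x \<phi>] by blast
  qed
  moreover have "closed (?S \<inter> - V)"
    by (rule closed_Int[OF closed_closure closed_Compl[OF \<rho>(3)]])
  ultimately have "closure {x. \<phi> x - \<rho> x * \<phi> x \<noteq> 0} \<subseteq> ?S \<inter> - V" by (rule closure_minimal)
  also have "\<dots> \<subseteq> W" using \<rho>(4) by blast
  finally have "closure {x. \<phi> x - \<rho> x * \<phi> x \<noteq> 0} \<subseteq> W" .
  from dist_null_onD[OF W t2 this] have z2: "T (\<lambda>x. \<phi> x - \<rho> x * \<phi> x) = 0" .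
  show "T \<phi> = 0" using dist_additiveD[OF add t1 t2] z1 z2 by simp
qed

lemma dist_null_on_Union:
  assumes add: "dist_additive T"
    and "finite \<U>" "\<forall>U\<in>\<U>. dist_null_on T U"
  shows "dist_null_on T (\<Union>\<U>)"
  using assms(2,3)
proof (induction \<U>)
  case empty
  show ?case using dist_null_on_empty[OF add] by simp
next
  case (insert U \<U>)
  then show ?case using dist_null_on_Un[OF add, of U "\<Union>\<U>"] by simp
qed

text \<open>Two test functions that agree with \<open>f\<close> near the support differ by one whose
  compact support is covered by null sets, hence by finitely many of them. So the description in
  \<open>dist_pair\<close> is satisfied by a single value. \<open>Z\<close> is an upper bound for
  the support.\<close>

lemma dist_pair_eq:
  assumes add: "dist_additive T"
    and null: "dist_null_on T (- Z)"
    and \<phi>: "test_function \<phi>" and V: "open V" "Z \<subseteq> V" "\<forall>x\<in>V. \<phi> x = f x"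
  shows "dist_pair T f = T \<phi>"
proof -
  have supp: "dist_support T = - \<Union>(Collect (dist_null_on T))"
    unfolding dist_support_def dist_null_on_def ..
  have Z: "dist_support T \<subseteq> Z" using null unfolding supp by blast
  have eq: "T \<psi> = T \<phi>" if \<psi>: "test_function \<psi>" and U: "open U" "dist_support T \<subseteq> U" "\<forall>x\<in>U. \<psi> x = f x"
    for \<psi> U
  proof -
    let ?\<chi> = "\<lambda>x. \<psi> x - \<phi> x"
    have t: "test_function ?\<chi>" by (rule test_function_diff[OF \<psi> \<phi>])
    have "{x. ?\<chi> x \<noteq> 0} \<subseteq> - (U \<inter> V)" using U(3) V(3) by auto
    moreover have "closed (- (U \<inter> V))" using U(1) V(1) by (intro closed_Compl open_Int)
    ultimately have "closure {x. ?\<chi> x \<noteq> 0} \<subseteq> - (U \<inter> V)" by (rule closure_minimal)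
    also have "\<dots> \<subseteq> \<Union>(Collect (dist_null_on T))" using U(2) V(2) Z unfolding supp by blast
    finally have sub: "closure {x. ?\<chi> x \<noteq> 0} \<subseteq> \<Union>(Collect (dist_null_on T))" .
    have "\<forall>W\<in>Collect (dist_null_on T). open W" by (simp add: dist_null_on_def)
    then obtain \<U> where \<U>: "\<U> \<subseteq> Collect (dist_null_on T)" "finite \<U>" "closure {x. ?\<chi> x \<noteq> 0} \<subseteq> \<Union>\<U>"
      using compactE[OF test_function_compact[OF t] sub] by metis
    have "\<forall>U\<in>\<U>. dist_null_on T U" using \<U>(1) by blast
    then have "dist_null_on T (\<Union>\<U>)" by (rule dist_null_on_Union[OF add \<U>(2)])
    from dist_null_onD[OF this t \<U>(3)] have "T ?\<chi> = 0" .
    then show ?thesis using dist_additiveD[OF add t \<phi>] by simp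
  qed
  show ?thesis
    unfolding dist_pair_def
  proof (rule the_equality)
    show "\<forall>\<psi>. test_function \<psi> \<and> (\<exists>U. open U \<and> dist_support T \<subseteq> U \<and> (\<forall>x\<in>U. \<psi> x = f x)) \<longrightarrow> T \<psi> = T \<phi>"
      using eq by blast
    show "c = T \<phi>" if "\<forall>\<psi>. test_function \<psi> \<and>
        (\<exists>U. open U \<and> dist_support T \<subseteq> U \<and> (\<forall>x\<in>U. \<psi> x = f x)) \<longrightarrow> T \<psi> = c" for c
    proof -
      have "dist_support T \<subseteq> V" using Z V(2) by (rule order_trans)
      then show ?thesis using that \<phi> V(1,3) by metis
    qed
  qed
qed

section \<open>Integration by parts\<close>

lemma bounded_support_cball:
  fixes f :: "'a::euclidean_space \<Rightarrow> complex"
  assumes "bounded {x. f x \<noteq> 0}"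
  obtains R where "R > 0" "\<forall>x. x \<notin> cball 0 R \<longrightarrow> f x = 0"
proof -
  obtain R where R: "R > 0" "\<forall>x\<in>{x. f x \<noteq> 0}. norm x \<le> R"
    using assms bounded_pos by blast
  have "\<forall>x. x \<notin> cball 0 R \<longrightarrow> f x = 0" using R(2) by auto
  with R(1) show ?thesis by (rule that)
qed

lemma integrable_bounded_support:
  fixes f :: "'a::euclidean_space \<Rightarrow> complex"
  assumes "continuous_on UNIV f" "bounded {x. f x \<noteq> 0}"
  shows "integrable lborel f"
proof -
  obtain R where R: "R > 0" "\<forall>x. x \<notin> cball 0 R \<longrightarrow> f x = 0"
    using bounded_support_cball[OF assms(2)] by blast
  have "integrable lborel (\<lambda>x. indicator (cball 0 R) x *\<^sub>R f x)"
    by (rule borel_integrable_compact) (use assms(1) continuous_on_subset in auto)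
  moreover have "(\<lambda>x. indicator (cball 0 R) x *\<^sub>R f x) = f"
    using R(2) by (auto simp: indicator_def fun_eq_iff)
  ultimately show ?thesis by simp
qed

lemma norm_bounded_support:
  fixes f :: "'a::euclidean_space \<Rightarrow> complex"
  assumes "continuous_on UNIV f" "bounded {x. f x \<noteq> 0}"
  obtains C where "C > 0" "\<forall>x. cmod (f x) \<le> C"
proof -
  obtain R where R: "R > 0" "\<forall>x. x \<notin> cball 0 R \<longrightarrow> f x = 0"
    using bounded_support_cball[OF assms(2)] by blast
  have "compact (f ` cball 0 R)"
    by (intro compact_continuous_image continuous_on_subset[OF assms(1)]) auto
  then obtain C where C: "C > 0" "\<forall>z\<in>f ` cball 0 R. norm z \<le> C"
    using compact_imp_bounded bounded_pos by metis
  have "cmod (f x) \<le> C" for x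
    using C R(2) by (cases "x \<in> cball 0 R") auto
  with C(1) show ?thesis using that by blast
qed

lemma bounded_dir_deriv_support:
  "bounded {x. f x \<noteq> 0} \<Longrightarrow> bounded {x. dir_deriv v f x \<noteq> 0}"
  by (rule bounded_subset[OF bounded_closure dir_deriv_support])

lemma bounded_mult_support:
  "bounded {x. f x \<noteq> 0} \<Longrightarrow> bounded {x. g x * f x \<noteq> (0::complex)}"
  by (rule bounded_subset) auto

lemma lborel_integral_shift:
  fixes f :: "'a::euclidean_space \<Rightarrow> complex"
  assumes "continuous_on UNIV f"
  shows "(LINT x|lborel. f (x + c)) = (LINT x|lborel. f x)"
proof -
  have m: "f \<in> borel_measurable borel" by (rule borel_measurable_continuous_onI[OF assms])
  have "(LINT x|lborel. f x) = (LINT x|distr lborel borel ((+) c). f x)"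
    by (simp add: lborel_distr_plus)
  also have "\<dots> = (LINT x|lborel. f (c + x))"
    by (rule integral_distr) (use m in auto)
  finally show ?thesis by (simp add: add.commute)
qed

lemma difference_quotient_tendsto:
  assumes "f differentiable (at x)"
  shows "(\<lambda>n. real (Suc n) *\<^sub>R (f (x + inverse (real (Suc n)) *\<^sub>R v) - f x)) \<longlonglongrightarrow> dir_deriv v f x"
proof -
  have v: "((\<lambda>t. x + t *\<^sub>R v) has_derivative (\<lambda>t. t *\<^sub>R v)) (at (0::real))"
    by (auto intro!: derivative_eq_intros)
  have "(f has_derivative (\<lambda>v. dir_deriv v f x)) (at (x + 0 *\<^sub>R v))"
    using has_derivative_dir_deriv[OF assms] by simp
  from has_derivative_compose[OF v this]
  have "((\<lambda>t. f (x + t *\<^sub>R v)) has_derivative (\<lambda>t. dir_deriv (t *\<^sub>R v) f x)) (at 0)" .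
  then have "((\<lambda>t. f (x + t *\<^sub>R v)) has_derivative (\<lambda>t. t *\<^sub>R dir_deriv v f x)) (at 0)"
    by (simp add: dir_deriv_linear(2)[OF assms])
  then have "((\<lambda>t. f (x + t *\<^sub>R v)) has_vector_derivative dir_deriv v f x) (at 0)"
    by (simp add: has_vector_derivative_def)
  then have "\<forall>e>0. \<exists>d>0. \<forall>t. norm (t - 0) < d \<longrightarrow>
      norm (f (x + t *\<^sub>R v) - f (x + 0 *\<^sub>R v) - (t - 0) *\<^sub>R dir_deriv v f x) \<le> e * norm (t - 0)"
    unfolding has_vector_derivative_def has_derivative_at_alt by blast
  then have alt: "\<exists>d>0. \<forall>t::real. \<bar>t\<bar> < d \<longrightarrow>
      norm (f (x + t *\<^sub>R v) - f x - t *\<^sub>R dir_deriv v f x) \<le> e * \<bar>t\<bar>" if "e > 0" for e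
    using that by simp
  show ?thesis
  proof (rule LIMSEQ_I)
    fix e :: real assume "e > 0"
    then obtain d where d: "d > 0" "\<forall>t::real. \<bar>t\<bar> < d \<longrightarrow>
      norm (f (x + t *\<^sub>R v) - f x - t *\<^sub>R dir_deriv v f x) \<le> e / 2 * \<bar>t\<bar>"
      using alt[of "e / 2"] by auto
    obtain N where N: "inverse (real (Suc N)) < d" using reals_Archimedean[OF d(1)] by blast
    have "norm (real (Suc n) *\<^sub>R (f (x + inverse (real (Suc n)) *\<^sub>R v) - f x) - dir_deriv v f x) < e"
      if "n \<ge> N" for n
    proof -
      define t where "t = inverse (real (Suc n))"
      have t: "t > 0" "real (Suc n) * t = 1" by (auto simp: t_def)
      have "t \<le> inverse (real (Suc N))" using that unfolding t_def by (intro le_imp_inverse_le) auto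
      then have "\<bar>t\<bar> < d" using N t by simp
      then have b: "norm (f (x + t *\<^sub>R v) - f x - t *\<^sub>R dir_deriv v f x) \<le> e / 2 * t"
        using d(2)[rule_format, of t] t(1) by simp
      have "real (Suc n) *\<^sub>R (f (x + t *\<^sub>R v) - f x) - dir_deriv v f x =
          real (Suc n) *\<^sub>R (f (x + t *\<^sub>R v) - f x - t *\<^sub>R dir_deriv v f x)"
        unfolding scaleR_diff_right scaleR_scaleR t(2) by simp
      then have "norm (real (Suc n) *\<^sub>R (f (x + t *\<^sub>R v) - f x) - dir_deriv v f x) =
          real (Suc n) * norm (f (x + t *\<^sub>R v) - f x - t *\<^sub>R dir_deriv v f x)"
        by (simp only: norm_scaleR abs_of_nat)
      also have "\<dots> \<le> real (Suc n) * (e / 2 * t)" using b by (intro mult_left_mono) auto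
      also have "\<dots> = e / 2 * (real (Suc n) * t)" by (simp only: mult.left_commute)
      also have "\<dots> < e" using \<open>e > 0\<close> unfolding t(2) by simp
      finally show ?thesis unfolding t_def .
    qed
    then show "\<exists>N. \<forall>n\<ge>N. norm (real (Suc n) *\<^sub>R (f (x + inverse (real (Suc n)) *\<^sub>R v) - f x) -
        dir_deriv v f x) < e" by blast
  qed
qed

lemma difference_quotient_bound:
  assumes "\<forall>x. f differentiable (at x)" "\<forall>x. cmod (dir_deriv v f x) \<le> C" "t > 0"
  shows "cmod (f (x + t *\<^sub>R v) - f x) \<le> C * t"
proof -
  have der: "((\<lambda>s. f (x + s *\<^sub>R v)) has_derivative (\<lambda>r. r *\<^sub>R dir_deriv v f (x + s *\<^sub>R v))) (at s)" for s
  proof -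
    have v: "((\<lambda>s. x + s *\<^sub>R v) has_derivative (\<lambda>r. r *\<^sub>R v)) (at s)"
      by (auto intro!: derivative_eq_intros)
    have "f differentiable (at (x + s *\<^sub>R v))" using assms(1) by blast
    from has_derivative_compose[OF v has_derivative_dir_deriv[OF this]] show ?thesis
      by (simp add: dir_deriv_linear(2)[OF assms(1)[rule_format]])
  qed
  have "continuous_on {0..t} (\<lambda>s. f (x + s *\<^sub>R v))"
    using der by (meson continuous_at_imp_continuous_on has_derivative_continuous)
  from mvt_general[OF assms(3) this der]
  obtain s where "cmod (f (x + t *\<^sub>R v) - f (x + 0 *\<^sub>R v)) \<le> norm ((t - 0) *\<^sub>R dir_deriv v f (x + s *\<^sub>R v))"
    by blast
  then have "cmod (f (x + t *\<^sub>R v) - f x) \<le> t * cmod (dir_deriv v f (x + s *\<^sub>R v))"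
    using assms(3) by simp
  also have "\<dots> \<le> t * C" using assms(2,3) by (intro mult_left_mono) auto
  finally show ?thesis by (simp add: mult.commute)
qed

text \<open>Translation invariance of Lebesgue measure makes all difference quotients integrate to
  0, and they converge boundedly on a fixed ball.\<close>

lemma integral_dir_deriv_eq_0:
  fixes f :: "'a::euclidean_space \<Rightarrow> complex"
  assumes "Ck_on (Suc 0) UNIV f" "bounded {x. f x \<noteq> 0}"
  shows "(LINT x|lborel. dir_deriv v f x) = 0"
proof -
  have cont: "continuous_on UNIV f" by (rule Ck_on_continuous[OF open_UNIV assms(1)])
  have cont': "continuous_on UNIV (dir_deriv v f)"
    by (rule Ck_on_continuous[OF open_UNIV Ck_on_dir_deriv[OF assms(1)]])
  have diff: "\<forall>x. f differentiable (at x)" using Ck_on_differentiable[OF assms(1)] by simp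
  obtain R where R: "R > 0" "\<forall>x. x \<notin> cball 0 R \<longrightarrow> f x = 0"
    using bounded_support_cball[OF assms(2)] by blast
  obtain C where C: "C > 0" "\<forall>x. cmod (dir_deriv v f x) \<le> C"
    using norm_bounded_support[OF cont' bounded_dir_deriv_support[OF assms(2)]] by blast
  define s where "s n x = real (Suc n) *\<^sub>R (f (x + inverse (real (Suc n)) *\<^sub>R v) - f x)" for n x
  have int: "integrable lborel f" by (rule integrable_bounded_support[OF cont assms(2)])
  have cs: "continuous_on UNIV (\<lambda>x. f (x + c))" for c
    by (rule continuous_on_compose2[OF cont]) (auto intro: continuous_intros)
  have int': "integrable lborel (\<lambda>x. f (x + c))" for c
  proof (rule integrable_bounded_support[OF cs])
    have "{x. f (x + c) \<noteq> 0} \<subseteq> (\<lambda>x. x - c) ` {x. f x \<noteq> 0}" by (auto simp: image_iff algebra_simps intro: exI[of _ "_ + c"])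
    then show "bounded {x. f (x + c) \<noteq> 0}"
      by (rule bounded_subset[rotated]) (use bounded_translation[OF assms(2), of "- c"] in simp)
  qed
  have s0: "(LINT x|lborel. s n x) = 0" for n
    unfolding s_def using int int' by (simp add: lborel_integral_shift[OF cont])
  \<comment> \<open>Shifts by at most \<open>norm v\<close> keep the quotients inside the enlarged
    ball; the mean value inequality bounds them there.\<close>
  have bnd: "cmod (s n x) \<le> C * indicat_real (cball 0 (R + norm v)) x" for n x
  proof (cases "x \<in> cball 0 (R + norm v)")
    case True
    define t where "t = inverse (real (Suc n))"
    have t: "t > 0" "real (Suc n) * t = 1" by (auto simp: t_def)
    have "cmod (s n x) = real (Suc n) * cmod (f (x + t *\<^sub>R v) - f x)"
      unfolding s_def t_def by simp
    also have "\<dots> \<le> real (Suc n) * (C * t)"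
      by (intro mult_left_mono difference_quotient_bound[OF diff C(2) t(1)]) auto
    also have "\<dots> = C * (real (Suc n) * t)" by (simp only: mult.left_commute)
    finally show ?thesis using True t(2) by simp
  next
    case False
    have "norm (inverse (real (Suc n)) *\<^sub>R v) \<le> norm v"
      by (auto simp: field_simps)
    then have "norm x > R" "norm (x + inverse (real (Suc n)) *\<^sub>R v) > R"
      using False norm_diff_ineq[of x "inverse (real (Suc n)) *\<^sub>R v"] norm_ge_zero[of v]
      unfolding mem_cball dist_0_norm by linarith+
    then have "x \<notin> cball 0 R" "x + inverse (real (Suc n)) *\<^sub>R v \<notin> cball 0 R" by simp_all
    then have "s n x = 0" using R(2) by (simp add: s_def)
    then show ?thesis using C(1) by simp
  qed
  have "(\<lambda>n. LINT x|lborel. s n x) \<longlonglongrightarrow> (LINT x|lborel. dir_deriv v f x)"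
  proof (rule integral_dominated_convergence[where w = "\<lambda>x. C * indicat_real (cball 0 (R + norm v)) x"])
    show "dir_deriv v f \<in> borel_measurable lborel"
      using borel_measurable_continuous_onI[OF cont'] by simp
    show "s n \<in> borel_measurable lborel" for n
      using int int' unfolding s_def by (intro borel_measurable_integrable) auto
    show "integrable lborel (\<lambda>x::'a. C * indicat_real (cball 0 (R + norm v)) x)"
      using emeasure_bounded_finite[OF bounded_cball[of "0 :: 'a" "R + norm v"]]
      by (intro integrable_mult_right integrable_real_indicator) auto
    show "AE x in lborel. (\<lambda>n. s n x) \<longlonglongrightarrow> dir_deriv v f x"
      unfolding s_def using difference_quotient_tendsto diff by blast
    show "AE x in lborel. cmod (s n x) \<le> C * indicat_real (cball 0 (R + norm v)) x" for n
      using bnd by simp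
  qed
  then have "(\<lambda>n::nat. 0) \<longlonglongrightarrow> (LINT x|lborel. dir_deriv v f x)" by (simp only: s0)
  from LIMSEQ_unique[OF this tendsto_const] show ?thesis .
qed

section \<open>Integrals over sublevel sets and their antiderivatives in the level\<close>

definition sublevel_integral :: "('a::euclidean_space \<Rightarrow> real) \<Rightarrow> ('a \<Rightarrow> complex) \<Rightarrow> real \<Rightarrow> complex" where
  "sublevel_integral h \<phi> s = (LINT x:{x. h x < s}|lborel. \<phi> x)"

text \<open>Formally the antiderivative of \<open>sublevel_integral h \<phi>\<close> in the level
  \<open>s\<close>, and so more regular in \<open>s\<close>.\<close>

definition hinge_integral :: "('a::euclidean_space \<Rightarrow> real) \<Rightarrow> ('a \<Rightarrow> complex) \<Rightarrow> real \<Rightarrow> complex" where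
  "hinge_integral h \<phi> s = (LINT x|lborel. complex_of_real (max 0 (s - h x)) * \<phi> x)"

lemma flat_exp_0_le_1: "flat_exp 0 t \<le> 1"
  by (auto simp: flat_exp_def)

lemma flat_exp_1_le_1: "flat_exp 1 t \<le> 1"
proof (cases "t > 0")
  case True
  have "inverse t \<le> exp (inverse t)" using exp_ge_add_one_self[of "inverse t"] by linarith
  then have "inverse t * exp (- inverse t) \<le> exp (inverse t) * exp (- inverse t)"
    by (intro mult_right_mono) auto
  also have "\<dots> = 1" by (simp add: exp_minus)
  finally show ?thesis using True by (simp add: flat_exp_def)
qed simp

text \<open>A smooth approximation of \<open>max 0\<close> from below, with derivative
  \<open>soft_step\<close>. Rescaling the flat functions by \<open>Suc n\<close> makes the two
  converge pointwise, to the hinge and to the indicator of the positive numbers.\<close>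

definition soft_hinge :: "nat \<Rightarrow> real \<Rightarrow> real" where
  "soft_hinge n t = t * flat_exp 0 (real (Suc n) * t)"

definition soft_step :: "nat \<Rightarrow> real \<Rightarrow> real" where
  "soft_step n t = flat_exp 0 (real (Suc n) * t) + flat_exp 1 (real (Suc n) * t)"

lemma soft_hinge_has_derivative: "(soft_hinge n has_real_derivative soft_step n t) (at t)"
proof -
  let ?k = "real (Suc n)"
  have "((\<lambda>t. flat_exp 0 (?k * t)) has_real_derivative flat_exp 2 (?k * t) * ?k) (at t)"
  proof (rule DERIV_chain2[where f = "flat_exp 0" and g = "\<lambda>t. ?k * t"])
    show "(flat_exp 0 has_real_derivative flat_exp 2 (?k * t)) (at (?k * t))"
      using flat_exp_has_derivative[of 0 "?k * t"] by (simp add: numeral_2_eq_2)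
    show "((\<lambda>t. ?k * t) has_real_derivative ?k) (at t)"
      using DERIV_cmult[OF DERIV_ident, of ?k] by simp
  qed
  from DERIV_mult[OF DERIV_ident this]
  have "((\<lambda>t. t * flat_exp 0 (?k * t)) has_real_derivative
      1 * flat_exp 0 (?k * t) + flat_exp 2 (?k * t) * ?k * t) (at t)" by (simp only: DERIV_ident)
  moreover have "u * flat_exp 2 u = flat_exp 1 u" for u :: real
    by (auto simp: flat_exp_def power2_eq_square)
  then have "flat_exp 2 (?k * t) * ?k * t = flat_exp 1 (?k * t)"
    by (metis mult.assoc mult.commute)
  ultimately show ?thesis
    by (simp add: soft_hinge_def[abs_def] soft_step_def)
qed

lemma smooth_on_soft_hinge: "smooth_on UNIV (\<lambda>t. complex_of_real (soft_hinge n t))"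
proof -
  have id: "smooth_on UNIV complex_of_real"
    by (rule smooth_on_bounded_linear[OF open_UNIV bounded_linear_of_real])
  have "smooth_on UNIV (\<lambda>t. complex_of_real (real (Suc n)) * complex_of_real t)"
    by (rule smooth_on_mult[OF open_UNIV smooth_on_const[OF open_UNIV] id])
  then have "smooth_on UNIV (\<lambda>t. complex_of_real (real (Suc n) * t))"
    by (simp only: of_real_mult)
  from smooth_on_mult[OF open_UNIV id smooth_on_flat_exp_compose[OF open_UNIV this, of 0]]
  show ?thesis by (simp only: soft_hinge_def of_real_mult)
qed

lemma soft_hinge_tendsto: "(\<lambda>n. soft_hinge n t) \<longlonglongrightarrow> max 0 t"
  and soft_step_tendsto: "(\<lambda>n. soft_step n t) \<longlonglongrightarrow> indicator {0<..} t"
proof -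
  have *: "(\<lambda>n. soft_hinge n t) \<longlonglongrightarrow> max 0 t \<and> (\<lambda>n. soft_step n t) \<longlonglongrightarrow> indicator {0<..} t"
  proof (cases "t > 0")
    case True
    have "(\<lambda>n. inverse (real (Suc n)) * inverse t) \<longlonglongrightarrow> 0 * inverse t"
      by (intro tendsto_mult LIMSEQ_inverse_real_of_nat tendsto_const)
    then have i: "(\<lambda>n. inverse (real (Suc n) * t)) \<longlonglongrightarrow> 0"
      by (simp only: inverse_mult_distrib mult_zero_left)
    have e: "(\<lambda>n. exp (- inverse (real (Suc n) * t))) \<longlonglongrightarrow> exp (- 0)"
      by (intro tendsto_exp tendsto_minus i)
    have p: "real (Suc n) * t > 0" for n using True by simp
    have "(\<lambda>n. t * exp (- inverse (real (Suc n) * t))) \<longlonglongrightarrow> t * exp (- 0)"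
      by (intro tendsto_mult tendsto_const e)
    moreover have "(\<lambda>n. exp (- inverse (real (Suc n) * t)) +
        inverse (real (Suc n) * t) * exp (- inverse (real (Suc n) * t))) \<longlonglongrightarrow> exp (- 0) + 0 * exp (- 0)"
      by (intro tendsto_add tendsto_mult e i)
    ultimately show ?thesis
      unfolding soft_hinge_def soft_step_def flat_exp_def using p True by (simp add: max_def)
  next
    case False
    then have "real (Suc n) * t \<le> 0" for n by (simp add: mult_nonneg_nonpos)
    then have "soft_hinge n t = 0" "soft_step n t = 0" for n
      by (simp_all add: soft_hinge_def soft_step_def)
    then show ?thesis using False by simp
  qed
  show "(\<lambda>n. soft_hinge n t) \<longlonglongrightarrow> max 0 t" using * by simp
  show "(\<lambda>n. soft_step n t) \<longlonglongrightarrow> indicator {0<..} t" using * by simp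
qed

lemma soft_hinge_bound: "\<bar>soft_hinge n t\<bar> \<le> \<bar>max 0 t\<bar>"
proof (cases "t > 0")
  case True
  then show ?thesis
    using flat_exp_0_le_1[of "real (Suc n) * t"] flat_exp_nonneg[of 0 "real (Suc n) * t"]
    by (simp add: soft_hinge_def abs_mult mult_left_le max_def)
next
  case False
  then have "real (Suc n) * t \<le> 0" by (simp add: mult_nonneg_nonpos)
  then show ?thesis by (simp add: soft_hinge_def)
qed

lemma soft_step_bound: "\<bar>soft_step n t\<bar> \<le> 2"
  using flat_exp_0_le_1[of "real (Suc n) * t"] flat_exp_nonneg[of 0 "real (Suc n) * t"]
    flat_exp_1_le_1[of "real (Suc n) * t"] flat_exp_nonneg[of 1 "real (Suc n) * t"]
  unfolding soft_step_def by linarith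

lemma continuous_on_of_real_cancel:
  "continuous_on S (\<lambda>x. complex_of_real (h x)) \<Longrightarrow> continuous_on S h"
  using continuous_on_Re[of S "\<lambda>x. complex_of_real (h x)"] by simp

text \<open>The hinge function \<open>t \<mapsto> max 0 (b - t)\<close> has derivative \<open>-1\<close> exactly for \<open>t < b\<close>, so this is integration by
  parts.\<close>

lemma hinge_integral_dir_deriv:
  fixes h :: "'a::euclidean_space \<Rightarrow> real"
  assumes h: "Ck_on (Suc 0) UNIV (\<lambda>x. complex_of_real (h x))"
    and f: "Ck_on (Suc 0) UNIV f" "bounded {x. f x \<noteq> 0}"
  shows "hinge_integral h (dir_deriv v f) b =
    sublevel_integral h (\<lambda>x. dir_deriv v (\<lambda>x. complex_of_real (h x)) x * f x) b"
proof -
  let ?hc = "\<lambda>x. complex_of_real (h x)"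
  define G where "G n x = complex_of_real (soft_hinge n (b - h x))" for n x
  define H where "H n x = complex_of_real (soft_step n (b - h x))" for n x
  have hcont: "continuous_on UNIV h"
    by (rule continuous_on_of_real_cancel[OF Ck_on_continuous[OF open_UNIV h]])
  have f': "continuous_on UNIV f" "continuous_on UNIV (dir_deriv v f)"
    using Ck_on_continuous[OF open_UNIV] f(1) Ck_on_dir_deriv by blast+
  have h': "continuous_on UNIV (dir_deriv v ?hc)"
    using Ck_on_continuous[OF open_UNIV] h Ck_on_dir_deriv by blast
  have bh: "Ck_on (Suc 0) UNIV (\<lambda>x. complex_of_real (b - h x))"
    using Ck_on_add[OF open_UNIV Ck_on_const[OF open_UNIV, of _ "complex_of_real b"]
        Ck_on_mult[OF open_UNIV Ck_on_const[OF open_UNIV, of _ "-1"] h]] by simp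
  have CG: "Ck_on (Suc 0) UNIV (G n)" for n
    unfolding G_def
    by (rule Ck_on_compose[OF open_UNIV open_UNIV _ bh smooth_on_Ck_on[OF smooth_on_soft_hinge]]) simp
  have hder: "(h has_derivative (\<lambda>v. Re (dir_deriv v ?hc x))) (at x)" for x
    using has_derivative_Re[OF Ck_on_has_derivative[OF h open_UNIV, of x]] by simp
  have ofr: "complex_of_real (Re (dir_deriv w ?hc x)) = dir_deriv w ?hc x" for w x
    using dir_deriv_eqI[OF has_derivative_of_real[OF hder, where 'a = complex], of w x] by simp
  have DG: "dir_deriv v (G n) x = - (H n x * dir_deriv v ?hc x)" for n x
  proof -
    have "((\<lambda>x. b - h x) has_derivative (\<lambda>v. - Re (dir_deriv v ?hc x))) (at x)"
      using has_derivative_diff[OF has_derivative_const[of b] hder[of x]] by simp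
    from has_derivative_compose[OF this has_field_derivative_imp_has_derivative[OF soft_hinge_has_derivative]]
    have "((\<lambda>x. soft_hinge n (b - h x)) has_derivative
        (\<lambda>v. soft_step n (b - h x) * - Re (dir_deriv v ?hc x))) (at x)" .
    from dir_deriv_eqI[OF has_derivative_of_real[OF this, where 'a = complex], of v]
    show ?thesis unfolding G_def H_def using ofr[of v x] by simp
  qed
  have Hcont: "continuous_on UNIV (H n)" for n
  proof -
    have "continuous_on UNIV (soft_step n)"
      unfolding soft_step_def[abs_def]
      by (intro continuous_intros continuous_on_compose2[OF DERIV_continuous_on[OF flat_exp_has_derivative]])
        (auto intro: continuous_intros)
    then have "continuous_on UNIV (\<lambda>x. soft_step n (b - h x))"
      by (rule continuous_on_compose2) (auto intro: continuous_intros hcont)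
    then show ?thesis unfolding H_def by (rule continuous_on_of_real)
  qed
  have Gcont: "continuous_on UNIV (G n)" for n by (rule Ck_on_continuous[OF open_UNIV CG])
  have i1: "integrable lborel (\<lambda>x. G n x * dir_deriv v f x)" for n
    by (intro integrable_bounded_support continuous_on_mult Gcont f' bounded_mult_support
        bounded_dir_deriv_support f)
  have c2: "continuous_on UNIV (\<lambda>x. dir_deriv v ?hc x * f x)"
    by (intro continuous_on_mult h' f')
  have b2: "bounded {x. dir_deriv v ?hc x * f x \<noteq> 0}" by (rule bounded_mult_support[OF f(2)])
  have i2: "integrable lborel (\<lambda>x. H n x * (dir_deriv v ?hc x * f x))" for n
    by (intro integrable_bounded_support continuous_on_mult[OF Hcont c2] bounded_mult_support[OF b2])
  \<comment> \<open>The derivative of the product of \<open>G n\<close> and \<open>f\<close>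
    integrates to 0.\<close>
  have key: "(LINT x|lborel. G n x * dir_deriv v f x) =
      (LINT x|lborel. H n x * (dir_deriv v ?hc x * f x))" for n
  proof -
    have "dir_deriv v (\<lambda>x. G n x * f x) x =
        G n x * dir_deriv v f x - H n x * (dir_deriv v ?hc x * f x)" for x
      using dir_deriv_mult[OF Ck_on_differentiable[OF CG[of n] open_UNIV, of x]
          Ck_on_differentiable[OF f(1) open_UNIV, of x], of v] by (simp add: DG)
    then have "(LINT x|lborel. G n x * dir_deriv v f x - H n x * (dir_deriv v ?hc x * f x)) = 0"
      using integral_dir_deriv_eq_0[OF Ck_on_mult[OF open_UNIV CG[of n] f(1)] bounded_mult_support[OF f(2)], of v]
      by simp
    then show ?thesis using Bochner_Integration.integral_diff[OF i1[of n] i2[of n]] by simp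
  qed
  have L1: "(\<lambda>n. LINT x|lborel. G n x * dir_deriv v f x) \<longlonglongrightarrow>
      (LINT x|lborel. complex_of_real (max 0 (b - h x)) * dir_deriv v f x)"
  proof (rule integral_dominated_convergence
      [where w = "\<lambda>x. cmod (complex_of_real (max 0 (b - h x)) * dir_deriv v f x)"])
    have "continuous_on UNIV (\<lambda>x. complex_of_real (max 0 (b - h x)) * dir_deriv v f x)"
      by (intro continuous_intros hcont f')
    then have i: "integrable lborel (\<lambda>x. complex_of_real (max 0 (b - h x)) * dir_deriv v f x)"
      by (intro integrable_bounded_support bounded_mult_support bounded_dir_deriv_support f)
    then show "(\<lambda>x. complex_of_real (max 0 (b - h x)) * dir_deriv v f x) \<in> borel_measurable lborel"
      by (rule borel_measurable_integrable)
    show "(\<lambda>x. G n x * dir_deriv v f x) \<in> borel_measurable lborel" for n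
      by (rule borel_measurable_integrable[OF i1])
    show "integrable lborel (\<lambda>x. cmod (complex_of_real (max 0 (b - h x)) * dir_deriv v f x))"
      by (rule integrable_norm[OF i])
    show "AE x in lborel. (\<lambda>n. G n x * dir_deriv v f x) \<longlonglongrightarrow>
        complex_of_real (max 0 (b - h x)) * dir_deriv v f x"
      unfolding G_def by (intro AE_I2 tendsto_mult tendsto_const tendsto_of_real soft_hinge_tendsto)
    show "AE x in lborel. cmod (G n x * dir_deriv v f x) \<le>
        cmod (complex_of_real (max 0 (b - h x)) * dir_deriv v f x)" for n
      unfolding G_def norm_mult norm_of_real
      by (intro AE_I2 mult_right_mono soft_hinge_bound norm_ge_zero)
  qed
  have L2: "(\<lambda>n. LINT x|lborel. H n x * (dir_deriv v ?hc x * f x)) \<longlonglongrightarrow>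
      (LINT x|lborel. indicator {x. h x < b} x *\<^sub>R (dir_deriv v ?hc x * f x))"
  proof (rule integral_dominated_convergence
      [where w = "\<lambda>x. 2 * cmod (dir_deriv v ?hc x * f x)"])
    have i: "integrable lborel (\<lambda>x. dir_deriv v ?hc x * f x)"
      by (rule integrable_bounded_support[OF c2 b2])
    have "{x. h x < b} \<in> sets borel"
      by (intro borel_open open_Collect_less hcont continuous_on_const)
    then show "(\<lambda>x. indicator {x. h x < b} x *\<^sub>R (dir_deriv v ?hc x * f x)) \<in> borel_measurable lborel"
      using borel_measurable_integrable[OF i] by simp
    show "(\<lambda>x. H n x * (dir_deriv v ?hc x * f x)) \<in> borel_measurable lborel" for n
      by (rule borel_measurable_integrable[OF i2])
    show "integrable lborel (\<lambda>x. 2 * cmod (dir_deriv v ?hc x * f x))"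
      by (intro integrable_mult_right integrable_norm[OF i])
    show "AE x in lborel. (\<lambda>n. H n x * (dir_deriv v ?hc x * f x)) \<longlonglongrightarrow>
        indicator {x. h x < b} x *\<^sub>R (dir_deriv v ?hc x * f x)"
    proof (rule AE_I2)
      fix x
      have "(\<lambda>n. H n x * (dir_deriv v ?hc x * f x)) \<longlonglongrightarrow>
          complex_of_real (indicator {0<..} (b - h x)) * (dir_deriv v ?hc x * f x)"
        unfolding H_def by (intro tendsto_mult tendsto_const tendsto_of_real soft_step_tendsto)
      then show "(\<lambda>n. H n x * (dir_deriv v ?hc x * f x)) \<longlonglongrightarrow>
          indicator {x. h x < b} x *\<^sub>R (dir_deriv v ?hc x * f x)"
        by (simp add: indicator_def scaleR_conv_of_real)
    qed
    show "AE x in lborel. cmod (H n x * (dir_deriv v ?hc x * f x)) \<le> 2 * cmod (dir_deriv v ?hc x * f x)" for n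
      unfolding H_def norm_mult norm_of_real
      by (intro AE_I2 mult_right_mono soft_step_bound mult_nonneg_nonneg norm_ge_zero)
  qed
  show ?thesis
    using LIMSEQ_unique[OF L1] L2 unfolding key hinge_integral_def sublevel_integral_def
      set_lebesgue_integral_def by simp
qed

section \<open>Derivatives of the Dirac distribution on a regular level set\<close>

lemma integrable_sublevel:
  fixes h :: "'a::euclidean_space \<Rightarrow> real" and f :: "'a \<Rightarrow> complex"
  assumes "continuous_on UNIV h" "integrable lborel f"
  shows "integrable lborel (\<lambda>x. indicat_real {x. h x < s} x *\<^sub>R f x)"
proof (rule integrable_mult_indicator[OF _ assms(2)])
  have "open {x. h x < s}" by (intro open_Collect_less assms(1) continuous_on_const)
  then show "{x. h x < s} \<in> sets lborel" by simp
qed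

lemma sublevel_integral_add:
  assumes "continuous_on UNIV h" "integrable lborel f" "integrable lborel g"
  shows "sublevel_integral h (\<lambda>x. f x + g x) s = sublevel_integral h f s + sublevel_integral h g s"
  using integrable_sublevel[OF assms(1,2)] integrable_sublevel[OF assms(1,3)]
  by (simp add: sublevel_integral_def set_lebesgue_integral_def scaleR_add_right)

lemma sublevel_integral_cmult:
  "sublevel_integral h (\<lambda>x. c * f x) s = c * sublevel_integral h f s"
  by (simp add: sublevel_integral_def set_lebesgue_integral_def flip: mult_scaleR_right)

lemma sublevel_integral_sum:
  assumes "continuous_on UNIV h" "\<And>i. i \<in> I \<Longrightarrow> integrable lborel (f i)"
  shows "sublevel_integral h (\<lambda>x. \<Sum>i\<in>I. f i x) s = (\<Sum>i\<in>I. sublevel_integral h (f i) s)"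
  using integrable_sublevel[OF assms(1) assms(2)]
  by (simp add: sublevel_integral_def set_lebesgue_integral_def scaleR_sum_right)

lemma integrable_hinge:
  fixes f :: "'a::euclidean_space \<Rightarrow> complex"
  assumes "continuous_on UNIV h" "continuous_on UNIV f" "bounded {x. f x \<noteq> 0}"
  shows "integrable lborel (\<lambda>x. complex_of_real (max 0 (s - h x)) * f x)"
  by (intro integrable_bounded_support continuous_intros assms bounded_mult_support)

lemma hinge_integral_sum:
  assumes "continuous_on UNIV h"
    "\<And>i. i \<in> I \<Longrightarrow> continuous_on UNIV (f i)" "\<And>i. i \<in> I \<Longrightarrow> bounded {x. f i x \<noteq> 0}"
  shows "hinge_integral h (\<lambda>x. \<Sum>i\<in>I. f i x) s = (\<Sum>i\<in>I. hinge_integral h (f i) s)"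
  using integrable_hinge[OF assms(1) assms(2,3)]
  by (simp add: hinge_integral_def sum_distrib_left)

lemma cmod_integral_le:
  fixes f :: "'a \<Rightarrow> complex"
  assumes "integrable M f" "integrable M g" "\<And>x. cmod (f x) \<le> g x"
  shows "cmod (LINT x|M. f x) \<le> (LINT x|M. g x)"
proof -
  have "cmod (LINT x|M. f x) \<le> (LINT x|M. cmod (f x))" by (rule integral_norm_bound)
  also have "\<dots> \<le> (LINT x|M. g x)"
    by (rule integral_mono[OF integrable_norm[OF assms(1)] assms(2,3)])
  finally show ?thesis .
qed

text \<open>The hinge is 1-Lipschitz in the level, so the integral is Lipschitz in \<open>s\<close>
  with the integral of |f| as constant.\<close>

lemma hinge_integral_isCont:
  assumes "continuous_on UNIV h" "continuous_on UNIV f" "bounded {x. f x \<noteq> 0}"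
  shows "isCont (hinge_integral h f) s"
proof -
  let ?J = "hinge_integral h f"
  have int: "integrable lborel f" by (rule integrable_bounded_support[OF assms(2,3)])
  have int2: "integrable lborel (\<lambda>x. complex_of_real (max 0 (t - h x)) * f x - complex_of_real (max 0 (s - h x)) * f x)" for t
    by (intro Bochner_Integration.integrable_diff integrable_hinge[OF assms])
  have lip: "cmod (?J t - ?J s) \<le> \<bar>t - s\<bar> * (LINT x|lborel. cmod (f x))" for t
  proof -
    have "?J t - ?J s = (LINT x|lborel. complex_of_real (max 0 (t - h x)) * f x - complex_of_real (max 0 (s - h x)) * f x)"
      unfolding hinge_integral_def
      by (rule Bochner_Integration.integral_diff[symmetric]; rule integrable_hinge[OF assms])
    also have "cmod \<dots> \<le> (LINT x|lborel. \<bar>t - s\<bar> * cmod (f x))"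
    proof (rule cmod_integral_le[OF int2])
      show "integrable lborel (\<lambda>x. \<bar>t - s\<bar> * cmod (f x))"
        by (intro integrable_mult_right integrable_norm int)
      show "cmod (complex_of_real (max 0 (t - h x)) * f x - complex_of_real (max 0 (s - h x)) * f x) \<le> \<bar>t - s\<bar> * cmod (f x)" for x
      proof -
        have "complex_of_real (max 0 (t - h x)) * f x - complex_of_real (max 0 (s - h x)) * f x =
            complex_of_real (max 0 (t - h x) - max 0 (s - h x)) * f x"
          by (simp add: left_diff_distrib)
        then have "cmod (complex_of_real (max 0 (t - h x)) * f x - complex_of_real (max 0 (s - h x)) * f x) =
            \<bar>max 0 (t - h x) - max 0 (s - h x)\<bar> * cmod (f x)"
          by (simp only: norm_mult norm_of_real)
        also have "\<dots> \<le> \<bar>t - s\<bar> * cmod (f x)" by (intro mult_right_mono) auto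
        finally show ?thesis .
      qed
    qed
    finally show ?thesis by simp
  qed
  have "((\<lambda>t. ?J t - ?J s) \<longlongrightarrow> 0) (at s)"
  proof (rule Lim_null_comparison)
    show "eventually (\<lambda>t. cmod (?J t - ?J s) \<le> \<bar>t - s\<bar> * (LINT x|lborel. cmod (f x))) (at s)"
      using lip by simp
    have "((\<lambda>t. \<bar>t - s\<bar> * (LINT x|lborel. cmod (f x))) \<longlongrightarrow> \<bar>s - s\<bar> * (LINT x|lborel. cmod (f x))) (at s)"
      by (intro tendsto_intros)
    then show "((\<lambda>t. \<bar>t - s\<bar> * (LINT x|lborel. cmod (f x))) \<longlongrightarrow> 0) (at s)" by simp
  qed
  then show ?thesis unfolding isCont_def using LIM_zero_iff by blast
qed

lemma hinge_bracket:
  fixes t s u :: real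
  shows "\<bar>max 0 (t - u) - max 0 (s - u) - (t - s) * (if u < s then 1 else 0)\<bar> \<le>
    \<bar>t - s\<bar> * \<bar>(if u < t then 1 else 0) - (if u < s then 1 else 0)\<bar>"
  by (auto simp: max_def)

text \<open>The deviation from linearity only involves the region where \<open>h\<close> lies between \<open>s\<close> and the new level.\<close>

lemma hinge_integral_has_derivative:
  fixes \<phi> :: "'a::euclidean_space \<Rightarrow> complex"
  assumes h: "continuous_on UNIV h"
    and \<phi>: "continuous_on UNIV \<phi>" "bounded {x. \<phi> x \<noteq> 0}"
    and \<psi>: "continuous_on UNIV \<psi>" "bounded {x. \<psi> x \<noteq> 0}" "\<forall>x. \<psi> x = complex_of_real (cmod (\<psi> x))"
    and C: "C > 0" "\<forall>x. cmod (\<phi> x) \<le> C * cmod (\<psi> x)"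
    and cont: "isCont (sublevel_integral h \<psi>) s"
  shows "(hinge_integral h \<phi> has_vector_derivative sublevel_integral h \<phi> s) (at s)"
proof -
  let ?J = "hinge_integral h \<phi>" and ?I = "sublevel_integral h \<phi>"
  let ?\<chi> = "\<lambda>s x. if h x < s then 1 else (0::real)"
  have i\<phi>: "integrable lborel \<phi>" by (rule integrable_bounded_support[OF \<phi>])
  have i\<psi>: "integrable lborel \<psi>" by (rule integrable_bounded_support[OF \<psi>(1,2)])
  have ind: "indicat_real {x. h x < s} x = ?\<chi> s x" for s x by (simp add: indicator_def)
  have int\<chi>: "integrable lborel (\<lambda>x. ?\<chi> s x *\<^sub>R \<psi> x)" "integrable lborel (\<lambda>x. ?\<chi> s x *\<^sub>R \<phi> x)" for s
    using integrable_sublevel[OF h i\<psi>, of s] integrable_sublevel[OF h i\<phi>, of s] by (simp_all only: ind)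
  have I\<psi>: "sublevel_integral h \<psi> s = complex_of_real (LINT x|lborel. ?\<chi> s x * cmod (\<psi> x))" for s
  proof -
    have "sublevel_integral h \<psi> s = (LINT x|lborel. ?\<chi> s x *\<^sub>R \<psi> x)"
      unfolding sublevel_integral_def set_lebesgue_integral_def by (simp only: ind)
    also have "\<dots> = (LINT x|lborel. complex_of_real (?\<chi> s x * cmod (\<psi> x)))"
      by (rule Bochner_Integration.integral_cong) (use \<psi>(3) in \<open>simp_all add: scaleR_conv_of_real\<close>)
    finally show ?thesis by (simp del: of_real_mult)
  qed
  have int\<psi>: "integrable lborel (\<lambda>x. ?\<chi> s x * cmod (\<psi> x))" for s
  proof -
    have "integrable lborel (\<lambda>x. cmod (?\<chi> s x *\<^sub>R \<psi> x))" by (rule integrable_norm[OF int\<chi>(1)])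
    moreover have "(\<lambda>x. cmod (?\<chi> s x *\<^sub>R \<psi> x)) = (\<lambda>x. ?\<chi> s x * cmod (\<psi> x))" by auto
    ultimately show ?thesis by simp
  qed
  \<comment> \<open>Up to the factor \<open>C\<close>, the deviation is at most |t - s| times the
    \<psi>-mass between the two levels, and continuity of the sublevel integral of \<psi> makes this
    mass tend to 0.\<close>
  have est: "cmod (?J t - ?J s - (t - s) *\<^sub>R ?I s) \<le>
      \<bar>t - s\<bar> * (C * cmod (sublevel_integral h \<psi> t - sublevel_integral h \<psi> s))" for t
  proof -
    let ?D = "\<lambda>x. complex_of_real (max 0 (t - h x)) * \<phi> x - complex_of_real (max 0 (s - h x)) * \<phi> x -
        (t - s) *\<^sub>R (?\<chi> s x *\<^sub>R \<phi> x)"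
    let ?A = "\<lambda>t x. complex_of_real (max 0 (t - h x)) * \<phi> x" and ?E = "\<lambda>x. ?\<chi> s x *\<^sub>R \<phi> x"
    have iA: "integrable lborel (?A t)" for t by (rule integrable_hinge[OF h \<phi>])
    have iAA: "integrable lborel (\<lambda>x. ?A t x - ?A s x)"
      by (rule Bochner_Integration.integrable_diff[OF iA iA])
    have iE: "integrable lborel (\<lambda>x. (t - s) *\<^sub>R ?E x)"
      by (rule integrable_scaleR_right) (rule int\<chi>(2))
    have iD: "integrable lborel ?D"
      by (rule Bochner_Integration.integrable_diff[OF iAA iE])
    have J: "?J t = (LINT x|lborel. ?A t x)" for t by (simp add: hinge_integral_def)
    have I: "?I s = (LINT x|lborel. ?E x)"
      unfolding sublevel_integral_def set_lebesgue_integral_def ind ..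
    have "(LINT x|lborel. ?D x) = (LINT x|lborel. ?A t x - ?A s x) - (LINT x|lborel. (t - s) *\<^sub>R ?E x)"
      by (rule Bochner_Integration.integral_diff[OF iAA iE])
    also have "(LINT x|lborel. ?A t x - ?A s x) = ?J t - ?J s"
      unfolding J by (rule Bochner_Integration.integral_diff[OF iA iA])
    also have "(LINT x|lborel. (t - s) *\<^sub>R ?E x) = (t - s) *\<^sub>R ?I s"
      unfolding I by (rule integral_scaleR_right)
    finally have "?J t - ?J s - (t - s) *\<^sub>R ?I s = (LINT x|lborel. ?D x)" ..
    then have "cmod (?J t - ?J s - (t - s) *\<^sub>R ?I s) = cmod (LINT x|lborel. ?D x)" by (rule arg_cong)
    also have "\<dots> \<le> (LINT x|lborel. \<bar>t - s\<bar> * (C * \<bar>?\<chi> t x * cmod (\<psi> x) - ?\<chi> s x * cmod (\<psi> x)\<bar>))"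
    proof (rule cmod_integral_le[OF iD])
      show "integrable lborel (\<lambda>x. \<bar>t - s\<bar> * (C * \<bar>?\<chi> t x * cmod (\<psi> x) - ?\<chi> s x * cmod (\<psi> x)\<bar>))"
        by (intro integrable_mult_right integrable_abs Bochner_Integration.integrable_diff int\<psi>)
      show "cmod (?D x) \<le> \<bar>t - s\<bar> * (C * \<bar>?\<chi> t x * cmod (\<psi> x) - ?\<chi> s x * cmod (\<psi> x)\<bar>)" for x
      proof -
        have "?D x = complex_of_real (max 0 (t - h x) - max 0 (s - h x) - (t - s) * ?\<chi> s x) * \<phi> x"
          by (simp add: algebra_simps scaleR_conv_of_real)
        then have "cmod (?D x) = \<bar>max 0 (t - h x) - max 0 (s - h x) - (t - s) * ?\<chi> s x\<bar> * cmod (\<phi> x)"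
          by (simp only: norm_mult norm_of_real)
        also have "\<dots> \<le> (\<bar>t - s\<bar> * \<bar>?\<chi> t x - ?\<chi> s x\<bar>) * (C * cmod (\<psi> x))"
          by (intro mult_mono hinge_bracket) (use C(2) in auto)
        also have "\<dots> = \<bar>t - s\<bar> * (C * \<bar>?\<chi> t x * cmod (\<psi> x) - ?\<chi> s x * cmod (\<psi> x)\<bar>)" by auto
        finally show ?thesis .
      qed
    qed
    also have "\<dots> = \<bar>t - s\<bar> * (C * (LINT x|lborel. \<bar>?\<chi> t x * cmod (\<psi> x) - ?\<chi> s x * cmod (\<psi> x)\<bar>))" by simp
    \<comment> \<open>The two sublevel sets are nested, so the integrand has constant sign and the
      absolute value can leave the integral.\<close>
    also have "(LINT x|lborel. \<bar>?\<chi> t x * cmod (\<psi> x) - ?\<chi> s x * cmod (\<psi> x)\<bar>) =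
        \<bar>LINT x|lborel. ?\<chi> t x * cmod (\<psi> x) - ?\<chi> s x * cmod (\<psi> x)\<bar>"
    proof (cases "s \<le> t")
      case True
      then have "(\<lambda>x. \<bar>?\<chi> t x * cmod (\<psi> x) - ?\<chi> s x * cmod (\<psi> x)\<bar>) = (\<lambda>x. ?\<chi> t x * cmod (\<psi> x) - ?\<chi> s x * cmod (\<psi> x))"
        by auto
      moreover have "(LINT x|lborel. \<bar>?\<chi> t x * cmod (\<psi> x) - ?\<chi> s x * cmod (\<psi> x)\<bar>) \<ge> 0"
        by (intro integral_nonneg_AE) simp
      ultimately show ?thesis by simp
    next
      case False
      then have e: "(\<lambda>x. \<bar>?\<chi> t x * cmod (\<psi> x) - ?\<chi> s x * cmod (\<psi> x)\<bar>) = (\<lambda>x. - (?\<chi> t x * cmod (\<psi> x) - ?\<chi> s x * cmod (\<psi> x)))"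
        by auto
      have "(LINT x|lborel. \<bar>?\<chi> t x * cmod (\<psi> x) - ?\<chi> s x * cmod (\<psi> x)\<bar>) =
          - (LINT x|lborel. ?\<chi> t x * cmod (\<psi> x) - ?\<chi> s x * cmod (\<psi> x))"
        unfolding e by (rule integral_minus)
      moreover have "(LINT x|lborel. \<bar>?\<chi> t x * cmod (\<psi> x) - ?\<chi> s x * cmod (\<psi> x)\<bar>) \<ge> 0"
        by (intro integral_nonneg_AE) simp
      ultimately show ?thesis by simp
    qed
    also have "(LINT x|lborel. ?\<chi> t x * cmod (\<psi> x) - ?\<chi> s x * cmod (\<psi> x)) =
        (LINT x|lborel. ?\<chi> t x * cmod (\<psi> x)) - (LINT x|lborel. ?\<chi> s x * cmod (\<psi> x))"
      by (intro Bochner_Integration.integral_diff int\<psi>)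
    also have "\<bar>\<dots>\<bar> = cmod (sublevel_integral h \<psi> t - sublevel_integral h \<psi> s)"
      unfolding I\<psi> by (simp only: of_real_diff[symmetric] norm_of_real)
    finally show ?thesis .
  qed
  have "(?J has_derivative (\<lambda>r. r *\<^sub>R ?I s)) (at s)"
    unfolding has_derivative_at_alt
  proof (intro conjI allI impI)
    show "bounded_linear (\<lambda>r. r *\<^sub>R ?I s)" by (rule bounded_linear_scaleR_left)
    fix e :: real assume "e > 0"
    then have "e / C > 0" using C(1) by simp
    then obtain d where d: "d > 0"
      "\<forall>t. dist t s < d \<longrightarrow> dist (sublevel_integral h \<psi> t) (sublevel_integral h \<psi> s) < e / C"
      using cont unfolding continuous_at_eps_delta by blast
    have "cmod (?J t - ?J s - (t - s) *\<^sub>R ?I s) \<le> e * norm (t - s)" if "norm (t - s) < d" for t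
    proof -
      have "cmod (sublevel_integral h \<psi> t - sublevel_integral h \<psi> s) \<le> e / C"
        using d(2)[rule_format, of t] that by (simp add: dist_norm)
      then have "C * cmod (sublevel_integral h \<psi> t - sublevel_integral h \<psi> s) \<le> e"
        using C(1) by (simp add: field_simps)
      then have "\<bar>t - s\<bar> * (C * cmod (sublevel_integral h \<psi> t - sublevel_integral h \<psi> s)) \<le> \<bar>t - s\<bar> * e"
        by (intro mult_left_mono) auto
      with est[of t] show ?thesis by (simp add: mult.commute)
    qed
    then show "\<exists>d>0. \<forall>t. norm (t - s) < d \<longrightarrow> cmod (?J t - ?J s - (t - s) *\<^sub>R ?I s) \<le> e * norm (t - s)"
      using d(1) by blast
  qed
  then show ?thesis by (simp add: has_vector_derivative_def)
qed

text \<open>The functional \<open>\<langle>\<delta>\<^bsup>(j)\<^esup>(h), \<phi>\<rangle>\<close>.\<close>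

definition delta_deriv :: "('a::euclidean_space \<Rightarrow> real) \<Rightarrow> nat \<Rightarrow> ('a \<Rightarrow> complex) \<Rightarrow> complex" where
  "delta_deriv h j = pullback h ((dist_deriv ^^ j) dirac)"

definition vderiv :: "(real \<Rightarrow> complex) \<Rightarrow> real \<Rightarrow> complex" where
  "vderiv \<psi> = (\<lambda>t. vector_derivative \<psi> (at t))"

lemma dist_deriv_dirac: "(dist_deriv ^^ j) dirac \<psi> = (-1) ^ j * (vderiv ^^ j) \<psi> 0"
proof (induction j arbitrary: \<psi>)
  case 0
  show ?case by (simp add: dirac_def)
next
  case (Suc j)
  have "(dist_deriv ^^ Suc j) dirac \<psi> = - (dist_deriv ^^ j) dirac (vderiv \<psi>)"
    by (simp add: dist_deriv_def vderiv_def)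
  also have "\<dots> = (-1) ^ Suc j * (vderiv ^^ Suc j) \<psi> 0"
    by (simp add: Suc.IH funpow_swap1)
  finally show ?case .
qed

lemma delta_deriv_eq: "delta_deriv h j \<phi> = (-1) ^ j * (vderiv ^^ j) (pushforward h \<phi>) 0"
  by (simp add: delta_deriv_def pullback_def dist_deriv_dirac)

lemma pushforward_eq: "pushforward h \<phi> = vderiv (sublevel_integral h \<phi>)"
  by (simp add: pushforward_def vderiv_def sublevel_integral_def[abs_def] fun_eq_iff)

lemma eventually_vderiv_cong:
  assumes "eventually (\<lambda>s. f s = g s) (nhds a)"
  shows "eventually (\<lambda>s. vderiv f s = vderiv g s) (nhds a)"
proof -
  have "eventually (\<lambda>s. eventually (\<lambda>s. f s = g s) (nhds s)) (nhds a)"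
    using assms by (simp add: eventually_eventually)
  then show ?thesis
  proof (rule eventually_mono)
    fix s assume "eventually (\<lambda>s. f s = g s) (nhds s)"
    then show "vderiv f s = vderiv g s"
      unfolding vderiv_def by (intro vector_derivative_cong_eq) auto
  qed
qed

lemma eventually_vderiv_funpow_cong:
  assumes "eventually (\<lambda>s. f s = g s) (nhds a)"
  shows "eventually (\<lambda>s. (vderiv ^^ j) f s = (vderiv ^^ j) g s) (nhds a)"
  by (induction j) (auto intro: assms eventually_vderiv_cong)

lemma delta_deriv_cong:
  assumes "eventually (\<lambda>s. pushforward h \<phi> s = pushforward h \<psi> s) (nhds 0)"
  shows "delta_deriv h j \<phi> = delta_deriv h j \<psi>"
  using eventually_nhds_x_imp_x[OF eventually_vderiv_funpow_cong[OF assms, of j]]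
  by (simp add: delta_deriv_eq)

lemma eventually_nhds_0I:
  assumes "\<epsilon> > 0" "\<And>s::real. \<bar>s\<bar> < \<epsilon> \<Longrightarrow> P s"
  shows "eventually P (nhds 0)"
  unfolding eventually_nhds_metric using assms by (auto simp: dist_real_def)

section \<open>Sublevel integrals near a regular level\<close>

locale regular_level =
  fixes h :: "'a::euclidean_space \<Rightarrow> real"
  assumes smooth_h: "smooth_on UNIV (\<lambda>x. complex_of_real (h x))"
    and compact_zero: "compact {x. h x = 0}"
    and regular: "h x = 0 \<Longrightarrow> \<exists>i\<in>Basis. dir_deriv i (\<lambda>x. complex_of_real (h x)) x \<noteq> 0"
begin

abbreviation hc :: "'a \<Rightarrow> complex" where "hc \<equiv> \<lambda>x. complex_of_real (h x)"

lemma continuous_h: "continuous_on UNIV h"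
  by (rule continuous_on_of_real_cancel[OF smooth_on_continuous[OF open_UNIV smooth_h]])

lemma dir_deriv_h_real: "complex_of_real (Re (dir_deriv v hc x)) = dir_deriv v hc x"
proof -
  have "(h has_derivative (\<lambda>v. Re (dir_deriv v hc x))) (at x)"
    using has_derivative_Re[OF smooth_on_has_derivative[OF smooth_h open_UNIV, of x]] by simp
  from dir_deriv_eqI[OF has_derivative_of_real[OF this, where 'a = complex], of v]
  show ?thesis by simp
qed

definition grad_sq :: "'a \<Rightarrow> complex" where
  "grad_sq x = (\<Sum>i\<in>Basis. dir_deriv i hc x * dir_deriv i hc x)"

lemma smooth_grad_sq: "smooth_on UNIV grad_sq"
  unfolding grad_sq_def[abs_def]
  by (intro smooth_on_sum smooth_on_mult smooth_on_dir_deriv smooth_h open_UNIV)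

lemma grad_sq_nonzero:
  assumes "h x = 0"
  shows "grad_sq x \<noteq> 0"
proof -
  obtain i where i: "i \<in> Basis" "dir_deriv i hc x \<noteq> 0" using regular[OF assms] by blast
  define r where "r i = Re (dir_deriv i hc x)" for i
  have dr: "dir_deriv i hc x = complex_of_real (r i)" for i by (simp add: r_def dir_deriv_h_real)
  have "(\<Sum>i\<in>Basis. r i * r i) > 0"
    using i dr by (intro sum_pos2[where i = i]) (auto simp: zero_less_mult_iff linorder_neq_iff)
  moreover have "grad_sq x = complex_of_real (\<Sum>i\<in>Basis. r i * r i)"
    by (simp add: grad_sq_def dr)
  ultimately show ?thesis by (metis of_real_eq_0_iff less_irrefl)
qed

text \<open>Chosen once and for all, so that \<open>normal_div\<close> becomes a fixed operator that
  can be iterated.\<close>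

definition regular_cutoff :: "'a \<Rightarrow> complex" where
  "regular_cutoff = (SOME \<theta>. test_function \<theta> \<and> closure {x. \<theta> x \<noteq> 0} \<subseteq> {x. grad_sq x \<noteq> 0} \<and>
     (\<exists>V. open V \<and> {x. h x = 0} \<subseteq> V \<and> (\<forall>x\<in>V. \<theta> x = 1)))"

lemma open_grad_sq: "open {x. grad_sq x \<noteq> 0}"
  using smooth_on_continuous[OF open_UNIV smooth_grad_sq]
  by (intro open_Collect_neq) (auto intro: continuous_intros)

lemma regular_cutoff:
  "test_function regular_cutoff" "closure {x. regular_cutoff x \<noteq> 0} \<subseteq> {x. grad_sq x \<noteq> 0}"
  "\<exists>V. open V \<and> {x. h x = 0} \<subseteq> V \<and> (\<forall>x\<in>V. regular_cutoff x = 1)"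
proof -
  have "{x. h x = 0} \<subseteq> {x. grad_sq x \<noteq> 0}" using grad_sq_nonzero by blast
  from exists_cutoff[OF compact_zero open_grad_sq this]
  have "\<exists>\<theta>. test_function \<theta> \<and> closure {x. \<theta> x \<noteq> 0} \<subseteq> {x. grad_sq x \<noteq> 0} \<and>
     (\<exists>V. open V \<and> {x. h x = 0} \<subseteq> V \<and> (\<forall>x\<in>V. \<theta> x = 1))" by metis
  from someI_ex[OF this] show "test_function regular_cutoff"
    "closure {x. regular_cutoff x \<noteq> 0} \<subseteq> {x. grad_sq x \<noteq> 0}"
    "\<exists>V. open V \<and> {x. h x = 0} \<subseteq> V \<and> (\<forall>x\<in>V. regular_cutoff x = 1)"
    unfolding regular_cutoff_def by blast+
qed

text \<open>A compactly supported field \<open>b\<close> with \<open>b \<bullet> \<nabla>h = 1\<close> near the level set. The operator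
  \<open>\<phi> \<mapsto> div (\<phi> b)\<close> then turns into the derivative of the density of \<open>\<phi>\<close> along \<open>h\<close>.\<close>

definition normal_field :: "'a \<Rightarrow> 'a \<Rightarrow> complex" where
  "normal_field i x = regular_cutoff x * (dir_deriv i hc x * inverse (grad_sq x))"

definition normal_div :: "('a \<Rightarrow> complex) \<Rightarrow> 'a \<Rightarrow> complex" where
  "normal_div \<phi> x = (\<Sum>i\<in>Basis. dir_deriv i (\<lambda>x. normal_field i x * \<phi> x) x)"

lemma test_normal_field: "test_function (normal_field i)"
  unfolding normal_field_def[abs_def]
proof (rule test_function_mult_local[OF open_grad_sq _ regular_cutoff(1,2)])
  have "smooth_on {x. grad_sq x \<noteq> 0} (dir_deriv i hc)"
    by (rule smooth_on_subset[OF smooth_on_dir_deriv[OF smooth_h] open_grad_sq]) auto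
  moreover have "smooth_on {x. grad_sq x \<noteq> 0} grad_sq"
    by (rule smooth_on_subset[OF smooth_grad_sq open_grad_sq]) auto
  ultimately show "smooth_on {x. grad_sq x \<noteq> 0} (\<lambda>x. dir_deriv i hc x * inverse (grad_sq x))"
    by (intro smooth_on_mult smooth_on_inverse open_grad_sq) auto
qed

lemma normal_field_h: "(\<Sum>i\<in>Basis. dir_deriv i hc x * normal_field i x) = regular_cutoff x"
proof (cases "grad_sq x = 0")
  case True
  then have "x \<notin> closure {x. regular_cutoff x \<noteq> 0}" using regular_cutoff(2) by blast
  then have "regular_cutoff x = 0" by (rule test_function_outside[of x regular_cutoff])
  then show ?thesis by (simp add: normal_field_def)
next
  case False
  have "(\<Sum>i\<in>Basis. dir_deriv i hc x * normal_field i x) =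
      (\<Sum>i\<in>Basis. (regular_cutoff x * inverse (grad_sq x)) * (dir_deriv i hc x * dir_deriv i hc x))"
    by (rule sum.cong) (simp_all add: normal_field_def)
  also have "\<dots> = (regular_cutoff x * inverse (grad_sq x)) * grad_sq x"
    unfolding grad_sq_def by (rule sum_distrib_left[symmetric])
  also have "\<dots> = regular_cutoff x" using False by simp
  finally show ?thesis .
qed

lemma test_normal_mult: "test_function \<phi> \<Longrightarrow> test_function (\<lambda>x. normal_field i x * \<phi> x)"
  by (rule test_function_mult_smooth[OF test_function_smooth[OF test_normal_field]])

lemma test_normal_div: "test_function \<phi> \<Longrightarrow> test_function (normal_div \<phi>)"
  unfolding normal_div_def[abs_def]
  by (intro test_function_sum test_function_dir_deriv test_normal_mult)

lemma test_normal_div_funpow: "test_function \<phi> \<Longrightarrow> test_function ((normal_div ^^ k) \<phi>)"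
  by (induction k) (auto intro: test_normal_div)

lemma test_continuous: "test_function \<phi> \<Longrightarrow> continuous_on UNIV \<phi>"
  using smooth_on_continuous[OF open_UNIV test_function_smooth] by blast

lemma test_bounded: "test_function \<phi> \<Longrightarrow> bounded {x. \<phi> x \<noteq> 0}"
  by (rule bounded_subset[OF compact_imp_bounded[OF test_function_compact] closure_subset])

lemma test_integrable: "test_function \<phi> \<Longrightarrow> integrable lborel \<phi>"
  by (intro integrable_bounded_support test_continuous test_bounded)

text \<open>Integration by parts in every coordinate; \<open>normal_field_h\<close> sums the
  resulting factors to the cutoff. Near the level set this rewrites a sublevel integral as a hinge
  integral.\<close>

lemma hinge_normal_div:
  assumes "test_function \<phi>"
  shows "hinge_integral h (normal_div \<phi>) s = sublevel_integral h (\<lambda>x. regular_cutoff x * \<phi> x) s"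
proof -
  let ?n = "\<lambda>i x. normal_field i x * \<phi> x"
  have t: "test_function (?n i)" for i by (rule test_normal_mult[OF assms])
  have td: "test_function (dir_deriv i (?n i))" for i by (rule test_function_dir_deriv[OF t])
  have th: "test_function (\<lambda>x. dir_deriv i hc x * ?n i x)" for i
    by (rule test_function_mult_smooth[OF smooth_on_dir_deriv[OF smooth_h] t])
  have "hinge_integral h (normal_div \<phi>) s = (\<Sum>i\<in>Basis. hinge_integral h (dir_deriv i (?n i)) s)"
    unfolding normal_div_def[abs_def]
    by (rule hinge_integral_sum[OF continuous_h test_continuous[OF td] test_bounded[OF td]])
  also have "\<dots> = (\<Sum>i\<in>Basis. sublevel_integral h (\<lambda>x. dir_deriv i hc x * ?n i x) s)"
    by (rule sum.cong[OF refl], rule hinge_integral_dir_deriv)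
      (rule smooth_on_Ck_on[OF smooth_h] smooth_on_Ck_on[OF test_function_smooth[OF t]] test_bounded[OF t])+
  also have "\<dots> = sublevel_integral h (\<lambda>x. \<Sum>i\<in>Basis. dir_deriv i hc x * ?n i x) s"
    by (rule sublevel_integral_sum[OF continuous_h test_integrable[OF th], symmetric])
  also have "(\<lambda>x. \<Sum>i\<in>Basis. dir_deriv i hc x * ?n i x) = (\<lambda>x. regular_cutoff x * \<phi> x)"
    by (simp add: normal_field_h[symmetric] sum_distrib_right mult.assoc)
  finally show ?thesis .
qed

text \<open>The points where \<phi> is nonzero lie in a compact set disjoint from the level set, and
  \<open>h\<close> stays away from 0 there. Levels near 0 therefore cross no mass.\<close>

lemma sublevel_integral_const:
  assumes "continuous_on UNIV \<phi>" "bounded {x. \<phi> x \<noteq> 0}"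
    and V: "open V" "{x. h x = 0} \<subseteq> V" "\<forall>x\<in>V. \<phi> x = 0"
  obtains \<epsilon> where "\<epsilon> > 0" "\<And>s. \<bar>s\<bar> < \<epsilon> \<Longrightarrow> sublevel_integral h \<phi> s = sublevel_integral h \<phi> 0"
proof -
  obtain R where R: "R > 0" "\<forall>x. x \<notin> cball 0 R \<longrightarrow> \<phi> x = 0"
    using bounded_support_cball[OF assms(2)] by blast
  let ?K = "cball 0 R \<inter> - V"
  have K: "compact ?K" by (rule compact_Int_closed[OF compact_cball closed_Compl[OF V(1)]])
  obtain \<epsilon> where \<epsilon>: "\<epsilon> > 0" "\<forall>x\<in>?K. \<epsilon> \<le> \<bar>h x\<bar>"
  proof (cases "?K = {}")
    case True
    then show ?thesis using that[of 1] by simp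
  next
    case False
    have "continuous_on ?K (\<lambda>x. \<bar>h x\<bar>)"
      by (intro continuous_intros continuous_on_subset[OF continuous_h]) simp
    from continuous_attains_inf[OF K False this]
    obtain z where z: "z \<in> ?K" "\<forall>x\<in>?K. \<bar>h z\<bar> \<le> \<bar>h x\<bar>" by blast
    have "h z \<noteq> 0" using z(1) V(2) by blast
    then show ?thesis using that[of "\<bar>h z\<bar>"] z(2) by simp
  qed
  have "sublevel_integral h \<phi> s = sublevel_integral h \<phi> 0" if s: "\<bar>s\<bar> < \<epsilon>" for s
  proof -
    have "indicat_real {x. h x < s} x *\<^sub>R \<phi> x = indicat_real {x. h x < 0} x *\<^sub>R \<phi> x" for x
    proof (cases "\<phi> x = 0")
      case False
      then have "x \<in> ?K" using R(2) V(3) by blast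
      then have "\<epsilon> \<le> \<bar>h x\<bar>" using \<epsilon>(2) by blast
      then have "h x < s \<longleftrightarrow> h x < 0" using s by linarith
      then show ?thesis by (simp add: indicator_def)
    qed simp
    then have "(\<lambda>x. indicat_real {x. h x < s} x *\<^sub>R \<phi> x) = (\<lambda>x. indicat_real {x. h x < 0} x *\<^sub>R \<phi> x)"
      by (rule ext)
    then show ?thesis unfolding sublevel_integral_def set_lebesgue_integral_def by (simp only:)
  qed
  with \<epsilon>(1) show ?thesis using that by blast
qed

text \<open>This drives the regularity: hinge integrals are more regular than sublevel integrals,
  and the identity transfers each gain back. The constant collects the part of \<phi> away from the
  level set.\<close>

lemma sublevel_integral_cutoff:
  assumes "test_function \<phi>"
  obtains \<epsilon> c where "\<epsilon> > 0" "\<And>s. \<bar>s\<bar> < \<epsilon> \<Longrightarrow> sublevel_integral h \<phi> s = hinge_integral h (normal_div \<phi>) s + c"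
proof -
  have t1: "test_function (\<lambda>x. regular_cutoff x * \<phi> x)"
    by (rule test_function_mult_smooth[OF test_function_smooth[OF regular_cutoff(1)] assms])
  have t2: "test_function (\<lambda>x. \<phi> x - regular_cutoff x * \<phi> x)"
    by (rule test_function_diff[OF assms t1])
  obtain V where V: "open V" "{x. h x = 0} \<subseteq> V" "\<forall>x\<in>V. regular_cutoff x = 1"
    using regular_cutoff(3) by blast
  have V3: "\<forall>x\<in>V. \<phi> x - regular_cutoff x * \<phi> x = 0" using V(3) by simp
  obtain \<epsilon> where \<epsilon>: "\<epsilon> > 0" "\<And>s. \<bar>s\<bar> < \<epsilon> \<Longrightarrow>
      sublevel_integral h (\<lambda>x. \<phi> x - regular_cutoff x * \<phi> x) s = sublevel_integral h (\<lambda>x. \<phi> x - regular_cutoff x * \<phi> x) 0"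
    using sublevel_integral_const[OF test_continuous[OF t2] test_bounded[OF t2] V(1,2) V3] by blast
  have "sublevel_integral h \<phi> s = hinge_integral h (normal_div \<phi>) s + sublevel_integral h (\<lambda>x. \<phi> x - regular_cutoff x * \<phi> x) 0"
    if "\<bar>s\<bar> < \<epsilon>" for s
    using sublevel_integral_add[OF continuous_h test_integrable[OF t1] test_integrable[OF t2], of s]
    by (simp add: \<epsilon>(2)[OF that] hinge_normal_div[OF assms])
  with \<epsilon>(1) show ?thesis using that by blast
qed

lemma sublevel_integral_isCont:
  assumes "test_function \<phi>"
  obtains \<epsilon> where "\<epsilon> > 0" "\<And>s. \<bar>s\<bar> < \<epsilon> \<Longrightarrow> isCont (sublevel_integral h \<phi>) s"
proof -
  obtain \<epsilon> c where \<epsilon>: "\<epsilon> > 0"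
    "\<And>s. \<bar>s\<bar> < \<epsilon> \<Longrightarrow> sublevel_integral h \<phi> s = hinge_integral h (normal_div \<phi>) s + c"
    using sublevel_integral_cutoff[OF assms] by blast
  have "isCont (sublevel_integral h \<phi>) s" if s: "\<bar>s\<bar> < \<epsilon>" for s
  proof -
    have "eventually (\<lambda>t. t \<in> {-\<epsilon><..<\<epsilon>}) (nhds s)"
      using s by (intro eventually_nhds_in_open) auto
    then have "eventually (\<lambda>t. sublevel_integral h \<phi> t = hinge_integral h (normal_div \<phi>) t + c) (nhds s)"
      by (rule eventually_mono) (auto intro: \<epsilon>(2))
    moreover have "isCont (\<lambda>t. hinge_integral h (normal_div \<phi>) t + c) s"
      using test_normal_div[OF assms]
      by (intro continuous_intros hinge_integral_isCont continuous_h test_continuous test_bounded)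
    ultimately show ?thesis by (subst isCont_cong)
  qed
  with \<epsilon>(1) show ?thesis using that by blast
qed

text \<open>A cutoff \<psi> equal to 1 on a ball that carries \<phi> dominates it up to a constant.
  Its sublevel integral is continuous near 0, which is what
  \<open>hinge_integral_has_derivative\<close> asks for.\<close>

lemma hinge_integral_deriv_near_0:
  assumes "continuous_on UNIV \<phi>" "bounded {x. \<phi> x \<noteq> 0}"
  shows "eventually (\<lambda>s. (hinge_integral h \<phi> has_vector_derivative sublevel_integral h \<phi> s) (at s)) (nhds 0)"
proof -
  obtain R where R: "R > 0" "\<forall>x. x \<notin> cball 0 R \<longrightarrow> \<phi> x = 0"
    using bounded_support_cball[OF assms(2)] by blast
  obtain C where C: "C > 0" "\<forall>x. cmod (\<phi> x) \<le> C" using norm_bounded_support[OF assms] by blast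
  obtain \<psi> :: "'a \<Rightarrow> complex" and V where \<psi>: "test_function \<psi>" "closure {x. \<psi> x \<noteq> 0} \<subseteq> UNIV"
      "open V" "cball 0 R \<subseteq> V"
      "\<And>x. x \<in> V \<Longrightarrow> \<psi> x = 1" "\<And>x. \<psi> x = complex_of_real (cmod (\<psi> x))"
    using exists_cutoff[OF compact_cball open_UNIV subset_UNIV, of "0 :: 'a" R] by metis
  obtain \<epsilon> where \<epsilon>: "\<epsilon> > 0" "\<And>s. \<bar>s\<bar> < \<epsilon> \<Longrightarrow> isCont (sublevel_integral h \<psi>) s"
    using sublevel_integral_isCont[OF \<psi>(1)] by blast
  have dom: "\<forall>x. cmod (\<phi> x) \<le> C * cmod (\<psi> x)"
  proof
    fix x
    show "cmod (\<phi> x) \<le> C * cmod (\<psi> x)"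
    proof (cases "x \<in> cball 0 R")
      case True
      then have "\<psi> x = 1" using \<psi>(4,5) by blast
      then show ?thesis using C by simp
    next
      case False
      then show ?thesis using R(2) C(1) by simp
    qed
  qed
  have re: "\<forall>x. \<psi> x = complex_of_real (cmod (\<psi> x))" using \<psi>(6) by blast
  have "(hinge_integral h \<phi> has_vector_derivative sublevel_integral h \<phi> s) (at s)" if "\<bar>s\<bar> < \<epsilon>" for s
    by (rule hinge_integral_has_derivative[OF continuous_h assms test_continuous[OF \<psi>(1)]
        test_bounded[OF \<psi>(1)] re C(1) dom \<epsilon>(2)[OF that]])
  then show ?thesis by (rule eventually_nhds_0I[OF \<epsilon>(1)])
qed

lemma sublevel_integral_deriv_near_0:
  assumes "test_function \<phi>"
  shows "eventually (\<lambda>s. (sublevel_integral h \<phi> has_vector_derivative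
    sublevel_integral h (normal_div \<phi>) s) (at s)) (nhds 0)"
proof -
  obtain \<epsilon> c where \<epsilon>: "\<epsilon> > 0"
    "\<And>s. \<bar>s\<bar> < \<epsilon> \<Longrightarrow> sublevel_integral h \<phi> s = hinge_integral h (normal_div \<phi>) s + c"
    using sublevel_integral_cutoff[OF assms] by blast
  have t: "test_function (normal_div \<phi>)" by (rule test_normal_div[OF assms])
  have "eventually (\<lambda>s. \<bar>s\<bar> < \<epsilon>) (nhds 0)" by (rule eventually_nhds_0I[OF \<epsilon>(1)])
  then show ?thesis
    using hinge_integral_deriv_near_0[OF test_continuous[OF t] test_bounded[OF t]]
  proof eventually_elim
    case (elim s)
    have "((\<lambda>t. hinge_integral h (normal_div \<phi>) t + c) has_vector_derivative
        sublevel_integral h (normal_div \<phi>) s) (at s)"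
      using elim(2) by (simp add: has_vector_derivative_add_const)
    then show ?case
      by (rule has_vector_derivative_transform_within_open[where S = "{-\<epsilon><..<\<epsilon>}"])
        (use elim(1) \<epsilon>(2) in \<open>auto simp: abs_less_iff\<close>)
  qed
qed

lemma pushforward_near_0:
  assumes "test_function \<phi>"
  shows "eventually (\<lambda>s. pushforward h \<phi> s = sublevel_integral h (normal_div \<phi>) s) (nhds 0)"
  using sublevel_integral_deriv_near_0[OF assms]
  by (rule eventually_mono) (simp add: pushforward_eq vderiv_def vector_derivative_at)

text \<open>A formula free of derivatives in the level. The exponent is \<open>Suc j\<close> because
  the pushforward is already one derivative of the sublevel integral.\<close>

lemma delta_deriv_sublevel:
  assumes "test_function \<phi>"
  shows "delta_deriv h j \<phi> = (-1) ^ j * sublevel_integral h ((normal_div ^^ Suc j) \<phi>) 0"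
proof -
  have "eventually (\<lambda>s. (vderiv ^^ j) (pushforward h \<phi>) s = sublevel_integral h ((normal_div ^^ Suc j) \<phi>) s) (nhds 0)"
  proof (induction j)
    case 0
    then show ?case using pushforward_near_0[OF assms] by simp
  next
    case (Suc j)
    let ?\<phi> = "(normal_div ^^ Suc j) \<phi>"
    have "eventually (\<lambda>s. vderiv ((vderiv ^^ j) (pushforward h \<phi>)) s = vderiv (sublevel_integral h ?\<phi>) s) (nhds 0)"
      by (rule eventually_vderiv_cong[OF Suc.IH])
    with pushforward_near_0[OF test_normal_div_funpow[OF assms], of "Suc j"] show ?case
      unfolding pushforward_eq by eventually_elim simp
  qed
  from eventually_nhds_x_imp_x[OF this] show ?thesis by (simp add: delta_deriv_eq)
qed

lemma normal_div_linear:
  assumes "test_function \<phi>" "test_function \<psi>"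
  shows "normal_div (\<lambda>x. c * \<phi> x + \<psi> x) = (\<lambda>x. c * normal_div \<phi> x + normal_div \<psi> x)"
proof
  fix x
  have d: "(\<lambda>x. normal_field i x * \<eta> x) differentiable (at x)" if "test_function \<eta>" for i \<eta>
    using smooth_on_differentiable[OF test_function_smooth[OF test_normal_mult[OF that]] open_UNIV] by blast
  have "dir_deriv i (\<lambda>x. normal_field i x * (c * \<phi> x + \<psi> x)) x =
      c * dir_deriv i (\<lambda>x. normal_field i x * \<phi> x) x + dir_deriv i (\<lambda>x. normal_field i x * \<psi> x) x" for i
  proof -
    let ?f = "\<lambda>x. normal_field i x * \<phi> x" and ?g = "\<lambda>x. normal_field i x * \<psi> x"
    have "(\<lambda>x. c * ?f x) differentiable (at x)"
      by (rule differentiable_mult[OF differentiable_const d[OF assms(1)]])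
    then have "dir_deriv i (\<lambda>x. c * ?f x + ?g x) x = c * dir_deriv i ?f x + dir_deriv i ?g x"
      using dir_deriv_add[of "\<lambda>x. c * ?f x" x ?g i] dir_deriv_cmult[of ?f x i c] d[OF assms(1)] d[OF assms(2)]
      by simp
    moreover have "(\<lambda>x. normal_field i x * (c * \<phi> x + \<psi> x)) = (\<lambda>x. c * ?f x + ?g x)"
      by (simp add: algebra_simps)
    ultimately show ?thesis by simp
  qed
  then show "normal_div (\<lambda>x. c * \<phi> x + \<psi> x) x = c * normal_div \<phi> x + normal_div \<psi> x"
    by (simp add: normal_div_def sum.distrib sum_distrib_left)
qed

lemma test_function_linear:
  "test_function \<phi> \<Longrightarrow> test_function \<psi> \<Longrightarrow> test_function (\<lambda>x. c * \<phi> x + \<psi> x)"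
  by (intro test_function_add test_function_cmult)

text \<open>Linearity of an iterated \<open>vector_derivative\<close> presupposes differentiability.
  The derivative-free formula settles it, since \<open>normal_div\<close> is linear on test
  functions.\<close>

lemma delta_deriv_linear:
  assumes "test_function \<phi>" "test_function \<psi>"
  shows "delta_deriv h j (\<lambda>x. c * \<phi> x + \<psi> x) = c * delta_deriv h j \<phi> + delta_deriv h j \<psi>"
proof -
  have "(normal_div ^^ k) (\<lambda>x. c * \<phi> x + \<psi> x) = (\<lambda>x. c * (normal_div ^^ k) \<phi> x + (normal_div ^^ k) \<psi> x)" for k
    by (induction k) (simp_all add: normal_div_linear test_normal_div_funpow assms)
  from this[of "Suc j"] have "delta_deriv h j (\<lambda>x. c * \<phi> x + \<psi> x) = (-1) ^ j *
      sublevel_integral h (\<lambda>x. c * (normal_div ^^ Suc j) \<phi> x + (normal_div ^^ Suc j) \<psi> x) 0"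
    by (simp only: delta_deriv_sublevel[OF test_function_linear[OF assms]])
  also have "sublevel_integral h (\<lambda>x. c * (normal_div ^^ Suc j) \<phi> x + (normal_div ^^ Suc j) \<psi> x) 0 =
      c * sublevel_integral h ((normal_div ^^ Suc j) \<phi>) 0 + sublevel_integral h ((normal_div ^^ Suc j) \<psi>) 0"
    using test_normal_div_funpow[OF assms(1), of "Suc j"] test_normal_div_funpow[OF assms(2), of "Suc j"]
    by (subst sublevel_integral_add[OF continuous_h])
      (simp_all only: sublevel_integral_cmult test_integrable test_function_cmult)
  finally show ?thesis by (simp add: delta_deriv_sublevel assms algebra_simps)
qed

lemma delta_deriv_0: "delta_deriv h j (\<lambda>x. 0) = 0"
  using delta_deriv_linear[OF test_function_0 test_function_0, of j "-1"] by simp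

lemma delta_deriv_add:
  "test_function \<phi> \<Longrightarrow> test_function \<psi> \<Longrightarrow>
    delta_deriv h j (\<lambda>x. \<phi> x + \<psi> x) = delta_deriv h j \<phi> + delta_deriv h j \<psi>"
  using delta_deriv_linear[of \<phi> \<psi> j 1] by simp

lemma delta_deriv_cmult:
  "test_function \<phi> \<Longrightarrow> delta_deriv h j (\<lambda>x. c * \<phi> x) = c * delta_deriv h j \<phi>"
  using delta_deriv_linear[of \<phi> "\<lambda>_. 0" j c] by (simp add: test_function_0 delta_deriv_0)

lemma delta_deriv_sum:
  "(\<And>i. i \<in> I \<Longrightarrow> test_function (\<phi> i)) \<Longrightarrow>
    delta_deriv h j (\<lambda>x. \<Sum>i\<in>I. \<phi> i x) = (\<Sum>i\<in>I. delta_deriv h j (\<phi> i))"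
proof (induction I rule: infinite_finite_induct)
  case (insert i I)
  then have "test_function (\<lambda>x. \<Sum>i\<in>I. \<phi> i x)" by (intro test_function_sum) simp
  with insert show ?case by (simp add: delta_deriv_add)
qed (simp_all add: delta_deriv_0)

text \<open>The difference vanishes near the level set, so the sublevel integrals differ by a
  constant, which the derivative in the level removes.\<close>

lemma pushforward_local:
  assumes "continuous_on UNIV \<phi>" "bounded {x. \<phi> x \<noteq> 0}" "continuous_on UNIV \<psi>" "bounded {x. \<psi> x \<noteq> 0}"
    and V: "open V" "{x. h x = 0} \<subseteq> V" "\<forall>x\<in>V. \<phi> x = \<psi> x"
  shows "eventually (\<lambda>s. pushforward h \<phi> s = pushforward h \<psi> s) (nhds 0)"
proof -
  let ?d = "\<lambda>x. \<phi> x - \<psi> x"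
  have c: "continuous_on UNIV ?d" by (intro continuous_on_diff assms)
  have b: "bounded {x. ?d x \<noteq> 0}"
    by (rule bounded_subset[of "{x. \<phi> x \<noteq> 0} \<union> {x. \<psi> x \<noteq> 0}"]) (use assms(2,4) in auto)
  obtain \<epsilon> where \<epsilon>: "\<epsilon> > 0" "\<And>s. \<bar>s\<bar> < \<epsilon> \<Longrightarrow> sublevel_integral h ?d s = sublevel_integral h ?d 0"
    using sublevel_integral_const[OF c b V(1,2)] V(3) by auto
  define k where "k = sublevel_integral h ?d 0"
  have eq: "sublevel_integral h \<phi> s = sublevel_integral h \<psi> s + k" if "\<bar>s\<bar> < \<epsilon>" for s
    using sublevel_integral_add[OF continuous_h integrable_bounded_support[OF c b]
        integrable_bounded_support[OF assms(3,4)], of s] \<epsilon>(2)[OF that] by (simp add: k_def)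
  have "eventually (\<lambda>s. sublevel_integral h \<phi> s = sublevel_integral h \<psi> s + k) (nhds 0)"
    by (rule eventually_nhds_0I[OF \<epsilon>(1) eq])
  from eventually_vderiv_cong[OF this] show ?thesis
    by (simp add: pushforward_eq vderiv_def vector_derivative_def has_vector_derivative_add_const)
qed

lemma delta_deriv_local:
  assumes "test_function \<phi>" "test_function \<psi>" "open V" "{x. h x = 0} \<subseteq> V" "\<forall>x\<in>V. \<phi> x = \<psi> x"
  shows "delta_deriv h j \<phi> = delta_deriv h j \<psi>"
  by (rule delta_deriv_cong[OF pushforward_local])
    (rule assms test_continuous[OF assms(1)] test_continuous[OF assms(2)]
      test_bounded[OF assms(1)] test_bounded[OF assms(2)])+

lemma pushforward_dir_deriv:
  assumes "Ck_on (Suc 0) UNIV \<phi>" "bounded {x. \<phi> x \<noteq> 0}"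
  shows "eventually (\<lambda>s. pushforward h (\<lambda>x. dir_deriv v hc x * \<phi> x) s =
    sublevel_integral h (dir_deriv v \<phi>) s) (nhds 0)"
proof -
  have "continuous_on UNIV (dir_deriv v \<phi>)"
    by (rule Ck_on_continuous[OF open_UNIV Ck_on_dir_deriv[OF assms(1)]])
  from hinge_integral_deriv_near_0[OF this bounded_dir_deriv_support[OF assms(2)]]
  show ?thesis
  proof (rule eventually_mono)
    fix s
    assume d: "(hinge_integral h (dir_deriv v \<phi>) has_vector_derivative sublevel_integral h (dir_deriv v \<phi>) s) (at s)"
    have "sublevel_integral h (\<lambda>x. dir_deriv v hc x * \<phi> x) = hinge_integral h (dir_deriv v \<phi>)"
      using hinge_integral_dir_deriv[OF smooth_on_Ck_on[OF smooth_h] assms] by (simp add: fun_eq_iff)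
    with d show "pushforward h (\<lambda>x. dir_deriv v hc x * \<phi> x) s = sublevel_integral h (dir_deriv v \<phi>) s"
      by (simp add: pushforward_eq vderiv_def vector_derivative_at)
  qed
qed

text \<open>The chain rule for \<delta>^(j)(h): its derivative in direction \<open>v\<close> is
  \<delta>^(j+1)(h) times the derivative of \<open>h\<close>. The minus sign comes from
  transposition.\<close>

lemma delta_deriv_dir_deriv:
  assumes "test_function \<phi>"
  shows "delta_deriv h (Suc j) (\<lambda>x. dir_deriv v hc x * \<phi> x) = - delta_deriv h j (dir_deriv v \<phi>)"
proof -
  have "eventually (\<lambda>s. vderiv (pushforward h (\<lambda>x. dir_deriv v hc x * \<phi> x)) s =
      pushforward h (dir_deriv v \<phi>) s) (nhds 0)"
    unfolding pushforward_eq[of h "dir_deriv v \<phi>"]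
    by (rule eventually_vderiv_cong[OF pushforward_dir_deriv
        [OF smooth_on_Ck_on[OF test_function_smooth[OF assms]] test_bounded[OF assms]]])
  from eventually_nhds_x_imp_x[OF eventually_vderiv_funpow_cong[OF this, of j]]
  show ?thesis by (simp add: delta_deriv_eq funpow_swap1)
qed

end

section \<open>The classical Bochner-Martinelli formula\<close>

lemma has_real_derivative_splice:
  fixes f g :: "real \<Rightarrow> real"
  assumes f: "(f has_real_derivative d) (at s)" and g: "(g has_real_derivative d) (at s)" and "f s = g s"
  shows "((\<lambda>t. if t < s then f t else g t) has_real_derivative d) (at s)"
  unfolding has_field_derivative_def has_derivative_at_alt
proof (intro conjI allI impI)
  show "bounded_linear (\<lambda>x. d * x)" by (rule bounded_linear_mult_right)
  fix e :: real assume e: "e > 0"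
  obtain p where p: "p > 0" "\<forall>t. norm (t - s) < p \<longrightarrow> norm (f t - f s - d * (t - s)) \<le> e * norm (t - s)"
    using f e unfolding has_field_derivative_def has_derivative_at_alt by blast
  obtain q where q: "q > 0" "\<forall>t. norm (t - s) < q \<longrightarrow> norm (g t - g s - d * (t - s)) \<le> e * norm (t - s)"
    using g e unfolding has_field_derivative_def has_derivative_at_alt by blast
  show "\<exists>r>0. \<forall>t. norm (t - s) < r \<longrightarrow>
      norm ((if t < s then f t else g t) - (if s < s then f s else g s) - d * (t - s)) \<le> e * norm (t - s)"
  proof (rule exI[of _ "min p q"], intro conjI allI impI)
    show "0 < min p q" using p(1) q(1) by simp
    fix t assume t: "norm (t - s) < min p q"
    show "norm ((if t < s then f t else g t) - (if s < s then f s else g s) - d * (t - s)) \<le> e * norm (t - s)"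
      using p(2)[rule_format, of t] q(2)[rule_format, of t] t assms(3) by auto
  qed
qed

text \<open>The first branch is the tangent of \<open>t\<^sup>-\<^sup>m\<close> at \<open>s\<close>, so that the function is continuously differentiable.\<close>

definition reg_kernel :: "nat \<Rightarrow> real \<Rightarrow> real \<Rightarrow> real" where
  "reg_kernel m s t = (if t < s then inverse s ^ m - real m * inverse s ^ Suc m * (t - s) else inverse t ^ m)"

definition reg_kernel' :: "nat \<Rightarrow> real \<Rightarrow> real \<Rightarrow> real" where
  "reg_kernel' m s t = - (real m * inverse (max s t) ^ Suc m)"

lemma inverse_power_has_derivative:
  assumes "t > 0"
  shows "((\<lambda>t::real. inverse t ^ m) has_real_derivative - (real m * inverse t ^ Suc m)) (at t)"
proof -
  have i: "(inverse has_real_derivative - (inverse t * inverse t)) (at t)"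
    using DERIV_inverse[of t UNIV] assms by (simp add: power2_eq_square)
  have "m * (- (inverse t * inverse t) * inverse t ^ (m - Suc 0)) = - (real m * inverse t ^ Suc m)"
    by (cases m) (simp_all only: diff_Suc_1 power_Suc of_nat_0 mult_zero_left, simp)
  with DERIV_power[OF i, of m] show ?thesis by (simp only:)
qed

lemma reg_kernel_has_derivative:
  assumes "s > 0"
  shows "(reg_kernel m s has_real_derivative reg_kernel' m s t) (at t)"
proof -
  let ?f = "\<lambda>t. inverse s ^ m - real m * inverse s ^ Suc m * (t - s)" and ?g = "\<lambda>t::real. inverse t ^ m"
  have f: "(?f has_real_derivative - (real m * inverse s ^ Suc m)) (at t)" for t
    by (auto intro!: derivative_eq_intros)
  have eq: "reg_kernel m s = (\<lambda>t. if t < s then ?f t else ?g t)"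
    by (simp add: reg_kernel_def fun_eq_iff)
  consider "t < s" | "t = s" | "t > s" by linarith
  then show ?thesis
  proof cases
    case 1
    have "(?f has_real_derivative reg_kernel' m s t) (at t)"
      using f[of t] 1 by (simp add: reg_kernel'_def max_def)
    then show ?thesis
      by (rule has_field_derivative_transform_within_open[where S = "{..<s}"])
        (use 1 in \<open>auto simp: reg_kernel_def\<close>)
  next
    case 2
    have "((\<lambda>t. if t < s then ?f t else ?g t) has_real_derivative - (real m * inverse s ^ Suc m)) (at s)"
      by (rule has_real_derivative_splice[OF f inverse_power_has_derivative[OF assms]]) simp
    then show ?thesis unfolding eq using 2 by (simp add: reg_kernel'_def)
  next
    case 3
    have "(?g has_real_derivative reg_kernel' m s t) (at t)"
      using inverse_power_has_derivative[of t m] 3 assms by (simp add: reg_kernel'_def max_def)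
    then show ?thesis
      by (rule has_field_derivative_transform_within_open[where S = "{s<..}"])
        (use 3 in \<open>auto simp: reg_kernel_def\<close>)
  qed
qed

lemma Ck_on_reg_kernel:
  assumes "s > 0"
  shows "Ck_on (Suc 0) UNIV (\<lambda>t. complex_of_real (reg_kernel m s t))"
proof (rule Ck_on_has_real_derivative[OF open_UNIV reg_kernel_has_derivative[OF assms]])
  have "continuous_on UNIV (\<lambda>t. max s t)" by (intro continuous_intros)
  moreover have "max s t \<noteq> 0" for t using assms by (simp add: max_def)
  ultimately have "continuous_on UNIV (reg_kernel' m s)"
    unfolding reg_kernel'_def[abs_def] by (intro continuous_intros) auto
  then show "Ck_on 0 UNIV (\<lambda>t. complex_of_real (reg_kernel' m s t))"
    by (simp add: continuous_on_of_real)
qed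

text \<open>For \<open>t \<ge> s\<close> homogeneity of degree -m gives 0. For \<open>t < s\<close>
  the left-hand side is affine in \<open>t\<close> and vanishes at \<open>t = s\<close>, hence it is
  a multiple of the hinge. This is why the tangent is the right continuation.\<close>

lemma reg_kernel_euler:
  assumes "s > 0"
  shows "real m * reg_kernel m s t + t * reg_kernel' m s t =
    real m * real (Suc m) * inverse s ^ Suc m * max 0 (s - t)"
proof (cases "t < s")
  case True
  have "inverse s ^ m = inverse s ^ Suc m * s" using assms by simp
  then have "real m * reg_kernel m s t + t * reg_kernel' m s t =
      real m * (inverse s ^ Suc m * s - real m * inverse s ^ Suc m * (t - s)) - t * (real m * inverse s ^ Suc m)"
    using True by (simp only: reg_kernel_def reg_kernel'_def if_True max.absorb1[OF less_imp_le[OF True]] mult_minus_right diff_conv_add_uminus)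
  also have "\<dots> = real m * real (Suc m) * inverse s ^ Suc m * (s - t)"
    by (simp only: of_nat_Suc) algebra
  finally show ?thesis using True by simp
next
  case False
  then have "t > 0" using assms by simp
  then have "t * inverse t ^ Suc m = inverse t ^ m" by simp
  then have z: "real m * inverse t ^ m + t * - (real m * inverse t ^ Suc m) = 0"
    by (simp only: mult_minus_right mult.left_commute[of t] add.right_inverse)
  have "max s t = t" "max 0 (s - t) = 0" using False by auto
  then show ?thesis
    using z False by (simp only: reg_kernel_def reg_kernel'_def if_False mult_zero_right)
qed

lemma sq_dist_has_derivative:
  "((\<lambda>x. (dist x y)\<^sup>2) has_derivative (\<lambda>v. 2 * inner (x - y) v)) (at (x :: 'a::euclidean_space))"
proof -
  have "((\<lambda>x. inner (x - y) (x - y)) has_derivative (\<lambda>v. inner (x - y) v + inner v (x - y))) (at x)"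
    by (auto intro!: derivative_eq_intros)
  moreover have "(\<lambda>v. inner (x - y) v + inner v (x - y)) = (\<lambda>v. 2 * inner (x - y) v)"
    by (simp add: inner_commute)
  ultimately show ?thesis by (simp add: dist_norm power2_norm_eq_inner)
qed

lemma dir_deriv_sq_dist:
  "dir_deriv v (\<lambda>x. complex_of_real ((dist x y)\<^sup>2)) x = complex_of_real (2 * inner (x - y) v)"
  by (rule dir_deriv_eqI[OF has_derivative_of_real[OF sq_dist_has_derivative]])

lemma dir_deriv_of_real_compose:
  assumes "(u has_real_derivative u') (at (h x))" "(\<lambda>x. complex_of_real (h x)) differentiable (at x)"
  shows "dir_deriv v (\<lambda>x. complex_of_real (u (h x))) x =
    complex_of_real u' * dir_deriv v (\<lambda>x. complex_of_real (h x)) x"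
proof -
  have h: "(h has_derivative (\<lambda>v. Re (dir_deriv v (\<lambda>x. complex_of_real (h x)) x))) (at x)"
    using has_derivative_Re[OF has_derivative_dir_deriv[OF assms(2)]] by simp
  have re: "complex_of_real (Re (dir_deriv v (\<lambda>x. complex_of_real (h x)) x)) = dir_deriv v (\<lambda>x. complex_of_real (h x)) x"
    using dir_deriv_eqI[OF has_derivative_of_real[OF h, where 'a = complex], of v] by simp
  from dir_deriv_eqI[OF has_derivative_of_real[OF has_derivative_compose[OF h
        has_field_derivative_imp_has_derivative[OF assms(1)]], where 'a = complex], of v]
  show ?thesis by (simp only: of_real_mult re)
qed

lemma ball_sq_dist: "r > 0 \<Longrightarrow> (dist x y)\<^sup>2 < r\<^sup>2 \<longleftrightarrow> x \<in> ball y r"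
  by (auto simp: dist_commute power_strict_mono intro: power_less_imp_less_base)

text \<open>Divergence theorem for the field \<open>x - y\<close>.\<close>

lemma hinge_integral_sq_dist:
  fixes y :: "'a::euclidean_space"
  assumes \<psi>: "test_function \<psi>" and V: "open V" "ball y r \<subseteq> V" "\<forall>x\<in>V. \<psi> x = 1" and r: "r > 0"
  shows "of_nat (DIM('a) + 2) * hinge_integral (\<lambda>x. (dist x y)\<^sup>2) \<psi> (r\<^sup>2) =
    complex_of_real (2 * r\<^sup>2 * measure lborel (ball y r))"
proof -
  let ?h = "\<lambda>x. (dist x y)\<^sup>2"
  let ?hc = "\<lambda>x. complex_of_real (?h x)"
  have sm: "smooth_on UNIV ?hc" by (rule smooth_on_sq_dist[OF open_UNIV])
  have ch: "continuous_on UNIV ?h"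
    by (rule continuous_on_of_real_cancel[OF smooth_on_continuous[OF open_UNIV sm]])
  define F where "F b x = (complex_of_real (inner x b) - of_real (inner y b)) * \<psi> x" for b x
  have tF: "test_function (F b)" for b
    unfolding F_def
    by (intro test_function_mult_smooth[OF _ \<psi>] smooth_on_diff smooth_on_inner smooth_on_const open_UNIV)
  have cont: "continuous_on UNIV \<phi>" "bounded {x. \<phi> x \<noteq> 0}" if "test_function \<phi>" for \<phi> :: "'a \<Rightarrow> complex"
    using smooth_on_continuous[OF open_UNIV test_function_smooth[OF that]]
      bounded_subset[OF compact_imp_bounded[OF test_function_compact[OF that]] closure_subset] by blast+
  have int: "integrable lborel \<phi>" if "test_function \<phi>" for \<phi> :: "'a \<Rightarrow> complex"
    by (rule integrable_bounded_support[OF cont[OF that]])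
  have dF: "dir_deriv b (F b) x = 1" if "b \<in> Basis" "x \<in> V" for b x
  proof -
    have "dir_deriv b (F b) x = dir_deriv b (\<lambda>x. complex_of_real (inner x b) - of_real (inner y b)) x"
      by (rule dir_deriv_cong[OF V(1) that(2)]) (simp add: F_def V(3))
    also have "\<dots> = complex_of_real (inner b b)"
      by (rule dir_deriv_eqI[of _ "\<lambda>v. complex_of_real (inner v b)"]) (auto intro!: derivative_eq_intros)
    finally show ?thesis using that(1) by simp
  qed
  have ball: "?h x < r\<^sup>2 \<longleftrightarrow> x \<in> ball y r" for x by (rule ball_sq_dist[OF r])
  let ?J = "hinge_integral ?h \<psi> (r\<^sup>2)" and ?S = "sublevel_integral ?h \<psi> (r\<^sup>2)"
  let ?R = "sublevel_integral ?h (\<lambda>x. ?hc x * \<psi> x) (r\<^sup>2)"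
  have J1: "?J = hinge_integral ?h (dir_deriv b (F b)) (r\<^sup>2)" if "b \<in> Basis" for b
    unfolding hinge_integral_def
  proof (rule Bochner_Integration.integral_cong[OF refl])
    fix x
    show "complex_of_real (max 0 (r\<^sup>2 - ?h x)) * \<psi> x = complex_of_real (max 0 (r\<^sup>2 - ?h x)) * dir_deriv b (F b) x"
    proof (cases "?h x < r\<^sup>2")
      case True
      then have "x \<in> V" using ball V(2) by blast
      then show ?thesis using dF[OF that] V(3) by simp
    qed simp
  qed
  have J2: "hinge_integral ?h (dir_deriv b (F b)) (r\<^sup>2) = sublevel_integral ?h (\<lambda>x. dir_deriv b ?hc x * F b x) (r\<^sup>2)" for b
    by (rule hinge_integral_dir_deriv[OF smooth_on_Ck_on[OF sm]
        smooth_on_Ck_on[OF test_function_smooth[OF tF]] cont(2)[OF tF]])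
  have tdF: "test_function (\<lambda>x. dir_deriv b ?hc x * F b x)" for b
    by (rule test_function_mult_smooth[OF smooth_on_dir_deriv[OF sm] tF])
  have "of_nat DIM('a) * ?J = (\<Sum>b\<in>(Basis::'a set). ?J)" by simp
  also have "\<dots> = (\<Sum>b\<in>Basis. sublevel_integral ?h (\<lambda>x. dir_deriv b ?hc x * F b x) (r\<^sup>2))"
    by (rule sum.cong[OF refl]) (simp only: J1 J2)
  also have "\<dots> = sublevel_integral ?h (\<lambda>x. \<Sum>b\<in>Basis. dir_deriv b ?hc x * F b x) (r\<^sup>2)"
    by (rule sublevel_integral_sum[OF ch int[OF tdF], symmetric])
  also have "(\<lambda>x. \<Sum>b\<in>Basis. dir_deriv b ?hc x * F b x) = (\<lambda>x. 2 * (?hc x * \<psi> x))"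
  proof
    fix x
    have "(\<Sum>b\<in>Basis. dir_deriv b ?hc x * F b x) =
        (\<Sum>b\<in>Basis. 2 * (complex_of_real (inner (x - y) b * inner (x - y) b) * \<psi> x))"
      unfolding dir_deriv_sq_dist F_def by (rule sum.cong[OF refl]) (simp add: inner_diff_left)
    also have "\<dots> = 2 * (complex_of_real (\<Sum>b\<in>Basis. inner (x - y) b * inner (x - y) b) * \<psi> x)"
      by (simp only: sum_distrib_left[symmetric] sum_distrib_right[symmetric] of_real_sum)
    also have "(\<Sum>b\<in>Basis. inner (x - y) b * inner (x - y) b) = ?h x"
      unfolding dist_norm power2_norm_eq_inner by (rule euclidean_inner[symmetric])
    finally show "(\<Sum>b\<in>Basis. dir_deriv b ?hc x * F b x) = 2 * (?hc x * \<psi> x)" .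
  qed
  finally have A: "of_nat DIM('a) * ?J = 2 * ?R" by (simp only: sublevel_integral_cmult)
  have tR: "test_function (\<lambda>x. ?hc x * \<psi> x)" by (rule test_function_mult_smooth[OF sm \<psi>])
  \<comment> \<open>On the ball the hinge is the squared radius minus the squared distance. Combined
    with \<open>A\<close>, this eliminates the second moment \<open>?R\<close> and leaves the
    volume.\<close>
  have "complex_of_real (r\<^sup>2) * ?S = ?J + ?R"
  proof -
    have "?J = sublevel_integral ?h (\<lambda>x. complex_of_real (r\<^sup>2) * \<psi> x + (- 1) * (?hc x * \<psi> x)) (r\<^sup>2)"
      unfolding hinge_integral_def sublevel_integral_def set_lebesgue_integral_def
    proof (rule Bochner_Integration.integral_cong[OF refl])
      fix x
      show "complex_of_real (max 0 (r\<^sup>2 - ?h x)) * \<psi> x =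
          indicat_real {x. ?h x < r\<^sup>2} x *\<^sub>R (complex_of_real (r\<^sup>2) * \<psi> x + (- 1) * (?hc x * \<psi> x))"
        by (cases "?h x < r\<^sup>2") (simp_all add: algebra_simps)
    qed
    also have "\<dots> = complex_of_real (r\<^sup>2) * ?S + (- 1) * ?R"
      using sublevel_integral_add[OF ch int[OF test_function_cmult[OF \<psi>]] int[OF test_function_cmult[OF tR]],
          of "complex_of_real (r\<^sup>2)" "- 1" "r\<^sup>2"]
      by (simp only: sublevel_integral_cmult)
    finally show ?thesis by simp
  qed
  moreover have "?S = complex_of_real (measure lborel (ball y r))"
  proof -
    have "?S = (LINT x|lborel. complex_of_real (indicat_real (ball y r) x))"
      unfolding sublevel_integral_def set_lebesgue_integral_def
    proof (rule Bochner_Integration.integral_cong[OF refl])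
      fix x
      show "indicat_real {x. ?h x < r\<^sup>2} x *\<^sub>R \<psi> x = complex_of_real (indicat_real (ball y r) x)"
      proof (cases "x \<in> ball y r")
        case True
        then have "\<psi> x = 1" using V(2,3) by blast
        then show ?thesis using True ball[of x] by (simp only: indicator_def mem_Collect_eq) simp
      next
        case False
        then show ?thesis using ball[of x] by (simp only: indicator_def mem_Collect_eq) simp
      qed
    qed
    also have "\<dots> = complex_of_real (LINT x|lborel. indicat_real (ball y r) x)" by simp
    also have "(LINT x|lborel. indicat_real (ball y r) x) = measure lborel (ball y r)" by simp
    finally show ?thesis .
  qed
  ultimately show ?thesis using A by (simp add: algebra_simps)
qed

subsection \<open>Coordinates of complex space\<close>

definition dzc_scalar :: "'m::finite \<Rightarrow> (real ^ ('m + 'm) \<Rightarrow> complex) \<Rightarrow> real ^ ('m + 'm) \<Rightarrow> complex" where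
  "dzc_scalar j f x = 1 / 2 * (dir_deriv (axis (Inl j) 1) f x + \<i> * dir_deriv (axis (Inr j) 1) f x)"

definition zdiff_cnj :: "real ^ ('m::finite + 'm) \<Rightarrow> 'm \<Rightarrow> real ^ ('m + 'm) \<Rightarrow> complex" where
  "zdiff_cnj y j x = cnj (zvar x j - zvar y j)"

lemma dzc_scalar_mult:
  "f differentiable (at x) \<Longrightarrow> g differentiable (at x) \<Longrightarrow>
    dzc_scalar j (\<lambda>x. f x * g x) x = f x * dzc_scalar j g x + dzc_scalar j f x * g x"
  by (simp add: dzc_scalar_def dir_deriv_mult algebra_simps)

lemma zdiff_cnj_eq:
  "zdiff_cnj y j x = of_real (inner x (axis (Inl j) 1)) - \<i> * of_real (inner x (axis (Inr j) 1)) - cnj (zvar y j)"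
  by (simp add: zdiff_cnj_def zvar_def inner_axis complex_eq_iff)

lemma smooth_zdiff_cnj: "open S \<Longrightarrow> smooth_on S (zdiff_cnj y j)"
  unfolding zdiff_cnj_eq[abs_def]
  by (intro smooth_on_diff smooth_on_mult smooth_on_inner smooth_on_const)

lemma dir_deriv_zdiff_cnj:
  "dir_deriv v (zdiff_cnj y j) x = of_real (inner v (axis (Inl j) 1)) - \<i> * of_real (inner v (axis (Inr j) 1))"
proof -
  have "(zdiff_cnj y j has_derivative (\<lambda>v. of_real (inner v (axis (Inl j) 1)) - \<i> * of_real (inner v (axis (Inr j) 1)))) (at x)"
    unfolding zdiff_cnj_eq[abs_def] by (auto intro!: derivative_eq_intros)
  from dir_deriv_eqI[OF this] show ?thesis .
qed

lemma dzc_zdiff_cnj: "dzc_scalar k (zdiff_cnj y j) x = (if j = k then 1 else 0)"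
  by (simp add: dzc_scalar_def dir_deriv_zdiff_cnj inner_axis_axis)

lemma dzc_sq_dist: "dzc_scalar j (\<lambda>x. complex_of_real ((dist x y)\<^sup>2)) x = zvar x j - zvar y j"
  unfolding dzc_scalar_def dir_deriv_sq_dist
  by (simp add: inner_axis zvar_def complex_eq_iff)

lemma sum_zdiff_sq:
  fixes x y :: "real ^ ('m::finite + 'm)"
  shows "(\<Sum>j\<in>UNIV. (zvar x j - zvar y j) * zdiff_cnj y j x) = complex_of_real ((dist x y)\<^sup>2)"
proof -
  have U: "(UNIV :: ('m + 'm) set) = range Inl \<union> range Inr" by (rule UNIV_sum)
  have "(dist x y)\<^sup>2 = (\<Sum>i\<in>UNIV. ((x - y) $ i)\<^sup>2)"
    unfolding dist_norm power2_norm_eq_inner inner_vec_def by (simp add: power2_eq_square)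
  also have "\<dots> = (\<Sum>i\<in>range Inl. ((x - y) $ i)\<^sup>2) + (\<Sum>i\<in>range Inr. ((x - y) $ i)\<^sup>2)"
    unfolding U by (rule sum.union_disjoint) auto
  also have "\<dots> = (\<Sum>j\<in>UNIV. ((x - y) $ Inl j)\<^sup>2) + (\<Sum>j\<in>UNIV. ((x - y) $ Inr j)\<^sup>2)"
    by (simp add: sum.reindex)
  also have "\<dots> = (\<Sum>j\<in>UNIV. ((x - y) $ Inl j)\<^sup>2 + ((x - y) $ Inr j)\<^sup>2)"
    by (rule sum.distrib[symmetric])
  finally have "complex_of_real ((dist x y)\<^sup>2) =
      (\<Sum>j\<in>UNIV. complex_of_real (((x - y) $ Inl j)\<^sup>2 + ((x - y) $ Inr j)\<^sup>2))"
    by (simp only: of_real_sum)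
  also have "\<dots> = (\<Sum>j\<in>UNIV. (zvar x j - zvar y j) * zdiff_cnj y j x)"
    by (rule sum.cong[OF refl])
      (simp add: zdiff_cnj_def zvar_def complex_eq_iff power2_eq_square algebra_simps)
  finally show ?thesis ..
qed

lemma DIM_real_space: "DIM(real ^ ('m::finite + 'm)) = 2 * CARD('m)"
  by simp

lemma measure_ball_real_space:
  fixes y :: "real ^ ('m::finite + 'm)"
  assumes "r \<ge> 0"
  shows "measure lborel (ball y r) = pi ^ CARD('m) / fact CARD('m) * (r\<^sup>2) ^ CARD('m)"
proof -
  have "measure lborel (ball y r) = unit_ball_vol (real DIM(real ^ ('m + 'm))) * r ^ DIM(real ^ ('m + 'm))"
    by (rule content_ball[OF assms])
  then show ?thesis
    unfolding DIM_real_space unit_ball_vol_even by (simp only: power_mult)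
qed

section \<open>The formula on a regular sublevel set of complex space\<close>

locale complex_level = regular_level h for h :: "real ^ ('m::finite + 'm) \<Rightarrow> real" +
  fixes \<Omega> :: "(real ^ ('m + 'm)) set" and y :: "real ^ ('m + 'm)"
  assumes open_\<Omega>: "open \<Omega>" and compact_sublevel: "compact {x. h x \<le> 0}"
    and sublevel_\<Omega>: "{x. h x \<le> 0} \<subseteq> \<Omega>" and inside: "h y < 0"
begin

lemma small_ball: obtains e where "e > 0" "cball y e \<subseteq> {x. h x < 0}"
proof -
  have "open {x. h x < 0}" by (intro open_Collect_less continuous_h continuous_on_const)
  then show ?thesis using inside that open_contains_cball by (metis mem_Collect_eq)
qed

text \<open>The field with the regularised kernel has divergence \<open>0\<close> outside the ball of radius \<open>r\<close>.\<close>

lemma kernel_regularised: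
  fixes f \<phi> \<psi> :: "real ^ ('m + 'm) \<Rightarrow> complex"
  assumes f: "smooth_on \<Omega> f" "\<forall>x\<in>\<Omega>. \<forall>j. dzc_scalar j f x = 0"
    and \<psi>: "test_function \<psi>" "closure {x. \<psi> x \<noteq> 0} \<subseteq> \<Omega>" "open V" "{x. h x \<le> 0} \<subseteq> V" "\<forall>x\<in>V. \<psi> x = 1"
    and \<phi>: "test_function \<phi>" "open W" "{x. h x = 0} \<subseteq> W"
      "\<forall>x\<in>W. \<phi> x = (\<Sum>j\<in>UNIV. zdiff_cnj y j x * dzc_scalar j hc x) *
        of_real (inverse ((dist x y)\<^sup>2) ^ CARD('m)) * f x"
    and r: "r > 0" "cball y r \<subseteq> {x. h x < 0}"
  shows "delta_deriv h 0 \<phi> = of_real (real CARD('m) * real (Suc CARD('m)) * inverse (r\<^sup>2) ^ Suc CARD('m)) *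
    hinge_integral (\<lambda>x. (dist x y)\<^sup>2) (\<lambda>x. \<psi> x * f x) (r\<^sup>2)"
proof -
  let ?m = "CARD('m)"
  let ?d = "\<lambda>x. (dist x y)\<^sup>2"
  let ?dc = "\<lambda>x. complex_of_real (?d x)"
  let ?L = "\<lambda>j::'m. axis (Inl j) (1::real) :: real ^ ('m + 'm)" and ?R = "\<lambda>j::'m. axis (Inr j) (1::real) :: real ^ ('m + 'm)"
  have r2: "r\<^sup>2 > 0" using r(1) by simp
  define E where "E x = complex_of_real (reg_kernel ?m (r\<^sup>2) (?d x))" for x
  define A where "A j x = zdiff_cnj y j x * (\<psi> x * f x)" for j x
  define P where "P j x = E x * A j x" for j x
  have sd: "smooth_on UNIV ?dc" by (rule smooth_on_sq_dist[OF open_UNIV])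
  have CE: "Ck_on (Suc 0) UNIV E"
    unfolding E_def
    by (rule Ck_on_compose[OF open_UNIV open_UNIV _ smooth_on_Ck_on[OF sd] Ck_on_reg_kernel[OF r2]]) simp
  have tf: "test_function (\<lambda>x. \<psi> x * f x)"
    by (rule test_function_mult_local[OF open_\<Omega> f(1) \<psi>(1,2)])
  have tA: "test_function (A j)" for j
    unfolding A_def by (rule test_function_mult_smooth[OF smooth_zdiff_cnj[OF open_UNIV] tf])
  have CP: "Ck_on (Suc 0) UNIV (P j)" for j
    unfolding P_def
    by (rule Ck_on_mult[OF open_UNIV CE smooth_on_Ck_on[OF test_function_smooth[OF tA]]])
  have bP: "bounded {x. P j x \<noteq> 0}" for j
    unfolding P_def by (rule bounded_mult_support[OF test_bounded[OF tA]])
  \<comment> \<open>\<open>B\<close> pairs the field \<open>P\<close> with the conjugate derivatives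
    of \<open>h\<close>, and \<open>G\<close> is the divergence of \<open>P\<close> in the conjugate
    variables. Integration by parts relates the two.\<close>
  define B where "B x = (\<Sum>j\<in>UNIV. dzc_scalar j hc x * P j x)" for x
  define G where "G x = (\<Sum>j\<in>UNIV. dzc_scalar j (P j) x)" for x
  have cdP: "continuous_on UNIV (dir_deriv v (P j))" for v j
    by (rule Ck_on_continuous[OF open_UNIV Ck_on_dir_deriv[OF CP]])
  have bdP: "bounded {x. dir_deriv v (P j) x \<noteq> 0}" for v j
    by (rule bounded_dir_deriv_support[OF bP])
  have cP: "continuous_on UNIV (P j)" for j by (rule Ck_on_continuous[OF open_UNIV CP])
  have cdh: "continuous_on UNIV (dir_deriv v hc)" for v
    by (rule smooth_on_continuous[OF open_UNIV smooth_on_dir_deriv[OF smooth_h]])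
  have B_eq: "B = (\<lambda>x. \<Sum>j\<in>UNIV. 1 / 2 * (dir_deriv (?L j) hc x * P j x) + \<i> / 2 * (dir_deriv (?R j) hc x * P j x))"
    unfolding B_def dzc_scalar_def by (simp add: algebra_simps)
  have G_eq: "G = (\<lambda>x. \<Sum>j\<in>UNIV. 1 / 2 * dir_deriv (?L j) (P j) x + \<i> / 2 * dir_deriv (?R j) (P j) x)"
    unfolding G_def dzc_scalar_def by (simp add: algebra_simps)
  have bsum: "bounded {x. (\<Sum>j\<in>UNIV. 1 / 2 * p j x + \<i> / 2 * q j x) \<noteq> 0}"
    if "\<And>j. bounded {x. p j x \<noteq> 0}" "\<And>j. bounded {x. q j x \<noteq> 0}" for p q :: "'m \<Rightarrow> real ^ ('m + 'm) \<Rightarrow> complex"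
  proof (rule bounded_subset)
    show "bounded (\<Union>j\<in>UNIV. {x. p j x \<noteq> 0} \<union> {x. q j x \<noteq> 0})"
      using that by (intro bounded_UN) auto
    show "{x. (\<Sum>j\<in>UNIV. 1 / 2 * p j x + \<i> / 2 * q j x) \<noteq> 0} \<subseteq> (\<Union>j\<in>UNIV. {x. p j x \<noteq> 0} \<union> {x. q j x \<noteq> 0})"
    proof
      fix x assume "x \<in> {x. (\<Sum>j\<in>UNIV. 1 / 2 * p j x + \<i> / 2 * q j x) \<noteq> 0}"
      then obtain j where "1 / 2 * p j x + \<i> / 2 * q j x \<noteq> 0"
        by (metis (mono_tags, lifting) mem_Collect_eq sum.neutral)
      then have "p j x \<noteq> 0 \<or> q j x \<noteq> 0" by auto
      then show "x \<in> (\<Union>j\<in>UNIV. {x. p j x \<noteq> 0} \<union> {x. q j x \<noteq> 0})" by blast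
    qed
  qed
  have cB: "continuous_on UNIV B"
    unfolding B_eq by (intro continuous_on_sum continuous_on_add continuous_on_mult continuous_on_const cdh cP)
  have bB: "bounded {x. B x \<noteq> 0}"
    unfolding B_eq by (rule bsum) (rule bounded_mult_support[OF bP])+
  have cG: "continuous_on UNIV G"
    unfolding G_eq by (intro continuous_on_sum continuous_on_add continuous_on_mult continuous_on_const cdP)
  have bG: "bounded {x. G x \<noteq> 0}" unfolding G_eq by (rule bsum) (rule bdP)+
  have int_h: "integrable lborel (\<lambda>x. dir_deriv v hc x * P j x)" for v j
    by (intro integrable_bounded_support continuous_on_mult cdh cP bounded_mult_support bP)
  have int_c: "integrable lborel (\<lambda>x. c * (dir_deriv v hc x * P j x))" for c v j
    by (rule integrable_mult_right) (rule int_h)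
  have SB: "sublevel_integral h B s = hinge_integral h G s" for s
  proof -
    have one: "sublevel_integral h (\<lambda>x. dir_deriv v hc x * P j x) s = hinge_integral h (dir_deriv v (P j)) s" for v j
      by (rule hinge_integral_dir_deriv[OF smooth_on_Ck_on[OF smooth_h] CP bP, symmetric])
    have "sublevel_integral h B s = (\<Sum>j\<in>UNIV. sublevel_integral h
        (\<lambda>x. 1 / 2 * (dir_deriv (?L j) hc x * P j x) + \<i> / 2 * (dir_deriv (?R j) hc x * P j x)) s)"
      unfolding B_eq
      by (rule sublevel_integral_sum[OF continuous_h]) (intro Bochner_Integration.integrable_add int_c)
    also have "\<dots> = (\<Sum>j\<in>UNIV. 1 / 2 * hinge_integral h (dir_deriv (?L j) (P j)) s +
        \<i> / 2 * hinge_integral h (dir_deriv (?R j) (P j)) s)"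
      unfolding sublevel_integral_add[OF continuous_h int_c int_c] sublevel_integral_cmult one ..
    also have "\<dots> = (\<Sum>j\<in>UNIV. hinge_integral h (\<lambda>x. 1 / 2 * dir_deriv (?L j) (P j) x + \<i> / 2 * dir_deriv (?R j) (P j) x) s)"
    proof (rule sum.cong[OF refl])
      fix j
      let ?M = "\<lambda>x. complex_of_real (max 0 (s - h x))"
      have iL: "integrable lborel (\<lambda>x. ?M x * dir_deriv v (P j) x)" for v
        by (rule integrable_hinge[OF continuous_h cdP bdP])
      have "(\<lambda>x. ?M x * (1 / 2 * dir_deriv (?L j) (P j) x + \<i> / 2 * dir_deriv (?R j) (P j) x)) =
          (\<lambda>x. 1 / 2 * (?M x * dir_deriv (?L j) (P j) x) + \<i> / 2 * (?M x * dir_deriv (?R j) (P j) x))"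
        by (simp add: algebra_simps)
      then have "hinge_integral h (\<lambda>x. 1 / 2 * dir_deriv (?L j) (P j) x + \<i> / 2 * dir_deriv (?R j) (P j) x) s =
          (LINT x|lborel. 1 / 2 * (?M x * dir_deriv (?L j) (P j) x) + \<i> / 2 * (?M x * dir_deriv (?R j) (P j) x))"
        unfolding hinge_integral_def by (simp only:)
      also have "\<dots> = (LINT x|lborel. 1 / 2 * (?M x * dir_deriv (?L j) (P j) x)) + (LINT x|lborel. \<i> / 2 * (?M x * dir_deriv (?R j) (P j) x))"
        by (rule Bochner_Integration.integral_add) (rule integrable_mult_right, rule iL)+
      finally show "1 / 2 * hinge_integral h (dir_deriv (?L j) (P j)) s + \<i> / 2 * hinge_integral h (dir_deriv (?R j) (P j)) s =
          hinge_integral h (\<lambda>x. 1 / 2 * dir_deriv (?L j) (P j) x + \<i> / 2 * dir_deriv (?R j) (P j) x) s"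
        unfolding hinge_integral_def by (simp only: integral_mult_right_zero)
    qed
    also have "\<dots> = hinge_integral h G s"
      unfolding G_eq
    proof (rule hinge_integral_sum[OF continuous_h, symmetric])
      fix j
      show "continuous_on UNIV (\<lambda>x. 1 / 2 * dir_deriv (?L j) (P j) x + \<i> / 2 * dir_deriv (?R j) (P j) x)"
        by (intro continuous_on_add continuous_on_mult continuous_on_const cdP)
      have "{x. 1 / 2 * dir_deriv (?L j) (P j) x + \<i> / 2 * dir_deriv (?R j) (P j) x \<noteq> 0} \<subseteq>
          {x. dir_deriv (?L j) (P j) x \<noteq> 0} \<union> {x. dir_deriv (?R j) (P j) x \<noteq> 0}" by auto
      then show "bounded {x. 1 / 2 * dir_deriv (?L j) (P j) x + \<i> / 2 * dir_deriv (?R j) (P j) x \<noteq> 0}"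
        by (rule bounded_subset[rotated]) (use bdP in simp)
    qed
    finally show ?thesis .
  qed
  have pB: "pushforward h B 0 = sublevel_integral h G 0"
  proof -
    have "sublevel_integral h B = hinge_integral h G" using SB by (rule ext)
    with eventually_nhds_x_imp_x[OF hinge_integral_deriv_near_0[OF cG bG]] show ?thesis
      by (simp add: pushforward_eq vderiv_def vector_derivative_at)
  qed
  have opd: "open {x. r < dist x y}" by (intro open_Collect_less continuous_intros)
  \<comment> \<open>The ball around \<open>y\<close> lies strictly inside the sublevel set, so near
    the level set the regularised kernel is the true one, and the pushforward at 0 sees only that
    neighbourhood.\<close>
  have "pushforward h \<phi> 0 = pushforward h B 0"
  proof (rule eventually_nhds_x_imp_x[OF pushforward_local])
    show "continuous_on UNIV \<phi>" "bounded {x. \<phi> x \<noteq> 0}" by (rule test_continuous[OF \<phi>(1)] test_bounded[OF \<phi>(1)])+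
    show "continuous_on UNIV B" "bounded {x. B x \<noteq> 0}" by (rule cB bB)+
    show "open (W \<inter> V \<inter> {x. r < dist x y})" by (intro open_Int \<phi>(2) \<psi>(3) opd)
    show "{x. h x = 0} \<subseteq> W \<inter> V \<inter> {x. r < dist x y}"
    proof
      fix x assume "x \<in> {x. h x = 0}"
      then have x: "h x = 0" by simp
      then have "x \<notin> cball y r" using r(2) by auto
      then show "x \<in> W \<inter> V \<inter> {x. r < dist x y}" using x \<phi>(3) \<psi>(4) by (auto simp: dist_commute)
    qed
    show "\<forall>x\<in>W \<inter> V \<inter> {x. r < dist x y}. \<phi> x = B x"
    proof
      fix x assume "x \<in> W \<inter> V \<inter> {x. r < dist x y}"
      then have x: "x \<in> W" "x \<in> V" "r < dist x y" by auto
      have "\<not> ?d x < r\<^sup>2" using x(3) r(1) by (simp add: power_mono not_less)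
      then have "E x = of_real (inverse (?d x) ^ ?m)" by (simp only: E_def reg_kernel_def if_False)
      then have "B x = (\<Sum>j\<in>UNIV. (zdiff_cnj y j x * dzc_scalar j hc x) * (of_real (inverse (?d x) ^ ?m) * f x))"
        unfolding B_def P_def A_def using \<psi>(5) x(2) by (simp add: mult_ac)
      also have "\<dots> = (\<Sum>j\<in>UNIV. zdiff_cnj y j x * dzc_scalar j hc x) * (of_real (inverse (?d x) ^ ?m) * f x)"
        by (rule sum_distrib_right[symmetric])
      finally show "\<phi> x = B x" using \<phi>(4) x(1) by (simp only: mult.assoc)
    qed
  qed
  then have "delta_deriv h 0 \<phi> = sublevel_integral h G 0" using pB by (simp add: delta_deriv_eq)
  also have "\<dots> = of_real (real ?m * real (Suc ?m) * inverse (r\<^sup>2) ^ Suc ?m) * hinge_integral ?d (\<lambda>x. \<psi> x * f x) (r\<^sup>2)"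
  proof -
    let ?c = "real ?m * real (Suc ?m) * inverse (r\<^sup>2) ^ Suc ?m"
    \<comment> \<open>\<open>f\<close> is holomorphic and \<psi> is 1 near \<open>x\<close>, so the
      derivatives fall on the conjugate coordinates and on the kernel. This gives the Euler
      expression of the kernel, times \<open>f\<close>.\<close>
    have Gx: "G x = of_real (?c * max 0 (r\<^sup>2 - ?d x)) * f x" if x: "h x < 0" for x
    proof -
      have op: "open (V \<inter> \<Omega>)" by (rule open_Int[OF \<psi>(3) open_\<Omega>])
      have xV: "x \<in> V \<inter> \<Omega>" using x \<psi>(4) sublevel_\<Omega> by auto
      have df: "f differentiable (at x)" using smooth_on_differentiable[OF f(1) open_\<Omega>] xV by blast
      have da: "zdiff_cnj y j differentiable (at x)" for j
        by (rule smooth_on_differentiable[OF smooth_zdiff_cnj[OF open_UNIV] open_UNIV UNIV_I])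
      have dE: "E differentiable (at x)" by (rule Ck_on_differentiable[OF CE open_UNIV UNIV_I])
      have dd: "?dc differentiable (at x)" by (rule smooth_on_differentiable[OF sd open_UNIV UNIV_I])
      have dzE: "dzc_scalar j E x = of_real (reg_kernel' ?m (r\<^sup>2) (?d x)) * (zvar x j - zvar y j)" for j
      proof -
        have "dir_deriv v E x = of_real (reg_kernel' ?m (r\<^sup>2) (?d x)) * dir_deriv v ?dc x" for v
          unfolding E_def by (rule dir_deriv_of_real_compose[OF reg_kernel_has_derivative[OF r2] dd])
        then have "dzc_scalar j E x = of_real (reg_kernel' ?m (r\<^sup>2) (?d x)) * dzc_scalar j ?dc x"
          by (simp add: dzc_scalar_def algebra_simps)
        then show ?thesis by (simp only: dzc_sq_dist)
      qed
      have "dzc_scalar j (P j) x = dzc_scalar j (\<lambda>x. E x * (zdiff_cnj y j x * f x)) x" for j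
      proof -
        have "dir_deriv v (P j) x = dir_deriv v (\<lambda>x. E x * (zdiff_cnj y j x * f x)) x" for v
          by (rule dir_deriv_cong[OF op xV]) (simp add: P_def A_def \<psi>(5))
        then show ?thesis by (simp add: dzc_scalar_def)
      qed
      moreover have "dzc_scalar j (\<lambda>x. E x * (zdiff_cnj y j x * f x)) x =
          E x * f x + of_real (reg_kernel' ?m (r\<^sup>2) (?d x)) * f x * ((zvar x j - zvar y j) * zdiff_cnj y j x)" for j
      proof -
        have "(\<lambda>x. zdiff_cnj y j x * f x) differentiable (at x)" by (rule differentiable_mult[OF da df])
        then have "dzc_scalar j (\<lambda>x. E x * (zdiff_cnj y j x * f x)) x =
            E x * (zdiff_cnj y j x * dzc_scalar j f x + dzc_scalar j (zdiff_cnj y j) x * f x) +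
            dzc_scalar j E x * (zdiff_cnj y j x * f x)"
          by (simp only: dzc_scalar_mult[OF dE] dzc_scalar_mult[OF da df])
        then show ?thesis using f(2) xV by (simp add: dzc_zdiff_cnj dzE mult_ac)
      qed
      ultimately have "G x = (\<Sum>j\<in>(UNIV::'m set). E x * f x) + of_real (reg_kernel' ?m (r\<^sup>2) (?d x)) * f x *
          (\<Sum>j\<in>UNIV. (zvar x j - zvar y j) * zdiff_cnj y j x)"
        unfolding G_def by (simp only: sum.distrib sum_distrib_left)
      also have "\<dots> = of_real (real ?m * reg_kernel ?m (r\<^sup>2) (?d x) + ?d x * reg_kernel' ?m (r\<^sup>2) (?d x)) * f x"
        unfolding sum_zdiff_sq E_def by (simp add: algebra_simps)
      finally show ?thesis by (simp only: reg_kernel_euler[OF r2])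
    qed
    have "sublevel_integral h G 0 = (LINT x|lborel. of_real ?c * (complex_of_real (max 0 (r\<^sup>2 - ?d x)) * (\<psi> x * f x)))"
      unfolding sublevel_integral_def set_lebesgue_integral_def
    proof (rule Bochner_Integration.integral_cong[OF refl])
      fix x
      show "indicat_real {x. h x < 0} x *\<^sub>R G x = of_real ?c * (complex_of_real (max 0 (r\<^sup>2 - ?d x)) * (\<psi> x * f x))"
      proof (cases "h x < 0")
        case True
        then have "x \<in> V" using \<psi>(4) by auto
        then have "\<psi> x = 1" using \<psi>(5) by blast
        then show ?thesis using Gx[OF True] True by simp
      next
        case False
        \<comment> \<open>Both sides vanish outside the sublevel set, because the ball that carries
          the hinge lies inside it.\<close>
        then have "x \<notin> ball y r" using r(2) ball_subset_cball by blast
        then have "max 0 (r\<^sup>2 - ?d x) = 0" using ball_sq_dist[OF r(1), of x y] by simp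
        then show ?thesis using False by simp
      qed
    qed
    then show ?thesis unfolding hinge_integral_def by (simp only: integral_mult_right_zero)
  qed
  finally show ?thesis .
qed

text \<open>For every small \<open>r\<close> the left-hand side is a weighted integral of
  \<open>f\<close> over the ball of radius \<open>r\<close> about \<open>y\<close>, with a
  nonnegative weight whose total does not depend on \<open>r\<close>. Continuity of \<open>f\<close>
  at \<open>y\<close> identifies the value.\<close>

theorem bochner_martinelli:
  fixes f \<phi> :: "real ^ ('m + 'm) \<Rightarrow> complex"
  assumes f: "smooth_on \<Omega> f" "\<forall>x\<in>\<Omega>. \<forall>j. dzc_scalar j f x = 0"
    and \<phi>: "test_function \<phi>" "open W" "{x. h x = 0} \<subseteq> W"
      "\<forall>x\<in>W. \<phi> x = (\<Sum>j\<in>UNIV. zdiff_cnj y j x * dzc_scalar j hc x) *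
        of_real (inverse ((dist x y)\<^sup>2) ^ CARD('m)) * f x"
  shows "delta_deriv h 0 \<phi> = of_real (pi ^ CARD('m) / fact (CARD('m) - 1)) * f y"
proof -
  let ?m = "CARD('m)"
  let ?d = "\<lambda>x. (dist x y)\<^sup>2"
  let ?C = "pi ^ ?m / fact (?m - 1)"
  obtain \<psi> V where \<psi>: "test_function \<psi>" "closure {x. \<psi> x \<noteq> 0} \<subseteq> \<Omega>" "open V" "{x. h x \<le> 0} \<subseteq> V"
      "\<And>x. x \<in> V \<Longrightarrow> \<psi> x = 1" "\<And>x. \<psi> x = complex_of_real (cmod (\<psi> x))"
    using exists_cutoff[OF compact_sublevel open_\<Omega> sublevel_\<Omega>] by metis
  have \<psi>1: "\<forall>x\<in>V. \<psi> x = 1" using \<psi>(5) by blast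
  obtain e where e: "e > 0" "cball y e \<subseteq> {x. h x < 0}" by (rule small_ball)
  have Cpos: "?C > 0" by simp
  have m1: "?m \<ge> 1" by (simp add: Suc_le_eq)
  have tf: "test_function (\<lambda>x. \<psi> x * f x)"
    by (rule test_function_mult_local[OF open_\<Omega> f(1) \<psi>(1,2)])
  have cd: "continuous_on UNIV ?d" by (intro continuous_intros)
  have est: "cmod (delta_deriv h 0 \<phi> - of_real ?C * f y) \<le> \<eta> * ?C" if \<eta>: "\<eta> > 0" for \<eta>
  proof -
    have y: "y \<in> \<Omega>" using inside sublevel_\<Omega> by auto
    have "isCont f y"
      using smooth_on_continuous[OF open_\<Omega> f(1)] open_\<Omega> y continuous_on_eq_continuous_at by blast
    then obtain p where p: "p > 0" "\<forall>x. dist x y < p \<longrightarrow> dist (f x) (f y) < \<eta>"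
      using \<eta> unfolding continuous_at_eps_delta by blast
    define r where "r = min e p"
    have r: "r > 0" "cball y r \<subseteq> {x. h x < 0}" using e p(1) by (auto simp: r_def)
    define c where "c = real ?m * real (Suc ?m) * inverse (r\<^sup>2) ^ Suc ?m"
    have c0: "c \<ge> 0" by (simp add: c_def)
    have ball: "?d x < r\<^sup>2 \<longleftrightarrow> x \<in> ball y r" for x by (rule ball_sq_dist[OF r(1)])
    have bV: "ball y r \<subseteq> V" using r(2) \<psi>(4) ball_subset_cball by fastforce
    \<comment> \<open>The total weight: the hinge integral over the ball is 2 r^2 / (2 m + 2) times
      its volume \<pi>^m r^(2 m) / m!, and \<open>c\<close> is m (m + 1) r^(-2 m - 2). The product
      is m \<pi>^m / m! for every \<open>r\<close>.\<close>
    have vol: "of_real c * hinge_integral ?d \<psi> (r\<^sup>2) = complex_of_real ?C"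
    proof -
      have "complex_of_real (2 * real (Suc ?m)) * hinge_integral ?d \<psi> (r\<^sup>2) =
          complex_of_real (2 * r\<^sup>2 * (pi ^ ?m / fact ?m * (r\<^sup>2) ^ ?m))"
        using hinge_integral_sq_dist[OF \<psi>(1,3) bV \<psi>1 r(1)]
        unfolding DIM_real_space measure_ball_real_space[OF less_imp_le[OF r(1)]]
        by (simp add: algebra_simps)
      then have "hinge_integral ?d \<psi> (r\<^sup>2) = complex_of_real (r\<^sup>2 * (pi ^ ?m / fact ?m * (r\<^sup>2) ^ ?m) / real (Suc ?m))"
        by (simp add: field_simps del: of_nat_Suc)
      then have "of_real c * hinge_integral ?d \<psi> (r\<^sup>2) =
          complex_of_real (c * (r\<^sup>2 * (pi ^ ?m / fact ?m * (r\<^sup>2) ^ ?m) / real (Suc ?m)))"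
        by (simp only: of_real_mult)
      also have "c * (r\<^sup>2 * (pi ^ ?m / fact ?m * (r\<^sup>2) ^ ?m) / real (Suc ?m)) = real ?m * (pi ^ ?m / fact ?m)"
      proof -
        have "inverse (r\<^sup>2) ^ Suc ?m * (r\<^sup>2) ^ Suc ?m = 1"
          unfolding power_mult_distrib[symmetric] using r(1) by simp
        then have "(inverse (r\<^sup>2) ^ Suc ?m * (r\<^sup>2) ^ Suc ?m) * (real ?m * (pi ^ ?m / fact ?m)) = real ?m * (pi ^ ?m / fact ?m)"
          by simp
        moreover have "c * (r\<^sup>2 * (pi ^ ?m / fact ?m * (r\<^sup>2) ^ ?m) / real (Suc ?m)) =
            (inverse (r\<^sup>2) ^ Suc ?m * (r\<^sup>2) ^ Suc ?m) * (real ?m * (pi ^ ?m / fact ?m))"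
          unfolding c_def power_Suc[of "r\<^sup>2"] by (simp del: of_nat_Suc power_Suc)
        ultimately show ?thesis by simp
      qed
      also have "real ?m * (pi ^ ?m / fact ?m) = ?C"
      proof -
        have "fact ?m = real ?m * fact (?m - 1)" using m1 by (metis fact_reduce Suc_le_eq One_nat_def)
        then show ?thesis using m1 by simp
      qed
      finally show ?thesis .
    qed
    have ti: "integrable lborel (\<lambda>x. complex_of_real (max 0 (r\<^sup>2 - ?d x)) * \<rho> x)" if "test_function \<rho>" for \<rho>
      by (rule integrable_hinge[OF cd test_continuous[OF that] test_bounded[OF that]])
    have tfy: "test_function (\<lambda>x. f y * \<psi> x)" by (rule test_function_cmult[OF \<psi>(1)])
    have "delta_deriv h 0 \<phi> - of_real ?C * f y =
        of_real c * (hinge_integral ?d (\<lambda>x. \<psi> x * f x) (r\<^sup>2) - f y * hinge_integral ?d \<psi> (r\<^sup>2))"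
      using kernel_regularised[OF f \<psi>(1-4) \<psi>1 \<phi> r] vol[symmetric] unfolding c_def[symmetric]
      by (simp add: algebra_simps)
    also have "f y * hinge_integral ?d \<psi> (r\<^sup>2) = hinge_integral ?d (\<lambda>x. f y * \<psi> x) (r\<^sup>2)"
      unfolding hinge_integral_def by (simp add: mult.left_commute)
    also have "hinge_integral ?d (\<lambda>x. \<psi> x * f x) (r\<^sup>2) - hinge_integral ?d (\<lambda>x. f y * \<psi> x) (r\<^sup>2) =
        (LINT x|lborel. complex_of_real (max 0 (r\<^sup>2 - ?d x)) * (\<psi> x * f x) - complex_of_real (max 0 (r\<^sup>2 - ?d x)) * (f y * \<psi> x))"
      unfolding hinge_integral_def by (rule Bochner_Integration.integral_diff[OF ti[OF tf] ti[OF tfy], symmetric])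
    finally have eq: "cmod (delta_deriv h 0 \<phi> - of_real ?C * f y) = c *
        cmod (LINT x|lborel. complex_of_real (max 0 (r\<^sup>2 - ?d x)) * (\<psi> x * f x) - complex_of_real (max 0 (r\<^sup>2 - ?d x)) * (f y * \<psi> x))"
      using c0 by (simp only: norm_mult norm_of_real abs_of_nonneg)
    \<comment> \<open>Since \<psi> is real and nonnegative, the total weight is also the integral of
      its absolute value, which appears in the estimate.\<close>
    have hr: "hinge_integral ?d \<psi> (r\<^sup>2) = complex_of_real (LINT x|lborel. max 0 (r\<^sup>2 - ?d x) * cmod (\<psi> x))"
    proof -
      have "(\<lambda>x. complex_of_real (max 0 (r\<^sup>2 - ?d x)) * \<psi> x) = (\<lambda>x. complex_of_real (max 0 (r\<^sup>2 - ?d x) * cmod (\<psi> x)))"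
        using \<psi>(6) by (simp add: fun_eq_iff)
      then show ?thesis unfolding hinge_integral_def by (simp del: of_real_mult)
    qed
    have ir: "integrable lborel (\<lambda>x. max 0 (r\<^sup>2 - ?d x) * cmod (\<psi> x))"
      using integrable_norm[OF ti[OF \<psi>(1)]] by (simp add: norm_mult)
    have "cmod (LINT x|lborel. complex_of_real (max 0 (r\<^sup>2 - ?d x)) * (\<psi> x * f x) - complex_of_real (max 0 (r\<^sup>2 - ?d x)) * (f y * \<psi> x)) \<le>
        (LINT x|lborel. \<eta> * (max 0 (r\<^sup>2 - ?d x) * cmod (\<psi> x)))"
    proof (rule cmod_integral_le)
      show "integrable lborel (\<lambda>x. complex_of_real (max 0 (r\<^sup>2 - ?d x)) * (\<psi> x * f x) - complex_of_real (max 0 (r\<^sup>2 - ?d x)) * (f y * \<psi> x))"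
        by (rule Bochner_Integration.integrable_diff[OF ti[OF tf] ti[OF tfy]])
      show "integrable lborel (\<lambda>x. \<eta> * (max 0 (r\<^sup>2 - ?d x) * cmod (\<psi> x)))"
        by (rule integrable_mult_right) (rule ir)
      fix x
      have "complex_of_real (max 0 (r\<^sup>2 - ?d x)) * (\<psi> x * f x) - complex_of_real (max 0 (r\<^sup>2 - ?d x)) * (f y * \<psi> x) =
          complex_of_real (max 0 (r\<^sup>2 - ?d x)) * \<psi> x * (f x - f y)" by (simp add: algebra_simps)
      then have n: "cmod (complex_of_real (max 0 (r\<^sup>2 - ?d x)) * (\<psi> x * f x) - complex_of_real (max 0 (r\<^sup>2 - ?d x)) * (f y * \<psi> x)) =
          max 0 (r\<^sup>2 - ?d x) * cmod (\<psi> x) * cmod (f x - f y)" by (simp add: norm_mult)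
      show "cmod (complex_of_real (max 0 (r\<^sup>2 - ?d x)) * (\<psi> x * f x) - complex_of_real (max 0 (r\<^sup>2 - ?d x)) * (f y * \<psi> x)) \<le>
          \<eta> * (max 0 (r\<^sup>2 - ?d x) * cmod (\<psi> x))"
      proof (cases "?d x < r\<^sup>2")
        case True
        then have "dist x y < p" using ball[of x] by (simp add: r_def dist_commute)
        then have "cmod (f x - f y) \<le> \<eta>" using p(2) by (simp add: dist_norm less_imp_le)
        then show ?thesis unfolding n mult.commute[of \<eta>] by (intro mult_left_mono mult_nonneg_nonneg) auto
      next
        case False
        then have "max 0 (r\<^sup>2 - ?d x) = 0" by simp
        then show ?thesis unfolding n by (simp only: mult_zero_left mult_zero_right)
      qed
    qed
    also have "\<dots> = \<eta> * (LINT x|lborel. max 0 (r\<^sup>2 - ?d x) * cmod (\<psi> x))" by simp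
    finally have "cmod (delta_deriv h 0 \<phi> - of_real ?C * f y) \<le> c * (\<eta> * (LINT x|lborel. max 0 (r\<^sup>2 - ?d x) * cmod (\<psi> x)))"
      unfolding eq using c0 by (rule mult_left_mono)
    also have "\<dots> = \<eta> * (c * (LINT x|lborel. max 0 (r\<^sup>2 - ?d x) * cmod (\<psi> x)))" by (rule mult.left_commute)
    also have "c * (LINT x|lborel. max 0 (r\<^sup>2 - ?d x) * cmod (\<psi> x)) = ?C"
      using vol unfolding hr by (simp only: of_real_mult[symmetric] of_real_eq_iff)
    finally show ?thesis .
  qed
  have "cmod (delta_deriv h 0 \<phi> - of_real ?C * f y) \<le> 0"
  proof (rule field_le_epsilon)
    fix \<epsilon> :: real assume "\<epsilon> > 0"
    then have "\<epsilon> / ?C > 0" using Cpos by simp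
    from est[OF this] show "cmod (delta_deriv h 0 \<phi> - of_real ?C * f y) \<le> 0 + \<epsilon>" using Cpos by simp
  qed
  then show ?thesis by simp
qed

lemma delta_deriv_dzc:
  assumes "test_function \<phi>"
  shows "delta_deriv h (Suc j) (\<lambda>x. dzc_scalar i hc x * \<phi> x) = - delta_deriv h j (dzc_scalar i \<phi>)"
    and "test_function (dzc_scalar i \<phi>)" and "test_function (\<lambda>x. dzc_scalar i hc x * \<phi> x)"
proof -
  let ?L = "axis (Inl i) 1" and ?R = "axis (Inr i) 1"
  have t: "test_function (dir_deriv v \<phi>)" for v by (rule test_function_dir_deriv[OF assms])
  have th: "test_function (\<lambda>x. dir_deriv v hc x * \<phi> x)" for v
    by (rule test_function_mult_smooth[OF smooth_on_dir_deriv[OF smooth_h] assms])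
  have e1: "dzc_scalar i \<phi> = (\<lambda>x. 1 / 2 * dir_deriv ?L \<phi> x + \<i> / 2 * dir_deriv ?R \<phi> x)"
    by (simp add: dzc_scalar_def fun_eq_iff algebra_simps)
  have e2: "(\<lambda>x. dzc_scalar i hc x * \<phi> x) =
      (\<lambda>x. 1 / 2 * (dir_deriv ?L hc x * \<phi> x) + \<i> / 2 * (dir_deriv ?R hc x * \<phi> x))"
    by (simp add: dzc_scalar_def fun_eq_iff algebra_simps)
  show "test_function (dzc_scalar i \<phi>)" unfolding e1
    by (intro test_function_add test_function_cmult t)
  show "test_function (\<lambda>x. dzc_scalar i hc x * \<phi> x)" unfolding e2
    by (intro test_function_add test_function_cmult th)
  show "delta_deriv h (Suc j) (\<lambda>x. dzc_scalar i hc x * \<phi> x) = - delta_deriv h j (dzc_scalar i \<phi>)"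
    unfolding e1 e2 delta_deriv_add[OF test_function_cmult[OF t] test_function_cmult[OF t]]
      delta_deriv_add[OF test_function_cmult[OF th] test_function_cmult[OF th]]
      delta_deriv_cmult[OF t] delta_deriv_cmult[OF th] delta_deriv_dir_deriv[OF assms]
    by simp
qed

end

section \<open>Smooth superfunctions\<close>

text \<open>Unlike \<open>superfunction\<close> it leaves the generators free, because the kernel
  also involves those of \<open>y\<close>.\<close>

definition gsmooth :: "'a::euclidean_space set \<Rightarrow> ('a \<Rightarrow> grassmann) \<Rightarrow> bool" where
  "gsmooth S F \<longleftrightarrow> (\<forall>A. smooth_on S (\<lambda>x. gcoeff (F x) A))"

lemma gsmoothD: "gsmooth S F \<Longrightarrow> smooth_on S (\<lambda>x. gcoeff (F x) A)"
  by (simp add: gsmooth_def)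

lemma gsmooth_differentiable:
  "gsmooth S F \<Longrightarrow> open S \<Longrightarrow> x \<in> S \<Longrightarrow> (\<lambda>x. gcoeff (F x) A) differentiable (at x)"
  by (rule smooth_on_differentiable[OF gsmoothD])

lemma gsmooth_const: "open S \<Longrightarrow> gsmooth S (\<lambda>x. a)"
  by (simp add: gsmooth_def smooth_on_const)

lemma gsmooth_gconst:
  assumes "open S" "smooth_on S \<phi>"
  shows "gsmooth S (\<lambda>x. gconst (\<phi> x))"
  unfolding gsmooth_def
proof
  fix A :: "nat set"
  show "smooth_on S (\<lambda>x. gcoeff (gconst (\<phi> x)) A)"
    using assms by (cases "A = {}") (simp_all add: gcoeff_gconst smooth_on_const)
qed

lemma gsmooth_add: "open S \<Longrightarrow> gsmooth S F \<Longrightarrow> gsmooth S G \<Longrightarrow> gsmooth S (\<lambda>x. F x + G x)"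
  by (simp add: gsmooth_def smooth_on_add)

lemma gsmooth_diff: "open S \<Longrightarrow> gsmooth S F \<Longrightarrow> gsmooth S G \<Longrightarrow> gsmooth S (\<lambda>x. F x - G x)"
  by (simp add: gsmooth_def smooth_on_diff)

lemma gsmooth_mult:
  assumes "open S" "gsmooth S F" "gsmooth S G"
  shows "gsmooth S (\<lambda>x. F x * G x)"
  unfolding gsmooth_def gcoeff_mult
  by (intro allI smooth_on_sum smooth_on_mult smooth_on_const gsmoothD[OF assms(2)] gsmoothD[OF assms(3)] assms(1))

lemma gsmooth_power: "open S \<Longrightarrow> gsmooth S F \<Longrightarrow> gsmooth S (\<lambda>x. F x ^ k)"
  by (induction k) (auto intro: gsmooth_const gsmooth_mult)

lemma gsmooth_sum:
  "open S \<Longrightarrow> (\<And>i. i \<in> I \<Longrightarrow> gsmooth S (F i)) \<Longrightarrow> gsmooth S (\<lambda>x. \<Sum>i\<in>I. F i x)"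
  by (simp add: gsmooth_def gcoeff_sum smooth_on_sum)

lemma gsmooth_lderiv:
  assumes "open S" "gsmooth S F"
  shows "gsmooth S (\<lambda>x. lderiv j (F x))"
  unfolding gsmooth_def
proof
  fix A :: "nat set"
  have "smooth_on S (\<lambda>x. (-1) ^ card {i \<in> A. i < j} * gcoeff (F x) (insert j A))"
    by (rule smooth_on_mult[OF assms(1) smooth_on_const[OF assms(1)] gsmoothD[OF assms(2)]])
  then show "smooth_on S (\<lambda>x. gcoeff (lderiv j (F x)) A)"
    using smooth_on_const[OF assms(1), of 0] by (cases "j \<in> A") (simp_all add: gcoeff_lderiv)
qed

lemma gsmooth_subset: "gsmooth S F \<Longrightarrow> open T \<Longrightarrow> T \<subseteq> S \<Longrightarrow> open S \<Longrightarrow> gsmooth T F"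
  unfolding gsmooth_def using smooth_on_subset by blast

lemma gcoeff_sderiv_dir: "gcoeff (sderiv v F x) A = dir_deriv v (\<lambda>w. gcoeff (F w) A) x"
  by (simp add: gcoeff_sderiv dir_deriv_def)

lemma gsmooth_sderiv: "gsmooth S F \<Longrightarrow> gsmooth S (sderiv v F)"
  unfolding gsmooth_def gcoeff_sderiv_dir using smooth_on_dir_deriv by blast

lemma sderiv_mult:
  assumes "open S" "gsmooth S F" "gsmooth S G" "x \<in> S"
  shows "sderiv v (\<lambda>x. F x * G x) x = sderiv v F x * G x + F x * sderiv v G x"
proof (rule grassmann_eqI)
  fix C :: "nat set"
  note d = gsmooth_differentiable[OF assms(2,1,4)] gsmooth_differentiable[OF assms(3,1,4)]
  have dFG: "(\<lambda>x. gsign A (C - A) * gcoeff (F x) A) differentiable (at x)" for A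
    by (rule differentiable_mult[OF differentiable_const d(1)])
  have "gcoeff (sderiv v (\<lambda>x. F x * G x) x) C =
      (\<Sum>A\<in>Pow C. dir_deriv v (\<lambda>x. gsign A (C - A) * gcoeff (F x) A * gcoeff (G x) (C - A)) x)"
    unfolding gcoeff_sderiv_dir gcoeff_mult
    by (rule dir_deriv_sum) (rule differentiable_mult[OF dFG d(2)])
  also have "\<dots> = (\<Sum>A\<in>Pow C. gsign A (C - A) * gcoeff (sderiv v F x) A * gcoeff (G x) (C - A) +
      gsign A (C - A) * gcoeff (F x) A * gcoeff (sderiv v G x) (C - A))"
    by (rule sum.cong[OF refl])
      (simp add: dir_deriv_mult[OF dFG d(2)] dir_deriv_cmult[OF d(1)] gcoeff_sderiv_dir)
  also have "\<dots> = gcoeff (sderiv v F x * G x + F x * sderiv v G x) C"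
    by (simp only: gcoeff_add gcoeff_mult sum.distrib)
  finally show "gcoeff (sderiv v (\<lambda>x. F x * G x) x) C = gcoeff (sderiv v F x * G x + F x * sderiv v G x) C" .
qed

lemma gcoeff_dzc: "gcoeff (dzc j F x) A = dzc_scalar j (\<lambda>w. gcoeff (F w) A) x"
  by (simp add: dzc_def dzc_scalar_def gcoeff_sderiv_dir)

lemma gsmooth_dzc: "open S \<Longrightarrow> gsmooth S F \<Longrightarrow> gsmooth S (dzc j F)"
  unfolding dzc_def[abs_def]
  by (intro gsmooth_mult gsmooth_add gsmooth_const gsmooth_sderiv)

lemma gsmooth_dgzc: "open S \<Longrightarrow> gsmooth S F \<Longrightarrow> gsmooth S (\<lambda>x. dgzc k (F x))"
  unfolding dgzc_def
  by (intro gsmooth_mult gsmooth_add gsmooth_const gsmooth_lderiv)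

lemma dzc_mult:
  assumes "open S" "gsmooth S F" "gsmooth S G" "x \<in> S"
  shows "dzc j (\<lambda>x. F x * G x) x = dzc j F x * G x + F x * dzc j G x"
  unfolding dzc_def sderiv_mult[OF assms]
  by (rule grassmann_eqI) (simp add: gconst_left_comm[of "F x"] distrib_left[of "F x"]
      distrib_right mult.assoc algebra_simps)

lemma dzc_const: "dzc j (\<lambda>x. a) x = 0"
  by (rule grassmann_eqI) (simp add: gcoeff_dzc dzc_scalar_def)

lemma dzc_gconst: "dzc j (\<lambda>x. gconst (\<phi> x)) x = gconst (dzc_scalar j \<phi> x)"
proof (rule grassmann_eqI)
  fix A :: "nat set"
  show "gcoeff (dzc j (\<lambda>x. gconst (\<phi> x)) x) A = gcoeff (gconst (dzc_scalar j \<phi> x)) A"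
    by (cases "A = {}") (simp_all add: gcoeff_dzc gcoeff_gconst dzc_scalar_def)
qed

lemma D_dagger_eq:
  "D_dagger n y F x = (\<Sum>j\<in>UNIV. gconst (zdiff_cnj y j x) * dzc j F x) + odd_D n (F x)"
  by (simp add: D_dagger_def odd_D_def zdiff_cnj_def gwc_def)

lemma gsmooth_D_dagger: "open S \<Longrightarrow> gsmooth S F \<Longrightarrow> gsmooth S (D_dagger n y F)"
  unfolding D_dagger_eq[abs_def] odd_D_def
  by (intro gsmooth_add gsmooth_sum gsmooth_mult gsmooth_gconst smooth_zdiff_cnj gsmooth_dzc
      gsmooth_const gsmooth_dgzc)

text \<open>The left factor is taken even at the point because the anticommuting derivatives pass an
  odd factor with a sign.\<close>

lemma D_dagger_mult:
  assumes "open S" "gsmooth S F" "gsmooth S G" "x \<in> S" "geven (F x)"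
  shows "D_dagger n y (\<lambda>x. F x * G x) x = D_dagger n y F x * G x + F x * D_dagger n y G x"
proof -
  have "gconst (zdiff_cnj y j x) * dzc j (\<lambda>x. F x * G x) x =
      gconst (zdiff_cnj y j x) * dzc j F x * G x + F x * (gconst (zdiff_cnj y j x) * dzc j G x)" for j
    unfolding dzc_mult[OF assms(1-4)] distrib_left gconst_left_comm[of "F x"] by (simp only: mult.assoc)
  then show ?thesis
    unfolding D_dagger_eq odd_D_mult_even[OF assms(5)]
    by (simp only: sum.distrib sum_distrib_right[symmetric] sum_distrib_left[symmetric]
        distrib_left distrib_right add_ac)
qed

lemma D_dagger_sum:
  assumes "open S" "\<And>i. i \<in> I \<Longrightarrow> gsmooth S (F i)" "x \<in> S"
  shows "D_dagger n y (\<lambda>x. \<Sum>i\<in>I. F i x) x = (\<Sum>i\<in>I. D_dagger n y (F i) x)"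
proof -
  have d: "(\<lambda>x. gcoeff (F i x) A) differentiable (at x)" if "i \<in> I" for i A
    by (rule gsmooth_differentiable[OF assms(2)[OF that] assms(1,3)])
  have "dzc j (\<lambda>x. \<Sum>i\<in>I. F i x) x = (\<Sum>i\<in>I. dzc j (F i) x)" for j
    by (rule grassmann_eqI)
      (simp only: gcoeff_dzc gcoeff_sum dzc_scalar_def dir_deriv_sum[OF d] sum.distrib sum_distrib_left distrib_left)
  then show ?thesis
    unfolding D_dagger_eq odd_D_sum by (simp add: sum.distrib sum_distrib_left) (rule sum.swap)
qed

lemma D_dagger_gconst: "D_dagger n y (\<lambda>x. gconst (\<phi> x)) x = gconst (\<Sum>j\<in>UNIV. zdiff_cnj y j x * dzc_scalar j \<phi> x)"
  by (simp add: D_dagger_eq dzc_gconst gconst_sum gconst_mult)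

lemma D_dagger_const: "D_dagger n y (\<lambda>x. a) x = odd_D n a"
  by (simp add: D_dagger_eq dzc_const)

lemma D_dagger_add:
  assumes "open S" "gsmooth S F" "gsmooth S G" "x \<in> S"
  shows "D_dagger n y (\<lambda>x. F x + G x) x = D_dagger n y F x + D_dagger n y G x"
  using D_dagger_sum[OF assms(1), of UNIV "\<lambda>b. if b then F else G" x n y] assms(2-4)
  by (simp add: UNIV_bool add.commute)

lemma D_dagger_power:
  assumes "open S" "gsmooth S F" "x \<in> S" "\<forall>x. geven (F x)"
  shows "D_dagger n y (\<lambda>x. F x ^ Suc k) x = gconst (of_nat (Suc k)) * (F x ^ k * D_dagger n y F x)"
proof (induction k)
  case 0
  show ?case by simp
next
  case (Suc k)
  have e: "geven (F x)" using assms(4) by blast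
  have "D_dagger n y (\<lambda>x. F x ^ Suc (Suc k)) x = D_dagger n y (\<lambda>x. F x * F x ^ Suc k) x" by simp
  also have "\<dots> = D_dagger n y F x * F x ^ Suc k + F x * D_dagger n y (\<lambda>x. F x ^ Suc k) x"
    by (rule D_dagger_mult[OF assms(1,2) gsmooth_power[OF assms(1,2)] assms(3) e])
  also have "D_dagger n y F x * F x ^ Suc k = gconst 1 * (F x ^ Suc k * D_dagger n y F x)"
    unfolding gconst_1 mult_1_left by (rule geven_comm[OF geven_power[OF e], symmetric])
  also have "F x * D_dagger n y (\<lambda>x. F x ^ Suc k) x = gconst (of_nat (Suc k)) * (F x ^ Suc k * D_dagger n y F x)"
    unfolding Suc.IH gconst_left_comm[of "F x"] by (simp add: mult.assoc)
  also have "gconst 1 * (F x ^ Suc k * D_dagger n y F x) + gconst (of_nat (Suc k)) * (F x ^ Suc k * D_dagger n y F x) =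
      gconst (1 + of_nat (Suc k)) * (F x ^ Suc k * D_dagger n y F x)"
    by (simp only: gconst_add distrib_right)
  finally show ?case by simp
qed

section \<open>The kernel\<close>

lemma sq_dist_ZU_eq: "sq_dist_ZU n x y = gconst (of_real ((dist x y)\<^sup>2)) + gN n 0"
proof -
  have "(\<Sum>j\<in>UNIV. gconst ((zvar x j - zvar y j) * cnj (zvar x j - zvar y j))) = gconst (of_real ((dist x y)\<^sup>2))"
    unfolding sum_zdiff_sq[symmetric] gconst_sum zdiff_cnj_def ..
  then show ?thesis
    by (simp add: sq_dist_ZU_def gN_def gw_def gwc_def gconst_uminus)
qed

text \<open>The coefficient of \<open>gN n 0 ^ j\<close> in the binomial expansion of |Z - U| to the
  power \<open>2 * p\<close>. The parameter is half the exponent, so that it becomes the eigenvalue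
  under \<open>D_dagger\<close>.\<close>

definition kernel_coeff :: "real \<Rightarrow> 'a::euclidean_space \<Rightarrow> nat \<Rightarrow> 'a \<Rightarrow> complex" where
  "kernel_coeff p y j x = of_real ((p gchoose j) * ((dist x y)\<^sup>2) powr (p - real j))"

lemma dist_ZU_pow_eq:
  "dist_ZU_pow n x y (2 * p) = (\<Sum>j\<le>n. gconst (kernel_coeff p y j x) * gN n 0 ^ j)"
proof -
  have e: "gcoeff (sq_dist_ZU n x y) {} = of_real ((dist x y)\<^sup>2)"
    by (simp add: sq_dist_ZU_eq gcoeff_gN_empty gcoeff_gconst)
  have "nilp (sq_dist_ZU n x y) = gN n 0" by (simp add: nilp_def e) (simp add: sq_dist_ZU_eq)
  moreover have "rbody (sq_dist_ZU n x y) = (dist x y)\<^sup>2" by (simp add: rbody_def e)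
  ultimately show ?thesis
    unfolding dist_ZU_pow_def gpow_def kernel_coeff_def by (simp add: gconst_comm)
qed

lemma geven_dist_ZU_pow: "geven (dist_ZU_pow n x y (2 * p))"
  unfolding dist_ZU_pow_eq by (intro geven_sum geven_gconst_mult geven_power geven_gN)

lemma smooth_kernel_coeff: "smooth_on (- {y}) (kernel_coeff p y j)"
proof -
  have op: "open (- {y})" by (rule open_Compl[OF closed_singleton])
  have "smooth_on (- {y}) (\<lambda>x. complex_of_real (((dist x y)\<^sup>2) powr (p - real j)))"
    by (rule smooth_on_compose[OF op _ _ smooth_on_sq_dist[OF op] smooth_on_powr[of "p - real j"]]) auto
  from smooth_on_mult[OF op smooth_on_const[OF op] this, of "of_real (p gchoose j)"]
  show ?thesis unfolding kernel_coeff_def[abs_def] by simp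
qed

lemma gsmooth_kernel_term: "gsmooth (- {y}) (\<lambda>x. gconst (kernel_coeff p y j x) * gN n 0 ^ j)"
  by (intro gsmooth_mult gsmooth_gconst smooth_kernel_coeff gsmooth_const open_Compl closed_singleton)

lemma gsmooth_dist_ZU_pow: "gsmooth (- {y}) (\<lambda>x. dist_ZU_pow n x y (2 * p))"
  unfolding dist_ZU_pow_eq by (rule gsmooth_sum[OF open_Compl[OF closed_singleton] gsmooth_kernel_term])

lemma dzc_scalar_scaled:
  "(\<And>v. dir_deriv v f x = c * dir_deriv v g x) \<Longrightarrow> dzc_scalar i f x = c * dzc_scalar i g x"
  by (simp add: dzc_scalar_def algebra_simps)

text \<open>Euler's relation in the conjugate coordinates: the squared distance has degree one in
  them, and the coefficient is a multiple of its power \<open>p - j\<close>.\<close>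

lemma zdiff_dzc_kernel_coeff:
  fixes y :: "real ^ ('m::finite + 'm)"
  assumes "x \<noteq> y"
  shows "(\<Sum>i\<in>UNIV. zdiff_cnj y i x * dzc_scalar i (kernel_coeff p y j) x) =
    of_real (p - real j) * kernel_coeff p y j x"
proof -
  let ?q = "p - real j" and ?d = "\<lambda>x. (dist x y)\<^sup>2"
  have pos: "?d x > 0" using assms by simp
  have dd: "(\<lambda>x. complex_of_real (?d x)) differentiable (at x)"
    by (rule smooth_on_differentiable[OF smooth_on_sq_dist[OF open_UNIV] open_UNIV UNIV_I])
  have u: "((\<lambda>t. (p gchoose j) * t powr ?q) has_real_derivative (p gchoose j) * (?q * ?d x powr (?q - 1))) (at (?d x))"
    using pos by (auto intro!: derivative_eq_intros)
  have "dir_deriv v (kernel_coeff p y j) x =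
      of_real ((p gchoose j) * (?q * ?d x powr (?q - 1))) * dir_deriv v (\<lambda>x. complex_of_real (?d x)) x" for v
    unfolding kernel_coeff_def[abs_def] by (rule dir_deriv_of_real_compose[OF u dd])
  then have "dzc_scalar i (kernel_coeff p y j) x =
      of_real ((p gchoose j) * (?q * ?d x powr (?q - 1))) * dzc_scalar i (\<lambda>x. complex_of_real (?d x)) x" for i
    by (rule dzc_scalar_scaled)
  then have "(\<Sum>i\<in>UNIV. zdiff_cnj y i x * dzc_scalar i (kernel_coeff p y j) x) =
      (\<Sum>i\<in>UNIV. of_real ((p gchoose j) * (?q * ?d x powr (?q - 1))) * ((zvar x i - zvar y i) * zdiff_cnj y i x))"
    unfolding dzc_sq_dist by (intro sum.cong refl) (simp only: mult_ac)
  also have "\<dots> = of_real ((p gchoose j) * (?q * ?d x powr (?q - 1))) * of_real (?d x)"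
    unfolding sum_distrib_left[symmetric] sum_zdiff_sq ..
  also have "\<dots> = of_real (?q * ((p gchoose j) * (?d x powr (?q - 1) * ?d x)))"
    by (simp only: of_real_mult mult_ac)
  also have "?d x powr (?q - 1) * ?d x = ?d x powr ?q"
    using pos powr_mult_base[of "?d x" "?q - 1"] by (simp add: mult.commute)
  finally have eq: "(\<Sum>i\<in>UNIV. zdiff_cnj y i x * dzc_scalar i (kernel_coeff p y j) x) =
      of_real (?q * ((p gchoose j) * ?d x powr ?q))" .
  have "kernel_coeff p y j x = of_real ((p gchoose j) * ?d x powr ?q)" by (simp only: kernel_coeff_def)
  then show ?thesis unfolding eq by (simp only: of_real_mult)
qed

text \<open>The commuting part of the field has eigenvalue \<open>p - j\<close> on the
  \<open>j\<close>-th coefficient, and the anticommuting part has eigenvalue \<open>j\<close> on the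
  \<open>j\<close>-th power of \<open>gN\<close>. The sum is \<open>p\<close> in every term.\<close>

lemma D_dagger_kernel:
  fixes y :: "real ^ ('m::finite + 'm)"
  assumes "x \<noteq> y"
  shows "D_dagger n y (\<lambda>x. dist_ZU_pow n x y (2 * p)) x = gconst (of_real p) * dist_ZU_pow n x y (2 * p)"
proof -
  have op: "open (- {y})" by (rule open_Compl[OF closed_singleton])
  have x: "x \<in> - {y}" using assms by simp
  have "D_dagger n y (\<lambda>x. gconst (kernel_coeff p y j x) * gN n 0 ^ j) x =
      gconst (of_real p) * (gconst (kernel_coeff p y j x) * gN n 0 ^ j)" for j
  proof -
    have "D_dagger n y (\<lambda>x. gconst (kernel_coeff p y j x) * gN n 0 ^ j) x =
        gconst (of_real (p - real j) * kernel_coeff p y j x) * gN n 0 ^ j +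
        gconst (kernel_coeff p y j x) * (gconst (of_nat j) * gN n 0 ^ j)"
      unfolding D_dagger_mult[OF op gsmooth_gconst[OF op smooth_kernel_coeff] gsmooth_const[OF op] x geven_gconst]
        D_dagger_gconst zdiff_dzc_kernel_coeff[OF assms] D_dagger_const odd_D_power[OF geven_gN odd_D_gN] ..
    also have "\<dots> = gconst (of_real (p - real j) * kernel_coeff p y j x + kernel_coeff p y j x * of_nat j) * gN n 0 ^ j"
      by (simp only: gconst_add gconst_mult distrib_right mult.assoc)
    also have "of_real (p - real j) * kernel_coeff p y j x + kernel_coeff p y j x * of_nat j =
        of_real p * kernel_coeff p y j x" by (simp add: algebra_simps)
    finally show ?thesis by (simp only: gconst_mult mult.assoc)
  qed
  then show ?thesis
    unfolding dist_ZU_pow_eq D_dagger_sum[OF op gsmooth_kernel_term x] by (simp only: sum_distrib_left)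
qed

text \<open>The divergence \<open>m - n\<close> of \<open>D\<^sup>\<dagger>\<close> cancels against the homogeneity of the kernel.\<close>

lemma berezin_divergence:
  fixes y :: "real ^ ('m::finite + 'm)"
  assumes S: "open S" "x \<in> S" "y \<notin> S" and P: "gsmooth S P" "geven (P x)" and F: "gsmooth S F"
    and hol: "\<forall>j. dzc j F x = 0" "\<forall>k\<in>{1..n}. dgzc k (F x) = 0"
    and p: "p = - (real CARD('m) - real n)"
  shows "gcoeff (berezin n (dist_ZU_pow n x y (2 * p) * D_dagger n y P x * F x)) C =
    (\<Sum>i\<in>UNIV. dzc_scalar i (\<lambda>x. zdiff_cnj y i x *
      gcoeff (berezin n (dist_ZU_pow n x y (2 * p) * P x * F x)) C) x)"
proof -
  let ?K = "\<lambda>x. dist_ZU_pow n x y (2 * p)"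
  let ?Q = "\<lambda>x. ?K x * P x * F x"
  have K: "gsmooth S ?K" using gsmooth_subset[OF gsmooth_dist_ZU_pow S(1)] S(3) by auto
  have PF: "gsmooth S (\<lambda>x. P x * F x)" by (rule gsmooth_mult[OF S(1) P(1) F])
  have Q: "gsmooth S ?Q" unfolding mult.assoc by (rule gsmooth_mult[OF S(1) K PF])
  have xy: "x \<noteq> y" using S by blast
  obtain \<sigma> where \<sigma>: "\<And>a. gcoeff (berezin n a) C = \<sigma> * gcoeff a (C \<union> {1..2 * n})"
    using berezin_coeff by blast
  let ?C = "C \<union> {1..2 * n}"
  have DF: "D_dagger n y F x = 0"
    using hol by (simp add: D_dagger_eq odd_D_def)
  have "D_dagger n y ?Q x = gconst (of_real p) * ?Q x + ?K x * (D_dagger n y P x * F x)"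
    unfolding mult.assoc
    by (simp only: D_dagger_mult[OF S(1) K PF S(2) geven_dist_ZU_pow] D_dagger_kernel[OF xy]
        D_dagger_mult[OF S(1) P(1) F S(2) P(2)] DF mult_zero_right add_0_right mult.assoc)
  then have e: "?K x * D_dagger n y P x * F x = D_dagger n y ?Q x - gconst (of_real p) * ?Q x"
    by (simp add: mult.assoc)
  define b where "b x = gcoeff (berezin n (?Q x)) C" for x
  have b_eq: "b x = \<sigma> * gcoeff (?Q x) ?C" for x by (simp only: b_def \<sigma>)
  have db: "b differentiable (at x)"
    unfolding b_eq[abs_def]
    by (rule differentiable_mult[OF differentiable_const gsmooth_differentiable[OF Q S(1,2)]])
  have dzb: "dzc_scalar i b x = gcoeff (berezin n (dzc i ?Q x)) C" for i
    unfolding \<sigma> gcoeff_dzc b_eq[abs_def] dzc_scalar_def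
      dir_deriv_cmult[OF gsmooth_differentiable[OF Q S(1,2)]]
    by (simp add: algebra_simps)
  have da: "zdiff_cnj y i differentiable (at x)" for i
    by (rule smooth_on_differentiable[OF smooth_zdiff_cnj[OF open_UNIV] open_UNIV UNIV_I])
  have "gcoeff (berezin n (D_dagger n y ?Q x)) C =
      (\<Sum>i\<in>UNIV. zdiff_cnj y i x * dzc_scalar i b x) + of_nat n * b x"
    unfolding D_dagger_eq berezin_add berezin_sum berezin_gconst_mult berezin_odd_D
      gcoeff_add gcoeff_sum gcoeff_gconst_mult dzb b_def ..
  \<comment> \<open>Pulling the factor \<open>zdiff_cnj y i\<close> into the derivative costs one
    \<open>b x\<close> for each of the complex coordinates.\<close>
  also have "(\<Sum>i\<in>UNIV. zdiff_cnj y i x * dzc_scalar i b x) =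
      (\<Sum>i\<in>(UNIV :: 'm set). dzc_scalar i (\<lambda>x. zdiff_cnj y i x * b x) x - b x)"
    by (rule sum.cong[OF refl]) (simp add: dzc_scalar_mult[OF da db] dzc_zdiff_cnj)
  also have "\<dots> = (\<Sum>i\<in>UNIV. dzc_scalar i (\<lambda>x. zdiff_cnj y i x * b x) x) - of_nat CARD('m) * b x"
    by (simp add: sum_subtractf)
  finally have "gcoeff (berezin n (?K x * D_dagger n y P x * F x)) C =
      (\<Sum>i\<in>UNIV. dzc_scalar i (\<lambda>x. zdiff_cnj y i x * b x) x) - of_nat CARD('m) * b x + of_nat n * b x - of_real p * b x"
    unfolding e berezin_diff berezin_gconst_mult gcoeff_diff gcoeff_gconst_mult b_def by simp
  \<comment> \<open>The multiples of \<open>b x\<close> have total -m + n - p = 0 by the choice of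
    \<open>p\<close>.\<close>
  also have "\<dots> = (\<Sum>i\<in>UNIV. dzc_scalar i (\<lambda>x. zdiff_cnj y i x * b x) x)"
    unfolding p by (simp add: algebra_simps)
  finally show ?thesis unfolding b_def .
qed

section \<open>The superdistribution \<open>\<delta>(g)\<close>\<close>

lemma gexpand:
  assumes "gsupp S a" "finite S"
  shows "a = (\<Sum>A\<in>Pow S. gconst (gcoeff a A) * gmono A)"
proof (rule grassmann_eqI)
  fix B :: "nat set" assume B: "finite B"
  have "gcoeff (\<Sum>A\<in>Pow S. gconst (gcoeff a A) * gmono A) B = (\<Sum>A\<in>Pow S. if A = B then gcoeff a A else 0)"
    unfolding gcoeff_sum gcoeff_gconst_mult gcoeff_gmono
    by (rule sum.cong[OF refl]) (use B in auto)
  also have "\<dots> = gcoeff a B"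
    using assms by (subst sum.delta) (auto simp: gsupp_def)
  finally show "gcoeff a B = gcoeff (\<Sum>A\<in>Pow S. gconst (gcoeff a A) * gmono A) B" ..
qed

lemma gmult_expand:
  assumes "gsupp S a" "finite S" "gsupp T b" "finite T"
  shows "a * b = (\<Sum>A\<in>Pow S. \<Sum>B\<in>Pow T. gconst (gcoeff a A * gcoeff b B) * (gmono A * gmono B))"
proof -
  have "a * b = (\<Sum>A\<in>Pow S. gconst (gcoeff a A) * gmono A) * (\<Sum>B\<in>Pow T. gconst (gcoeff b B) * gmono B)"
    using gexpand[OF assms(1,2)] gexpand[OF assms(3,4)] by simp
  also have "\<dots> = (\<Sum>A\<in>Pow S. \<Sum>B\<in>Pow T. gconst (gcoeff a A) * gmono A * (gconst (gcoeff b B) * gmono B))"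
    by (rule sum_product)
  also have "\<dots> = (\<Sum>A\<in>Pow S. \<Sum>B\<in>Pow T. gconst (gcoeff a A * gcoeff b B) * (gmono A * gmono B))"
  proof (intro sum.cong refl)
    fix A B
    show "gconst (gcoeff a A) * gmono A * (gconst (gcoeff b B) * gmono B) =
        gconst (gcoeff a A * gcoeff b B) * (gmono A * gmono B)"
      unfolding gconst_mult by (simp only: mult.assoc gconst_left_comm[of "gmono A"])
  qed
  finally show ?thesis .
qed

lemma (in regular_level) delta_deriv_null:
  assumes "test_function \<phi>" "closure {x. \<phi> x \<noteq> 0} \<subseteq> - {x. h x = 0}"
  shows "delta_deriv h j \<phi> = 0"
proof -
  have op: "open (- closure {x. \<phi> x \<noteq> 0})" by (rule open_Compl[OF closed_closure])
  have sub: "{x. h x = 0} \<subseteq> - closure {x. \<phi> x \<noteq> 0}" using assms(2) by blast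
  have "\<forall>x\<in>- closure {x. \<phi> x \<noteq> 0}. \<phi> x = 0"
    using test_function_outside[of _ \<phi>] by blast
  from delta_deriv_local[OF assms(1) test_function_0 op sub this] show ?thesis by (simp add: delta_deriv_0)
qed

text \<open>Every summand is additive and depends only on a neighbourhood of the level set, which
  therefore serves as the bound \<open>Z\<close> in \<open>dist_pair_eq\<close>.\<close>

lemma (in regular_level) dist_pair_delta:
  assumes c: "\<And>j. smooth_on UNIV (c j)"
    and T: "T = (\<lambda>\<phi>. \<Sum>j\<le>n. delta_deriv h j (\<lambda>x. c j x * \<phi> x))"
    and \<phi>: "test_function \<phi>" "open V" "{x. h x = 0} \<subseteq> V" "\<forall>x\<in>V. \<phi> x = f x"
  shows "dist_pair T f = (\<Sum>j\<le>n. delta_deriv h j (\<lambda>x. c j x * \<phi> x))"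
proof -
  have t: "test_function (\<lambda>x. c j x * \<psi> x)" if "test_function \<psi>" for j \<psi>
    by (rule test_function_mult_smooth[OF c that])
  have add: "dist_additive T"
    unfolding dist_additive_def
  proof (intro allI impI)
    fix \<phi> \<psi> :: "'a \<Rightarrow> complex" assume p: "test_function \<phi>" "test_function \<psi>"
    show "T (\<lambda>x. \<phi> x + \<psi> x) = T \<phi> + T \<psi>"
      unfolding T distrib_left delta_deriv_add[OF t[OF p(1)] t[OF p(2)]] by (rule sum.distrib)
  qed
  have null: "dist_null_on T (- {x. h x = 0})"
    unfolding dist_null_on_def
  proof (intro conjI allI impI)
    show "open (- {x. h x = 0})" by (rule open_Compl[OF compact_imp_closed[OF compact_zero]])
    fix \<psi> :: "'a \<Rightarrow> complex" assume p: "test_function \<psi> \<and> closure {x. \<psi> x \<noteq> 0} \<subseteq> - {x. h x = 0}"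
    have "delta_deriv h j (\<lambda>x. c j x * \<psi> x) = 0" for j
    proof (rule delta_deriv_null[OF t])
      have "closure {x. c j x * \<psi> x \<noteq> 0} \<subseteq> closure {x. \<psi> x \<noteq> 0}" by (rule closure_mono) auto
      then show "closure {x. c j x * \<psi> x \<noteq> 0} \<subseteq> - {x. h x = 0}" using p by blast
    qed (use p in blast)
    then show "T \<psi> = 0" unfolding T by simp
  qed
  show ?thesis
    unfolding dist_pair_eq[OF add null \<phi>] by (simp only: T)
qed

text \<open>The componentwise definition is resummed so that each Taylor term of \<delta>(g) becomes
  a single pairing with the Berezin integral inside. As \<open>G\<close> is smooth only on
  \<open>S\<close>, the cutoff \<rho> supplies the test functions.\<close>

lemma super_integral_delta:
  fixes g G :: "'a::euclidean_space \<Rightarrow> grassmann"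
  assumes level: "regular_level (\<lambda>x. rbody (g x))"
    and g: "gsmooth UNIV g" "\<And>x. gsupp {1..2 * n} (g x)"
    and S: "open S" "{x. rbody (g x) = 0} \<subseteq> V" "open V" "\<And>x. x \<in> V \<Longrightarrow> \<rho> x = 1"
      "test_function \<rho>" "closure {x. \<rho> x \<noteq> 0} \<subseteq> S"
    and G: "gsmooth S G" "\<And>x. x \<in> S \<Longrightarrow> gsupp {1..4 * n} (G x)"
  shows "gcoeff (super_integral n (sdelta n g) G) C =
    (\<Sum>j\<le>n. delta_deriv (\<lambda>x. rbody (g x)) j (\<lambda>x. \<rho> x * gcoeff (berezin n (nilp (g x) ^ j * G x)) C) / fact j)"
proof -
  interpret regular_level "\<lambda>x. rbody (g x)" by (rule level)
  let ?h = "\<lambda>x. rbody (g x)"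
  let ?n = "\<lambda>x. nilp (g x)"
  have nilp_sm: "gsmooth UNIV ?n"
    unfolding nilp_def by (intro gsmooth_diff gsmooth_gconst g(1) gsmoothD[OF g(1)] open_UNIV)
  have nilp_supp: "gsupp {1..2 * n} (?n x ^ j)" for x j
    unfolding nilp_def by (intro gsupp_power gsupp_diff gsupp_gconst g(2))
  have power_sm: "smooth_on UNIV (\<lambda>x. gcoeff (?n x ^ j) A)" for j A
    by (rule gsmoothD[OF gsmooth_power[OF open_UNIV nilp_sm]])
  have tG: "test_function (\<lambda>x. \<rho> x * gcoeff (G x) B)" for B
    by (rule test_function_mult_local[OF S(1) gsmoothD[OF G(1)] S(5,6)])
  let ?c = "\<lambda>A j x. gcoeff (?n x ^ j) A / fact j"
  have c_sm: "smooth_on UNIV (?c A j)" for A j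
    using smooth_on_mult[OF open_UNIV smooth_on_const[OF open_UNIV, of "1 / fact j"] power_sm[of j A]] by simp
  have pair: "dist_pair (sdelta n g A) (\<lambda>x. gcoeff (G x) B) =
      (\<Sum>j\<le>n. delta_deriv ?h j (\<lambda>x. ?c A j x * (\<rho> x * gcoeff (G x) B)))" for A B
  proof (rule dist_pair_delta[OF c_sm _ tG S(3,2)])
    show "sdelta n g A = (\<lambda>\<phi>. \<Sum>j\<le>n. delta_deriv ?h j (\<lambda>x. ?c A j x * \<phi> x))"
      by (simp add: fun_eq_iff sdelta_def delta_deriv_def)
    show "\<forall>x\<in>V. \<rho> x * gcoeff (G x) B = gcoeff (G x) B" using S(4) by simp
  qed
  define k where "k A B = gcoeff (berezin n (gmono A * gmono B)) C" for A B
  have tc: "test_function (\<lambda>x. ?c A j x * (\<rho> x * gcoeff (G x) B))" for A B j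
    by (rule test_function_mult_smooth[OF c_sm tG])
  have tk: "test_function (\<lambda>x. k A B * (?c A j x * (\<rho> x * gcoeff (G x) B)))" for A B j
    by (rule test_function_cmult[OF tc])
  have tkB: "test_function (\<lambda>x. \<Sum>B\<in>Pow {1..4 * n}. k A B * (?c A j x * (\<rho> x * gcoeff (G x) B)))" for A j
    by (rule test_function_sum[OF tk])
  have "gcoeff (super_integral n (sdelta n g) G) C = (\<Sum>A\<in>Pow {1..2 * n}. \<Sum>B\<in>Pow {1..4 * n}. \<Sum>j\<le>n.
      delta_deriv ?h j (\<lambda>x. k A B * (?c A j x * (\<rho> x * gcoeff (G x) B))))"
    unfolding super_integral_def gcoeff_sum gcoeff_gconst_mult pair k_def[symmetric] delta_deriv_cmult[OF tc]
    by (simp only: sum_distrib_left sum_distrib_right mult.commute)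
  also have "\<dots> = (\<Sum>A\<in>Pow {1..2 * n}. \<Sum>j\<le>n. \<Sum>B\<in>Pow {1..4 * n}.
      delta_deriv ?h j (\<lambda>x. k A B * (?c A j x * (\<rho> x * gcoeff (G x) B))))"
    by (rule sum.cong[OF refl], rule sum.swap)
  also have "\<dots> = (\<Sum>j\<le>n. \<Sum>A\<in>Pow {1..2 * n}. \<Sum>B\<in>Pow {1..4 * n}.
      delta_deriv ?h j (\<lambda>x. k A B * (?c A j x * (\<rho> x * gcoeff (G x) B))))"
    by (rule sum.swap)
  also have "\<dots> = (\<Sum>j\<le>n. delta_deriv ?h j (\<lambda>x. \<Sum>A\<in>Pow {1..2 * n}. \<Sum>B\<in>Pow {1..4 * n}.
      k A B * (?c A j x * (\<rho> x * gcoeff (G x) B))))"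
    unfolding delta_deriv_sum[OF tk, symmetric] delta_deriv_sum[OF tkB, symmetric] ..
  also have "\<dots> = (\<Sum>j\<le>n. delta_deriv ?h j (\<lambda>x. 1 / fact j * (\<rho> x * gcoeff (berezin n (?n x ^ j * G x)) C)))"
  proof (intro sum.cong refl arg_cong[of _ _ "delta_deriv ?h _"] ext)
    fix j x
    show "(\<Sum>A\<in>Pow {1..2 * n}. \<Sum>B\<in>Pow {1..4 * n}. k A B * (?c A j x * (\<rho> x * gcoeff (G x) B))) =
        1 / fact j * (\<rho> x * gcoeff (berezin n (?n x ^ j * G x)) C)"
    proof (cases "x \<in> S")
      case True
      have "gcoeff (berezin n (?n x ^ j * G x)) C =
          (\<Sum>A\<in>Pow {1..2 * n}. \<Sum>B\<in>Pow {1..4 * n}. gcoeff (?n x ^ j) A * gcoeff (G x) B * k A B)"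
        unfolding gmult_expand[OF nilp_supp finite_atLeastAtMost G(2)[OF True] finite_atLeastAtMost]
          berezin_sum berezin_gconst_mult gcoeff_sum gcoeff_gconst_mult k_def ..
      then show ?thesis by (simp add: sum_distrib_left mult_ac)
    next
      case False
      then have "\<rho> x = 0" using S(6) test_function_outside[of x \<rho>] by blast
      then show ?thesis by simp
    qed
  qed
  also have "\<dots> = (\<Sum>j\<le>n. delta_deriv ?h j (\<lambda>x. \<rho> x * gcoeff (berezin n (?n x ^ j * G x)) C) / fact j)"
  proof (rule sum.cong[OF refl])
    fix j
    obtain \<sigma> where \<sigma>: "\<And>a. gcoeff (berezin n a) C = \<sigma> * gcoeff a (C \<union> {1..2 * n})"
      using berezin_coeff by blast
    have "gsmooth S (\<lambda>x. ?n x ^ j * G x)"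
      by (rule gsmooth_mult[OF S(1) gsmooth_subset[OF gsmooth_power[OF open_UNIV nilp_sm] S(1) subset_UNIV open_UNIV] G(1)])
    from smooth_on_mult[OF S(1) smooth_on_const[OF S(1)] gsmoothD[OF this], of \<sigma> "C \<union> {1..2 * n}"]
    have "smooth_on S (\<lambda>x. gcoeff (berezin n (?n x ^ j * G x)) C)" by (simp only: \<sigma>)
    from test_function_mult_local[OF S(1) this S(5,6)]
    show "delta_deriv ?h j (\<lambda>x. 1 / fact j * (\<rho> x * gcoeff (berezin n (?n x ^ j * G x)) C)) =
        delta_deriv ?h j (\<lambda>x. \<rho> x * gcoeff (berezin n (?n x ^ j * G x)) C) / fact j"
      by (subst delta_deriv_cmult) simp_all
  qed
  finally show ?thesis .
qed

context complex_level
begin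

text \<open>Summed over the coordinates, \<open>delta_deriv_dzc\<close> moves the conjugate
  derivatives from the function to the distribution. The cutoff is constant near the level set, so
  its derivatives do not contribute.\<close>

lemma delta_deriv_divergence:
  assumes S: "open S" "{x. h x = 0} \<subseteq> V" "open V" "\<forall>x\<in>V. \<rho> x = 1"
      "test_function \<rho>" "closure {x. \<rho> x \<noteq> 0} \<subseteq> S"
    and \<beta>: "smooth_on S \<beta>"
  shows "delta_deriv h j (\<lambda>x. \<rho> x * (\<Sum>i\<in>UNIV. dzc_scalar i (\<lambda>x. zdiff_cnj y i x * \<beta> x) x)) =
    - delta_deriv h (Suc j) (\<lambda>x. \<rho> x * ((\<Sum>i\<in>UNIV. zdiff_cnj y i x * dzc_scalar i hc x) * \<beta> x))"
proof -
  let ?a = "\<lambda>i x. zdiff_cnj y i x * \<beta> x"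
  have sa: "smooth_on S (?a i)" for i by (rule smooth_on_mult[OF S(1) smooth_zdiff_cnj[OF S(1)] \<beta>])
  have t: "test_function (\<lambda>x. \<rho> x * ?a i x)" for i by (rule test_function_mult_local[OF S(1) sa S(5,6)])
  note d = delta_deriv_dzc[OF t]
  have sd: "smooth_on S (dzc_scalar i (?a i))" for i
    unfolding dzc_scalar_def[abs_def]
    by (intro smooth_on_mult smooth_on_add smooth_on_const smooth_on_dir_deriv sa S(1))
  have t1: "test_function (\<lambda>x. \<rho> x * (\<Sum>i\<in>UNIV. dzc_scalar i (?a i) x))"
    by (rule test_function_mult_local[OF S(1) smooth_on_sum[OF S(1) sd] S(5,6)])
  have t2: "test_function (\<lambda>x. \<Sum>i\<in>UNIV. dzc_scalar i (\<lambda>x. \<rho> x * ?a i x) x)"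
    by (rule test_function_sum[OF d(2)])
  have loc: "\<forall>x\<in>V. \<rho> x * (\<Sum>i\<in>UNIV. dzc_scalar i (?a i) x) = (\<Sum>i\<in>UNIV. dzc_scalar i (\<lambda>x. \<rho> x * ?a i x) x)"
  proof
    fix x assume x: "x \<in> V"
    have "dir_deriv v (\<lambda>x. \<rho> x * ?a i x) x = dir_deriv v (?a i) x" for v i
      by (rule dir_deriv_cong[OF S(3) x]) (simp add: S(4))
    then show "\<rho> x * (\<Sum>i\<in>UNIV. dzc_scalar i (?a i) x) = (\<Sum>i\<in>UNIV. dzc_scalar i (\<lambda>x. \<rho> x * ?a i x) x)"
      using x S(4) by (simp add: dzc_scalar_def)
  qed
  have "delta_deriv h j (\<lambda>x. \<rho> x * (\<Sum>i\<in>UNIV. dzc_scalar i (?a i) x)) =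
      delta_deriv h j (\<lambda>x. \<Sum>i\<in>UNIV. dzc_scalar i (\<lambda>x. \<rho> x * ?a i x) x)"
    by (rule delta_deriv_local[OF t1 t2 S(3,2) loc])
  also have "\<dots> = (\<Sum>i\<in>UNIV. delta_deriv h j (dzc_scalar i (\<lambda>x. \<rho> x * ?a i x)))"
    by (rule delta_deriv_sum[OF d(2)])
  also have "\<dots> = (\<Sum>i\<in>UNIV. - delta_deriv h (Suc j) (\<lambda>x. dzc_scalar i hc x * (\<rho> x * ?a i x)))"
    by (simp only: d(1) minus_minus)
  also have "\<dots> = - delta_deriv h (Suc j) (\<lambda>x. \<Sum>i\<in>UNIV. dzc_scalar i hc x * (\<rho> x * ?a i x))"
    unfolding delta_deriv_sum[OF d(3)] by (rule sum_negf)
  also have "(\<lambda>x. \<Sum>i\<in>UNIV. dzc_scalar i hc x * (\<rho> x * ?a i x)) =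
      (\<lambda>x. \<rho> x * ((\<Sum>i\<in>UNIV. zdiff_cnj y i x * dzc_scalar i hc x) * \<beta> x))"
    by (simp add: fun_eq_iff sum_distrib_left sum_distrib_right mult_ac)
  finally show ?thesis .
qed

end

text \<open>With k = m - n \<ge> 1, Gamma at k is (k - 1)!, and (-1)^n n! times the binomial
  coefficient of -k over n is the rising product k (k + 1) ... (m - 1). The condition
  \<open>n < m\<close> keeps Gamma away from its poles.\<close>

lemma kernel_constant:
  assumes "n < m"
  shows "2 / ssphere_area (2 * real m - 2 * real n) *
    (1 / pi ^ n * ((-1) ^ n * fact n * ((- (real m - real n)) gchoose n)) * (pi ^ m / fact (m - 1))) = 1"
proof -
  define k where "k = m - n"
  have k: "m = k + n" "k \<ge> 1" using assms by (auto simp: k_def)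
  have r: "real m - real n = real k" using k(1) by simp
  have "(2 * real m - 2 * real n) / 2 = real k" using k(1) by simp
  then have area: "ssphere_area (2 * real m - 2 * real n) = 2 * pi ^ k / fact (k - 1)"
    using k(2) Gamma_fact[of "k - 1", where 'a = real]
    by (simp add: ssphere_area_def powr_realpow of_nat_diff)
  have "(-1) ^ n * fact n * ((- real k) gchoose n) = pochhammer (real k) n"
    by (simp add: gbinomial_pochhammer flip: power_mult_distrib mult.assoc)
  moreover have "pochhammer (real k) n = fact (m - 1) / fact (k - 1)"
  proof -
    have "pochhammer 1 (m - 1) = pochhammer 1 (k - 1) * pochhammer (1 + real (k - 1)) (m - 1 - (k - 1))"
      by (rule pochhammer_product) (use k in simp)
    moreover have "1 + real (k - 1) = real k" "m - 1 - (k - 1) = n" using k by simp_all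
    ultimately have "fact (m - 1) = fact (k - 1) * pochhammer (real k) n"
      by (simp add: pochhammer_fact)
    then show ?thesis by simp
  qed
  ultimately have c: "(-1) ^ n * fact n * ((- (real m - real n)) gchoose n) = fact (m - 1) / fact (k - 1)"
    unfolding r by simp
  have "pi ^ m = pi ^ k * pi ^ n" by (simp add: k(1) power_add)
  then show ?thesis unfolding area c by simp
qed

text \<open>The gradient condition speaks about every \<open>D\<close> that is a gradient of
  \<open>h\<close> at the point. Smoothness provides one, assembled from the partial derivatives,
  and if it is nonzero then so is some partial derivative.\<close>

lemma regular_levelI:
  fixes h :: "'a::euclidean_space \<Rightarrow> real"
  assumes h: "smooth_on UNIV (\<lambda>x. complex_of_real (h x))" and "compact {x. h x \<le> 0}"
    and grad: "\<forall>w D. h w = 0 \<longrightarrow> GDERIV h w :> D \<longrightarrow> D \<noteq> 0"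
  shows "regular_level h"
proof
  show "smooth_on UNIV (\<lambda>x. complex_of_real (h x))" by (rule h)
  have "continuous_on UNIV h"
    by (rule continuous_on_of_real_cancel[OF smooth_on_continuous[OF open_UNIV h]])
  then have "closed {x. h x = 0}" by (intro closed_Collect_eq continuous_on_const)
  moreover have "{x. h x = 0} = {x. h x \<le> 0} \<inter> {x. h x = 0}" by auto
  ultimately show "compact {x. h x = 0}" using compact_Int_closed[OF assms(2)] by metis
  fix x assume x: "h x = 0"
  let ?hc = "\<lambda>x. complex_of_real (h x)"
  have d: "?hc differentiable (at x)" by (rule smooth_on_differentiable[OF h open_UNIV UNIV_I])
  have hd: "(h has_derivative (\<lambda>v. Re (dir_deriv v ?hc x))) (at x)"
    using has_derivative_Re[OF has_derivative_dir_deriv[OF d]] by simp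
  define D where "D = (\<Sum>i\<in>Basis. Re (dir_deriv i ?hc x) *\<^sub>R i)"
  have "Re (dir_deriv v ?hc x) = inner v D" for v
  proof -
    have lin: "linear (\<lambda>v. Re (dir_deriv v ?hc x))" by (rule has_derivative_linear[OF hd])
    have "Re (dir_deriv v ?hc x) = Re (dir_deriv (\<Sum>i\<in>Basis. inner v i *\<^sub>R i) ?hc x)"
      by (simp add: euclidean_representation)
    also have "\<dots> = (\<Sum>i\<in>Basis. inner v i * Re (dir_deriv i ?hc x))"
      unfolding linear_sum[OF lin] linear_cmul[OF lin] by simp
    also have "\<dots> = inner v D" by (simp add: D_def inner_sum_right mult.commute)
    finally show ?thesis .
  qed
  then have "GDERIV h x :> D" using hd unfolding gderiv_def by (simp add: inner_commute)
  then have "D \<noteq> 0" using grad x by blast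
  then obtain i where i: "i \<in> Basis" "Re (dir_deriv i ?hc x) \<noteq> 0"
    unfolding D_def by (metis (no_types, lifting) scaleR_eq_0_iff sum.neutral)
  then have "dir_deriv i ?hc x \<noteq> 0" by auto
  with i(1) show "\<exists>i\<in>Basis. dir_deriv i ?hc x \<noteq> 0" by blast
qed

theorem theorem6:
  fixes m n :: nat
    and M :: real
    and \<Omega> :: "(real ^ ('m::finite + 'm)) set"
    and F g :: "real ^ ('m + 'm) \<Rightarrow> grassmann"
    and y :: "real ^ ('m + 'm)"
  assumes "CARD('m) = m"
    and "n < m"
    and "M = 2 * real m - 2 * real n"
    and "open \<Omega>"
    and "superfunction n \<Omega> F"
    and "super_holomorphic n \<Omega> F"
    and "phase_function n g"
    and "{w. rbody (g w) \<le> 0} \<subseteq> \<Omega>"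
    and "compact {w. rbody (g w) \<le> 0}"
    and "\<forall>w D. rbody (g w) = 0 \<longrightarrow> GDERIV (\<lambda>x. rbody (g x)) w :> D \<longrightarrow> D \<noteq> 0"
    and "rbody (g y) < 0"
  shows "gconst (of_real (2 / ssphere_area M)) *
           super_integral n (sdelta n g)
             (\<lambda>x. dist_ZU_pow n x y (- M) * D_dagger n y g x * F x)
         = subst_U n F y"
proof -
  note m = assms(1) and open_\<Omega> = assms(4)
  define p where "p = - (real m - real n)"
  have M: "- M = 2 * p" using assms(3) by (simp add: p_def)
  let ?h = "\<lambda>x. rbody (g x)"
  let ?hc = "\<lambda>x. complex_of_real (?h x)"
  let ?K = "\<lambda>x. dist_ZU_pow n x y (2 * p)"
  let ?N = "\<lambda>x. nilp (g x)"
  have g_sm: "gsmooth UNIV g" and g_supp: "gsupp {1..2 * n} (g x)" and g_even: "geven (g x)" for x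
    using assms(7) by (auto simp: phase_function_def superfunction_def gsmooth_def gsupp_def geven_def)
  have body: "gcoeff (g x) {} = ?hc x" for x
    using assms(7) by (simp add: phase_function_def rbody_def of_real_Re)
  have h_sm: "smooth_on UNIV ?hc" using gsmoothD[OF g_sm, of "{}"] by (simp only: body)
  have F_sm: "gsmooth \<Omega> F" and F_supp: "\<And>x. x \<in> \<Omega> \<Longrightarrow> gsupp {1..2 * n} (F x)"
    using assms(5) by (auto simp: superfunction_def gsmooth_def gsupp_def)
  have hol: "\<forall>j. dzc j F x = 0" "\<forall>k\<in>{1..n}. dgzc k (F x) = 0" if "x \<in> \<Omega>" for x
    using assms(6) that by (auto simp: super_holomorphic_def)
  have level: "regular_level ?h" by (rule regular_levelI[OF h_sm assms(9,10)])
  interpret complex_level ?h \<Omega> y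
    by (intro complex_level.intro level complex_level_axioms.intro assms(4,8,9,11))
  \<comment> \<open>The kernel is singular at \<open>y\<close>, which is removed; the level set does
    not contain it because \<open>rbody (g y) < 0\<close>.\<close>
  define S where "S = \<Omega> - {y}"
  have S: "open S" "y \<notin> S" "S \<subseteq> \<Omega>" using open_\<Omega> by (auto simp: S_def open_Diff)
  have Z: "{x. ?h x = 0} \<subseteq> S" using assms(8,11) by (auto simp: S_def)
  obtain \<rho> V where \<rho>: "test_function \<rho>" "closure {x. \<rho> x \<noteq> 0} \<subseteq> S" "open V" "{x. ?h x = 0} \<subseteq> V"
      "\<And>x. x \<in> V \<Longrightarrow> \<rho> x = 1"
    using exists_cutoff[OF compact_zero S(1) Z] by metis
  have \<rho>1: "\<forall>x\<in>V. \<rho> x = 1" using \<rho>(5) by blast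
  have \<rho>0: "\<rho> x = 0" if "x \<notin> S" for x using that \<rho>(2) test_function_outside[of x \<rho>] by blast
  have K_sm: "gsmooth S ?K" using gsmooth_subset[OF gsmooth_dist_ZU_pow S(1)] S(2) by auto
  have F_smS: "gsmooth S F" by (rule gsmooth_subset[OF F_sm S(1,3) open_\<Omega>])
  have N_sm: "gsmooth S ?N"
    unfolding nilp_def
    by (intro gsmooth_diff gsmooth_gconst gsmoothD gsmooth_subset[OF g_sm] S(1) subset_UNIV open_UNIV)
  have g_smS: "gsmooth S g" by (rule gsmooth_subset[OF g_sm S(1) subset_UNIV open_UNIV])
  have N_even: "geven (?N x)" for x unfolding nilp_def by (intro geven_diff geven_gconst g_even)
  have N_nil: "?N x ^ Suc n = 0" for x
  proof (rule geven_nilpotent[OF N_even])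
    show "gcoeff (?N x) {} = 0" by (simp add: nilp_def gcoeff_gconst)
    show "gsupp {1..2 * n} (?N x)" unfolding nilp_def by (intro gsupp_diff gsupp_gconst g_supp)
  qed simp_all
  \<comment> \<open>What \<open>D_dagger\<close> gives on the body of \<open>g\<close>; it becomes
    the scalar factor of the classical kernel.\<close>
  define H where "H x = (\<Sum>i\<in>UNIV. zdiff_cnj y i x * dzc_scalar i ?hc x)" for x
  let ?G = "\<lambda>x. ?K x * D_dagger n y g x * F x"
  have G_sm: "gsmooth S ?G"
    by (intro gsmooth_mult K_sm gsmooth_D_dagger F_smS S(1) g_smS)
  have gz_supp: "gsupp {1..4 * n} (gwc n k)" "gsupp {1..4 * n} (gw n k)" if "k \<in> {1..n}" for k
    unfolding gw_def gwc_def gz_def gzc_def gu_def guc_def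
    by (intro gsupp_diff gsupp_add gsupp_gconst_mult gsupp_gen; use that in auto)+
  have up: "gsupp {1..4 * n} a" if "gsupp {1..2 * n} a" for a by (rule gsupp_mono[OF that]) auto
  have dzc_supp: "gsupp {1..2 * n} (dzc j g x)" for j x
  proof -
    have "(\<lambda>w. gcoeff (g w) A) = (\<lambda>_. 0)" if "\<not> A \<subseteq> {1..2 * n}" for A
      using g_supp that by (auto simp: gsupp_def fun_eq_iff)
    then show ?thesis by (simp add: gsupp_def gcoeff_dzc dzc_scalar_def)
  qed
  have G_supp: "gsupp {1..4 * n} (?G x)" if "x \<in> S" for x
  proof -
    have "gsupp {1..4 * n} (gN n 0)"
      unfolding gN_def by (intro gsupp_gconst_mult gsupp_sum gsupp_mult gz_supp) auto
    then have K: "gsupp {1..4 * n} (?K x)"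
      unfolding dist_ZU_pow_eq by (intro gsupp_sum gsupp_gconst_mult gsupp_power)
    have D: "gsupp {1..4 * n} (D_dagger n y g x)"
      unfolding D_dagger_eq odd_D_def dgzc_def
      by (intro gsupp_add gsupp_sum gsupp_mult gsupp_gconst gsupp_gconst_mult gz_supp up gsupp_lderiv dzc_supp g_supp)
    have "gsupp {1..2 * n} (F x)" using F_supp that S(3) by blast
    then show ?thesis by (rule gsupp_mult[OF gsupp_mult[OF K D] up])
  qed
  have split: "D_dagger n y g x = gconst (H x) + D_dagger n y ?N x" if "x \<in> S" for x
  proof -
    have "gsmooth S (\<lambda>x. gconst (?hc x))"
      by (rule gsmooth_gconst[OF S(1) smooth_on_subset[OF h_sm S(1) subset_UNIV open_UNIV]])
    from D_dagger_add[OF S(1) this N_sm that, of n y]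
    have "D_dagger n y (\<lambda>x. gconst (?hc x) + ?N x) x = gconst (H x) + D_dagger n y ?N x"
      by (simp only: D_dagger_gconst H_def)
    moreover have "(\<lambda>x. gconst (?hc x) + ?N x) = g" by (simp add: nilp_def body fun_eq_iff)
    ultimately show ?thesis by simp
  qed
  have "gcoeff (gconst (of_real (2 / ssphere_area M)) * super_integral n (sdelta n g) ?G) C = gcoeff (subst_U n F y) C" for C
  proof -
    obtain \<sigma> where \<sigma>: "\<And>a. gcoeff (berezin n a) C = \<sigma> * gcoeff a (C \<union> {1..2 * n})"
      using berezin_coeff by blast
    define \<beta> where "\<beta> j x = gcoeff (berezin n (?K x * ?N x ^ j * F x)) C" for j x
    have \<beta>_sm: "smooth_on S (\<beta> j)" for j
    proof -
      have "gsmooth S (\<lambda>x. ?K x * ?N x ^ j * F x)"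
        by (intro gsmooth_mult gsmooth_power K_sm N_sm F_smS S(1))
      from smooth_on_mult[OF S(1) smooth_on_const[OF S(1)] gsmoothD[OF this], of \<sigma> "C \<union> {1..2 * n}"]
      show ?thesis by (simp only: \<beta>_def[abs_def] \<sigma>)
    qed
    \<comment> \<open>The quantities that telescope: the pairing of the \<open>j\<close>-th Dirac
      derivative on the body with the contribution of the \<open>j\<close>-th power of the nilpotent
      part.\<close>
    define \<delta> where "\<delta> j = delta_deriv ?h j (\<lambda>x. \<rho> x * (H x * \<beta> j x)) / fact j" for j
    have H_sm: "smooth_on S H"
      unfolding H_def[abs_def] dzc_scalar_def
      by (intro smooth_on_sum smooth_on_mult smooth_on_add smooth_on_const smooth_zdiff_cnj
          smooth_on_subset[OF smooth_on_dir_deriv[OF h_sm]] S(1) subset_UNIV open_UNIV)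
    \<comment> \<open>The field acts on \<open>g\<close> through body and nilpotent part. The body
      gives the factor \<open>H\<close>. The nilpotent part gives the field on the power
      \<open>Suc j\<close>, divided by \<open>Suc j\<close>, which \<open>berezin_divergence\<close>
      turns into a divergence.\<close>
    have expand: "gcoeff (berezin n (?N x ^ j * ?G x)) C =
        H x * \<beta> j x + 1 / of_nat (Suc j) * (\<Sum>i\<in>UNIV. dzc_scalar i (\<lambda>x. zdiff_cnj y i x * \<beta> (Suc j) x) x)"
      if x: "x \<in> S" for x j
    proof -
      have N_comm: "?N x ^ j * a = a * ?N x ^ j" for a by (rule geven_comm[OF geven_power[OF N_even]])
      have "D_dagger n y (\<lambda>x. ?N x ^ Suc j) x = gconst (of_nat (Suc j)) * (?N x ^ j * D_dagger n y ?N x)"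
        by (rule D_dagger_power[OF S(1) N_sm x]) (simp add: N_even)
      then have "gconst (1 / of_nat (Suc j)) * D_dagger n y (\<lambda>x. ?N x ^ Suc j) x = ?N x ^ j * D_dagger n y ?N x"
        by (simp only: mult.assoc[symmetric] gconst_mult[symmetric]) (simp del: of_nat_Suc)
      note DN = this[symmetric]
      have "?N x ^ j * ?G x = ?K x * (?N x ^ j * D_dagger n y g x) * F x"
        using N_comm[of "?K x"] by (simp add: mult.assoc[symmetric])
      also have "?N x ^ j * D_dagger n y g x = gconst (H x) * ?N x ^ j + gconst (1 / of_nat (Suc j)) * D_dagger n y (\<lambda>x. ?N x ^ Suc j) x"
        unfolding split[OF x] distrib_left DN by (simp only: gconst_comm)
      also have "?K x * (gconst (H x) * ?N x ^ j + gconst (1 / of_nat (Suc j)) * D_dagger n y (\<lambda>x. ?N x ^ Suc j) x) * F x =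
          gconst (H x) * (?K x * ?N x ^ j * F x) +
          gconst (1 / of_nat (Suc j)) * (?K x * D_dagger n y (\<lambda>x. ?N x ^ Suc j) x * F x)"
        by (simp only: distrib_left distrib_right gconst_left_comm[of "?K x"] mult.assoc)
      finally have "gcoeff (berezin n (?N x ^ j * ?G x)) C = H x * \<beta> j x +
          1 / of_nat (Suc j) * gcoeff (berezin n (?K x * D_dagger n y (\<lambda>x. ?N x ^ Suc j) x * F x)) C"
        by (simp only: berezin_add berezin_gconst_mult gcoeff_add gcoeff_gconst_mult \<beta>_def)
      moreover have "x \<in> \<Omega>" using x S(3) by blast
      ultimately show ?thesis
        using berezin_divergence[OF S(1) x S(2) gsmooth_power[OF S(1) N_sm] geven_power[OF N_even] F_smS hol, of p "Suc j" C]
        unfolding \<beta>_def p_def m by simp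
    qed
    \<comment> \<open>Moving that divergence onto the distribution raises the order of the Dirac
      derivative by one and changes the sign; the factor \<open>1 / of_nat (Suc j)\<close> completes
      \<open>fact j\<close> to \<open>fact (Suc j)\<close>.\<close>
    have step: "delta_deriv ?h j (\<lambda>x. \<rho> x * gcoeff (berezin n (?N x ^ j * ?G x)) C) / fact j = \<delta> j - \<delta> (Suc j)" for j
    proof -
      let ?D = "\<lambda>x. \<Sum>i\<in>UNIV. dzc_scalar i (\<lambda>x. zdiff_cnj y i x * \<beta> (Suc j) x) x"
      have D_sm: "smooth_on S ?D"
        unfolding dzc_scalar_def
        by (intro smooth_on_sum smooth_on_mult smooth_on_add smooth_on_const smooth_zdiff_cnj
            smooth_on_dir_deriv \<beta>_sm S(1))
      have t1: "test_function (\<lambda>x. \<rho> x * (H x * \<beta> j x))"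
        by (rule test_function_mult_local[OF S(1) smooth_on_mult[OF S(1) H_sm \<beta>_sm] \<rho>(1,2)])
      have t2: "test_function (\<lambda>x. \<rho> x * ?D x)" by (rule test_function_mult_local[OF S(1) D_sm \<rho>(1,2)])
      have e: "(\<lambda>x. \<rho> x * gcoeff (berezin n (?N x ^ j * ?G x)) C) =
          (\<lambda>x. 1 / of_nat (Suc j) * (\<rho> x * ?D x) + \<rho> x * (H x * \<beta> j x))"
      proof
        fix x
        show "\<rho> x * gcoeff (berezin n (?N x ^ j * ?G x)) C = 1 / of_nat (Suc j) * (\<rho> x * ?D x) + \<rho> x * (H x * \<beta> j x)"
        proof (cases "x \<in> S")
          case True
          show ?thesis unfolding expand[OF True] by (simp only: distrib_left mult.left_commute add.commute)
        next
          case False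
          show ?thesis unfolding \<rho>0[OF False] by simp
        qed
      qed
      have "delta_deriv ?h j (\<lambda>x. \<rho> x * ?D x) = - delta_deriv ?h (Suc j) (\<lambda>x. \<rho> x * (H x * \<beta> (Suc j) x))"
        unfolding H_def by (rule delta_deriv_divergence[OF S(1) \<rho>(4,3) \<rho>1 \<rho>(1,2) \<beta>_sm])
      then show ?thesis
        unfolding e delta_deriv_linear[OF t2 t1] \<delta>_def
        by (simp del: of_nat_Suc add: diff_divide_distrib fact_Suc)
    qed
    have "gcoeff (super_integral n (sdelta n g) ?G) C =
        (\<Sum>j\<le>n. delta_deriv ?h j (\<lambda>x. \<rho> x * gcoeff (berezin n (?N x ^ j * ?G x)) C) / fact j)"
      by (rule super_integral_delta[OF level g_sm g_supp S(1) \<rho>(4,3,5,1,2) G_sm G_supp])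
    also have "\<dots> = (\<Sum>j\<le>n. \<delta> j - \<delta> (Suc j))" by (simp only: step)
    also have "\<dots> = \<delta> 0 - \<delta> (Suc n)" by (rule sum_telescope)
    \<comment> \<open>The power \<open>Suc n\<close> of the nilpotent part is 0, as it would have
      degree above the \<open>2 * n\<close> available generators.\<close>
    also have "\<delta> (Suc n) = 0" by (simp only: \<delta>_def \<beta>_def N_nil mult_zero_left mult_zero_right berezin_0 gcoeff_0
          delta_deriv_0 div_0)
    finally have LHS: "gcoeff (super_integral n (sdelta n g) ?G) C = delta_deriv ?h 0 (\<lambda>x. \<rho> x * (H x * \<beta> 0 x))"
      by (simp add: \<delta>_def)
    \<comment> \<open>The coefficient at \<open>C\<close> of F with its monomials already written in
      the U-variables but its coefficients still functions of \<open>x\<close>. It is holomorphic on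
      all of \<Omega>, including \<open>y\<close>, and its value at \<open>y\<close> is the
      coefficient of F(U).\<close>
    define f where "f x = (\<Sum>A\<in>Pow {1..n}. gcoeff (F x) ((\<lambda>k. 2 * k - 1) ` A) *
        gcoeff (prod_list (map (gu n) (sorted_list_of_set A))) C)" for x
    let ?c = "1 / pi ^ n * ((-1) ^ n * fact n * (p gchoose n))"
    have f_sm: "smooth_on \<Omega> f"
      unfolding f_def[abs_def]
      by (intro smooth_on_sum smooth_on_mult smooth_on_const gsmoothD[OF F_sm] open_\<Omega>)
    have f_hol: "\<forall>x\<in>\<Omega>. \<forall>j. dzc_scalar j f x = 0"
    proof (intro ballI allI)
      fix x j assume x: "x \<in> \<Omega>"
      let ?k = "\<lambda>A. gcoeff (prod_list (map (gu n) (sorted_list_of_set A))) C"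
      let ?F = "\<lambda>A x. gcoeff (F x) ((\<lambda>k. 2 * k - 1) ` A)"
      have d: "?F A differentiable (at x)" for A by (rule gsmooth_differentiable[OF F_sm open_\<Omega> x])
      have "dir_deriv v f x = (\<Sum>A\<in>Pow {1..n}. dir_deriv v (?F A) x * ?k A)" for v
      proof -
        have dk: "(\<lambda>x. ?F A x * ?k A) differentiable (at x)" for A
          by (rule differentiable_mult[OF d differentiable_const])
        have one: "dir_deriv v (\<lambda>x. ?F A x * ?k A) x = dir_deriv v (?F A) x * ?k A" for A
          using dir_deriv_mult[OF d[of A] differentiable_const[of "?k A"], of v] by simp
        show ?thesis unfolding f_def[abs_def] dir_deriv_sum[OF dk] one ..
      qed
      then have "dzc_scalar j f x = (\<Sum>A\<in>Pow {1..n}. dzc_scalar j (?F A) x * ?k A)"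
        by (simp only: dzc_scalar_def sum_distrib_left sum.distrib[symmetric] distrib_left distrib_right mult.assoc)
      also have "\<dots> = 0"
        unfolding gcoeff_dzc[of j F x, symmetric] using hol(1)[OF x] by simp
      finally show "dzc_scalar j f x = 0" .
    qed
    \<comment> \<open>Only the top coefficient of the kernel survives the Berezin integral, and its
      exponent p - n = -m is that of the classical kernel.\<close>
    have \<beta>0: "\<beta> 0 x = of_real ?c * (of_real (inverse ((dist x y)\<^sup>2) ^ CARD('m)) * f x)" if x: "x \<in> S" for x
    proof -
      have x\<Omega>: "x \<in> \<Omega>" and xy: "x \<noteq> y" using x S(2,3) by auto
      have pos: "(dist x y)\<^sup>2 > 0" using xy by simp
      have "p - real n = - real m" by (simp add: p_def)
      then have "((dist x y)\<^sup>2) powr (p - real n) = inverse ((dist x y)\<^sup>2) ^ m"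
        using pos by (simp only: powr_minus powr_realpow power_inverse)
      then have kc: "kernel_coeff p y n x = of_real ((p gchoose n) * inverse ((dist x y)\<^sup>2) ^ m)"
        by (simp only: kernel_coeff_def)
      have "\<beta> 0 x = of_real (1 / pi ^ n) * ((-1) ^ n * fact n * kernel_coeff p y n x) * f x"
        unfolding \<beta>_def power_0 mult_1_right dist_ZU_pow_eq berezin_kernel[OF F_supp[OF x\<Omega>] hol(2)[OF x\<Omega>]]
          gcoeff_gconst_mult gcoeff_sum f_def ..
      then show ?thesis unfolding kc m by simp
    qed
    let ?\<phi> = "\<lambda>x. \<rho> x * (H x * (of_real (inverse ((dist x y)\<^sup>2) ^ CARD('m)) * f x))"
    have "smooth_on S (\<lambda>x. H x * (of_real (inverse ((dist x y)\<^sup>2) ^ CARD('m)) * f x))"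
    proof -
      have "smooth_on S (\<lambda>x. complex_of_real (((dist x y)\<^sup>2) powr (- real m)))"
        by (rule smooth_on_compose[OF S(1) _ _ smooth_on_sq_dist[OF S(1)] smooth_on_powr[of "- real m"]])
          (use S(2) in auto)
      moreover have "complex_of_real (((dist x y)\<^sup>2) powr (- real m)) = of_real (inverse ((dist x y)\<^sup>2) ^ CARD('m))"
        if "x \<in> S" for x
      proof -
        have "(dist x y)\<^sup>2 > 0" using that S(2) by auto
        then show ?thesis unfolding m by (simp only: powr_minus powr_realpow power_inverse)
      qed
      ultimately have "smooth_on S (\<lambda>x. complex_of_real (inverse ((dist x y)\<^sup>2) ^ CARD('m)))"
        using smooth_on_cong[OF S(1)] by (metis (no_types, lifting))
      then show ?thesis
        by (intro smooth_on_mult S(1) H_sm smooth_on_subset[OF f_sm S(1,3) open_\<Omega>])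
    qed
    from test_function_mult_local[OF S(1) this \<rho>(1,2)] have t\<phi>: "test_function ?\<phi>" .
    have "(\<lambda>x. \<rho> x * (H x * \<beta> 0 x)) = (\<lambda>x. of_real ?c * ?\<phi> x)"
    proof
      fix x
      show "\<rho> x * (H x * \<beta> 0 x) = of_real ?c * ?\<phi> x"
      proof (cases "x \<in> S")
        case True
        show ?thesis unfolding \<beta>0[OF True] by (simp only: mult.left_commute)
      next
        case False
        show ?thesis unfolding \<rho>0[OF False] by simp
      qed
    qed
    then have "gcoeff (super_integral n (sdelta n g) ?G) C = of_real ?c * delta_deriv ?h 0 ?\<phi>"
      unfolding LHS by (simp only: delta_deriv_cmult[OF t\<phi>])
    also have "delta_deriv ?h 0 ?\<phi> = of_real (pi ^ CARD('m) / fact (CARD('m) - 1)) * f y"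
    proof (rule bochner_martinelli[OF f_sm f_hol t\<phi> \<rho>(3,4)])
      show "\<forall>x\<in>V. ?\<phi> x = (\<Sum>j\<in>UNIV. zdiff_cnj y j x * dzc_scalar j ?hc x) *
          of_real (inverse ((dist x y)\<^sup>2) ^ CARD('m)) * f x"
        using \<rho>1 by (simp add: H_def mult.assoc)
    qed
    finally have "gcoeff (gconst (of_real (2 / ssphere_area M)) * super_integral n (sdelta n g) ?G) C =
        of_real (2 / ssphere_area M * (?c * (pi ^ m / fact (m - 1)))) * f y"
      unfolding m by simp
    also have "2 / ssphere_area M * (?c * (pi ^ m / fact (m - 1))) = 1"
      unfolding p_def assms(3) by (rule kernel_constant[OF assms(2)])
    also have "of_real 1 * f y = gcoeff (subst_U n F y) C"
    proof -
      have y: "y \<in> \<Omega>" using assms(8,11) by auto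
      have "hol_coeffs n (F y) A = gcoeff (F y) ((\<lambda>k. 2 * k - 1) ` A)" if "A \<in> Pow {1..n}" for A
        by (rule hol_coeffs_eq[OF F_supp[OF y] hol(2)[OF y]]) (use that in simp)
      then have "(\<Sum>A\<in>Pow {1..n}. hol_coeffs n (F y) A * gcoeff (prod_list (map (gu n) (sorted_list_of_set A))) C) = f y"
        unfolding f_def by (intro sum.cong refl arg_cong2[of _ _ _ _ times])
      then show ?thesis unfolding subst_U_def gcoeff_sum gcoeff_gconst_mult by simp
    qed
    finally show ?thesis .
  qed
  then have "gconst (of_real (2 / ssphere_area M)) * super_integral n (sdelta n g) ?G = subst_U n F y"
    by (intro grassmann_eqI)
  then show ?thesis unfolding M .
qed

end
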